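(* Let $k$ be a positive integer and let $M=p_1p_2\cdots p_r\neq1$ be an odd square-free positive integer with prime factors $p_1,\dots,p_r$; put $M_i=M/p_i$ and $B_i=S_{k+1/2}(\Gamma_0(4M_i))\oplus\widetilde W_{p_i^2}S_{k+1/2}(\Gamma_0(4M_i))$ for $i=1,\dots,r$. Let $$E=\sum_{i=1}^rB_i\ \oplus\ S^{+,\mathrm{new}}_{k+1/2}(4M)\ \oplus\ \widetilde W_4S^{+,\mathrm{new}}_{k+1/2}(4M)\subseteq S_{k+1/2}(\Gamma_0(4M))$$ and let $S^-_{k+1/2}(4M):=E^\perp$ be its orthogonal complement in $S_{k+1/2}(\Gamma_0(4M))$ under the Petersson inner product. Let $f\in S_{k+1/2}(\Gamma_0(4M))$. Then $f\in S^-_{k+1/2}(4M)$ if and only if $\widetilde Q_p(f)=-f=\widetilde Q'_p(f)$ for every prime $p$ dividing $M$ and $\widetilde Q_2(f)=-f=\widetilde Q'_2(f)$.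
   Context: **Spaces.** For $N$ odd, $S_{k+1/2}(\Gamma_0(4N))$ is the space of holomorphic cusp forms $f$ on the upper half plane with $f(\alpha z)=j(\alpha,z)^{2k+1}f(z)$ for $\alpha=\begin{pmatrix}a&b\\c&d\end{pmatrix}\in\Gamma_0(4N)$, where $j(\alpha,z)=\varepsilon_d^{-1}\left(\frac cd\right)(cz+d)^{1/2}$, $\varepsilon_d=1$ or $i$ as $d\equiv1$ or $3\pmod4$, square roots have argument in $(-\pi/2,\pi/2]$, $\left(\frac cd\right)$ is Shimura's quadratic symbol. For $\alpha\in\mathrm{GL}_2^+(\mathbb R)$ with lower row $(c,d)$ and holomorphic $\phi$ with $\phi(z)^2=t\det(\alpha)^{-1/2}(cz+d)$, $|t|=1$, put $f|[(\alpha,\phi)]_{k+1/2}(z)=f(\alpha z)\phi(z)^{-2k-1}$. $U_m(\sum a_nq^n)=\sum a_{mn}q^n$. **Operators at $p\mid M$.** For a prime $p\mid M$ and integers $m,n$ with $pn-4(M/p)m=1$, on $S_{k+1/2}(\Gamma_0(4M))$ put $$\widetilde W_{p^2}(f)=\frac{\overline{\varepsilon_p}}{\sqrt p}\left(\frac{-1}{p}\right)\left(\frac{M/p}{p}\right)\sum_{s=0}^{p-1}f\Big|\left[\left(\begin{pmatrix}p^2n-4Mms&m\\4pM(1-s)&p\end{pmatrix},(4M(1-s)z+1)^{1/2}\right)\right]_{k+1/2},$$ $$\widetilde Q_p(f)=\sum_{s=0}^{p-1}f\Big|\left[\left(\begin{pmatrix}1&m-s\\4M/p&np-4(M/p)s\end{pmatrix},\big(4(M/p)z+np-4(M/p)s\big)^{1/2}\right)\right]_{k+1/2},$$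 and $\widetilde Q'_p=\widetilde W_{p^2}\widetilde Q_p\widetilde W_{p^2}$ ($\widetilde W_{p^2}$ is an involution). **Operators at $2$.** With integers $m,n$ satisfying $4n-mM=1$, and $\omega_M=1$ if $M\equiv1\pmod4$, $\omega_M=-i(-1)^k$ if $M\equiv3\pmod4$, $$\widetilde W_4(f)=\left(\frac2{2k+1}\right)e^{(2k+1)\pi i/4}\omega_M\,f\Big|\left[\left(\begin{pmatrix}4n&m\\4M&4\end{pmatrix},(2Mz+2)^{1/2}\right)\right]_{k+1/2}$$ (an involution), $\widetilde Q_2=2^{1-k}U_4\widetilde W_4$, $\widetilde Q'_2=\widetilde W_4\widetilde Q_2\widetilde W_4=2^{1-k}\widetilde W_4U_4$. **Kohnen's spaces.** The plus space $S^+_{k+1/2}(4N)$ consists of the $\sum a_nq^n\in S_{k+1/2}(\Gamma_0(4N))$ with $a_n=0$ unless $(-1)^kn\equiv0,1\pmod4$. $S^{+,\mathrm{new}}_{k+1/2}(4M)$ is the orthogonal complement in $S^+_{k+1/2}(4M)$ of $\sum_{d\mid M,\,d<M}\left(S^+_{k+1/2}(4d)+U_{(M/d)^2}S^+_{k+1/2}(4d)\right)$. *)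

theory Defs
  imports
    "HOL-Complex_Analysis.Complex_Analysis"
    "HOL-Number_Theory.Number_Theory"
    "HOL-Computational_Algebra.Squarefree"
    "HOL-Library.Function_Algebras"
    "HOL-Library.Set_Algebras"
begin

text \<open>
  A function on the upper half plane is represented by a function
  \<^typ>\<open>complex \<Rightarrow> complex\<close> that vanishes outside the upper half plane, so that equality of
  forms is equality of functions. Sums of forms are pointwise sums, and sums of spaces of forms
  are the elementwise sums of \<^theory>\<open>HOL-Library.Set_Algebras\<close>.
\<close>

abbreviation upper_half_plane :: "complex set" where
  "upper_half_plane \<equiv> {z. 0 < Im z}"


subsection \<open>Matrices and the slash operator\<close>

definition mat2 :: "'a::zero \<Rightarrow> 'a \<Rightarrow> 'a \<Rightarrow> 'a \<Rightarrow> 'a ^ 2 ^ 2" where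
  "mat2 a b c d = vector [vector [a, b], vector [c, d]]"

definition mat_act :: "real ^ 2 ^ 2 \<Rightarrow> complex \<Rightarrow> complex" where
  "mat_act A = moebius (of_real (A $ 1 $ 1)) (of_real (A $ 1 $ 2))
                       (of_real (A $ 2 $ 1)) (of_real (A $ 2 $ 2))"

text \<open>
  The slash operator of weight \<open>k + 1/2\<close>. It is only used for pairs with \<open>det A > 0\<close> and
  \<open>\<phi>(z)\<^sup>2 = t * det(A) powr (-1/2) * (c * z + d)\<close>, \<open>|t| = 1\<close>; the determinant does not occur
  in the formula, as it is part of \<open>\<phi>\<close>.
\<close>

definition slash :: "nat \<Rightarrow> (real ^ 2 ^ 2) \<times> (complex \<Rightarrow> complex) \<Rightarrow> (complex \<Rightarrow> complex) \<Rightarrow> complex \<Rightarrow> complex"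
where
  "slash k \<xi> f = (\<lambda>z. if z \<in> upper_half_plane
     then f (mat_act (fst \<xi>) z) * snd \<xi> z powi (- 2 * int k - 1) else 0)"

definition SL2Z :: "(int ^ 2 ^ 2) set" where
  "SL2Z = {A. det A = 1}"

definition Gamma0 :: "nat \<Rightarrow> (int ^ 2 ^ 2) set" where
  "Gamma0 N = {A \<in> SL2Z. int N dvd A $ 2 $ 1}"

abbreviation real_mat :: "int ^ 2 ^ 2 \<Rightarrow> real ^ 2 ^ 2" where
  "real_mat \<equiv> map_matrix real_of_int"


subsection \<open>The theta multiplier\<close>

text \<open>
  Shimura's extension of the Jacobi symbol to all odd \<open>d\<close>: for \<open>d < 0\<close> it is the Jacobi symbol
  modulo \<open>|d|\<close>, with an additional sign if \<open>c < 0\<close>. The empty product gives \<open>(0/\<plusminus>1) = 1\<close>.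
\<close>

definition quad_symbol :: "int \<Rightarrow> int \<Rightarrow> int" where
  "quad_symbol c d = (if c < 0 \<and> d < 0 then -1 else 1) *
     (\<Prod>p\<in>#prime_factorization (nat \<bar>d\<bar>). Legendre c (int p))"

definition theta_eps :: "int \<Rightarrow> complex" where
  "theta_eps d = (if d mod 4 = 1 then 1 else \<i>)"

text \<open>\<^const>\<open>csqrt\<close> is the branch of the square root with argument in \<open>(-\<pi>/2, \<pi>/2]\<close>.\<close>

definition theta_factor :: "int ^ 2 ^ 2 \<Rightarrow> complex \<Rightarrow> complex" where
  "theta_factor A z = inverse (theta_eps (A $ 2 $ 2)) * of_int (quad_symbol (A $ 2 $ 1) (A $ 2 $ 2))
     * csqrt (of_int (A $ 2 $ 1) * z + of_int (A $ 2 $ 2))"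


subsection \<open>Cusp forms and Fourier coefficients\<close>

definition has_q_expansion :: "nat \<Rightarrow> (nat \<Rightarrow> complex) \<Rightarrow> (complex \<Rightarrow> complex) \<Rightarrow> bool" where
  "has_q_expansion h a f \<longleftrightarrow>
     (\<forall>z\<in>upper_half_plane. (\<lambda>n. a n * exp (2 * pi * \<i> * of_nat n * z / of_nat h)) sums f z)"

text \<open>
  The cusps are the points \<open>\<gamma>\<infinity>\<close> with \<open>\<gamma>\<close> in \<^const>\<open>SL2Z\<close>. The expansion of \<open>f\<close> at such a cusp
  may a priori involve exponents \<open>(n + r) / w\<close> with \<open>4 * r\<close> an integer, where \<open>w\<close> is the width of
  the cusp; these are covered by allowing an arbitrary period \<open>h\<close>.
\<close>

definition vanishes_at_cusps :: "nat \<Rightarrow> (complex \<Rightarrow> complex) \<Rightarrow> bool" where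
  "vanishes_at_cusps k f \<longleftrightarrow> (\<forall>\<gamma>\<in>SL2Z. \<exists>h>0. \<exists>a. a 0 = 0 \<and>
     has_q_expansion h a
       (slash k (real_mat \<gamma>, \<lambda>z. csqrt (of_int (\<gamma> $ 2 $ 1) * z + of_int (\<gamma> $ 2 $ 2))) f))"

definition cusp_forms :: "nat \<Rightarrow> nat \<Rightarrow> (complex \<Rightarrow> complex) set" where
  "cusp_forms k N = {f. (\<forall>z. z \<notin> upper_half_plane \<longrightarrow> f z = 0) \<and>
     f holomorphic_on upper_half_plane \<and>
     (\<forall>\<gamma>\<in>Gamma0 N. \<forall>z\<in>upper_half_plane.
        f (mat_act (real_mat \<gamma>) z) = theta_factor \<gamma> z ^ (2 * k + 1) * f z) \<and>
     vanishes_at_cusps k f}"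

definition fourier_coeff :: "(complex \<Rightarrow> complex) \<Rightarrow> nat \<Rightarrow> complex" where
  "fourier_coeff f = (THE a. has_q_expansion 1 a f)"

definition U_op :: "nat \<Rightarrow> (complex \<Rightarrow> complex) \<Rightarrow> complex \<Rightarrow> complex" where
  "U_op m f = (\<lambda>z. if z \<in> upper_half_plane
     then (\<Sum>n. fourier_coeff f (m * n) * exp (2 * pi * \<i> * of_nat n * z)) else 0)"

text \<open>The second argument is the full level \<open>4N\<close>, as for \<^const>\<open>cusp_forms\<close>.\<close>

definition plus_space :: "nat \<Rightarrow> nat \<Rightarrow> (complex \<Rightarrow> complex) set" where
  "plus_space k N = {f \<in> cusp_forms k N. \<forall>n.
     ((-1) ^ k * int n) mod 4 \<notin> {0, 1} \<longrightarrow> fourier_coeff f n = 0}"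


subsection \<open>The Petersson inner product\<close>

definition std_fundamental_domain :: "complex set" where
  "std_fundamental_domain = {z \<in> upper_half_plane. \<bar>Re z\<bar> \<le> 1/2 \<and> 1 \<le> cmod z}"

text \<open>The equivalence relation whose classes are the cosets \<open>\<Gamma>\<^sub>0(N) \<gamma>\<close> in \<^const>\<open>SL2Z\<close>.\<close>

definition Gamma0_coset_rel :: "nat \<Rightarrow> ((int ^ 2 ^ 2) \<times> (int ^ 2 ^ 2)) set" where
  "Gamma0_coset_rel N = {(\<gamma>, \<delta>). \<gamma> \<in> SL2Z \<and> (\<exists>g\<in>Gamma0 N. \<delta> = g ** \<gamma>)}"

text \<open>
  The integral of \<open>f(z) * cnj (g(z)) * y powr (k + 1/2)\<close> against \<open>dx dy / y\<^sup>2\<close> over the fundamental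
  domain for \<open>\<Gamma>\<^sub>0(N)\<close> consisting of the translates of the standard one by coset representatives;
  on each translate it is pulled back to the standard domain, the measure being invariant. There
  are finitely many cosets. No normalizing constant is included.
\<close>

definition petersson :: "nat \<Rightarrow> nat \<Rightarrow> (complex \<Rightarrow> complex) \<Rightarrow> (complex \<Rightarrow> complex) \<Rightarrow> complex" where
  "petersson k N f g =
     (\<Sum>C\<in>SL2Z // Gamma0_coset_rel N.
        LINT z:std_fundamental_domain|lborel.
          (let w = mat_act (real_mat (SOME \<gamma>. \<gamma> \<in> C)) z
           in f w * cnj (g w) * of_real (Im w powr (real k + 1/2)) / of_real ((Im z)\<^sup>2)))"

definition orth_compl ::
  "nat \<Rightarrow> nat \<Rightarrow> (complex \<Rightarrow> complex) set \<Rightarrow> (complex \<Rightarrow> complex) set \<Rightarrow> (complex \<Rightarrow> complex) set"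
where
  "orth_compl k N V W = {f \<in> V. \<forall>g\<in>W. petersson k N f g = 0}"

definition plus_new_space :: "nat \<Rightarrow> nat \<Rightarrow> (complex \<Rightarrow> complex) set" where
  "plus_new_space k M = orth_compl k (4 * M) (plus_space k (4 * M))
     (\<Sum>d\<in>{d. d dvd M \<and> d < M}.
        plus_space k (4 * d) + U_op ((M div d)\<^sup>2) ` plus_space k (4 * d))"


subsection \<open>The operators at odd primes\<close>

text \<open>
  Here \<open>m\<close> and \<open>n\<close> are integers with \<open>p * n - 4 * (M/p) * m = 1\<close>. The summation variable ranges
  over integers, so that the subtractions are not truncated.
\<close>

definition W_p2 :: "nat \<Rightarrow> nat \<Rightarrow> nat \<Rightarrow> int \<Rightarrow> int \<Rightarrow> (complex \<Rightarrow> complex) \<Rightarrow> complex \<Rightarrow> complex" where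
  "W_p2 k M p m n f = (\<lambda>z.
     cnj (theta_eps (int p)) / of_real (sqrt (real p))
     * of_int (Legendre (-1) (int p)) * of_int (Legendre (int (M div p)) (int p))
     * (\<Sum>s\<in>{0..int p - 1}. slash k
          (mat2 (of_int ((int p)\<^sup>2 * n - 4 * int M * m * s)) (of_int m)
                (of_int (4 * int p * int M * (1 - s))) (of_int (int p)),
           \<lambda>z. csqrt (of_int (4 * int M * (1 - s)) * z + 1)) f z))"

definition Q_p :: "nat \<Rightarrow> nat \<Rightarrow> nat \<Rightarrow> int \<Rightarrow> int \<Rightarrow> (complex \<Rightarrow> complex) \<Rightarrow> complex \<Rightarrow> complex" where
  "Q_p k M p m n f = (\<lambda>z. \<Sum>s\<in>{0..int p - 1}. slash k
     (mat2 1 (of_int (m - s))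
           (of_int (4 * int (M div p))) (of_int (n * int p - 4 * int (M div p) * s)),
      \<lambda>z. csqrt (of_int (4 * int (M div p)) * z + of_int (n * int p - 4 * int (M div p) * s))) f z)"

definition Q_p' :: "nat \<Rightarrow> nat \<Rightarrow> nat \<Rightarrow> int \<Rightarrow> int \<Rightarrow> (complex \<Rightarrow> complex) \<Rightarrow> complex \<Rightarrow> complex" where
  "Q_p' k M p m n = W_p2 k M p m n \<circ> Q_p k M p m n \<circ> W_p2 k M p m n"


subsection \<open>The operators at 2\<close>

text \<open>Here \<open>m\<close> and \<open>n\<close> are integers with \<open>4 * n - m * M = 1\<close>.\<close>

definition omega :: "nat \<Rightarrow> nat \<Rightarrow> complex" where
  "omega k M = (if M mod 4 = 1 then 1 else - \<i> * (-1) ^ k)"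

definition W_4 :: "nat \<Rightarrow> nat \<Rightarrow> int \<Rightarrow> int \<Rightarrow> (complex \<Rightarrow> complex) \<Rightarrow> complex \<Rightarrow> complex" where
  "W_4 k M m n f = (\<lambda>z.
     of_int (quad_symbol 2 (2 * int k + 1)) * exp ((2 * of_nat k + 1) * pi * \<i> / 4) * omega k M
     * slash k (mat2 (of_int (4 * n)) (of_int m) (of_nat (4 * M)) 4,
                \<lambda>z. csqrt (2 * of_nat M * z + 2)) f z)"

definition Q_2 :: "nat \<Rightarrow> nat \<Rightarrow> int \<Rightarrow> int \<Rightarrow> (complex \<Rightarrow> complex) \<Rightarrow> complex \<Rightarrow> complex" where
  "Q_2 k M m n f = (\<lambda>z. 2 powi (1 - int k) * U_op 4 (W_4 k M m n f) z)"

definition Q_2' :: "nat \<Rightarrow> nat \<Rightarrow> int \<Rightarrow> int \<Rightarrow> (complex \<Rightarrow> complex) \<Rightarrow> complex \<Rightarrow> complex" where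
  "Q_2' k M m n = W_4 k M m n \<circ> Q_2 k M m n \<circ> W_4 k M m n"


subsection \<open>The minus space\<close>

text \<open>
  Below, \<open>m\<close> and \<open>n\<close> assign to each prime \<open>p\<close> dividing \<open>M\<close> the integers entering \<^const>\<open>W_p2\<close>,
  and \<open>m\<^sub>2\<close>, \<open>n\<^sub>2\<close> are those entering \<^const>\<open>W_4\<close>. The operators, and hence the spaces, do not
  depend on these choices.
\<close>

definition B_space :: "nat \<Rightarrow> nat \<Rightarrow> (nat \<Rightarrow> int) \<Rightarrow> (nat \<Rightarrow> int) \<Rightarrow> nat \<Rightarrow> (complex \<Rightarrow> complex) set" where
  "B_space k M m n p =
     cusp_forms k (4 * (M div p)) + W_p2 k M p (m p) (n p) ` cusp_forms k (4 * (M div p))"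

definition E_space ::
  "nat \<Rightarrow> nat \<Rightarrow> (nat \<Rightarrow> int) \<Rightarrow> (nat \<Rightarrow> int) \<Rightarrow> int \<Rightarrow> int \<Rightarrow> (complex \<Rightarrow> complex) set" where
  "E_space k M m n m\<^sub>2 n\<^sub>2 = (\<Sum>p\<in>prime_factors M. B_space k M m n p)
     + plus_new_space k M + W_4 k M m\<^sub>2 n\<^sub>2 ` plus_new_space k M"

definition minus_space ::
  "nat \<Rightarrow> nat \<Rightarrow> (nat \<Rightarrow> int) \<Rightarrow> (nat \<Rightarrow> int) \<Rightarrow> int \<Rightarrow> int \<Rightarrow> (complex \<Rightarrow> complex) set" where
  "minus_space k M m n m\<^sub>2 n\<^sub>2 =
     orth_compl k (4 * M) (cusp_forms k (4 * M)) (E_space k M m n m\<^sub>2 n\<^sub>2)"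

end

(* For p | M the operator 1 + Q_p is the trace from level 4M to level 4M/p, and traces are adjoint
  to inclusions, so Q_p f = -f says that f is orthogonal to S(4M/p). As W_{p^2} is a self-adjoint
  involution, Q'_p f = -f says that f is orthogonal to W_{p^2} S(4M/p). (After rescaling by p,
  W_{p^2} f is a multiple of a sum of functions E_u indexed by residues u mod p. The products
  <E_u, E_0> with u \<noteq> 0 depend on u through the character (u/p) and cancel, so W_{p^2} is unitary;
  a self-adjoint unitary operator is an involution.) As Q_p W_{p^2} is a multiple of U_{p^2}, the
  space U_{p^2} S(4M/p) lies in B_p; hence, for f orthogonal to all B_p, orthogonality to the new
  plus space is orthogonality to the whole plus space.

  At 2, Q'_2 is the sum of R and of R slashed by a matrix of Gamma_0(4), where R is the involution
  that changes the sign of the coefficients a_n with (-1)^k n not congruent to 0, 1 mod 4. It is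
  self-adjoint, it is 2 on the plus space, and Q'_2 + 1 maps into the plus space: hence (Q'_2 + 1)/3
  is the orthogonal projection onto the plus space. So Q'_2 f = -f means that f is orthogonal to
  the plus space, and Q_2 f = -f says the same of W_4 f.

  All adjoints rest on one fact: the Petersson product is unchanged, up to a factor, when both
  arguments are slashed by the same rational matrix. It is proved by unfolding against a
  finite-index congruence subgroup, without computing fundamental domains of the groups involved. *)
theory Submission
 imports Defs
begin

section \<open>The Jacobi symbol\<close>

text \<open>The obstacle is the square root in the weight: slashes by matrices outside
  \<open>Gamma0 4\<close> compose only up to a sign. Two operations are therefore kept apart.
  \<open>js\<close>, the action of \<open>Gamma0 4\<close> through the theta multiplier, is exactly
  multiplicative once the multiplier is a cocycle; this is checked on generators, and quadratic
  reciprocity enters there through the periodicity of the symbol. \<open>sl\<close>, with principal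
  square roots, serves for all other matrices. The operators at p are expressed by \<open>js\<close>
  after rescaling; \<open>W_4\<close> is a matrix of \<open>Gamma0 4\<close> followed by z -> -1/(4
  z), which is compatible with the multiplier. The functions that arise have various levels and
  characters, but each is fixed by a principal congruence subgroup, and the product is formed over
  such a group. The projection onto the plus space is applied to f and to W_4 f alike; for W_4 f it
  has to be shown that W_4 preserves orthogonality to U_{p^2} S(4M/p), which comes from a matrix
  identity between W_4 and the rescaling by p^2.\<close>

definition jacobi :: "int \<Rightarrow> nat \<Rightarrow> int" where
 "jacobi a n = (\<Prod>p\<in>#prime_factorization n. Legendre a (int p))"

text \<open>On odd integers, negative ones included, this is the nontrivial character mod 4; the
  value at even integers has no meaning.\<close>

definition chi4 :: "int \<Rightarrow> int" where
 "chi4 d = (if d mod 4 = 1 then 1 else -1)"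

lemma Legendre_cases: "Legendre a p = 0 \<or> Legendre a p = 1 \<or> Legendre a p = -1"
 by (auto simp: Legendre_def)

lemma Legendre_cong: "[a = b] (mod p) \<Longrightarrow> Legendre a p = Legendre b p"
proof -
 assume "[a = b] (mod p)"
 hence "\<And>x. [x = a] (mod p) \<longleftrightarrow> [x = b] (mod p)" by (meson cong_sym cong_trans)
 moreover from this have "[a = 0] (mod p) \<longleftrightarrow> [b = 0] (mod p)" using cong_sym_eq by blast
 ultimately show ?thesis by (simp add: Legendre_def QuadRes_def)
qed

text \<open>Two numbers in {-1, 0, 1} differ by at most 2, which is less than p. Euler's criterion
  determines Legendre symbols only mod p; this turns its congruences into equalities.\<close>

lemma small_cong_eq:
 fixes x y p :: int
 assumes "[x = y] (mod p)" "\<bar>x\<bar> \<le> 1" "\<bar>y\<bar> \<le> 1" "p > 2" shows "x = y"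
proof -
 have "p dvd x - y" using assms(1) by (simp add: cong_iff_dvd_diff)
 moreover have "\<bar>x - y\<bar> < p" using assms by linarith
 ultimately show ?thesis using zdvd_not_zless[of "\<bar>x - y\<bar>" p] by auto
qed

lemma Legendre_mult:
 assumes "prime p" "p > (2::nat)"
 shows "Legendre (a * b) (int p) = Legendre a (int p) * Legendre b (int p)"
proof (rule small_cong_eq[of _ _ "int p"])
 show "[Legendre (a * b) (int p) = Legendre a (int p) * Legendre b (int p)] (mod int p)"
  using euler_criterion[OF assms, of "a*b"] cong_mult[OF euler_criterion[OF assms, of a] euler_criterion[OF assms, of b]]
  by (metis cong_sym cong_trans power_mult_distrib)
qed (use assms Legendre_cases[of a p] Legendre_cases[of b p] Legendre_cases[of "a*b" p] in auto)

lemma Legendre_minus1: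
 assumes "prime p" "p > (2::nat)" shows "Legendre (-1) (int p) = chi4 (int p)"
proof -
 have "Legendre (-1) (int p) = (-1) ^ ((p - 1) div 2)"
 proof (rule small_cong_eq[of _ _ "int p"])
  show "[Legendre (-1) (int p) = (-1) ^ ((p - 1) div 2)] (mod int p)" using euler_criterion[OF assms] .
 qed (use assms Legendre_cases[of "-1" p] in \<open>auto simp: power_abs\<close>)
 moreover have "odd p" using assms prime_odd_nat by auto
 hence "p mod 4 = 1 \<or> p mod 4 = 3" by presburger
 hence "(-1::int) ^ ((p - 1) div 2) = chi4 (int p)"
 proof
  assume "p mod 4 = 1"
  hence "even ((p-1) div 2)" "int p mod 4 = 1" by presburger+
  thus ?thesis by (simp add: chi4_def)
 next
  assume "p mod 4 = 3"
  hence "odd ((p-1) div 2)" "int p mod 4 = 3" by presburger+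
  thus ?thesis by (simp add: chi4_def)
 qed
 ultimately show ?thesis by simp
qed

lemma Legendre_eq_0_iff: "Legendre a (int p) = 0 \<longleftrightarrow> int p dvd a" by (auto simp: Legendre_def cong_0_iff)

lemma chi4_mult: "odd a \<Longrightarrow> odd b \<Longrightarrow> chi4 (a * b) = chi4 a * chi4 b"
proof -
 assume "odd a" "odd b"
 hence "a mod 4 = 1 \<or> a mod 4 = 3" "b mod 4 = 1 \<or> b mod 4 = 3" by presburger+
 moreover have "(a * b) mod 4 = ((a mod 4) * (b mod 4)) mod 4" by (simp add: mod_mult_eq)
 ultimately show ?thesis by (auto simp: chi4_def)
qed

lemma chi4_minus: "odd d \<Longrightarrow> chi4 (- d) = - chi4 d" by (simp add: chi4_def) presburger

lemma chi4_cong: "[a = b] (mod 4) \<Longrightarrow> chi4 a = chi4 b" by (simp add: chi4_def cong_def)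

lemma chi4_square [simp]: "chi4 d * chi4 d = 1" by (simp add: chi4_def)

lemma jacobi_1 [simp]: "jacobi a 1 = 1" "jacobi a (Suc 0) = 1" by (simp_all add: jacobi_def)

lemma jacobi_mult_right:
 "m \<noteq> 0 \<Longrightarrow> n \<noteq> 0 \<Longrightarrow> jacobi a (m * n) = jacobi a m * jacobi a n"
 by (simp add: jacobi_def prime_factorization_mult)

lemma jacobi_prime: "prime p \<Longrightarrow> jacobi a p = Legendre a (int p)"
 by (simp add: jacobi_def prime_factorization_prime)

lemma jacobi_prime_mult: "prime p \<Longrightarrow> n \<noteq> 0 \<Longrightarrow> jacobi a (p * n) = Legendre a (int p) * jacobi a n"
 by (subst jacobi_mult_right) (auto simp: jacobi_prime)

lemma odd_nat_induct [consumes 1, case_names one prime_mult]: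
 assumes "odd n" "P 1" "\<And>p n. prime p \<Longrightarrow> p > 2 \<Longrightarrow> odd n \<Longrightarrow> P n \<Longrightarrow> P (p * n)" shows "P (n::nat)"
proof -
 have "n \<noteq> 0" using assms(1) by (intro notI) auto
 thus ?thesis using assms(1)
 proof (induction n rule: prime_divisors_induct)
  case (unit x) thus ?case using assms(2) by simp
 next
  case (factor p x)
  hence "odd p" "odd x" "x \<noteq> 0" by auto
  moreover from \<open>odd p\<close> factor have "p > 2" by (metis odd_numeral_BitM prime_ge_2_nat order_le_imp_less_or_eq even_numeral)
  ultimately show ?case using factor assms(3) by blast
 qed simp
qed

lemma jacobi_mult_left: "odd n \<Longrightarrow> jacobi (a * b) n = jacobi a n * jacobi b n"
 by (induction n rule: odd_nat_induct) (auto simp: jacobi_prime_mult Legendre_mult odd_pos)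

lemma jacobi_cong: "odd n \<Longrightarrow> [a = b] (mod int n) \<Longrightarrow> jacobi a n = jacobi b n"
proof (induction n rule: odd_nat_induct)
 case one thus ?case by simp
next
 case (prime_mult p n)
 hence "[a = b] (mod int n)" "[a = b] (mod int p)"
  by (auto simp: cong_iff_dvd_diff intro: dvd_mult_left dvd_mult_right)
 with prime_mult show ?case by (simp add: jacobi_prime_mult odd_pos Legendre_cong[of a b])
qed

lemma jacobi_cases: "odd n \<Longrightarrow> jacobi a n = 0 \<or> jacobi a n = 1 \<or> jacobi a n = -1"
proof (induction n rule: odd_nat_induct)
 case (prime_mult p n) thus ?case using Legendre_cases[of a p] by (auto simp: jacobi_prime_mult odd_pos)
qed simp

lemma jacobi_eq_0_iff: "odd n \<Longrightarrow> jacobi a n = 0 \<longleftrightarrow> \<not> coprime a (int n)"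
proof (induction n rule: odd_nat_induct)
 case (prime_mult p n)
 hence "int p dvd a \<longleftrightarrow> \<not> coprime a (int p)"
  by (metis coprime_commute coprime_absorb_left not_prime_unit prime_imp_coprime prime_nat_int_transfer)
 with prime_mult show ?case by (simp add: jacobi_prime_mult odd_pos Legendre_eq_0_iff)
qed simp

lemma jacobi_coprime: "odd n \<Longrightarrow> coprime a (int n) \<Longrightarrow> jacobi a n = 1 \<or> jacobi a n = -1"
 using jacobi_eq_0_iff[of n a] jacobi_cases[of n a] by blast

lemma jacobi_coprime_sq: "odd n \<Longrightarrow> coprime a (int n) \<Longrightarrow> jacobi a n * jacobi a n = 1"
 using jacobi_coprime[of n a] by auto

lemma jacobi_one_left [simp]: "odd n \<Longrightarrow> jacobi 1 n = 1"
 using jacobi_mult_left[of n 1 1] jacobi_coprime[of n 1] by auto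

lemma jacobi_minus1: "odd n \<Longrightarrow> jacobi (-1) n = chi4 (int n)"
proof (induction n rule: odd_nat_induct)
 case one show ?case by (simp add: chi4_def)
next
 case (prime_mult p n)
 hence "odd p" using prime_odd_nat by blast
 with prime_mult show ?case by (simp add: jacobi_prime_mult odd_pos Legendre_minus1 chi4_mult)
qed

text \<open>For odd arguments this is the reciprocity sign, -1 exactly if both are 3 mod 4. The
  asymmetric form through \<open>chi4\<close> also makes sense for negative n and is visibly
  multiplicative in n.\<close>

definition recip_sign :: "int \<Rightarrow> int \<Rightarrow> int" where
 "recip_sign m n = (if m mod 4 = 1 then 1 else chi4 n)"

lemma recip_sign_mult_left:
 "odd a \<Longrightarrow> odd b \<Longrightarrow> recip_sign (a * b) n = recip_sign a n * recip_sign b n"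
 using chi4_mult[of a b] by (auto simp: recip_sign_def chi4_def split: if_splits)

lemma recip_sign_mult_right:
 "odd n \<Longrightarrow> odd a \<Longrightarrow> odd b \<Longrightarrow> recip_sign n (a * b) = recip_sign n a * recip_sign n b"
 by (auto simp: recip_sign_def chi4_mult)

lemma Legendre_reciprocity:
 assumes "prime p" "2 < p" "prime q" "2 < q" "p \<noteq> q"
 shows "Legendre (int p) (int q) * Legendre (int q) (int p) = recip_sign (int p) (int q)"
proof -
 have "odd p" "odd q" using assms prime_odd_nat by auto
 hence "p mod 4 = 1 \<or> p mod 4 = 3" "q mod 4 = 1 \<or> q mod 4 = 3" by presburger+
 moreover have "p mod 4 = 1 \<Longrightarrow> even ((p-1) div 2) \<and> int p mod 4 = 1"
  "q mod 4 = 1 \<Longrightarrow> even ((q-1) div 2) \<and> int q mod 4 = 1"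
  "p mod 4 = 3 \<Longrightarrow> odd ((p-1) div 2) \<and> int p mod 4 = 3"
  "q mod 4 = 3 \<Longrightarrow> odd ((q-1) div 2) \<and> int q mod 4 = 3" by presburger+
 ultimately show ?thesis unfolding Quadratic_Reciprocity[OF assms] recip_sign_def chi4_def by auto
qed

lemma recip_sign_1 [simp]: "recip_sign 1 n = 1" "recip_sign n 1 = 1"
 by (simp_all add: recip_sign_def chi4_def)

lemma jacobi_reciprocity_prime:
 assumes "prime p" "2 < p" "odd n" "coprime p n"
 shows "jacobi (int p) n = recip_sign (int p) (int n) * Legendre (int n) (int p)" using assms(3,4)
proof (induction n rule: odd_nat_induct)
 case one
 have "\<not> int p dvd 1" using assms(2) by auto
 thus ?case using Legendre_eq_0_iff[of 1 p] Legendre_mult[OF assms(1,2), of 1 1] by auto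
next
 case (prime_mult q n)
 hence ne: "p \<noteq> q" "coprime p n" "odd p" "odd q" using prime_odd_nat assms by auto
 have "\<not> int p dvd int q" using ne assms prime_mult primes_dvd_imp_eq[of p q] by auto
 hence l: "Legendre (int q) (int p) * Legendre (int q) (int p) = 1"
  using Legendre_eq_0_iff[of "int q" p] Legendre_cases[of "int q" "int p"] by auto
 have "jacobi (int p) (q * n) = Legendre (int p) (int q) * jacobi (int p) n"
  using prime_mult by (simp add: jacobi_prime_mult odd_pos)
 also have "... = (Legendre (int p) (int q) * (Legendre (int q) (int p) * Legendre (int q) (int p)))
    * (recip_sign (int p) (int n) * Legendre (int n) (int p))" using prime_mult ne l by simp
 also have "... = recip_sign (int p) (int q) * recip_sign (int p) (int n) *
   (Legendre (int q) (int p) * Legendre (int n) (int p))"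
  using Legendre_reciprocity[OF assms(1,2) prime_mult(1,2) ne(1)] by (simp add: mult_ac)
 also have "... = recip_sign (int p) (int (q * n)) * Legendre (int (q * n)) (int p)"
  using ne prime_mult assms by (simp add: recip_sign_mult_right Legendre_mult)
 finally show ?case .
qed

lemma jacobi_reciprocity:
 assumes "odd m" "odd n" "coprime m n"
 shows "jacobi (int m) n = recip_sign (int m) (int n) * jacobi (int n) m" using assms(1,3)
proof (induction m rule: odd_nat_induct)
 case one thus ?case using assms by simp
next
 case (prime_mult p m)
 hence "coprime p n" "coprime m n" "odd p" using prime_odd_nat by auto
 thus ?case using prime_mult assms jacobi_reciprocity_prime[of p n]
  by (simp add: jacobi_mult_left jacobi_prime_mult odd_pos recip_sign_mult_left)
qed

text \<open>For d < 0 the factor (-1/m) = \<open>chi4 m\<close> turns \<open>recip_sign m\<close> at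
  |d| into its value at d, so no separate sign is left over.\<close>

lemma jacobi_reciprocity_int:
 assumes "odd m" "odd d" "coprime (int m) d"
 shows "jacobi (int m) (nat \<bar>d\<bar>) = recip_sign (int m) d * jacobi d m"
proof -
 have o: "odd (nat \<bar>d\<bar>)" using assms by (simp add: even_nat_iff)
 have c: "coprime m (nat \<bar>d\<bar>)" using assms(3) by (simp flip: coprime_int_iff)
 have 1: "jacobi (int m) (nat \<bar>d\<bar>) = recip_sign (int m) \<bar>d\<bar> * jacobi \<bar>d\<bar> m"
  using jacobi_reciprocity[OF assms(1) o c] by simp
 show ?thesis
 proof (cases "d < 0")
  case True
  have "jacobi \<bar>d\<bar> m = chi4 (int m) * jacobi d m"
   using jacobi_mult_left[OF assms(1), of "-1" d] jacobi_minus1[OF assms(1)] True by simp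
  moreover have "recip_sign (int m) \<bar>d\<bar> * chi4 (int m) = recip_sign (int m) d"
   using True chi4_minus[OF assms(2)] assms(1) by (auto simp: recip_sign_def chi4_def)
  ultimately show ?thesis using 1 by (metis mult.assoc)
 qed (use 1 in auto)
qed

text \<open>Since 2 = -(n - 2) mod n and n = 2 mod n - 2, reciprocity between n and n - 2 relates
  the two symbols. Its sign is 1 because one of n, n - 2 is 1 mod 4, so only (-1/n) remains.\<close>

lemma jacobi_2_rec:
 assumes "odd n" "n > 2" shows "jacobi 2 n = chi4 (int n) * jacobi 2 (n - 2)"
proof -
 have o: "odd (n - 2)" using assms by auto
 have cop: "coprime (n - 2) n"
 proof -
  have "gcd n 2 = 1" using assms(1) coprime_right_2_iff_odd coprime_iff_gcd_eq_1 by blast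
  hence "gcd (n - 2) n = 1" using assms(2) by (metis gcd.commute gcd_diff2_nat less_or_eq_imp_le)
  thus ?thesis by (simp only: coprime_iff_gcd_eq_1)
 qed
 have "jacobi 2 n = jacobi (-1 * int (n - 2)) n"
  by (rule jacobi_cong[OF assms(1)]) (use assms in \<open>simp add: cong_iff_dvd_diff of_nat_diff\<close>)
 also have "... = chi4 (int n) * jacobi (int (n - 2)) n"
  by (subst jacobi_mult_left) (use assms in \<open>auto simp: jacobi_minus1\<close>)
 also have "jacobi (int (n - 2)) n = recip_sign (int (n-2)) (int n) * jacobi (int n) (n - 2)"
  by (rule jacobi_reciprocity[OF o assms(1) cop])
 also have "recip_sign (int (n - 2)) (int n) = 1"
  unfolding recip_sign_def chi4_def using assms by auto presburger
 also have "jacobi (int n) (n - 2) = jacobi 2 (n - 2)"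
  by (rule jacobi_cong[OF o]) (use assms in \<open>simp add: cong_iff_dvd_diff of_nat_diff\<close>)
 finally show ?thesis by simp
qed

definition chi8 :: "int \<Rightarrow> int" where
 "chi8 d = (if d mod 8 = 1 \<or> d mod 8 = 7 then 1 else -1)"

lemma jacobi_2: "odd n \<Longrightarrow> jacobi 2 n = chi8 (int n)"
proof (induction n rule: less_induct)
 case (less n)
 show ?case
 proof (cases "n > 2")
  case True
  have "jacobi 2 n = chi4 (int n) * chi8 (int (n - 2))"
   using jacobi_2_rec[OF less.prems True] less.IH[of "n - 2"] True less.prems by simp
  also have "... = chi8 (int n)"
  proof -
   have chi: "chi4 x * chi8 (x - 2) = chi8 x" if "x mod 8 = y" "y = 1 \<or> y = 3 \<or> y = 5 \<or> y = 7" for x y :: int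
   proof -
    have "x mod 4 = y mod 4" using that(1) by (auto simp: mod_mod_cancel)
    moreover have "(x - 2) mod 8 = (y - 2) mod 8" using that(1) by (auto simp: mod_diff_left_eq)
    ultimately show ?thesis unfolding chi4_def chi8_def that(1) using that(2) by auto
   qed
   have "int n mod 8 = 1 \<or> int n mod 8 = 3 \<or> int n mod 8 = 5 \<or> int n mod 8 = 7"
    using less.prems by presburger
   with chi[OF refl, of "int n"] show ?thesis using True by (simp add: of_nat_diff)
  qed
  finally show ?thesis .
 next
  case False
  hence "n = 1" using less.prems by presburger
  thus ?thesis by (simp add: chi8_def)
 qed
qed

lemma chi8_abs: "odd d \<Longrightarrow> chi8 \<bar>d\<bar> = chi8 d" by (auto simp: chi8_def abs_if zmod_zminus1_eq_if)

section \<open>Periodicity of Shimura's symbol in its lower argument\<close>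

lemma jacobi_power: "odd n \<Longrightarrow> jacobi (a ^ e) n = jacobi a n ^ e"
 by (induction e) (auto simp: jacobi_mult_left)

lemma recip_sign_cong: "[a = b] (mod 4) \<Longrightarrow> recip_sign m a = recip_sign m b"
 by (simp add: recip_sign_def chi4_cong)

text \<open>Write c = 2^e m with m odd. Reciprocity makes (m/|d|) a function of d mod m and d mod 4,
  and 4 dvd c controls the latter. The factor (2/|d|)^e is a square for e = 2 and depends on d mod 8
  for e >= 3, when 8 divides c; e < 2 is excluded by 4 dvd c.\<close>

lemma jacobi_periodic:
 assumes "4 dvd c" "c > 0" "odd d" "odd d'" "coprime c d" "[d = d'] (mod c)"
 shows "jacobi c (nat \<bar>d\<bar>) = jacobi c (nat \<bar>d'\<bar>)"
proof -
 obtain e m where c: "c = 2 ^ e * m" "odd m"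
  by (rule multiplicity_decompose'[of c 2]) (use assms(2) in auto)
 with assms(2) have m: "m > 0" by (simp add: zero_less_mult_iff)
 have "coprime c d'" using assms(5,6) cong_imp_coprime by (metis coprime_commute)
 hence cop: "coprime m d" "coprime m d'" using assms(5) c by auto
 have e: "e \<ge> 2"
 proof (rule ccontr)
  assume "\<not> e \<ge> 2"
  hence "e = 0 \<or> e = 1" by auto
  thus False using c assms(1) by auto
 qed
 have o: "odd (nat \<bar>d\<bar>)" "odd (nat \<bar>d'\<bar>)" using assms by (auto simp: even_nat_iff)
 have 4: "[d = d'] (mod 4)" using assms(1,6) cong_dvd_modulus by blast
 have m': "[d = d'] (mod m)" using c assms(6) cong_dvd_modulus by (metis dvd_triv_right)
 have M: "jacobi m (nat \<bar>d\<bar>) = jacobi m (nat \<bar>d'\<bar>)"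
  using jacobi_reciprocity_int[of "nat m" d] jacobi_reciprocity_int[of "nat m" d'] assms m c cop
   recip_sign_cong[OF 4] jacobi_cong[of "nat m" d d'] m' by (simp add: even_nat_iff)
 have E: "jacobi 2 (nat \<bar>d\<bar>) ^ e = jacobi 2 (nat \<bar>d'\<bar>) ^ e"
 proof (cases "e = 2")
  case True
  thus ?thesis using o assms jacobi_coprime[of "nat \<bar>d\<bar>" 2] jacobi_coprime[of "nat \<bar>d'\<bar>" 2]
   by (auto simp: coprime_left_2_iff_odd)
 next
  case False
  with e have "e \<ge> 3" by simp
  hence "(2::int)^3 dvd c" using c le_imp_power_dvd[of 3 e "2::int"] by simp
  hence "[d = d'] (mod 8)" using assms(6) cong_dvd_modulus by force
  hence "chi8 d = chi8 d'" by (simp add: chi8_def cong_def)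
  thus ?thesis using o assms by (simp add: jacobi_2 chi8_abs)
 qed
 show ?thesis unfolding c(1) jacobi_mult_left[OF o(1)] jacobi_mult_left[OF o(2)]
  jacobi_power[OF o(1)] jacobi_power[OF o(2)] M E ..
qed

lemma quad_symbol_jacobi:
 "quad_symbol c d = (if c < 0 \<and> d < 0 then -1 else 1) * jacobi c (nat \<bar>d\<bar>)"
 by (simp add: quad_symbol_def jacobi_def)

lemma quad_symbol_pos: "c \<ge> 0 \<Longrightarrow> quad_symbol c d = jacobi c (nat \<bar>d\<bar>)" by (simp add: quad_symbol_jacobi)

text \<open>Shimura's extra sign for c, d < 0 is exactly what turns (-1/|d|) into
  \<open>chi4 d\<close> for both signs of d.\<close>

lemma quad_symbol_neg:
 assumes "c < 0" "odd d" shows "quad_symbol c d = chi4 d * jacobi (- c) (nat \<bar>d\<bar>)"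
proof -
 have o: "odd (nat \<bar>d\<bar>)" using assms by (auto simp: even_nat_iff)
 have "jacobi c (nat \<bar>d\<bar>) = jacobi (-1) (nat \<bar>d\<bar>) * jacobi (- c) (nat \<bar>d\<bar>)"
  by (subst jacobi_mult_left[symmetric]) (use o in auto)
 also have "jacobi (-1) (nat \<bar>d\<bar>) = (if d < 0 then - chi4 d else chi4 d)"
  using jacobi_minus1[OF o] chi4_minus[OF assms(2)] by auto
 finally show ?thesis using assms by (simp add: quad_symbol_jacobi)
qed

lemma quad_symbol_periodic:
 assumes "4 dvd c" "odd d" "odd d'" "coprime c d" "[d = d'] (mod c)"
 shows "quad_symbol c d = quad_symbol c d'"
proof (cases "c > 0")
 case True thus ?thesis using jacobi_periodic[of c d d'] assms by (simp add: quad_symbol_pos)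
next
 case False
 show ?thesis
 proof (cases "c = 0")
  case True thus ?thesis using assms by simp
 next
  case ne: False
  with False have c: "c < 0" by simp
  have "[d = d'] (mod 4)" using assms cong_dvd_modulus by blast
  moreover have "jacobi (-c) (nat \<bar>d\<bar>) = jacobi (-c) (nat \<bar>d'\<bar>)"
   by (rule jacobi_periodic) (use assms c in auto)
  ultimately show ?thesis using c assms by (simp add: quad_symbol_neg chi4_cong)
 qed
qed

lemma quad_symbol_mult_left:
 assumes "a > 0" "odd d" shows "quad_symbol (a * c) d = jacobi a (nat \<bar>d\<bar>) * quad_symbol c d"
 using assms by (simp add: quad_symbol_jacobi jacobi_mult_left even_nat_iff mult_less_0_iff)

lemma quad_symbol_cases:
 assumes "odd d" "coprime c d" shows "quad_symbol c d = 1 \<or> quad_symbol c d = -1"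
 using jacobi_coprime[of "nat \<bar>d\<bar>" c] assms by (auto simp: quad_symbol_jacobi even_nat_iff)

lemma jacobi_square_left:
 assumes "odd n" "coprime a (int n)" shows "jacobi (a * a) n = 1"
 using assms by (simp add: jacobi_mult_left jacobi_coprime_sq)

no_notation fps_nth (infixl "$" 75)

section \<open>Integer matrices acting on the upper half plane\<close>

lemma mat2_nth [simp]:
 "mat2 a b c d $ 1 $ 1 = a" "mat2 a b c d $ 1 $ 2 = b"
 "mat2 a b c d $ 2 $ 1 = c" "mat2 a b c d $ 2 $ 2 = d" by (simp_all only: mat2_def vector_2)

lemma mat2_eq_iff:
 "(A :: 'a::zero ^ 2 ^ 2) = B \<longleftrightarrow>
   A $ 1 $ 1 = B $ 1 $ 1 \<and> A $ 1 $ 2 = B $ 1 $ 2 \<and> A $ 2 $ 1 = B $ 2 $ 1 \<and> A $ 2 $ 2 = B $ 2 $ 2"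
 by (auto simp: vec_eq_iff forall_2)

lemma mult2_nth [simp]:
 "((A :: 'a::comm_ring_1 ^ 2 ^ 2) ** B) $ i $ j = A $ i $ 1 * B $ 1 $ j + A $ i $ 2 * B $ 2 $ j"
 by (simp add: matrix_matrix_mult_def sum_2)

lemma mat_nth2 [simp]:
 "(mat x :: 'a::comm_ring_1 ^ 2 ^ 2) $ 1 $ 1 = x" "(mat x :: 'a ^ 2 ^ 2) $ 1 $ 2 = 0"
 "(mat x :: 'a ^ 2 ^ 2) $ 2 $ 1 = 0" "(mat x :: 'a ^ 2 ^ 2) $ 2 $ 2 = x" by (simp_all add: mat_def)

lemma det_mat2 [simp]: "det (mat2 a b c d :: 'a::comm_ring_1 ^ 2 ^ 2) = a * d - b * c"
 by (simp add: det_2)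

lemma mat2_mult: "mat2 a b c d ** mat2 a' b' c' (d' :: int) =
 mat2 (a * a' + b * c') (a * b' + b * d') (c * a' + d * c') (c * b' + d * d')"
 by (simp add: mat2_eq_iff)

text \<open>The adjugate is the inverse on \<open>SL2Z\<close> and an integral multiple of the
  inverse otherwise, so that conjugations stay within integer matrices.\<close>

definition adj2 :: "int ^ 2 ^ 2 \<Rightarrow> int ^ 2 ^ 2" where
 "adj2 A = mat2 (A $ 2 $ 2) (- (A $ 1 $ 2)) (- (A $ 2 $ 1)) (A $ 1 $ 1)"

lemma adj2_nth [simp]:
 "adj2 A $ 1 $ 1 = A $ 2 $ 2" "adj2 A $ 1 $ 2 = - (A $ 1 $ 2)"
 "adj2 A $ 2 $ 1 = - (A $ 2 $ 1)" "adj2 A $ 2 $ 2 = A $ 1 $ 1" by (simp_all add: adj2_def)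

lemma adj2_mult: "adj2 A ** A = mat (det A)" "A ** adj2 A = mat (det A)"
 by (simp_all add: mat2_eq_iff det_2 algebra_simps)

lemma adj2_adj2 [simp]: "adj2 (adj2 A) = A" by (simp add: mat2_eq_iff)

lemma det_adj2 [simp]: "det (adj2 A) = det A" by (simp add: det_2 algebra_simps)

lemma adj2_SL2Z: "A \<in> SL2Z \<Longrightarrow> adj2 A ** A = mat 1" "A \<in> SL2Z \<Longrightarrow> A ** adj2 A = mat 1"
 by (simp_all add: SL2Z_def adj2_mult)

lemma adj2_cancel:
 assumes "A \<in> SL2Z"
 shows "adj2 A ** (A ** B) = B" "A ** (adj2 A ** B) = B" "B ** A ** adj2 A = B" "B ** adj2 A ** A = B"
 using adj2_SL2Z[OF assms] by (metis matrix_mul_assoc matrix_mul_lid matrix_mul_rid)+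

lemma SL2Z_mult: "A \<in> SL2Z \<Longrightarrow> B \<in> SL2Z \<Longrightarrow> A ** B \<in> SL2Z" by (simp add: SL2Z_def det_mul)

lemma SL2Z_adj2: "A \<in> SL2Z \<Longrightarrow> adj2 A \<in> SL2Z" by (simp add: SL2Z_def)

lemma SL2Z_1: "mat 1 \<in> SL2Z" by (simp add: SL2Z_def)

lemma Gamma0_mult: "A \<in> Gamma0 N \<Longrightarrow> B \<in> Gamma0 N \<Longrightarrow> A ** B \<in> Gamma0 N"
 by (auto simp: Gamma0_def SL2Z_mult)

lemma Gamma0_adj2: "A \<in> Gamma0 N \<Longrightarrow> adj2 A \<in> Gamma0 N" by (auto simp: Gamma0_def SL2Z_adj2)

lemma Gamma0_1: "mat 1 \<in> Gamma0 N" by (simp add: Gamma0_def SL2Z_1)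

lemma Gamma0_SL2Z: "A \<in> Gamma0 N \<Longrightarrow> A \<in> SL2Z" by (simp add: Gamma0_def)

lemma Gamma0_mono: "N dvd N' \<Longrightarrow> A \<in> Gamma0 N' \<Longrightarrow> A \<in> Gamma0 N"
 unfolding Gamma0_def using dvd_trans[of "int N" "int N'"] by auto

lemma Gamma0_mat2: "mat2 a b c d \<in> Gamma0 N \<longleftrightarrow> a * d - b * c = 1 \<and> int N dvd c"
 by (simp add: Gamma0_def SL2Z_def)

lemma Gamma0_props:
 assumes "A \<in> Gamma0 N" shows "A $ 1 $ 1 * A $ 2 $ 2 - A $ 1 $ 2 * A $ 2 $ 1 = 1" "int N dvd A $ 2 $ 1"
 using assms by (auto simp: Gamma0_def SL2Z_def det_2)

lemma SL2Z_coprime: "A \<in> SL2Z \<Longrightarrow> coprime (A $ 2 $ 1) (A $ 2 $ 2)"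
proof -
 assume "A \<in> SL2Z"
 hence "A $ 1 $ 1 * A $ 2 $ 2 - A $ 1 $ 2 * A $ 2 $ 1 = 1" by (simp add: SL2Z_def det_2)
 thus ?thesis by (intro coprimeI) (metis dvd_diff dvd_mult)
qed

lemma Gamma0_4_odd:
 assumes "A \<in> Gamma0 4" shows "4 dvd A $ 2 $ 1" "odd (A $ 2 $ 2)" "odd (A $ 1 $ 1)"
  "coprime (A $ 2 $ 1) (A $ 2 $ 2)"
proof -
 show "coprime (A $ 2 $ 1) (A $ 2 $ 2)" by (rule SL2Z_coprime[OF Gamma0_SL2Z[OF assms]])
 show 4: "4 dvd A $ 2 $ 1" using Gamma0_props(2)[OF assms] by simp
 have "even (A $ 2 $ 1)" using 4 by presburger
 hence "odd (A $ 1 $ 1 * A $ 2 $ 2)"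
  using Gamma0_props(1)[OF assms] by (metis diff_eq_eq dvd_mult even_add odd_one)
 thus "odd (A $ 2 $ 2)" "odd (A $ 1 $ 1)" by simp_all
qed

abbreviation mact :: "int ^ 2 ^ 2 \<Rightarrow> complex \<Rightarrow> complex" where
 "mact A \<equiv> mat_act (real_mat A)"

definition den :: "int ^ 2 ^ 2 \<Rightarrow> complex \<Rightarrow> complex" where
 "den A z = of_int (A $ 2 $ 1) * z + of_int (A $ 2 $ 2)"

lemma map_matrix_nth [simp]: "map_matrix f A $ i $ j = f (A $ i $ j)" by (simp add: map_matrix_def)

lemma mact_eq: "mact A z = (of_int (A $ 1 $ 1) * z + of_int (A $ 1 $ 2)) / den A z"
 by (simp add: mat_act_def moebius_def den_def)

lemma den_nonzero:
 assumes "0 < Im z" "det A \<noteq> 0" shows "den A z \<noteq> 0"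
proof
 assume "den A z = 0"
 hence "of_int (A $ 2 $ 1) * Im z = 0" "of_int (A $ 2 $ 1) * Re z + of_int (A $ 2 $ 2) = (0::real)"
  by (auto simp: den_def complex_eq_iff)
 hence "A $ 2 $ 1 = 0" "A $ 2 $ 2 = 0" using assms(1) by auto
 thus False using assms(2) by (simp add: det_2)
qed

lemma Im_mact: "Im (mact A z) = of_int (det A) * Im z / (cmod (den A z))\<^sup>2"
proof -
 have "Im (mact A z) = Im ((of_int (A $ 1 $ 1) * z + of_int (A $ 1 $ 2)) * cnj (den A z)) / (cmod (den A z))\<^sup>2"
  unfolding mact_eq by (subst complex_div_cnj) (simp add: flip: Im_divide_of_real)
 also have "Im ((of_int (A $ 1 $ 1) * z + of_int (A $ 1 $ 2)) * cnj (den A z)) = of_int (det A) * Im z"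
  by (simp add: den_def det_2 algebra_simps)
 finally show ?thesis .
qed

lemma mact_upper: "0 < Im z \<Longrightarrow> 0 < det A \<Longrightarrow> 0 < Im (mact A z)"
 using den_nonzero[of z A] by (simp add: Im_mact)

lemma mact_upper_SL2Z: "0 < Im z \<Longrightarrow> A \<in> SL2Z \<Longrightarrow> 0 < Im (mact A z)"
 by (rule mact_upper) (auto simp: SL2Z_def)

lemma mact_not_upper: "\<not> 0 < Im z \<Longrightarrow> 0 < det A \<Longrightarrow> \<not> 0 < Im (mact A z)"
 by (auto simp: Im_mact divide_simps mult_le_0_iff not_less)

lemma den_mult:
 assumes "0 < Im z" "det B \<noteq> 0" shows "den (A ** B) z = den A (mact B z) * den B z"
 using den_nonzero[OF assms] by (simp add: den_def mact_eq field_simps)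

lemma mact_mult:
 assumes "0 < Im z" "det B \<noteq> 0" shows "mact (A ** B) z = mact A (mact B z)"
proof -
 define N where "N = of_int (A $ 1 $ 1) * mact B z + of_int (A $ 1 $ 2)"
 have "of_int ((A ** B) $ 1 $ 1) * z + of_int ((A ** B) $ 1 $ 2) = N * den B z"
  using den_nonzero[OF assms] by (simp add: N_def mact_eq field_simps) (simp add: den_def algebra_simps)
 hence "mact (A ** B) z = (N * den B z) / (den A (mact B z) * den B z)"
  by (simp only: mact_eq[of "A ** B"] den_mult[OF assms])
 also have "... = N / den A (mact B z)" using den_nonzero[OF assms] by simp
 also have "... = mact A (mact B z)" by (simp only: mact_eq[of A] N_def)
 finally show ?thesis .
qed

lemma mact_mat: "x \<noteq> 0 \<Longrightarrow> mact (mat x) z = z" unfolding mact_eq den_def mat_nth2 by simp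

lemma mact_adj2:
 assumes "0 < Im z" "0 < det A" shows "mact (adj2 A) (mact A z) = z" "mact A (mact (adj2 A) z) = z"
proof -
 show "mact (adj2 A) (mact A z) = z"
  using assms by (subst mact_mult[symmetric]) (simp_all add: adj2_mult mact_mat)
 show "mact A (mact (adj2 A) z) = z"
  using assms by (subst mact_mult[symmetric]) (simp_all add: adj2_mult mact_mat)
qed


section \<open>The theta multiplier is a cocycle\<close>

text \<open>The root of b has argument in (0, pi/2), so the product of the roots has argument in
  (-pi/2, pi). It leaves the principal range only beyond pi/2, which requires a root of a with
  positive argument, and then the argument of a b exceeds pi, that is Im (a b) < 0.\<close>

lemma csqrt_mult_upper:
 assumes "0 < Im b" shows "csqrt a * csqrt b =
  (if (Im a > 0 \<or> Im a = 0 \<and> Re a < 0) \<and> Im (a * b) < 0 then - csqrt (a * b) else csqrt (a * b))"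
proof -
 define x y u v where "x = Re (csqrt b)" "y = Im (csqrt b)" "u = Re (csqrt a)" "v = Im (csqrt a)"
 note d = this
 define s where "s = csqrt a * csqrt b"
 have xy: "x > 0" "y > 0"
 proof -
  have "\<bar>Re b\<bar>\<^sup>2 < (cmod b)\<^sup>2" using assms by (simp add: cmod_power2)
  hence "\<bar>Re b\<bar> < cmod b" by (rule power2_less_imp_less) simp
  hence "cmod b + Re b > 0" "cmod b - Re b > 0" by linarith+
  thus "x > 0" "y > 0" unfolding d using assms by simp_all
 qed
 have sq: "s^2 = a * b" by (simp add: s_def power_mult_distrib)
 have Re_s: "Re s = u * x - v * y" and Im_s: "Im s = u * y + v * x" by (simp_all add: s_def d)
 have Im_ab: "Im (a * b) = 2 * Re s * Im s" by (simp add: power2_eq_square flip: sq)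
 have Im_a: "Im a = 2 * u * v" using power2_csqrt[of a] by (metis Im_power2 d(3,4))
 have Re_a: "Re a = u^2 - v^2" using power2_csqrt[of a] by (metis Re_power2 d(3,4))
 have u: "u > 0 \<or> u = 0 \<and> v \<ge> 0" using csqrt_principal[of a] by (simp add: d)
 show ?thesis
 proof (cases "Im a > 0 \<or> Im a = 0 \<and> Re a < 0")
  case True
  have v: "v > 0"
  proof (rule ccontr)
   assume "\<not> v > 0"
   with u have "u > 0 \<and> v \<le> 0 \<or> u = 0 \<and> v = 0" by auto
   thus False using True unfolding Im_a Re_a by (auto simp: mult_less_0_iff zero_less_mult_iff)
  qed
  have Im_s_pos: "Im s > 0" unfolding Im_s using xy v u by (intro add_nonneg_pos mult_pos_pos mult_nonneg_nonneg) auto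
  show ?thesis
  proof (cases "Im (a * b) < 0")
   case neg: True
   hence "Re s < 0" using Im_s_pos unfolding Im_ab by (simp add: mult_less_0_iff)
   hence "csqrt (a * b) = - s" by (intro csqrt_unique) (auto simp: sq)
   thus ?thesis using True neg by (simp add: s_def)
  next
   case False
   hence "Re s \<ge> 0" using Im_s_pos unfolding Im_ab by (simp add: mult_less_0_iff not_less zero_le_mult_iff)
   hence "csqrt (a * b) = s" using Im_s_pos by (intro csqrt_unique) (auto simp: sq)
   thus ?thesis using False by (simp add: s_def)
  qed
 next
  case False
  have "csqrt (a * b) = s"
  proof (cases "a = 0")
   case True thus ?thesis by (simp add: s_def)
  next
   case ne: False
   have uv: "u > 0 \<and> v \<le> 0"
   proof -
    have "u \<noteq> 0"
    proof
     assume "u = 0"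
     with False have "v = 0" unfolding Im_a Re_a by simp
     with \<open>u = 0\<close> have "csqrt a = 0" by (simp add: d complex_eq_iff)
     with ne show False by simp
    qed
    with u have "u > 0" by auto
    moreover have "v \<le> 0" using False \<open>u > 0\<close> unfolding Im_a Re_a by (auto simp: zero_less_mult_iff)
    ultimately show ?thesis ..
   qed
   have "Re s > 0" unfolding Re_s using uv xy by (smt (verit) mult_pos_pos mult_nonpos_nonneg)
   thus ?thesis by (intro csqrt_unique) (auto simp: sq)
  qed
  hence "csqrt a * csqrt b = csqrt (a * b)" by (simp only: s_def)
  thus ?thesis using False by (simp only: if_False simp_thms)
 qed
qed

abbreviation Tmat :: "int \<Rightarrow> int ^ 2 ^ 2" where "Tmat n \<equiv> mat2 1 n 0 1"
abbreviation Lmat :: "int \<Rightarrow> int ^ 2 ^ 2" where "Lmat n \<equiv> mat2 1 0 n 1"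

lemma theta_factor_den:
 "theta_factor A z = inverse (theta_eps (A $ 2 $ 2)) * of_int (quad_symbol (A $ 2 $ 1) (A $ 2 $ 2))
   * csqrt (den A z)" by (simp add: theta_factor_def den_def)

lemma theta_eps_nonzero [simp]: "theta_eps d \<noteq> 0" by (simp add: theta_eps_def)

lemma theta_factor_nonzero:
 assumes "A \<in> Gamma0 4" "0 < Im z" shows "theta_factor A z \<noteq> 0"
proof -
 have "det A \<noteq> 0" using assms(1) by (simp add: Gamma0_def SL2Z_def)
 thus ?thesis
  using den_nonzero[OF assms(2)] quad_symbol_cases[of "A $ 2 $ 2" "A $ 2 $ 1"] Gamma0_4_odd[OF assms(1)]
  by (auto simp: theta_factor_den)
qed

lemma Gamma0_4_gens:
 "Tmat n \<in> Gamma0 4" "Lmat (4 * n) \<in> Gamma0 4" "mat2 (-1) 0 0 (-1) \<in> Gamma0 4"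
 by (simp_all add: Gamma0_mat2)

lemma quad_symbol_1 [simp]: "quad_symbol c 1 = 1" "quad_symbol 0 (- 1) = 1"
 by (simp_all add: quad_symbol_jacobi)

lemma theta_factor_Tmat [simp]: "theta_factor (Tmat n) z = 1"
 by (simp add: theta_factor_den den_def theta_eps_def)

lemma theta_factor_Lmat: "theta_factor (Lmat n) z = csqrt (of_int n * z + 1)"
 by (simp add: theta_factor_den den_def theta_eps_def)

lemma theta_factor_neg1: "theta_factor (mat2 (-1) 0 0 (-1)) z = 1"
 by (simp add: theta_factor_den den_def theta_eps_def)

text \<open>Quantified over all A on the left, so that the set of good B is closed under products
  and inverses and it suffices to check generators.\<close>

definition theta_cocycle :: "int ^ 2 ^ 2 \<Rightarrow> bool" where
 "theta_cocycle B \<longleftrightarrow> (\<forall>A\<in>Gamma0 4. \<forall>z. 0 < Im z \<longrightarrow>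
   theta_factor (A ** B) z = theta_factor A (mact B z) * theta_factor B z)"

text \<open>The denominator does not change and d moves by a multiple of c, so everything rests on
  \<open>quad_symbol_periodic\<close>; this is where reciprocity enters the cocycle
  relation.\<close>

lemma theta_cocycle_T: "theta_cocycle (Tmat n)" unfolding theta_cocycle_def
proof (intro ballI allI impI)
 fix A z assume A: "A \<in> Gamma0 4" and z: "0 < Im z"
 note o = Gamma0_4_odd[OF A]
 define c d where "c = A $ 2 $ 1" "d = A $ 2 $ 2"
 have e: "(A ** Tmat n) $ 2 $ 1 = c" "(A ** Tmat n) $ 2 $ 2 = c * n + d" by (simp_all add: c_d_def)
 have odd': "odd (c * n + d)" using o by (auto simp: c_d_def)
 have q: "quad_symbol c d = quad_symbol c (c * n + d)"
  by (rule quad_symbol_periodic) (use o odd' in \<open>auto simp: c_d_def cong_iff_dvd_diff\<close>)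
 have "[c * n + d = d] (mod 4)" using o(1) by (auto simp: c_d_def cong_iff_dvd_diff)
 hence eps: "theta_eps (c * n + d) = theta_eps d" by (simp add: theta_eps_def cong_def)
 have "den (A ** Tmat n) z = den A (mact (Tmat n) z)"
  using den_mult[OF z, of "Tmat n" A] by (simp add: den_def[of "Tmat n"])
 thus "theta_factor (A ** Tmat n) z = theta_factor A (mact (Tmat n) z) * theta_factor (Tmat n) z"
  unfolding theta_factor_Tmat mult_1_right unfolding theta_factor_den e eps q[symmetric]
  by (simp only: c_d_def)
qed

text \<open>Here d is fixed and c moves by 4 d, which changes the symbol only through Shimura's sign
  for negative pairs. By \<open>csqrt_mult_upper\<close> that sign flips exactly when the principal
  roots of the denominators fail to multiply.\<close>

lemma theta_cocycle_L4: "theta_cocycle (Lmat 4)" unfolding theta_cocycle_def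
proof (intro ballI allI impI)
 fix A z assume A: "A \<in> Gamma0 4" and z: "0 < Im z"
 note o = Gamma0_4_odd[OF A]
 define c d where "c = A $ 2 $ 1" "d = A $ 2 $ 2"
 have od: "odd d" using o by (auto simp: c_d_def)
 have e: "(A ** Lmat 4) $ 2 $ 1 = c + 4 * d" "(A ** Lmat 4) $ 2 $ 2 = d" by (simp_all add: c_d_def)
 have "odd (nat \<bar>d\<bar>)" using od by (auto simp: even_nat_iff)
 hence "jacobi (c + 4 * d) (nat \<bar>d\<bar>) = jacobi c (nat \<bar>d\<bar>)"
  by (rule jacobi_cong) (simp add: cong_iff_dvd_diff)
 hence q: "quad_symbol (c + 4 * d) d = (if c \<ge> 0 \<and> c + 4 * d < 0 then -1 else 1) * quad_symbol c d"
  unfolding quad_symbol_jacobi by auto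
 define w where "w = mact (Lmat 4) z"
 have w: "0 < Im w" unfolding w_def using z by (intro mact_upper) auto
 define a b where "a = of_int c * w + of_int d" "b = 4 * z + 1"
 have ab: "a * b = of_int (c + 4 * d) * z + of_int d"
  using den_mult[OF z, of "Lmat 4" A] by (simp add: den_def a_b_def c_d_def w_def algebra_simps)
 have "Im b > 0" using z by (simp add: a_b_def)
 note sgn = csqrt_mult_upper[OF this, of a]
 have "Im (a * b) = of_int (c + 4 * d) * Im z" unfolding ab by simp
 hence "Im (a * b) < 0 \<longleftrightarrow> c + 4 * d < 0" using z
  by (simp only: mult_less_0_iff of_int_less_0_iff of_int_0_less_iff) auto
 moreover have "Im a > 0 \<longleftrightarrow> c > 0" unfolding a_b_def using w by (simp add: zero_less_mult_iff)
 moreover have "Im a = 0 \<and> Re a < 0 \<longleftrightarrow> c = 0 \<and> d < 0" unfolding a_b_def using w by auto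
 ultimately have s: "csqrt a * csqrt b = of_int (if c \<ge> 0 \<and> c + 4 * d < 0 then -1 else 1) * csqrt (a * b)"
  using sgn by auto
 have "den (A ** Lmat 4) z = a * b" unfolding den_def e ab ..
 moreover have "den A w = a" by (simp add: den_def a_b_def c_d_def)
 moreover have "theta_factor (Lmat 4) z = csqrt b" by (simp add: theta_factor_Lmat a_b_def)
 ultimately have "theta_factor (A ** Lmat 4) z =
   inverse (theta_eps d) * of_int ((if c \<ge> 0 \<and> c + 4 * d < 0 then -1 else 1) * quad_symbol c d) * csqrt (a * b)"
  unfolding theta_factor_den e q by (simp only:)
 also have "... = inverse (theta_eps d) * of_int (quad_symbol c d) *
    (of_int (if c \<ge> 0 \<and> c + 4 * d < 0 then -1 else 1) * csqrt (a * b))"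
  by (simp only: of_int_mult mult_ac)
 also have "... = inverse (theta_eps d) * of_int (quad_symbol c d) * csqrt a * csqrt b"
  unfolding s[symmetric] by (simp only: mult_ac)
 also have "... = theta_factor A w * theta_factor (Lmat 4) z"
  using \<open>den A w = a\<close> \<open>theta_factor (Lmat 4) z = csqrt b\<close> by (simp add: theta_factor_den[of A] c_d_def)
 finally show "theta_factor (A ** Lmat 4) z = theta_factor A (mact (Lmat 4) z) * theta_factor (Lmat 4) z"
  unfolding w_def .
qed

lemma quad_symbol_uminus:
 assumes "4 dvd c" "odd d" "coprime c d" "c \<noteq> 0"
 shows "quad_symbol (- c) (- d) = (if c > 0 then - chi4 d else chi4 d) * quad_symbol c d"
proof -
 have "chi4 (- d) = - chi4 d" using chi4_minus assms(2) by blast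
 thus ?thesis
  using assms quad_symbol_neg[of c d] quad_symbol_neg[of "-c" "-d"] quad_symbol_pos[of c d] quad_symbol_pos[of "-c" "-d"]
  by (cases "c > 0") (auto simp: mult.assoc[symmetric])
qed

text \<open>Passing from (c, d) to (-c, -d) turns the square root by i or -i. This is compensated by
  the exchange of the two values of \<open>theta_eps\<close> together with the factor
  \<open>chi4\<close> from \<open>quad_symbol_uminus\<close>.\<close>

lemma theta_cocycle_neg1: "theta_cocycle (mat2 (-1) 0 0 (-1))" unfolding theta_cocycle_def
proof (intro ballI allI impI)
 fix A z assume A: "A \<in> Gamma0 4" and z: "0 < Im z"
 note o = Gamma0_4_odd[OF A]
 define c d where "c = A $ 2 $ 1" "d = A $ 2 $ 2"
 have od: "odd d" and cop: "coprime c d" and c4: "4 dvd c" using o by (auto simp: c_d_def)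
 let ?N = "mat2 (-1) 0 0 (-1) :: int ^ 2 ^ 2"
 have e: "(A ** ?N) $ 2 $ 1 = - c" "(A ** ?N) $ 2 $ 2 = - d" by (simp_all add: c_d_def)
 have act: "mact ?N z = z" by (simp add: mact_eq den_def)
 have dn: "den (A ** ?N) z = - den A z" by (simp add: den_def algebra_simps)
 have d34: "d mod 4 = 1 \<and> (- d) mod 4 = 3 \<or> d mod 4 = 3 \<and> (- d) mod 4 = 1" using od by presburger
 have "theta_factor (A ** ?N) z = theta_factor A z"
 proof (cases "c = 0")
  \<comment> \<open>Here the denominator is d = 1 or d = -1, on the real axis, where the branch is
    not decided by the sign of an imaginary part.\<close>
  case True
  with cop have "\<bar>d\<bar> = 1" by simp
  hence d1: "d = 1 \<or> d = -1" by arith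
  have t1: "theta_eps 1 = 1" "theta_eps (- 1) = \<i>" by (simp_all add: theta_eps_def)
  have c1: "csqrt 1 = 1" "csqrt (- 1) = \<i>" by (simp, rule csqrt_unique) simp_all
  have "den A z = of_int d" using True by (simp add: den_def c_d_def)
  have L: "theta_factor (A ** ?N) z = inverse (theta_eps (- d)) * of_int (quad_symbol 0 (- d)) * csqrt (- of_int d)"
   using \<open>den A z = of_int d\<close> True by (simp only: theta_factor_den e dn minus_zero)
  have R: "theta_factor A z = inverse (theta_eps d) * of_int (quad_symbol 0 d) * csqrt (of_int d)"
   using \<open>den A z = of_int d\<close> True by (simp only: theta_factor_den c_d_def[symmetric])
  from d1 show ?thesis
  proof
   assume "d = 1" thus ?thesis unfolding L R using t1 c1 by simp
  next
   assume "d = -1" thus ?thesis unfolding L R using t1 c1 by simp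
  qed
 next
  case False
  have Im: "Im (den A z) > 0 \<longleftrightarrow> c > 0" "Im (den A z) < 0 \<longleftrightarrow> c < 0"
   using z by (simp_all add: den_def c_d_def zero_less_mult_iff mult_less_0_iff)
  have s: "csqrt (- den A z) = (if c > 0 then - \<i> else \<i>) * csqrt (den A z)"
  proof (cases "c > 0")
   case True
   hence "csqrt (- (- den A z)) = \<i> * csqrt (- den A z)" using Im by (intro csqrt_minus) auto
   thus ?thesis using True by (simp add: field_simps)
  next
   case neg: False
   hence "csqrt (- den A z) = \<i> * csqrt (den A z)" using Im False by (intro csqrt_minus) auto
   thus ?thesis using neg by simp
  qed
  have E: "theta_eps d = 1 \<and> theta_eps (- d) = \<i> \<and> chi4 d = 1 \<or>
    theta_eps d = \<i> \<and> theta_eps (- d) = 1 \<and> chi4 d = -1"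
   using d34 by (elim disjE conjE) (simp_all add: theta_eps_def chi4_def)
  have K: "inverse (theta_eps (- d)) * of_int (if c > 0 then - chi4 d else chi4 d) * (if c > 0 then - \<i> else \<i>)
    = inverse (theta_eps d)" by (cases "c > 0"; use E in \<open>elim disjE conjE; simp\<close>)
  have "theta_factor (A ** ?N) z = inverse (theta_eps (- d)) * of_int ((if c > 0 then - chi4 d else chi4 d) * quad_symbol c d)
    * ((if c > 0 then - \<i> else \<i>) * csqrt (den A z))"
   by (simp only: theta_factor_den e dn s quad_symbol_uminus[OF c4 od cop False])
  also have "... = inverse (theta_eps d) * of_int (quad_symbol c d) * csqrt (den A z)"
   unfolding K[symmetric] by (simp only: of_int_mult mult_ac)
  also have "... = theta_factor A z" by (simp only: theta_factor_den c_d_def)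
  finally show ?thesis .
 qed
 thus "theta_factor (A ** ?N) z = theta_factor A (mact ?N z) * theta_factor ?N z"
  by (simp only: act theta_factor_neg1 mult_1_right)
qed

lemma theta_cocycle_mult:
 assumes "theta_cocycle B" "theta_cocycle C" "B \<in> Gamma0 4" "C \<in> Gamma0 4"
 shows "theta_cocycle (B ** C)" unfolding theta_cocycle_def
proof (intro ballI allI impI)
 fix A z assume A: "A \<in> Gamma0 4" and z: "0 < Im z"
 have det: "det C \<noteq> 0" "0 < Im (mact C z)"
  using assms(4) mact_upper_SL2Z[OF z] by (auto simp: Gamma0_def SL2Z_def)
 have "theta_factor (A ** (B ** C)) z = theta_factor (A ** B) (mact C z) * theta_factor C z"
  using assms(2) Gamma0_mult[OF A assms(3)] z by (simp add: theta_cocycle_def matrix_mul_assoc)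
 also have "theta_factor (A ** B) (mact C z) = theta_factor A (mact B (mact C z)) * theta_factor B (mact C z)"
  using assms(1) A det by (simp add: theta_cocycle_def)
 also have "theta_factor A (mact B (mact C z)) * theta_factor B (mact C z) * theta_factor C z =
   theta_factor A (mact (B ** C) z) * theta_factor (B ** C) z"
  using assms(2,3) z by (simp add: theta_cocycle_def mact_mult[OF z det(1)])
 finally show "theta_factor (A ** (B ** C)) z = theta_factor A (mact (B ** C) z) * theta_factor (B ** C) z" .
qed

lemma theta_cocycle_inverse:
 assumes "theta_cocycle B" "B \<in> Gamma0 4" shows "theta_cocycle (adj2 B)" unfolding theta_cocycle_def
proof (intro ballI allI impI)
 fix A z assume A: "A \<in> Gamma0 4" and z: "0 < Im z"
 have B: "B \<in> SL2Z" "det B = 1" using assms(2) by (auto simp: Gamma0_def SL2Z_def)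
 let ?w = "mact (adj2 B) z"
 have w: "0 < Im ?w" using z B by (intro mact_upper) auto
 have bk: "mact B ?w = z" using mact_adj2(2)[OF z, of B] B by simp
 have 1: "theta_factor A ?w = theta_factor (A ** adj2 B) z * theta_factor B ?w"
 proof -
  have "theta_factor (A ** adj2 B ** B) ?w = theta_factor (A ** adj2 B) (mact B ?w) * theta_factor B ?w"
   using assms(1) Gamma0_mult[OF A Gamma0_adj2[OF assms(2)]] w unfolding theta_cocycle_def by blast
  thus ?thesis by (simp only: adj2_cancel[OF B(1)] bk)
 qed
 have 2: "1 = theta_factor (adj2 B) z * theta_factor B ?w"
 proof -
  have "theta_factor (adj2 B ** B) ?w = theta_factor (adj2 B) (mact B ?w) * theta_factor B ?w"
   using assms(1) Gamma0_adj2[OF assms(2)] w unfolding theta_cocycle_def by blast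
  moreover have "theta_factor (mat 1) ?w = 1"
   using theta_factor_Tmat[of 0 ?w] by (simp add: theta_factor_den den_def)
  ultimately show ?thesis by (simp only: adj2_SL2Z[OF B(1)] bk)
 qed
 have "theta_factor A ?w * theta_factor (adj2 B) z =
   theta_factor (A ** adj2 B) z * (theta_factor (adj2 B) z * theta_factor B ?w)"
  unfolding 1 by (simp only: mult_ac)
 thus "theta_factor (A ** adj2 B) z = theta_factor A ?w * theta_factor (adj2 B) z"
  unfolding 2[symmetric] by simp
qed

lemma exists_small_residue:
 fixes x y :: int assumes "y \<noteq> 0" shows "\<exists>n. 2 * \<bar>x + n * y\<bar> \<le> \<bar>y\<bar>"
proof -
 define r where "r = x mod \<bar>y\<bar>"
 have r: "0 \<le> r" "r < \<bar>y\<bar>" using assms by (simp_all add: r_def)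
 have "\<bar>y\<bar> dvd x - r" by (simp add: r_def minus_mod_eq_mult_div)
 hence "y dvd x - r" by simp
 then obtain q where q: "x - r = y * q" ..
 show ?thesis
 proof (cases "2 * r \<le> \<bar>y\<bar>")
  case True
  have "x + (- q) * y = r" using q by (simp add: algebra_simps)
  thus ?thesis using True r by (intro exI[of _ "-q"]) simp
 next
  case False
  have "x + (- q - sgn y) * y = r - \<bar>y\<bar>" using q by (simp add: algebra_simps abs_sgn)
  thus ?thesis using False r by (intro exI[of _ "- q - sgn y"]) simp
 qed
qed

lemma int_power_induct:
 assumes "P (0::int)" "\<And>n. P n \<Longrightarrow> P (n + 1)" "\<And>n. P n \<Longrightarrow> P (n - 1)" shows "P n"
 using int_induct[of P 0 n] assms by auto

text \<open>Euclidean algorithm on the lower row: reduce d mod c by T, then c mod 4 d by L. The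
  first remainder d' is odd while c/2 is even, so 2 |d'| < |c| strictly, and the new c has absolute
  value at most 2 |d'| < |c|. At c = 0 only plus or minus a translation is left.\<close>

lemma Gamma0_4_induct [consumes 1, case_names T L neg mult inverse]:
 assumes "A \<in> Gamma0 4" and T: "P (Tmat 1)" and L: "P (Lmat 4)" and neg: "P (mat2 (-1) 0 0 (-1))"
  and mult: "\<And>A B. A \<in> Gamma0 4 \<Longrightarrow> B \<in> Gamma0 4 \<Longrightarrow> P A \<Longrightarrow> P B \<Longrightarrow> P (A ** B)"
  and inv: "\<And>A. A \<in> Gamma0 4 \<Longrightarrow> P A \<Longrightarrow> P (adj2 A)" shows "P A"
proof -
 note gens = Gamma0_4_gens Gamma0_4_gens(1)[of 1, simplified] Gamma0_4_gens(2)[of 1, simplified]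
 have I: "P (mat 1)"
 proof -
  have "mat2 (-1) 0 0 (-1) ** mat2 (-1) 0 0 (-1) = (mat 1 :: int ^ 2 ^ 2)" by (simp add: mat2_eq_iff)
  thus ?thesis using mult[OF gens(3,3) neg neg] by (simp only:)
 qed
 have T1: "P (Tmat n)" for n
 proof (induction n rule: int_power_induct)
  case 1
  have "mat2 1 0 0 1 = (mat 1 :: int ^ 2 ^ 2)" by (simp add: mat2_eq_iff)
  thus ?case using I by simp
 next
  case (2 n) thus ?case using mult[OF gens(1) gens(1) _ T, of n] by (simp add: mat2_mult algebra_simps)
 next
  case (3 n)
  have "adj2 (Tmat 1) = Tmat (-1)" by (simp add: mat2_eq_iff)
  hence "P (Tmat (-1))" using inv[OF gens(1) T] by simp
  thus ?case using mult[OF gens(1) gens(1) 3, of "-1"] by (simp add: mat2_mult algebra_simps)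
 qed
 have L1: "P (Lmat (4 * n))" for n
 proof (induction n rule: int_power_induct)
  case 1
  have "mat2 1 0 0 1 = (mat 1 :: int ^ 2 ^ 2)" by (simp add: mat2_eq_iff)
  thus ?case using I by simp
 next
  case (2 n) thus ?case using mult[OF gens(2) gens(2) _ _, of n 1] L by (simp add: mat2_mult algebra_simps)
 next
  case (3 n)
  have "adj2 (Lmat 4) = Lmat (-4)" by (simp add: mat2_eq_iff)
  hence "P (Lmat (-4))" using inv[of "Lmat 4"] gens L by (auto simp: Gamma0_mat2)
  thus ?case using mult[OF gens(2) gens(2) 3, of "-1"] by (simp add: mat2_mult algebra_simps)
 qed
 show ?thesis using assms(1)
 proof (induction "nat \<bar>A $ 2 $ 1\<bar>" arbitrary: A rule: less_induct)
  case (less A)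
  note o = Gamma0_4_odd[OF less.prems] and d = Gamma0_props(1)[OF less.prems]
  define c d where "c = A $ 2 $ 1" "d = A $ 2 $ 2"
  show ?case
  proof (cases "c = 0")
   case True
   hence ad: "A $ 1 $ 1 * A $ 2 $ 2 = 1" using d by (simp add: c_d_def)
   then consider "A $ 1 $ 1 = 1" "A $ 2 $ 2 = 1" | "A $ 1 $ 1 = -1" "A $ 2 $ 2 = -1"
    using zmult_eq_1_iff by auto
   thus ?thesis
   proof cases
    case 1
    hence "A = Tmat (A $ 1 $ 2)" using True by (simp add: mat2_eq_iff c_d_def)
    thus ?thesis using T1 by metis
   next
    case 2
    hence "A = mat2 (-1) 0 0 (-1) ** Tmat (- (A $ 1 $ 2))" using True by (simp add: mat2_eq_iff c_d_def)
    thus ?thesis using mult[OF gens(3) gens(1) neg T1] by metis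
   qed
  next
   case False
   obtain n where n: "2 * \<bar>d + n * c\<bar> \<le> \<bar>c\<bar>" using exists_small_residue[OF False] by blast
   define d' where "d' = d + n * c"
   have odd': "odd d'" using o by (auto simp: d'_def c_d_def)
   obtain c1 where c1: "c = 4 * c1" using o(1) by (auto simp: c_d_def dvd_def)
   have "2 * \<bar>d'\<bar> \<noteq> \<bar>c\<bar>"
   proof
    assume "2 * \<bar>d'\<bar> = \<bar>c\<bar>"
    hence "\<bar>d'\<bar> = 2 * \<bar>c1\<bar>" using c1 by (simp add: abs_mult)
    thus False using odd' by (metis dvd_abs_iff dvd_triv_left)
   qed
   hence lt: "2 * \<bar>d'\<bar> < \<bar>c\<bar>" using n d'_def by auto
   have d'0: "4 * d' \<noteq> 0" using odd' by auto
   obtain l where l: "2 * \<bar>c + l * (4 * d')\<bar> \<le> \<bar>4 * d'\<bar>" using exists_small_residue[OF d'0] by blast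
   define A' where "A' = A ** Tmat n ** Lmat (4 * l)"
   have A'G: "A' \<in> Gamma0 4" unfolding A'_def by (intro Gamma0_mult less.prems gens)
   have "A' $ 2 $ 1 = c + l * (4 * d')" by (simp add: A'_def c_d_def d'_def algebra_simps)
   moreover have "\<bar>e\<bar> < \<bar>c\<bar>" if "2 * \<bar>e\<bar> \<le> \<bar>4 * d'\<bar>" for e using that lt by linarith
   ultimately have "\<bar>A' $ 2 $ 1\<bar> < \<bar>c\<bar>" using l by (simp only:)
   hence PA': "P A'" using less.hyps[of A'] A'G by (simp add: c_d_def)
   have "A = A' ** Lmat (4 * (- l)) ** Tmat (- n)" by (simp add: A'_def mat2_eq_iff algebra_simps)
   thus ?thesis using mult[OF Gamma0_mult[OF A'G gens(2)] gens(1) mult[OF A'G gens(2) PA' L1] T1] by metis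
  qed
 qed
qed

lemma theta_cocycle: "B \<in> Gamma0 4 \<Longrightarrow> theta_cocycle B"
proof (induction B rule: Gamma0_4_induct)
 case (mult A B) thus ?case by (intro theta_cocycle_mult)
next
 case (inverse A) thus ?case by (intro theta_cocycle_inverse)
qed (fact theta_cocycle_T theta_cocycle_L4 theta_cocycle_neg1)+

lemma theta_factor_mult:
 assumes "A \<in> Gamma0 4" "B \<in> Gamma0 4" "0 < Im z"
 shows "theta_factor (A ** B) z = theta_factor A (mact B z) * theta_factor B z"
 using theta_cocycle[OF assms(2)] assms unfolding theta_cocycle_def by blast

section \<open>Spaces of cusp forms\<close>

text \<open>Meant for arbitrary integer matrices of positive determinant. The principal root is
  taken and the determinant is not normalised; composition holds up to sign
  (\<open>sl_mult\<close>).\<close>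

definition sl :: "nat \<Rightarrow> int ^ 2 ^ 2 \<Rightarrow> (complex \<Rightarrow> complex) \<Rightarrow> complex \<Rightarrow> complex" where
 "sl k A f = (\<lambda>z. f (mact A z) / csqrt (den A z) ^ (2 * k + 1))"

text \<open>The genuine right action of \<open>Gamma0 4\<close> (\<open>js_mult\<close>); forms of
  level N are its fixed vectors under \<open>Gamma0 N\<close>
  (\<open>cusp_forms_eq\<close>).\<close>

definition js :: "nat \<Rightarrow> int ^ 2 ^ 2 \<Rightarrow> (complex \<Rightarrow> complex) \<Rightarrow> complex \<Rightarrow> complex" where
 "js k A f = (\<lambda>z. f (mact A z) / theta_factor A z ^ (2 * k + 1))"

abbreviation qx :: "nat \<Rightarrow> nat \<Rightarrow> complex \<Rightarrow> complex" where
 "qx h n z \<equiv> exp (2 * pi * \<i> * of_nat n * z / of_nat h)"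

definition q_cuspidal :: "(complex \<Rightarrow> complex) \<Rightarrow> bool" where
 "q_cuspidal f \<longleftrightarrow> (\<exists>h>0. \<exists>a. a 0 = 0 \<and> has_q_expansion h a f)"

text \<open>No group occurs here: cuspidality is required after slashing by every integer matrix of
  positive determinant. The space is therefore stable under all matrices that occur later, and the
  level is imposed separately through \<open>js\<close>.\<close>

definition cusp_space :: "nat \<Rightarrow> (complex \<Rightarrow> complex) set" where
 "cusp_space k = {f. (\<forall>z. \<not> 0 < Im z \<longrightarrow> f z = 0) \<and> f holomorphic_on upper_half_plane \<and>
   (\<forall>A. 0 < det A \<longrightarrow> q_cuspidal (sl k A f))}"

lemma open_uhp: "open upper_half_plane" and convex_uhp: "convex upper_half_plane"
 and connected_uhp: "connected upper_half_plane"
 using open_halfspace_Im_gt[of 0] convex_halfspace_Im_gt[of 0] by (simp_all add: convex_connected)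

lemma has_q_expansion_cong:
 "(\<And>z. 0 < Im z \<Longrightarrow> f z = g z) \<Longrightarrow> has_q_expansion h a f \<longleftrightarrow> has_q_expansion h a g"
 by (simp add: has_q_expansion_def)

lemma q_cuspidal_cong: "(\<And>z. 0 < Im z \<Longrightarrow> f z = g z) \<Longrightarrow> q_cuspidal f \<longleftrightarrow> q_cuspidal g"
 unfolding q_cuspidal_def using has_q_expansion_cong[of f g] by simp

lemma q_cuspidal_cmult: "q_cuspidal f \<Longrightarrow> q_cuspidal (\<lambda>z. c * f z)"
proof -
 assume "q_cuspidal f"
 then obtain h a where ha: "h > 0" "a 0 = 0" "has_q_expansion h a f" by (auto simp: q_cuspidal_def)
 hence "has_q_expansion h (\<lambda>n. c * a n) (\<lambda>z. c * f z)"
  by (auto simp: has_q_expansion_def mult.assoc intro!: sums_mult)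
 thus ?thesis using ha unfolding q_cuspidal_def by (intro exI[of _ h] conjI exI[of _ "\<lambda>n. c * a n"]) auto
qed

lemma has_q_expansion_period_mult:
 assumes "has_q_expansion h a f" "h > 0" "(r::nat) > 0"
 shows "has_q_expansion (h * r) (\<lambda>n. if r dvd n then a (n div r) else 0) f"
 unfolding has_q_expansion_def
proof
 fix z assume "z \<in> upper_half_plane"
 hence s: "(\<lambda>n. a n * qx h n z) sums f z" using assms(1) by (simp add: has_q_expansion_def)
 let ?F = "\<lambda>n. (if r dvd n then a (n div r) else 0) * qx (h * r) n z"
 have "?F sums f z \<longleftrightarrow> (\<lambda>n. ?F (r * n)) sums f z"
  by (rule sums_mono_reindex[symmetric]) (use assms in \<open>auto simp: strict_mono_def image_iff dvd_def\<close>)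
 also have "(\<lambda>n. ?F (r * n)) = (\<lambda>n. a n * qx h n z)" using assms by (auto simp: fun_eq_iff field_simps)
 finally show "?F sums f z" using s by simp
qed

lemma q_cuspidal_add:
 assumes "q_cuspidal f" "q_cuspidal g" shows "q_cuspidal (\<lambda>z. f z + g z)"
proof -
 obtain h a where ha: "h > 0" "a 0 = 0" "has_q_expansion h a f" using assms(1) by (auto simp: q_cuspidal_def)
 obtain r b where rb: "r > 0" "b 0 = 0" "has_q_expansion r b g" using assms(2) by (auto simp: q_cuspidal_def)
 have 1: "has_q_expansion (h * r) (\<lambda>n. if r dvd n then a (n div r) else 0) f"
  using has_q_expansion_period_mult ha rb by blast
 have 2: "has_q_expansion (r * h) (\<lambda>n. if h dvd n then b (n div h) else 0) g"
  using has_q_expansion_period_mult ha rb by blast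
 have "has_q_expansion (h * r) (\<lambda>n. (if r dvd n then a (n div r) else 0) + (if h dvd n then b (n div h) else 0)) (\<lambda>z. f z + g z)"
  using 1 2 unfolding has_q_expansion_def by (auto simp only: distrib_right mult.commute[of r h] intro!: sums_add)
 thus ?thesis using ha rb unfolding q_cuspidal_def
  by (intro exI[of _ "h * r"] conjI exI[of _ "\<lambda>n. (if r dvd n then a (n div r) else 0) + (if h dvd n then b (n div h) else 0)"]) auto
qed

lemma q_cuspidal_zero: "q_cuspidal (\<lambda>z. 0)"
 unfolding q_cuspidal_def has_q_expansion_def by (intro exI[of _ 1] conjI exI[of _ "\<lambda>_. 0"]) auto

lemma q_cuspidal_affine:
 assumes "q_cuspidal f" "a > (0::int)" "d > (0::int)"
 shows "q_cuspidal (\<lambda>z. f ((of_int a * z + of_int b) / of_int d))"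
proof -
 obtain h c where hc: "h > 0" "c 0 = 0" "has_q_expansion h c f" using assms(1) by (auto simp: q_cuspidal_def)
 define r where "r = nat a"
 define s where "s = nat d"
 have rs: "r > 0" "s > 0" "a = int r" "d = int s" using assms by (auto simp: r_def s_def)
 define e where "e = (\<lambda>n. if r dvd n then c (n div r) * exp (2 * pi * \<i> * of_nat (n div r) * of_int b / of_nat (h * s)) else 0)"
 have "has_q_expansion (h * s) e (\<lambda>z. f ((of_int a * z + of_int b) / of_int d))"
  unfolding has_q_expansion_def
 proof
  fix z :: complex assume z: "z \<in> upper_half_plane"
  let ?w = "(of_int a * z + of_int b) / of_int d"
  let ?F = "\<lambda>n. e n * qx (h * s) n z"
  have "?w \<in> upper_half_plane" using z rs by (simp add: Im_divide_of_nat)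
  hence S: "(\<lambda>n. c n * qx h n ?w) sums f ?w" using hc(3) unfolding has_q_expansion_def by blast
  have "?F sums f ?w \<longleftrightarrow> (\<lambda>n. ?F (r * n)) sums f ?w"
   by (rule sums_mono_reindex[symmetric]) (use rs in \<open>auto simp: strict_mono_def image_iff dvd_def e_def\<close>)
  also have "(\<lambda>n. ?F (r * n)) = (\<lambda>n. c n * qx h n ?w)"
  proof
   fix n
   have "?F (r * n) = c n * (exp (2 * pi * \<i> * of_nat n * of_int b / of_nat (h * s)) *
     qx (h * s) (r * n) z)" using rs by (simp add: e_def)
   also have "... = c n * exp (2 * pi * \<i> * of_nat n * of_int b / of_nat (h * s) +
     2 * pi * \<i> * of_nat (r * n) * z / of_nat (h * s))" by (simp only: exp_add)
   also have "2 * pi * \<i> * of_nat n * of_int b / of_nat (h * s) + 2 * pi * \<i> * of_nat (r * n) * z / of_nat (h * s)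
     = 2 * pi * \<i> * of_nat n * ?w / of_nat h" using rs hc(1) by (simp add: field_simps)
   finally show "?F (r * n) = c n * qx h n ?w" .
  qed
  finally show "?F sums f ?w" using S by simp
 qed
 moreover have "e 0 = 0" using hc by (simp add: e_def)
 ultimately show ?thesis using hc rs unfolding q_cuspidal_def by (intro exI[of _ "h * s"] conjI exI[of _ e]) auto
qed

lemma csqrt_den_holomorphic:
 assumes "det A \<noteq> 0" shows "(\<lambda>z. csqrt (den A z)) holomorphic_on upper_half_plane"
proof (cases "A $ 2 $ 1 = 0")
 case True thus ?thesis by (simp add: den_def)
next
 case False
 have "den A z \<notin> \<real>\<^sub>\<le>\<^sub>0" if "z \<in> upper_half_plane" for z
  using that False by (auto simp: den_def complex_nonpos_Reals_iff)
 thus ?thesis unfolding den_def by (intro holomorphic_intros) (auto simp: den_def)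
qed

lemma den_holomorphic: "den A holomorphic_on S" unfolding den_def by (intro holomorphic_intros)

lemma mact_holomorphic:
 assumes "0 < det A" shows "mact A holomorphic_on upper_half_plane"
proof -
 have "(\<lambda>z. (of_int (A $ 1 $ 1) * z + of_int (A $ 1 $ 2)) / den A z) holomorphic_on upper_half_plane"
  using assms den_nonzero by (intro holomorphic_intros den_holomorphic) auto
 thus ?thesis by (simp only: mact_eq cong: holomorphic_cong)
qed

lemma sl_holomorphic:
 assumes "0 < det A" "f holomorphic_on upper_half_plane" shows "sl k A f holomorphic_on upper_half_plane"
proof -
 have "(f \<circ> mact A) holomorphic_on upper_half_plane"
  using assms mact_upper by (intro holomorphic_on_compose_gen[OF mact_holomorphic assms(2)]) auto
 thus ?thesis unfolding sl_def using assms den_nonzero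
  by (intro holomorphic_intros csqrt_den_holomorphic) (auto simp: o_def)
qed

text \<open>The quotient of the two sides is holomorphic on the half plane and has square 1; by
  connectedness it is constant.\<close>

lemma csqrt_den_mult_sign:
 assumes "0 < det A" "0 < det B"
 obtains e :: complex where "e = 1 \<or> e = -1"
  "\<And>z. 0 < Im z \<Longrightarrow> csqrt (den A (mact B z)) * csqrt (den B z) = e * csqrt (den (A ** B) z)"
proof -
 define s where "s z = csqrt (den A (mact B z)) * csqrt (den B z) / csqrt (den (A ** B) z)" for z
 have AB: "0 < det (A ** B)" using assms by (simp add: det_mul)
 have nz: "den (A ** B) z \<noteq> 0" "den B z \<noteq> 0" if "0 < Im z" for z using den_nonzero that assms AB by auto
 have "s holomorphic_on upper_half_plane" unfolding s_def using nz assms AB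
  by (intro holomorphic_intros csqrt_den_holomorphic
    holomorphic_on_compose_gen[OF mact_holomorphic csqrt_den_holomorphic, unfolded o_def]) (auto intro: mact_upper)
 hence cont: "continuous_on upper_half_plane s" by (rule holomorphic_on_imp_continuous_on)
 have sq: "s z = 1 \<or> s z = -1" if "0 < Im z" for z
 proof -
  have "(s z)^2 = den A (mact B z) * den B z / den (A ** B) z"
   by (simp add: s_def power_mult_distrib power_divide)
  hence "(s z)^2 = 1" using nz[OF that] den_mult[OF that, of B A] assms by simp
  thus ?thesis by (simp add: power2_eq_1_iff)
 qed
 have "finite (s ` upper_half_plane)" by (rule finite_subset[of _ "{1, -1}"]) (use sq in auto)
 hence "s constant_on upper_half_plane"
  using continuous_finite_range_constant[OF connected_uhp cont] by blast
 then obtain e where e: "\<And>z. 0 < Im z \<Longrightarrow> s z = e" unfolding constant_on_def by blast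
 have "e = 1 \<or> e = -1" using sq[of \<i>] e[of \<i>] by simp
 moreover have "csqrt (den A (mact B z)) * csqrt (den B z) = e * csqrt (den (A ** B) z)" if "0 < Im z" for z
  using e[OF that] nz[OF that] by (auto simp: s_def field_simps)
 ultimately show ?thesis using that by blast
qed

lemma sl_mult:
 assumes "0 < det A" "0 < det B"
 obtains e :: complex where "e = 1 \<or> e = -1"
  "\<And>f z. 0 < Im z \<Longrightarrow> sl k B (sl k A f) z = e * sl k (A ** B) f z"
proof -
 obtain e :: complex where e: "e = 1 \<or> e = -1"
  "\<And>z. 0 < Im z \<Longrightarrow> csqrt (den A (mact B z)) * csqrt (den B z) = e * csqrt (den (A ** B) z)"
  using csqrt_den_mult_sign[OF assms] by blast
 have "sl k B (sl k A f) z = e * sl k (A ** B) f z" if z: "0 < Im z" for f z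
 proof -
  have "sl k B (sl k A f) z = f (mact A (mact B z)) / (csqrt (den A (mact B z)) * csqrt (den B z)) ^ (2 * k + 1)"
   by (simp add: sl_def power_mult_distrib)
  also have "mact A (mact B z) = mact (A ** B) z" using mact_mult[OF z, of B A] assms by simp
  also have "(csqrt (den A (mact B z)) * csqrt (den B z)) ^ (2 * k + 1) = e * csqrt (den (A ** B) z) ^ (2 * k + 1)"
   using e(1) unfolding e(2)[OF z] by (auto simp: power_mult_distrib)
  finally show ?thesis using e(1) by (auto simp: sl_def)
 qed
 with e(1) show ?thesis using that by blast
qed

lemma sl_upper_zero:
 assumes "0 < det A" "\<And>z. \<not> 0 < Im z \<Longrightarrow> f z = 0" "\<not> 0 < Im z" shows "sl k A f z = 0"
 using assms mact_not_upper by (simp add: sl_def)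

lemma js_upper_zero:
 assumes "0 < det A" "\<And>z. \<not> 0 < Im z \<Longrightarrow> f z = 0" "\<not> 0 < Im z" shows "js k A f z = 0"
 using assms mact_not_upper by (simp add: js_def)

lemma sl_in_cusp_space:
 assumes "f \<in> cusp_space k" "0 < det A" shows "sl k A f \<in> cusp_space k"
proof -
 have f: "\<And>z. \<not> 0 < Im z \<Longrightarrow> f z = 0" "f holomorphic_on upper_half_plane"
  "\<And>A. 0 < det A \<Longrightarrow> q_cuspidal (sl k A f)" using assms(1) by (auto simp: cusp_space_def)
 have "q_cuspidal (sl k B (sl k A f))" if B: "0 < det B" for B
 proof -
  obtain e :: complex where e: "\<And>f z. 0 < Im z \<Longrightarrow> sl k B (sl k A f) z = e * sl k (A ** B) f z"
   using sl_mult[OF assms(2) B] by metis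
  have "q_cuspidal (\<lambda>z. e * sl k (A ** B) f z)"
   by (intro q_cuspidal_cmult f(3)) (use assms B in \<open>simp add: det_mul\<close>)
  thus ?thesis using q_cuspidal_cong[of "sl k B (sl k A f)" "\<lambda>z. e * sl k (A ** B) f z"] e by blast
 qed
 thus ?thesis using sl_upper_zero[OF assms(2) f(1)] sl_holomorphic[OF assms(2) f(2)]
  by (auto simp: cusp_space_def)
qed

lemma sl_lin: "sl k A (\<lambda>z. f z + g z) = (\<lambda>z. sl k A f z + sl k A g z)" "sl k A (\<lambda>z. c * f z) = (\<lambda>z. c * sl k A f z)"
 by (simp_all add: sl_def add_divide_distrib)

lemma cusp_space_add: "f \<in> cusp_space k \<Longrightarrow> g \<in> cusp_space k \<Longrightarrow> (\<lambda>z. f z + g z) \<in> cusp_space k"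
 by (auto simp: cusp_space_def sl_lin intro!: holomorphic_intros q_cuspidal_add)

lemma cusp_space_cmult: "f \<in> cusp_space k \<Longrightarrow> (\<lambda>z. c * f z) \<in> cusp_space k"
 by (auto simp: cusp_space_def sl_lin intro!: holomorphic_intros q_cuspidal_cmult)

lemma cusp_space_zero: "(\<lambda>z. 0) \<in> cusp_space k" by (auto simp: cusp_space_def sl_def q_cuspidal_zero)

lemma cusp_space_sum:
 "(\<And>i. i \<in> I \<Longrightarrow> F i \<in> cusp_space k) \<Longrightarrow> (\<lambda>z. \<Sum>i\<in>I. F i z) \<in> cusp_space k"
 by (induction I rule: infinite_finite_induct) (auto intro: cusp_space_zero cusp_space_add)

lemma js_eq_sl:
 assumes "A \<in> Gamma0 4"
 shows "js k A f = (\<lambda>z. inverse ((inverse (theta_eps (A $ 2 $ 2)) * of_int (quad_symbol (A $ 2 $ 1) (A $ 2 $ 2))) ^ (2 * k + 1)) * sl k A f z)"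
 by (simp add: fun_eq_iff js_def sl_def theta_factor_den power_mult_distrib field_simps)

lemma js_in_cusp_space:
 assumes "f \<in> cusp_space k" "A \<in> Gamma0 4" shows "js k A f \<in> cusp_space k"
 unfolding js_eq_sl[OF assms(2)] using assms(2)
 by (intro cusp_space_cmult sl_in_cusp_space assms(1)) (auto simp: Gamma0_def SL2Z_def)

lemma js_mult:
 assumes "A \<in> Gamma0 4" "B \<in> Gamma0 4" "\<And>z. \<not> 0 < Im z \<Longrightarrow> f z = 0"
 shows "js k B (js k A f) = js k (A ** B) f"
proof
 fix z
 have det: "det A = 1" "det B = 1" using assms by (auto simp: Gamma0_def SL2Z_def)
 show "js k B (js k A f) z = js k (A ** B) f z"
 proof (cases "0 < Im z")
  case True
  show ?thesis unfolding js_def theta_factor_mult[OF assms(1,2) True]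
   using mact_mult[OF True, of B A] det by (simp add: power_mult_distrib)
 next
  case False
  have "js k (A ** B) f z = 0" by (rule js_upper_zero) (use det assms False in \<open>auto simp: det_mul\<close>)
  moreover have "js k B (js k A f) z = 0"
   by (rule js_upper_zero) (use det assms False in \<open>auto intro: js_upper_zero\<close>)
  ultimately show ?thesis by simp
 qed
qed

text \<open>Bezout coefficients of the first column give the unimodular factor. Used to extend the
  condition at the cusps, that is for \<open>SL2Z\<close>, to all integer matrices of positive
  determinant.\<close>

lemma SL2Z_triangular_decomp:
 assumes "0 < det (A :: int ^ 2 ^ 2)"
 obtains G a b d where "G \<in> SL2Z" "a > 0" "d > 0" "A = G ** mat2 a b 0 d"
proof -
 define x y where "x = A $ 1 $ 1" "y = A $ 2 $ 1"
 define g where "g = gcd x y"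
 have "x \<noteq> 0 \<or> y \<noteq> 0" using assms by (auto simp: det_2 x_y_def)
 hence g: "g > 0" by (auto simp: g_def gcd_pos_int)
 obtain u v where uv: "u * x + v * y = g" using bezout_int[of x y] by (auto simp: g_def)
 obtain x' y' where xy': "x = g * x'" "y = g * y'" unfolding g_def by (meson dvdE gcd_dvd1 gcd_dvd2)
 have "g * (u * x' + v * y') = g * 1" using uv xy' by (simp add: algebra_simps)
 hence uv': "u * x' + v * y' = 1" using g by simp
 define G where "G = mat2 x' (- v) y' u"
 have G: "G \<in> SL2Z" using uv' by (simp add: G_def SL2Z_def algebra_simps)
 define b d where "b = u * A $ 1 $ 2 + v * A $ 2 $ 2" "d = x' * A $ 2 $ 2 - y' * A $ 1 $ 2"
 have "adj2 G ** A = mat2 g b 0 d"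
  using uv xy' by (simp add: mat2_eq_iff G_def b_d_def x_y_def algebra_simps)
 hence A: "A = G ** mat2 g b 0 d" using adj2_cancel(2)[OF G, of A] by simp
 have "det A = g * d" using G unfolding A by (simp add: det_mul SL2Z_def)
 hence "d > 0" using assms g by (simp add: zero_less_mult_iff)
 with g G A show ?thesis using that by blast
qed

lemma slash_csqrt_eq_sl:
 assumes "0 < Im z"
 shows "slash k (real_mat A, \<lambda>z. csqrt (of_int (A $ 2 $ 1) * z + of_int (A $ 2 $ 2))) f z = sl k A f z"
proof -
 have "- 2 * int k - 1 = - int (2 * k + 1)" by simp
 thus ?thesis using assms by (simp only: slash_def sl_def den_def power_int_minus power_int_of_nat) (simp add: field_simps)
qed

lemma vanishes_at_cusps_sl: "vanishes_at_cusps k f \<longleftrightarrow> (\<forall>A\<in>SL2Z. q_cuspidal (sl k A f))"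
 unfolding vanishes_at_cusps_def q_cuspidal_def
 using has_q_expansion_cong[OF slash_csqrt_eq_sl] by (simp cong: ex_cong)

lemma vanishes_at_cusps_imp:
 assumes "vanishes_at_cusps k f" "0 < det A" shows "q_cuspidal (sl k A f)"
proof -
 obtain G a b d where G: "G \<in> SL2Z" "a > 0" "d > 0" "A = G ** mat2 a b 0 d"
  using SL2Z_triangular_decomp[OF assms(2)] .
 let ?U = "mat2 a b 0 d"
 have "det G > 0" "det ?U > 0" using G by (auto simp: SL2Z_def)
 then obtain e :: complex where e: "e = 1 \<or> e = -1" "\<And>f z. 0 < Im z \<Longrightarrow> sl k ?U (sl k G f) z = e * sl k A f z"
  using sl_mult[of G ?U k] unfolding G(4) by metis
 have "q_cuspidal (sl k G f)" using assms(1) G(1) by (simp add: vanishes_at_cusps_sl)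
 hence "q_cuspidal (\<lambda>z. e * inverse (csqrt (of_int d) ^ (2 * k + 1)) * sl k G f ((of_int a * z + of_int b) / of_int d))"
  using G by (intro q_cuspidal_cmult q_cuspidal_affine)
 moreover have "sl k A f z = e * inverse (csqrt (of_int d) ^ (2 * k + 1)) * sl k G f ((of_int a * z + of_int b) / of_int d)"
  if "0 < Im z" for z
 proof -
  have "sl k A f z = e * sl k ?U (sl k G f) z" using e(1) e(2)[OF that, of f] by auto
  also have "sl k ?U (sl k G f) z = inverse (csqrt (of_int d) ^ (2 * k + 1)) * sl k G f ((of_int a * z + of_int b) / of_int d)"
   unfolding sl_def[of k ?U] by (simp add: mact_eq den_def field_simps)
  finally show ?thesis by (simp only: mult.assoc)
 qed
 ultimately show ?thesis using q_cuspidal_cong[of "sl k A f"] by simp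
qed

lemma cusp_forms_eq:
 assumes "4 dvd N" shows "cusp_forms k N = {f \<in> cusp_space k. \<forall>A\<in>Gamma0 N. js k A f = f}"
proof -
 have eq: "(\<forall>z\<in>upper_half_plane. f (mact A z) = theta_factor A z ^ (2 * k + 1) * f z) \<longleftrightarrow> js k A f = f"
  if A: "A \<in> Gamma0 N" and up: "\<And>z. \<not> 0 < Im z \<Longrightarrow> f z = 0" for A f
 proof -
  have A4: "A \<in> Gamma0 4" "0 < det A" using A Gamma0_mono[OF assms] by (auto simp: Gamma0_def SL2Z_def)
  have off: "js k A f z = f z" if "\<not> 0 < Im z" for z
   using js_upper_zero[OF A4(2) up that] up[OF that] by simp
  have on: "js k A f z = f z \<longleftrightarrow> f (mact A z) = theta_factor A z ^ (2 * k + 1) * f z" if "0 < Im z" for z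
   using nonzero_divide_eq_eq[OF power_not_zero[OF theta_factor_nonzero[OF A4(1) that]]]
   by (simp only: js_def mult.commute)
  have "js k A f = f \<longleftrightarrow> (\<forall>z. 0 < Im z \<longrightarrow> js k A f z = f z)" unfolding fun_eq_iff using off by blast
  also have "... \<longleftrightarrow> (\<forall>z\<in>upper_half_plane. f (mact A z) = theta_factor A z ^ (2 * k + 1) * f z)"
   using on by blast
  finally show ?thesis by simp
 qed
 have v: "vanishes_at_cusps k f \<longleftrightarrow> (\<forall>A. 0 < det A \<longrightarrow> q_cuspidal (sl k A f))" for f
  using vanishes_at_cusps_imp by (auto simp: vanishes_at_cusps_sl SL2Z_def)
 show ?thesis
 proof (rule Set.set_eqI)
  fix f
  have "(\<forall>A\<in>Gamma0 N. \<forall>z\<in>upper_half_plane. f (mact A z) = theta_factor A z ^ (2 * k + 1) * f z) \<longleftrightarrow>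
    (\<forall>A\<in>Gamma0 N. js k A f = f)" if "\<forall>z. \<not> 0 < Im z \<longrightarrow> f z = 0" using eq that by blast
  thus "f \<in> cusp_forms k N \<longleftrightarrow> f \<in> {f \<in> cusp_space k. \<forall>A\<in>Gamma0 N. js k A f = f}"
   unfolding cusp_forms_def cusp_space_def v mem_Collect_eq by blast
 qed
qed

lemma cusp_space_upper: "f \<in> cusp_space k \<Longrightarrow> \<not> 0 < Im z \<Longrightarrow> f z = 0"
 and cusp_space_holomorphic: "f \<in> cusp_space k \<Longrightarrow> f holomorphic_on upper_half_plane"
 and cusp_space_q_cuspidal: "f \<in> cusp_space k \<Longrightarrow> 0 < det A \<Longrightarrow> q_cuspidal (sl k A f)"
 by (auto simp: cusp_space_def)

subsection \<open>Fourier expansions\<close>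

lemma has_q_expansion_diff:
 assumes "has_q_expansion h a f" "has_q_expansion h b g"
 shows "has_q_expansion h (\<lambda>n. a n - b n) (\<lambda>z. f z - g z)"
 using assms unfolding has_q_expansion_def by (auto simp only: left_diff_distrib intro!: sums_diff)

lemma has_q_expansion_add:
 assumes "has_q_expansion h a f" "has_q_expansion h b g"
 shows "has_q_expansion h (\<lambda>n. a n + b n) (\<lambda>z. f z + g z)"
 using assms unfolding has_q_expansion_def by (auto simp only: distrib_right intro!: sums_add)

lemma has_q_expansion_cmult:
 assumes "has_q_expansion h a f" shows "has_q_expansion h (\<lambda>n. c * a n) (\<lambda>z. c * f z)"
 using assms unfolding has_q_expansion_def by (auto simp only: mult.assoc intro!: sums_mult)

text \<open>The map z -> exp(2 pi i z / h) sends the half plane onto the punctured unit disc, so the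
  power series vanishes there. Its constant term is the limit at 0; once it is known to vanish,
  isolation of zeros applies at 0.\<close>

lemma has_q_expansion_zero_imp:
 assumes "has_q_expansion h a (\<lambda>z. 0)" "h > 0" shows "a n = 0"
proof -
 have S: "(\<lambda>n. a n * q ^ n) sums 0" if q: "q \<noteq> 0" "norm q < 1" for q :: complex
 proof -
  define z where "z = of_nat h * Ln q / (2 * pi * \<i>)"
  have "Im z = - (of_nat h * ln (norm q) / (2 * pi))"
   using q by (simp add: z_def Im_divide Re_Ln power2_eq_square field_simps)
  moreover have "ln (norm q) < 0" using q by simp
  ultimately have "0 < Im z" using assms(2) by (simp add: mult_pos_neg divide_neg_pos)
  hence "(\<lambda>n. a n * qx h n z) sums 0" using assms(1) by (simp add: has_q_expansion_def)
  moreover have "qx h n z = q ^ n" for n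
  proof -
   have "2 * pi * \<i> * of_nat n * z / of_nat h = of_nat n * Ln q"
    using assms(2) by (simp add: z_def field_simps)
   thus ?thesis using q by (simp add: exp_of_nat_mult)
  qed
  ultimately show ?thesis by simp
 qed
 have a0: "a 0 = 0"
  using powser_limit_0_strong[of 1 a "\<lambda>_. 0"] S tendsto_unique[OF _ _ tendsto_const, of "at (0::complex)"] by simp
 show ?thesis
 proof (rule ccontr)
  assume n: "a n \<noteq> 0"
  with a0 have "n > 0" by (cases n) auto
  have S': "(\<lambda>n. a n * (x - 0) ^ n) sums 0" if "norm (x - 0) < 1" for x :: complex
  proof (cases "x = 0")
   case True
   thus ?thesis using powser_sums_zero[of a] a0 by simp
  qed (use S that in auto)
  obtain s where "0 < s" "\<And>z. z \<in> cball (0::complex) s - {0} \<Longrightarrow> (0::complex) \<noteq> 0"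
   by (rule powser_0_nonzero[of 1 0 a "\<lambda>_. 0" n]) (use S' n \<open>n > 0\<close> in auto)
  from this(2)[of "of_real s"] this(1) show False by simp
 qed
qed

lemma has_q_expansion_unique:
 assumes "has_q_expansion h a f" "has_q_expansion h b f" "h > 0" shows "a = b"
proof
 fix n
 have "has_q_expansion h (\<lambda>n. a n - b n) (\<lambda>z. 0)" using has_q_expansion_diff[OF assms(1,2)] by simp
 hence "a n - b n = 0" using has_q_expansion_zero_imp[OF _ assms(3), of "\<lambda>n. a n - b n"] by simp
 thus "a n = b n" by simp
qed

lemma fourier_coeff_eq: "has_q_expansion 1 a f \<Longrightarrow> fourier_coeff f = a"
 unfolding fourier_coeff_def using has_q_expansion_unique by (intro the_equality) auto

lemma has_q_expansion_shift:
 assumes "has_q_expansion h a f" "t \<in> \<real>" shows "has_q_expansion h (\<lambda>n. a n * qx h n t) (\<lambda>z. f (z + t))"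
 unfolding has_q_expansion_def
proof
 fix z assume "z \<in> upper_half_plane"
 with assms(2) have "z + t \<in> upper_half_plane" by (auto simp: complex_is_Real_iff)
 hence "(\<lambda>n. a n * qx h n (z + t)) sums f (z + t)" using assms(1) unfolding has_q_expansion_def by blast
 moreover have "a n * qx h n (z + t) =
   a n * qx h n t * qx h n z" for n
  by (simp add: exp_add[symmetric] add_divide_distrib[symmetric] algebra_simps)
 ultimately show "(\<lambda>n. a n * qx h n t * qx h n z) sums f (z + t)" by (simp only:)
qed

lemma exp_2pi_eq_1_iff: "h > 0 \<Longrightarrow> exp (2 * pi * \<i> * of_nat n / of_nat h) = 1 \<longleftrightarrow> h dvd n"
proof -
 assume h: "h > 0"
 have "exp (2 * pi * \<i> * of_nat n / of_nat h) = 1 \<longleftrightarrow> (\<exists>m::int. real n / real h = of_int m)"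
 proof -
  have "Im (2 * pi * \<i> * of_nat n / of_nat h) = of_int (2 * m) * pi \<longleftrightarrow> real n / real h = of_int m" for m
  proof -
   have "Im (2 * pi * \<i> * of_nat n / of_nat h) = (2 * pi) * (real n / real h)" by (simp add: Im_divide_of_nat)
   moreover have "of_int (2 * m) * pi = (2 * pi) * of_int m" by simp
   ultimately show ?thesis by (simp only: mult_cancel_left) simp
  qed
  moreover have "Re (2 * pi * \<i> * of_nat n / of_nat h) = 0" by (simp add: Re_divide_of_nat)
  ultimately show ?thesis unfolding exp_eq_1 by blast
 qed
 also have "... \<longleftrightarrow> (\<exists>m::int. int n = int h * m)"
 proof -
  have "real n / real h = of_int m \<longleftrightarrow> int n = int h * m" for m
  proof -
   have "real n / real h = of_int m \<longleftrightarrow> real_of_int (int n) = real_of_int (int h * m)"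
    using h by (simp add: field_simps)
   thus ?thesis by (simp only: of_int_eq_iff)
  qed
  thus ?thesis by simp
 qed
 also have "... \<longleftrightarrow> int h dvd int n" by (simp add: dvd_def)
 finally show ?thesis by simp
qed

text \<open>Replacing z by z + 1 multiplies a_n by exp(2 pi i n / h); by uniqueness of the
  coefficients only the multiples of h survive.\<close>

lemma periodic_q_expansion:
 assumes "q_cuspidal f" "\<And>z. 0 < Im z \<Longrightarrow> f (z + 1) = f z"
 obtains a where "a 0 = 0" "has_q_expansion 1 a f"
proof -
 obtain h a where ha: "h > 0" "a 0 = 0" "has_q_expansion h a f" using assms(1) by (auto simp: q_cuspidal_def)
 have "has_q_expansion h (\<lambda>n. a n * qx h n 1) f"
  using has_q_expansion_shift[OF ha(3), of 1] has_q_expansion_cong[of "\<lambda>z. f (z + 1)" f] assms(2) by simp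
 hence "(\<lambda>n. a n * qx h n 1) = a" using has_q_expansion_unique[OF _ ha(3) ha(1)] by blast
 hence "a n * exp (2 * pi * \<i> * of_nat n / of_nat h) = a n" for n by (auto simp: fun_eq_iff)
 hence z: "a n = 0" if "\<not> h dvd n" for n
  using exp_2pi_eq_1_iff[OF ha(1), of n] that by (metis mult_cancel_left2)
 have "has_q_expansion 1 (\<lambda>n. a (h * n)) f" unfolding has_q_expansion_def
 proof
  fix z assume "z \<in> upper_half_plane"
  hence S: "(\<lambda>n. a n * qx h n z) sums f z" using ha(3) by (simp add: has_q_expansion_def)
  let ?F = "\<lambda>n. a n * qx h n z"
  have "(\<lambda>n. ?F (h * n)) sums f z \<longleftrightarrow> ?F sums f z"
   by (rule sums_mono_reindex) (use ha(1) z in \<open>auto simp: strict_mono_def image_iff dvd_def\<close>)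
  moreover have "(\<lambda>n. ?F (h * n)) = (\<lambda>n. a (h * n) * exp (2 * pi * \<i> * of_nat n * z / of_nat 1))"
   using ha(1) by (simp add: fun_eq_iff field_simps)
  ultimately show "(\<lambda>n. a (h * n) * exp (2 * pi * \<i> * of_nat n * z / of_nat 1)) sums f z" using S by simp
 qed
 thus ?thesis using that[of "\<lambda>n. a (h * n)"] ha by simp
qed

lemma sum_roots_of_unity:
 assumes "m > 0"
 shows "(\<Sum>v<m. exp (2 * pi * \<i> * of_nat n * of_nat v / of_nat m)) = (if m dvd n then of_nat m else 0)"
proof -
 define w where "w = exp (2 * pi * \<i> * of_nat n / of_nat m)"
 have "exp (2 * pi * \<i> * of_nat n * of_nat v / of_nat m) = w ^ v" for v
  unfolding w_def exp_of_nat_mult[symmetric] by (simp add: field_simps)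
 hence "(\<Sum>v<m. exp (2 * pi * \<i> * of_nat n * of_nat v / of_nat m)) = (\<Sum>v<m. w ^ v)" by simp
 also have "... = (if m dvd n then of_nat m else 0)"
 proof (cases "m dvd n")
  case True
  hence "w = 1" using exp_2pi_eq_1_iff[OF assms] by (simp add: w_def)
  thus ?thesis using True by simp
 next
  case False
  hence "w \<noteq> 1" using exp_2pi_eq_1_iff[OF assms] by (simp add: w_def)
  moreover have "w ^ m = exp (2 * pi * \<i> * of_nat n)"
   unfolding w_def exp_of_nat_mult[symmetric] using assms by simp
  hence "w ^ m = 1" using exp_2pi_eq_1_iff[of 1 n] by simp
  ultimately show ?thesis using False by (simp add: sum_gp_strict)
 qed
 finally show ?thesis .
qed

lemma average_sums:
 assumes "has_q_expansion 1 a f" "m > 0" "0 < Im z"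
 shows "(\<lambda>n. a (m * n) * exp (2 * pi * \<i> * of_nat n * z)) sums
  ((\<Sum>v<m. f ((z + of_nat v) / of_nat m)) / of_nat m)"
proof -
 have S: "(\<lambda>n. a n * exp (2 * pi * \<i> * of_nat n * ((z + of_nat v) / of_nat m))) sums f ((z + of_nat v) / of_nat m)" for v
 proof -
  have "(z + of_nat v) / of_nat m \<in> upper_half_plane" using assms(2,3) by (simp add: Im_divide_of_nat)
  hence "(\<lambda>n. a n * exp (2 * pi * \<i> * of_nat n * ((z + of_nat v) / of_nat m) / of_nat 1)) sums f ((z + of_nat v) / of_nat m)"
   using assms(1) unfolding has_q_expansion_def by blast
  thus ?thesis by (simp only: of_nat_1 div_by_1)
 qed
 have "(\<lambda>n. \<Sum>v<m. a n * exp (2 * pi * \<i> * of_nat n * ((z + of_nat v) / of_nat m))) sums (\<Sum>v<m. f ((z + of_nat v) / of_nat m))"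
  by (intro sums_sum S)
 moreover have "(\<Sum>v<m. a n * exp (2 * pi * \<i> * of_nat n * ((z + of_nat v) / of_nat m))) =
   (if m dvd n then of_nat m * a n * qx m n z else 0)" for n
 proof -
  have "a n * exp (2 * pi * \<i> * of_nat n * ((z + of_nat v) / of_nat m)) =
   a n * qx m n z * exp (2 * pi * \<i> * of_nat n * of_nat v / of_nat m)" for v
   by (simp add: exp_add[symmetric] add_divide_distrib[symmetric] algebra_simps)
  hence "(\<Sum>v<m. a n * exp (2 * pi * \<i> * of_nat n * ((z + of_nat v) / of_nat m))) =
    (\<Sum>v<m. a n * qx m n z * exp (2 * pi * \<i> * of_nat n * of_nat v / of_nat m))" by (simp only:)
  also have "... = a n * qx m n z * (if m dvd n then of_nat m else 0)"
   by (simp only: sum_distrib_left[symmetric] sum_roots_of_unity[OF assms(2)])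
  finally show ?thesis by simp
 qed
 ultimately have S2: "(\<lambda>n. if m dvd n then of_nat m * a n * qx m n z else 0)
   sums (\<Sum>v<m. f ((z + of_nat v) / of_nat m))" by simp
 let ?F = "\<lambda>n. if m dvd n then of_nat m * a n * qx m n z else 0"
 have "(\<lambda>n. ?F (m * n)) sums (\<Sum>v<m. f ((z + of_nat v) / of_nat m)) \<longleftrightarrow> ?F sums (\<Sum>v<m. f ((z + of_nat v) / of_nat m))"
  by (rule sums_mono_reindex) (use assms in \<open>auto simp: strict_mono_def image_iff dvd_def\<close>)
 hence "(\<lambda>n. ?F (m * n)) sums (\<Sum>v<m. f ((z + of_nat v) / of_nat m))" using S2 by simp
 hence "(\<lambda>n. ?F (m * n) / of_nat m) sums ((\<Sum>v<m. f ((z + of_nat v) / of_nat m)) / of_nat m)" by (rule sums_divide)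
 moreover have "(\<lambda>n. ?F (m * n) / of_nat m) = (\<lambda>n. a (m * n) * exp (2 * pi * \<i> * of_nat n * z))"
  using assms(2) by (simp add: fun_eq_iff field_simps)
 ultimately show ?thesis by simp
qed

text \<open>Replaces the definition through coefficients by one through matrices, on which the group
  acts.\<close>

lemma U_op_eq_average:
 assumes "has_q_expansion 1 a f" "m > 0" "0 < Im z"
 shows "U_op m f z = (\<Sum>v<m. f ((z + of_nat v) / of_nat m)) / of_nat m"
 using average_sums[OF assms] assms(3) unfolding U_op_def fourier_coeff_eq[OF assms(1)] by (simp add: sums_iff)

lemma U_op_q_expansion:
 assumes "has_q_expansion 1 a f" "m > 0" shows "has_q_expansion 1 (\<lambda>n. a (m * n)) (U_op m f)"
 unfolding has_q_expansion_def using average_sums[OF assms] U_op_eq_average[OF assms] by simp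

text \<open>Convergence at z = i/4 bounds |a_n| r^n with r = exp(-c/4). For Im z >= 1/2 the number x
  = exp(-c Im z) is at most r^2; since a_0 = 0, one factor x/r can be kept for the decay while the
  others are bounded by a geometric series in r. The height 1/2 is chosen because
  \<open>Fdom\<close> lies above it.\<close>

lemma q_cuspidal_decay:
 assumes "q_cuspidal f"
 obtains B c where "B \<ge> 0" "c > 0" "\<And>z. 1/2 \<le> Im z \<Longrightarrow> norm (f z) \<le> B * exp (- c * Im z)"
proof -
 obtain h a where ha: "h > 0" "a 0 = 0" "has_q_expansion h a f" using assms by (auto simp: q_cuspidal_def)
 define c where "c = 2 * pi / real h"
 have c: "c > 0" using ha by (simp add: c_def)
 have nexp: "norm (qx h n z) = exp (- c * Im z) ^ n" for n z
 proof -
  have "Re (2 * pi * \<i> * of_nat n * z / of_nat h) = of_nat n * (- c * Im z)"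
   by (simp add: c_def Re_divide_of_nat)
  thus ?thesis by (simp only: norm_exp_eq_Re exp_of_nat_mult)
 qed
 define r where "r = exp (- c * (1/4))"
 have r: "0 < r" "r < 1" using c by (simp_all add: r_def)
 define z0 where "z0 = \<i> / 4"
 have "z0 \<in> upper_half_plane" by (simp add: z0_def)
 hence "summable (\<lambda>n. a n * qx h n z0)"
  using ha(3) unfolding has_q_expansion_def by (meson sums_summable)
 hence "Bseq (\<lambda>n. a n * qx h n z0)"
  using summable_LIMSEQ_zero convergent_imp_Bseq convergent_def by blast
 then obtain K where K: "K > 0" "\<And>n. norm (a n * qx h n z0) \<le> K" by (auto simp: Bseq_def)
 have "Im z0 = 1/4" by (simp add: z0_def)
 hence K': "norm (a n) * r ^ n \<le> K" for n using K(2)[of n] by (simp only: norm_mult nexp r_def)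
 have "norm (f z) \<le> K / (r * (1 - r)) * exp (- c * Im z)" if z: "1/2 \<le> Im z" for z
 proof -
  define x where "x = exp (- c * Im z)"
  have x: "0 < x" "x \<le> r * r" using z c by (simp_all add: x_def r_def mult_exp_exp)
  have xr: "x / r \<le> r" "0 < x / r" using x r by (simp_all add: field_simps)
  have S: "(\<lambda>n. a n * qx h n z) sums f z" using ha(3) z by (auto simp: has_q_expansion_def)
  hence S1: "(\<lambda>n. a (Suc n) * qx h (Suc n) z) sums f z" using ha(2) by (subst sums_Suc_iff) simp
  have bd: "norm (a (Suc n) * qx h (Suc n) z) \<le> (K * (x / r)) * r ^ n" for n
  proof -
   have "norm (a (Suc n) * qx h (Suc n) z) = norm (a (Suc n)) * x ^ Suc n"
    by (simp only: norm_mult nexp x_def)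
   also have "... = (norm (a (Suc n)) * r ^ Suc n) * (x / r) ^ Suc n"
    using r by (simp add: power_divide)
   also have "... \<le> K * (x / r) ^ Suc n"
    by (rule mult_right_mono[OF K']) (use xr(2) in \<open>intro zero_le_power less_imp_le\<close>)
   also have "... = K * (x / r) * (x / r) ^ n" by simp
   also have "... \<le> K * (x / r) * r ^ n"
    by (intro mult_left_mono power_mono mult_nonneg_nonneg xr(1)) (use xr(2) K(1) in simp_all)
   finally show ?thesis .
  qed
  have gs: "(\<lambda>n. (K * (x / r)) * r ^ n) sums ((K * (x / r)) * (1 / (1 - r)))"
   using r by (intro sums_mult geometric_sums) auto
  have "norm (f z) = norm (\<Sum>n. a (Suc n) * qx h (Suc n) z)" using sums_unique[OF S1] by simp
  also have "... \<le> (\<Sum>n. (K * (x / r)) * r ^ n)" by (rule norm_suminf_le[OF bd sums_summable[OF gs]])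
  also have "... = (K * (x / r)) * (1 / (1 - r))" using sums_unique[OF gs] by simp
  also have "... = K / (r * (1 - r)) * x" using r by (simp add: field_simps)
  finally show ?thesis by (simp add: x_def)
 qed
 moreover have "K / (r * (1 - r)) \<ge> 0" using r K by simp
 ultimately show ?thesis using that c by blast
qed

lemma cusp_space_periodic_expansion:
 assumes "f \<in> cusp_space k" "\<And>z. 0 < Im z \<Longrightarrow> f (z + 1) = f z"
 obtains a where "a 0 = 0" "has_q_expansion 1 a f"
proof -
 have "q_cuspidal (sl k (mat 1) f)" using assms(1) by (intro cusp_space_q_cuspidal) auto
 moreover have "sl k (mat 1) f = f" by (simp add: fun_eq_iff sl_def mact_mat den_def)
 ultimately show ?thesis using periodic_q_expansion[of f] assms(2) that by auto
qed

lemma js_Tmat: "js k (Tmat n) f = (\<lambda>z. f (z + of_int n))" by (simp add: js_def mact_eq den_def)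

lemma cusp_forms_expansion:
 assumes "f \<in> cusp_forms k N" "4 dvd N"
 obtains a where "a 0 = 0" "has_q_expansion 1 a f"
proof -
 have "f \<in> cusp_space k" "js k (Tmat 1) f = f" using assms cusp_forms_eq by (auto simp: Gamma0_mat2)
 thus ?thesis using cusp_space_periodic_expansion[of f k] that by (auto simp: js_Tmat fun_eq_iff)
qed

section \<open>The hyperbolic measure\<close>

abbreviation hden :: "complex \<Rightarrow> ennreal" where "hden z \<equiv> ennreal (indicator upper_half_plane z / (Im z)\<^sup>2)"
abbreviation pre :: "int ^ 2 ^ 2 \<Rightarrow> complex set \<Rightarrow> complex set" where "pre X A \<equiv> {z \<in> upper_half_plane. mact X z \<in> A}"

definition hyp :: "complex measure" where
 "hyp = density lborel (\<lambda>z. hden z)"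

section \<open>Transport to \<open>real ^ 2\<close> and change of variables for the hyperbolic
  measure\<close>

definition vec_complex :: "real ^ 2 \<Rightarrow> complex" where
 "vec_complex v = Complex (v $ 1) (v $ 2)"

definition complex_vec :: "complex \<Rightarrow> real ^ 2" where
 "complex_vec z = vector [Re z, Im z]"

lemma complex_vec_nth [simp]: "complex_vec z $ 1 = Re z" "complex_vec z $ 2 = Im z"
 by (simp_all only: complex_vec_def vector_2)

lemma vec_complex_sel [simp]: "Re (vec_complex v) = v $ 1" "Im (vec_complex v) = v $ 2"
 by (simp_all add: vec_complex_def)

lemma vec_complex_inverse [simp]: "vec_complex (complex_vec z) = z" "complex_vec (vec_complex v) = v"
 by (simp_all add: complex_eq_iff vec_eq_iff forall_2)

lemma bounded_linear_vec_complex: "bounded_linear vec_complex"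
 by (rule linear_conv_bounded_linear[THEN iffD1], rule linearI) (simp_all add: complex_eq_iff)

lemma bounded_linear_complex_vec: "bounded_linear complex_vec"
 by (rule linear_conv_bounded_linear[THEN iffD1], rule linearI) (simp_all add: vec_eq_iff forall_2)

lemma vec_complex_borel [measurable]: "vec_complex \<in> borel_measurable borel"
 by (intro borel_measurable_continuous_onI linear_continuous_on bounded_linear_vec_complex)

lemma complex_vec_borel [measurable]: "complex_vec \<in> borel_measurable borel"
 by (intro borel_measurable_continuous_onI linear_continuous_on bounded_linear_complex_vec)

lemma lborel_complex_eq: "(lborel :: complex measure) = distr lborel borel vec_complex"
proof (rule lborel_eqI)
 fix l u :: complex assume lu: "\<And>b. b \<in> Basis \<Longrightarrow> l \<bullet> b \<le> u \<bullet> b"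
 have le: "Re l \<le> Re u" "Im l \<le> Im u" using lu[of 1] lu[of \<i>] by (auto simp: Basis_complex_def)
 have pre: "vec_complex -` box l u \<inter> space lborel = box (complex_vec l) (complex_vec u)"
  by (auto simp: box_def Basis_complex_def Basis_vec_def inner_axis forall_2 UNIV_2)
 have "emeasure (distr lborel borel vec_complex) (box l u) = emeasure lborel (box (complex_vec l) (complex_vec u))"
  using pre by (subst emeasure_distr) simp_all
 also have "... = (\<Prod>b\<in>Basis. (complex_vec u - complex_vec l) \<bullet> b)"
  by (rule emeasure_lborel_box) (use le in \<open>auto simp: Basis_vec_def inner_axis UNIV_2\<close>)
 also have "(\<Prod>b\<in>Basis. (complex_vec u - complex_vec l) \<bullet> b) = (Re u - Re l) * (Im u - Im l)"
 proof -
  have B: "(Basis :: (real ^ 2) set) = {axis 1 1, axis 2 1}" by (auto simp: Basis_vec_def UNIV_2)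
  have "axis 1 (1::real) \<noteq> (axis 2 1 :: real ^ 2)" by (simp add: axis_eq_axis)
  thus ?thesis unfolding B by (simp add: inner_axis)
 qed
 also have "(Re u - Re l) * (Im u - Im l) = (\<Prod>b\<in>Basis. (u - l) \<bullet> b)" by (simp add: Basis_complex_def)
 finally show "emeasure (distr lborel borel vec_complex) (box l u) = (\<Prod>b\<in>Basis. (u - l) \<bullet> b)" .
qed simp

lemma sets_hyp [simp, measurable_cong]: "sets hyp = sets borel" and space_hyp [simp]: "space hyp = UNIV"
 by (simp_all add: hyp_def)

lemma mact_borel [measurable]: "mact X \<in> borel_measurable borel"
proof -
 have "mact X = (\<lambda>z. (of_int (X $ 1 $ 1) * z + of_int (X $ 1 $ 2)) / (of_int (X $ 2 $ 1) * z + of_int (X $ 2 $ 2)))"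
  by (rule ext) (simp only: mact_eq den_def)
 thus ?thesis by simp
qed

lemma uhp_borel [measurable]: "upper_half_plane \<in> sets borel" using open_uhp by (rule borel_open)

lemma emeasure_hyp_vec:
 assumes [measurable]: "A \<in> sets borel" and "A \<subseteq> upper_half_plane"
 shows "emeasure hyp A = (\<integral>\<^sup>+v. ennreal (if vec_complex v \<in> A then 1 / (v $ 2)\<^sup>2 else 0) \<partial>lborel)"
proof -
 have "emeasure hyp A = (\<integral>\<^sup>+z. hden z * indicator A z \<partial>lborel)"
  unfolding hyp_def by (rule emeasure_density) measurable
 also have "... = (\<integral>\<^sup>+v. ennreal (indicator upper_half_plane (vec_complex v) / (Im (vec_complex v))\<^sup>2) * indicator A (vec_complex v) \<partial>lborel)"
  unfolding lborel_complex_eq by (rule nn_integral_distr) measurable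
 also have "... = (\<integral>\<^sup>+v. ennreal (if vec_complex v \<in> A then 1 / (v $ 2)\<^sup>2 else 0) \<partial>lborel)"
  by (rule nn_integral_cong) (use assms(2) in \<open>auto simp: indicator_def\<close>)
 finally show ?thesis .
qed

lemma mact_inj_on:
 assumes "0 < det X" "0 < Im z" "0 < Im w" "mact X z = mact X w" shows "z = w"
 using mact_adj2(1)[OF assms(2,1)] mact_adj2(1)[OF assms(3,1)] assms(4) by metis

lemma mact_has_field_derivative:
 assumes "0 < det X" "0 < Im z"
 shows "(mact X has_field_derivative (of_int (det X) / (den X z)\<^sup>2)) (at z)"
proof -
 have "den X z \<noteq> 0" using den_nonzero assms by simp
 hence "((\<lambda>z. (of_int (X $ 1 $ 1) * z + of_int (X $ 1 $ 2)) / (of_int (X $ 2 $ 1) * z + of_int (X $ 2 $ 2)))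
   has_field_derivative (of_int (det X) / (den X z)\<^sup>2)) (at z)" unfolding den_def
  by (auto intro!: derivative_eq_intros simp: det_2 power2_eq_square divide_simps) (simp add: algebra_simps)?
 moreover have "mact X = (\<lambda>z. (of_int (X $ 1 $ 1) * z + of_int (X $ 1 $ 2)) / (of_int (X $ 2 $ 1) * z + of_int (X $ 2 $ 2)))"
  by (rule ext) (simp only: mact_eq den_def)
 ultimately show ?thesis by simp
qed

lemma det_complex_mult: "det (matrix (\<lambda>v. complex_vec (c * vec_complex v))) = (cmod c)\<^sup>2"
proof -
 let ?g = "\<lambda>v. complex_vec (c * vec_complex v)"
 have "matrix ?g $ i $ j = ?g (axis j 1) $ i" for i j by (simp add: matrix_def)
 hence "matrix ?g $ 1 $ 1 = Re c" "matrix ?g $ 1 $ 2 = - Im c" "matrix ?g $ 2 $ 1 = Im c" "matrix ?g $ 2 $ 2 = Re c"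
  by (simp_all add: axis_def)
 thus ?thesis unfolding det_2 cmod_power2 by (simp add: power2_eq_square)
qed

text \<open>The Jacobian det^2 / |den|^4 is cancelled by the change of the density 1 / Im^2. The
  change of variables theorem compares integrals with a prescribed real value r, so the measure has
  to be finite here; the general case follows by exhaustion.\<close>

lemma emeasure_hyp_mact_finite:
 assumes X: "0 < det X" and A [measurable]: "A \<in> sets borel" and AH: "A \<subseteq> upper_half_plane" and fin: "emeasure hyp A < \<infinity>"
 shows "emeasure hyp (pre X A) = emeasure hyp A"
proof -
 define A' where "A' = pre X A"
 have A' [measurable]: "A' \<in> sets borel" unfolding A'_def by measurable
 have A'H: "A' \<subseteq> upper_half_plane" by (auto simp: A'_def)
 define F where "F v = 1 / (v $ 2)\<^sup>2" for v :: "real ^ 2"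
 obtain r where r: "0 \<le> r" "emeasure hyp A = ennreal r" using fin by (cases "emeasure hyp A") auto
 define S where "S = vec_complex -` A'"
 have S: "S \<in> sets borel" unfolding S_def using measurable_sets[OF vec_complex_borel A'] by simp
 define g where "g v = complex_vec (mact X (vec_complex v))" for v
 have gS: "g ` S = vec_complex -` A"
 proof (intro equalityI subsetI)
  fix v assume "v \<in> vec_complex -` A"
  hence w: "vec_complex v \<in> A" "0 < Im (vec_complex v)" using AH by auto
  define z where "z = mact (adj2 X) (vec_complex v)"
  have z: "0 < Im z" "mact X z = vec_complex v" using mact_upper[OF w(2), of "adj2 X"] mact_adj2(2)[OF w(2) X] X by (auto simp: z_def)
  have "complex_vec z \<in> S" using z w by (simp add: S_def A'_def)
  moreover have "g (complex_vec z) = v" using z by (simp add: g_def)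
  ultimately show "v \<in> g ` S" by force
 qed (auto simp: S_def g_def A'_def)
 have inj: "inj_on g S"
 proof (rule inj_onI)
  fix v w assume vw: "v \<in> S" "w \<in> S" "g v = g w"
  hence "mact X (vec_complex v) = mact X (vec_complex w)" unfolding g_def by (metis vec_complex_inverse(1))
  hence "vec_complex v = vec_complex w" using vw mact_inj_on[OF X, of "vec_complex v" "vec_complex w"] by (auto simp: S_def A'_def)
  thus "v = w" by (metis vec_complex_inverse(2))
 qed
 define g' where "g' v = (\<lambda>h. complex_vec ((of_int (det X) / (den X (vec_complex v))\<^sup>2) * vec_complex h))" for v
 have der: "(g has_derivative g' v) (at v within S)" if "v \<in> S" for v
 proof -
  have "0 < Im (vec_complex v)" using that by (auto simp: S_def A'_def)
  from mact_has_field_derivative[OF X this]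
  have "(mact X has_derivative (\<lambda>h. (of_int (det X) / (den X (vec_complex v))\<^sup>2) * h)) (at (vec_complex v))"
   unfolding has_field_derivative_def .
  hence "((\<lambda>v. mact X (vec_complex v)) has_derivative (\<lambda>h. (of_int (det X) / (den X (vec_complex v))\<^sup>2) * vec_complex h)) (at v)"
   using has_derivative_compose[OF bounded_linear_imp_has_derivative[OF bounded_linear_vec_complex]] by blast
  from bounded_linear.has_derivative[OF bounded_linear_complex_vec this]
  show ?thesis unfolding g_def g'_def by (rule has_derivative_at_withinI)
 qed
 have jac: "\<bar>det (matrix (g' v))\<bar> * F (g v) = F v" if "v \<in> S" for v
 proof -
  define z where "z = vec_complex v"
  have z: "0 < Im z" using that by (auto simp: S_def A'_def z_def)
  have nz: "cmod (den X z) \<noteq> 0" using den_nonzero[OF z] X by simp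
  have 1: "\<bar>det (matrix (g' v))\<bar> = (of_int (det X))\<^sup>2 / (cmod (den X z))^4"
   unfolding g'_def det_complex_mult using X by (simp add: norm_divide norm_power power_divide z_def)
  have 2: "F (g v) = 1 / (of_int (det X) * Im z / (cmod (den X z))\<^sup>2)\<^sup>2"
   by (simp add: F_def g_def Im_mact z_def)
  have 3: "F v = 1 / (Im z)\<^sup>2" by (simp add: F_def z_def)
  have alg: "D\<^sup>2 / n ^ 4 * (1 / (D * y / n\<^sup>2)\<^sup>2) = 1 / y\<^sup>2" if "D \<noteq> 0" "n \<noteq> 0" "y \<noteq> 0" for D n y :: real
   using that by (simp add: field_simps power_mult_distrib power_divide)
  show ?thesis unfolding 1 2 3 by (rule alg) (use z nz X in auto)
 qed
 \<comment> \<open>The theorem is formulated for vector values; \<open>real ^ 1\<close> provides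
   them for a scalar density.\<close>
 define f where "f = (\<lambda>v. vec (F v) :: real ^ 1)"
 have cov: "((\<lambda>x. \<bar>det (matrix (g' x))\<bar> *\<^sub>R f (g x)) absolutely_integrable_on S \<and>
      integral S (\<lambda>x. \<bar>det (matrix (g' x))\<bar> *\<^sub>R f (g x)) = vec r)
   \<longleftrightarrow> f absolutely_integrable_on (g ` S) \<and> integral (g ` S) f = vec r"
  by (rule has_absolute_integral_change_of_variables[OF _ der inj]) (use S in auto)
 have nonneg: "F v \<ge> 0" for v by (simp add: F_def)
 have vecint: "f absolutely_integrable_on T \<and> integral T f = vec r \<longleftrightarrow> (F has_integral r) T" for T
 proof -
  have "f absolutely_integrable_on T \<longleftrightarrow> F absolutely_integrable_on T"
   unfolding f_def absolutely_integrable_on_1_iff by simp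
  moreover have "F absolutely_integrable_on T \<longleftrightarrow> F integrable_on T"
   using nonneg by (intro absolutely_integrable_on_iff_nonneg) auto
  moreover have "integral T f = vec (integral T F)" unfolding f_def by (simp add: integral_on_1_eq)
  ultimately show ?thesis by (auto simp: has_integral_iff vec_eq_iff)
 qed
 have "(\<lambda>x. \<bar>det (matrix (g' x))\<bar> *\<^sub>R f (g x)) x = f x" if "x \<in> S" for x
  using jac[OF that] by (simp add: f_def vec_eq_iff)
 hence "((\<lambda>x. \<bar>det (matrix (g' x))\<bar> *\<^sub>R f (g x)) absolutely_integrable_on S \<and>
      integral S (\<lambda>x. \<bar>det (matrix (g' x))\<bar> *\<^sub>R f (g x)) = vec r) \<longleftrightarrow>
     f absolutely_integrable_on S \<and> integral S f = vec r"
  using set_integrable_cong[of lebesgue lebesgue S S "\<lambda>x. \<bar>det (matrix (g' x))\<bar> *\<^sub>R f (g x)" f]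
   Henstock_Kurzweil_Integration.integral_cong[of S "\<lambda>x. \<bar>det (matrix (g' x))\<bar> *\<^sub>R f (g x)" f] by simp
 with cov vecint have key: "(F has_integral r) S \<longleftrightarrow> (F has_integral r) (g ` S)" by simp
 have FA: "(\<lambda>v. if vec_complex v \<in> B then F v else 0) = (\<lambda>v. if v \<in> vec_complex -` B then F v else 0)" for B by simp
 have Fm: "(\<lambda>v. if vec_complex v \<in> B then F v else 0) \<in> borel_measurable borel" if "B \<in> sets borel" for B
  unfolding F_def using that by measurable
 have "(\<integral>\<^sup>+v. ennreal (if vec_complex v \<in> A then F v else 0) \<partial>lborel) = ennreal r"
  using emeasure_hyp_vec[OF A AH] r(2) unfolding F_def by (simp only:)
 hence "((\<lambda>v. if vec_complex v \<in> A then F v else 0) has_integral r) UNIV"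
  using nonneg Fm[OF A] r by (intro nn_integral_has_integral) auto
 hence "(F has_integral r) (g ` S)" unfolding FA gS by (simp only: has_integral_restrict_UNIV)
 hence "(F has_integral r) S" using key by simp
 hence "((\<lambda>v. if vec_complex v \<in> A' then F v else 0) has_integral r) UNIV"
  unfolding FA S_def by (simp only: has_integral_restrict_UNIV)
 hence "(\<integral>\<^sup>+v. ennreal (if vec_complex v \<in> A' then F v else 0) \<partial>lborel) = ennreal r"
  using nonneg Fm[OF A'] by (intro nn_integral_has_integral_lborel) auto
 thus ?thesis using emeasure_hyp_vec[OF A' A'H] r(2) unfolding F_def A'_def[symmetric] by (simp only:)
qed

lemma emeasure_hyp_mact:
 assumes X: "0 < det X" and A [measurable]: "A \<in> sets borel"
 shows "emeasure hyp (pre X A) = emeasure hyp A"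
proof -
 \<comment> \<open>Bounded sets that stay away from the real axis have finite measure, and they
   exhaust the part of A in the half plane.\<close>
 define C where "C n = A \<inter> {z. 1 / Suc n \<le> Im z} \<inter> cball 0 (Suc n)" for n :: nat
 have Cb: "C n \<in> sets borel" for n unfolding C_def by measurable
 have CH: "C n \<subseteq> upper_half_plane" for n
 proof
  fix z assume "z \<in> C n"
  hence "1 / real (Suc n) \<le> Im z" by (simp add: C_def)
  moreover have "0 < 1 / real (Suc n)" by simp
  ultimately show "z \<in> upper_half_plane" by (simp only: mem_Collect_eq)
 qed
 have inc: "incseq C"
 proof (rule incseq_SucI)
  fix n
  have "1 / real (Suc (Suc n)) \<le> 1 / real (Suc n)" by (intro divide_left_mono) auto
  thus "C n \<le> C (Suc n)" by (auto simp: C_def)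
 qed
 have UN: "(\<Union>n. C n) = A \<inter> upper_half_plane"
 proof (intro equalityI subsetI)
  fix z assume z: "z \<in> A \<inter> upper_half_plane"
  obtain n where n: "inverse (Suc n) < Im z" using reals_Archimedean z by auto
  obtain m where m: "cmod z \<le> real m" using real_arch_simple by blast
  have "1 / real (Suc (max n m)) \<le> 1 / real (Suc n)" by (intro divide_left_mono) auto
  hence "z \<in> C (max n m)" using z n m by (auto simp: C_def inverse_eq_divide)
  thus "z \<in> (\<Union>n. C n)" by blast
 next
  fix z assume "z \<in> (\<Union>n. C n)"
  then obtain n where "z \<in> C n" by blast
  thus "z \<in> A \<inter> upper_half_plane" using CH[of n] unfolding C_def by blast
 qed
 have fin: "emeasure hyp (C n) < \<infinity>" for n
 proof -
  have "emeasure hyp (C n) = (\<integral>\<^sup>+z. hden z * indicator (C n) z \<partial>lborel)"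
   unfolding hyp_def using Cb by (intro emeasure_density) auto
  also have "... \<le> (\<integral>\<^sup>+z. ennreal ((real (Suc n))\<^sup>2) * indicator (cball (0::complex) (real (Suc n))) z \<partial>lborel)"
  proof (intro nn_integral_mono)
   fix z :: complex
   show "hden z * indicator (C n) z \<le> ennreal ((real (Suc n))\<^sup>2) * indicator (cball 0 (real (Suc n))) z"
   proof (cases "z \<in> C n")
    case True
    hence i: "1 / real (Suc n) \<le> Im z" "z \<in> cball 0 (real (Suc n))" by (auto simp: C_def)
    have "(1 / real (Suc n))\<^sup>2 \<le> (Im z)\<^sup>2" using i by (intro power_mono) auto
    hence "1 / (Im z)\<^sup>2 \<le> 1 / (1 / real (Suc n))\<^sup>2" by (intro divide_left_mono) (auto intro!: mult_pos_pos zero_less_power order.strict_trans2[OF _ i(1)])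
    hence "1 / (Im z)\<^sup>2 \<le> (real (Suc n))\<^sup>2" by (simp add: power_divide)
    thus ?thesis using True i CH by (auto simp: indicator_def intro!: ennreal_leI)
   qed simp
  qed
  also have "... = ennreal ((real (Suc n))\<^sup>2) * emeasure lborel (cball (0::complex) (real (Suc n)))"
   by (rule nn_integral_cmult_indicator) simp
  also have "... < \<infinity>"
   using emeasure_lborel_cball_finite[of "0::complex" "real (Suc n)"] ennreal_mult_less_top by auto
  finally show ?thesis .
 qed
 have "emeasure hyp A = emeasure hyp (A \<inter> upper_half_plane)"
 proof -
  have "emeasure hyp A = (\<integral>\<^sup>+z. hden z * indicator A z \<partial>lborel)"
   unfolding hyp_def by (intro emeasure_density) auto
  also have "... = (\<integral>\<^sup>+z. hden z * indicator (A \<inter> upper_half_plane) z \<partial>lborel)"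
   by (rule nn_integral_cong) (auto simp: indicator_def)
  also have "... = emeasure hyp (A \<inter> upper_half_plane)"
   unfolding hyp_def by (intro emeasure_density[symmetric]) auto
  finally show ?thesis .
 qed
 also have "... = (SUP n. emeasure hyp (C n))"
  unfolding UN[symmetric] using inc Cb by (intro SUP_emeasure_incseq[symmetric]) auto
 also have "... = (SUP n. emeasure hyp (pre X (C n)))"
  using emeasure_hyp_mact_finite[OF X Cb CH fin] by simp
 also have "... = emeasure hyp (\<Union>n. pre X (C n))"
 proof (rule SUP_emeasure_incseq)
  have "pre X (C n) \<in> sets borel" for n
  proof -
   have [measurable]: "C n \<in> sets borel" by (rule Cb)
   show ?thesis by measurable
  qed
  thus "range (\<lambda>n. pre X (C n)) \<subseteq> sets hyp" by auto
  show "incseq (\<lambda>n. pre X (C n))" using inc by (auto simp: incseq_def le_fun_def)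
 qed
 also have "(\<Union>n. pre X (C n)) = pre X (\<Union>n. C n)" by auto
 also have "... = pre X A" unfolding UN using mact_upper[OF _ X] by auto
 finally show ?thesis by simp
qed

lemma AE_hyp_upper: "AE z in hyp. 0 < Im z"
 unfolding hyp_def by (subst AE_density) (auto simp: indicator_def)

lemma nn_integral_hyp_mact:
 assumes X: "0 < det X" and [measurable]: "f \<in> borel_measurable borel"
 shows "(\<integral>\<^sup>+z. f (mact X z) \<partial>hyp) = (\<integral>\<^sup>+z. f z \<partial>hyp)"
proof -
 have "distr hyp borel (mact X) = hyp"
 proof (rule measure_eqI)
  fix A assume "A \<in> sets (distr hyp borel (mact X))"
  hence A [measurable]: "A \<in> sets borel" by simp
  have "emeasure (distr hyp borel (mact X)) A = emeasure hyp (mact X -` A)"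
   by (subst emeasure_distr) auto
  also have "... = emeasure hyp (pre X A)"
  proof (rule emeasure_eq_AE)
   show "AE x in hyp. (x \<in> mact X -` A) = (x \<in> pre X A)" using AE_hyp_upper by eventually_elim auto
   show "mact X -` A \<in> sets hyp" using measurable_sets[OF mact_borel A] by simp
  qed measurable
  also have "... = emeasure hyp A" by (rule emeasure_hyp_mact[OF X A])
  finally show "emeasure (distr hyp borel (mact X)) A = emeasure hyp A" .
 qed simp
 hence "(\<integral>\<^sup>+z. f z \<partial>hyp) = (\<integral>\<^sup>+z. f z \<partial>distr hyp borel (mact X))" by simp
 also have "... = (\<integral>\<^sup>+z. f (mact X z) \<partial>hyp)" by (rule nn_integral_distr) auto
 finally show ?thesis by simp
qed

section \<open>The modular group and its fundamental domain\<close>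

abbreviation Fdom :: "complex set" where "Fdom \<equiv> std_fundamental_domain"

lemma countable_int_mat: "countable (G :: (int ^ 2 ^ 2) set)"
proof (rule countableI')
 show "inj_on (\<lambda>A. to_nat (A $ 1 $ 1, A $ 1 $ 2, A $ 2 $ 1, A $ 2 $ 2)) G"
  by (rule inj_onI) (simp add: mat2_eq_iff)
qed

lemma Fdom_borel [measurable]: "Fdom \<in> sets borel"
proof -
 have "Fdom = {z. 0 < Im z} \<inter> {z. \<bar>Re z\<bar> \<le> 1/2} \<inter> {z. 1 \<le> cmod z}" by (auto simp: std_fundamental_domain_def)
 also have "... \<in> sets borel" by measurable
 finally show ?thesis .
qed

lemma cmod_den_sq: "(cmod (den A z))\<^sup>2 = (of_int (A $ 2 $ 1) * Re z + of_int (A $ 2 $ 2))\<^sup>2 + (of_int (A $ 2 $ 1) * Im z)\<^sup>2"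
 by (simp add: den_def cmod_power2)

lemma finite_small_rows:
 assumes z: "0 < Im z" shows "finite {(c :: int, d :: int). cmod (of_int c * z + of_int d) \<le> 1}"
proof -
 define C where "C = \<lceil>1 / Im z\<rceil>"
 define D where "D = \<lceil>1 + of_int C * \<bar>Re z\<bar>\<rceil>"
 have "{(c :: int, d :: int). cmod (of_int c * z + of_int d) \<le> 1} \<subseteq> {- C..C} \<times> {- D..D}"
 proof clarsimp
  fix c d :: int assume le: "cmod (of_int c * z + of_int d) \<le> 1"
  have "\<bar>of_int c * Im z\<bar> \<le> 1" using abs_Im_le_cmod[of "of_int c * z + of_int d"] le by simp
  hence "\<bar>of_int c\<bar> \<le> 1 / Im z" using z by (simp add: abs_mult field_simps)
  hence c: "\<bar>c\<bar> \<le> C" unfolding C_def by (metis ceiling_mono ceiling_of_int of_int_abs)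
  have "\<bar>of_int c * Re z + of_int d\<bar> \<le> 1" using abs_Re_le_cmod[of "of_int c * z + of_int d"] le by simp
  hence "\<bar>of_int d\<bar> \<le> 1 + \<bar>of_int c * Re z\<bar>" by linarith
  also have "\<bar>of_int c * Re z\<bar> \<le> of_int C * \<bar>Re z\<bar>" unfolding abs_mult using c by (intro mult_right_mono) auto
  finally have "\<bar>d\<bar> \<le> D" unfolding D_def by (metis add_left_mono ceiling_mono ceiling_of_int of_int_abs)
  with c show "- C \<le> c \<and> c \<le> C \<and> - D \<le> d \<and> d \<le> D" by auto
 qed
 thus ?thesis by (rule finite_subset) simp
qed

lemma mact_Tmat: "mact (Tmat n) z = z + of_int n" by (simp add: mact_eq den_def)

text \<open>Choose A with |c z + d| minimal, which maximises the imaginary part; the minimum exists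
  because only finitely many rows have |c z + d| <= 1 and (0, 1) is one of them. A translation makes
  the real part small, and |u| < 1 would contradict minimality via z -> -1/z.\<close>

lemma Fdom_reach:
 assumes z: "0 < Im z" shows "\<exists>A\<in>SL2Z. mact A z \<in> Fdom"
proof -
 define R where "R = {(c :: int, d :: int). cmod (of_int c * z + of_int d) \<le> 1 \<and> (\<exists>A\<in>SL2Z. A $ 2 $ 1 = c \<and> A $ 2 $ 2 = d)}"
 have fin: "finite R" by (rule finite_subset[OF _ finite_small_rows[OF z]]) (auto simp: R_def)
 have "(0, 1) \<in> R" unfolding R_def using SL2Z_1 by (auto intro!: bexI[of _ "mat 1"])
 hence ne: "R \<noteq> {}" by blast
 define m where "m = Min ((\<lambda>(c, d). cmod (of_int c * z + of_int d)) ` R)"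
 have "m \<in> (\<lambda>(c, d). cmod (of_int c * z + of_int d)) ` R" unfolding m_def using fin ne by (intro Min_in) auto
 then obtain A where A: "A \<in> SL2Z" "cmod (den A z) = m" "m \<le> 1" by (auto simp: R_def den_def)
 have min: "m \<le> cmod (den B z)" if "B \<in> SL2Z" for B
 proof (cases "cmod (den B z) \<le> 1")
  case True
  hence "(B $ 2 $ 1, B $ 2 $ 2) \<in> R" using that by (auto simp: R_def den_def)
  thus ?thesis unfolding m_def den_def using fin by (intro Min_le) force+
 next
  case False thus ?thesis using A(3) by simp
 qed
 define w where "w = mact A z"
 define n where "n = - round (Re w)"
 define B where "B = Tmat n ** A"
 have B: "B \<in> SL2Z" unfolding B_def by (rule SL2Z_mult) (use A in \<open>auto simp: SL2Z_def\<close>)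
 have detA: "det A = 1" "det B = 1" using A B by (auto simp: SL2Z_def)
 define u where "u = mact B z"
 have u: "u = w + of_int n" unfolding u_def B_def w_def using mact_mult[OF z, of A "Tmat n"] detA by (simp add: mact_Tmat)
 have Imu: "0 < Im u" unfolding u_def using z detA by (intro mact_upper) auto
 have Re: "\<bar>Re u\<bar> \<le> 1/2" unfolding u n_def using of_int_round_abs_le[of "Re w"] by (simp add: abs_minus_commute)
 have denB: "den B z = den A z" unfolding B_def by (simp add: den_def)
 have "1 \<le> cmod u"
 proof (rule ccontr)
  assume lt: "\<not> 1 \<le> cmod u"
  define S where "S = mat2 0 (-1) 1 (0::int)"
  have "S ** B \<in> SL2Z" by (rule SL2Z_mult[OF _ B]) (simp add: S_def SL2Z_def)
  hence "m \<le> cmod (den (S ** B) z)" by (rule min)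
  also have "den (S ** B) z = den S u * den B z" unfolding u_def using den_mult[OF z, of B S] detA by simp
  also have "den S u = u" by (simp add: S_def den_def)
  also have "cmod (u * den B z) = cmod u * m" using A denB by (simp add: norm_mult)
  finally have "m \<le> cmod u * m" .
  moreover have "m > 0" using A(2) den_nonzero[OF z, of A] detA by auto
  ultimately show False using lt by simp
 qed
 thus ?thesis using B Imu Re unfolding u_def by (intro bexI[of _ B]) (auto simp: std_fundamental_domain_def)
qed

text \<open>On \<open>Fdom\<close> the square of |c z + d| is at least c^2 - |c d| + d^2, a positive
  integer for c nonzero. Strict inequalities for z give a strict inequality.\<close>

lemma Fdom_den_ge:
 assumes "0 < Im z" "\<bar>Re z\<bar> \<le> 1/2" "1 \<le> cmod z" "A $ 2 $ 1 \<noteq> 0"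
 shows "1 \<le> cmod (den A z)" "\<bar>Re z\<bar> < 1/2 \<Longrightarrow> 1 < cmod z \<Longrightarrow> 1 < cmod (den A z)"
proof -
 define c d where "c = A $ 2 $ 1" "d = A $ 2 $ 2"
 have e: "(cmod (den A z))\<^sup>2 = (of_int c)\<^sup>2 * (cmod z)\<^sup>2 + 2 * of_int (c * d) * Re z + (of_int d)\<^sup>2"
  unfolding cmod_den_sq cmod_power2[of z] c_d_def by (simp add: power2_eq_square algebra_simps)
 have i1: "1 \<le> c^2 - \<bar>c * d\<bar> + d^2"
 proof -
  have "c^2 - \<bar>c * d\<bar> + d^2 = (\<bar>c\<bar> - \<bar>d\<bar>)^2 + \<bar>c\<bar> * \<bar>d\<bar>" by (simp add: power2_eq_square algebra_simps abs_mult)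
  moreover have "(\<bar>c\<bar> - \<bar>d\<bar>)^2 + \<bar>c\<bar> * \<bar>d\<bar> \<ge> 1"
  proof (cases "d = 0")
   case True
   have "c^2 > 0" using assms(4) by (simp add: c_d_def)
   hence "c^2 \<ge> 1" by linarith
   thus ?thesis using True by simp
  next
   case False
   hence "\<bar>c\<bar> * \<bar>d\<bar> > 0" using assms(4) by (simp add: c_d_def)
   thus ?thesis using zero_le_power2[of "\<bar>c\<bar> - \<bar>d\<bar>"] by linarith
  qed
  ultimately show ?thesis by simp
 qed
 have "real_of_int 1 \<le> of_int (c^2 - \<bar>c * d\<bar> + d^2)" using i1 by (rule of_int_le_iff[THEN iffD2])
 hence i: "1 \<le> (of_int c)\<^sup>2 - \<bar>real_of_int (c * d)\<bar> + (of_int d)\<^sup>2" by simp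
 have c2: "(real_of_int c)\<^sup>2 > 0" using assms(4) by (simp add: c_d_def)
 have z2: "1 \<le> (cmod z)\<^sup>2" using assms(3) by (simp add: one_le_power)
 have m1: "(of_int c)\<^sup>2 \<le> (of_int c)\<^sup>2 * (cmod z)\<^sup>2" using z2 c2 by (simp add: mult_le_cancel_left1)
 have "\<bar>2 * real_of_int (c * d) * Re z\<bar> = \<bar>real_of_int (c * d)\<bar> * (2 * \<bar>Re z\<bar>)" by (simp add: abs_mult)
 also have "... \<le> \<bar>real_of_int (c * d)\<bar> * 1" using assms(2) by (intro mult_left_mono) auto
 finally have m2: "2 * real_of_int (c * d) * Re z \<ge> - \<bar>real_of_int (c * d)\<bar>" by linarith
 have "1 \<le> (cmod (den A z))\<^sup>2" unfolding e using i m1 m2 by linarith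
 thus "1 \<le> cmod (den A z)" by (simp add: power2_nonneg_ge_1_iff)
 assume "\<bar>Re z\<bar> < 1/2" "1 < cmod z"
 hence "1 < (cmod z)\<^sup>2" by (simp add: one_less_power)
 hence "(of_int c)\<^sup>2 < (of_int c)\<^sup>2 * (cmod z)\<^sup>2" using c2 by simp
 hence "1\<^sup>2 < (cmod (den A z))\<^sup>2" unfolding e using i m2 by simp
 thus "1 < cmod (den A z)" by (rule power2_less_imp_less) simp
qed

text \<open>If c were nonzero, \<open>Fdom_den_ge\<close> applied to A at z and to the inverse at w
  would give Im w < Im z and Im z <= Im w. So A is plus or minus a translation, and the width of the
  strip excludes a nonzero shift.\<close>

lemma Fdom_interior_unique:
 assumes z: "0 < Im z" "\<bar>Re z\<bar> < 1/2" "1 < cmod z" and A: "A \<in> SL2Z" "mact A z \<in> Fdom"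
 shows "A = mat 1 \<or> A = mat (-1)"
proof -
 define w where "w = mact A z"
 have det: "det A = 1" using A by (simp add: SL2Z_def)
 have w: "0 < Im w" "\<bar>Re w\<bar> \<le> 1/2" "1 \<le> cmod w" using A by (auto simp: w_def std_fundamental_domain_def)
 have zw: "z = mact (adj2 A) w" unfolding w_def using mact_adj2[OF z(1)] det by simp
 have c: "A $ 2 $ 1 = 0"
 proof (rule ccontr)
  assume c: "A $ 2 $ 1 \<noteq> 0"
  have "1 < cmod (den A z)" by (rule Fdom_den_ge(2)) (use z c in auto)
  hence "1 < (cmod (den A z))\<^sup>2" by (simp add: one_less_power)
  hence "Im w < Im z" unfolding w_def Im_mact det using z by (simp add: divide_less_eq)
  moreover have "1 \<le> cmod (den (adj2 A) w)" by (rule Fdom_den_ge(1)) (use w c in auto)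
  hence "1 \<le> (cmod (den (adj2 A) w))\<^sup>2" by (simp add: one_le_power)
  hence "Im z \<le> Im w" unfolding zw Im_mact using det w by (simp add: divide_le_eq)
  ultimately show False by simp
 qed
 hence "A $ 1 $ 1 * A $ 2 $ 2 = 1" using det by (simp add: det_2)
 hence ad: "A $ 1 $ 1 = 1 \<and> A $ 2 $ 2 = 1 \<or> A $ 1 $ 1 = -1 \<and> A $ 2 $ 2 = -1" by (simp add: zmult_eq_1_iff)
 hence "Re w = Re z + of_int (A $ 1 $ 2) \<or> Re w = Re z - of_int (A $ 1 $ 2)"
  unfolding w_def mact_eq den_def using c by auto
 hence "\<bar>of_int (A $ 1 $ 2)\<bar> < (1::real)" using z w by linarith
 hence "A $ 1 $ 2 = 0" by linarith
 thus ?thesis using ad c by (auto simp: mat2_eq_iff)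
qed

definition Fbd :: "complex set" where
 "Fbd = {z. Re z = 1/2} \<union> {z. Re z = -1/2} \<union> sphere 0 1"

lemma null_hyp: "N \<in> sets borel \<Longrightarrow> negligible N \<Longrightarrow> N \<in> null_sets hyp"
proof -
 assume N: "N \<in> sets borel" "negligible N"
 have "N \<in> null_sets lborel"
  using N negligible_iff_null_sets null_sets_completion_iff by (metis sets_lborel)
 hence "AE z in lborel. z \<notin> N" by (rule AE_not_in)
 hence "AE z in hyp. z \<notin> N" unfolding hyp_def by (subst AE_density) auto
 thus "N \<in> null_sets hyp" using N by (subst (asm) AE_iff_null_sets[symmetric]) auto
qed

lemma Fbd_null: "Fbd \<in> null_sets hyp"
proof (rule null_hyp)
 have "{z. Re z = a} = {z :: complex. z \<bullet> 1 = a}" for a by (auto simp: inner_complex_def)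
 hence "negligible {z. Re z = a}" for a
  using negligible_standard_hyperplane[of "1::complex" a] by (auto simp: Basis_complex_def)
 thus "negligible Fbd" unfolding Fbd_def by (intro negligible_Un negligible_sphere)
 show "Fbd \<in> sets borel" unfolding Fbd_def by measurable
qed

lemma AE_hyp_mact:
 assumes "0 < det X" "AE z in hyp. P z" shows "AE z in hyp. P (mact X z)"
proof -
 obtain N where N: "{z. \<not> P z} \<subseteq> N" "N \<in> null_sets hyp" using assms(2) by (auto elim: AE_E simp: null_sets_def)
 have Nb: "N \<in> sets borel" using N by (auto simp: null_sets_def)
 have "emeasure hyp (pre X N) = 0"
  using emeasure_hyp_mact[OF assms(1) Nb] N by (auto simp: null_sets_def)
 hence "pre X N \<in> null_sets hyp"
 proof (intro null_setsI)
  note [measurable] = Nb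
  have "pre X N \<in> sets borel" by measurable
  thus "pre X N \<in> sets hyp" by simp
 qed
 hence "AE z in hyp. z \<notin> pre X N" by (rule AE_not_in)
 thus ?thesis using AE_hyp_upper by eventually_elim (use N in auto)
qed

text \<open>\<open>SL2Z\<close> is countable, so almost every z has no translate on the lines and
  the circle that bound \<open>Fdom\<close>. For such z exactly two matrices, B and -B, move z into
  \<open>Fdom\<close>.\<close>

lemma hyp_tessellation:
 "AE z in hyp. (\<integral>\<^sup>+A. indicator Fdom (mact A z) \<partial>count_space SL2Z) = 2"
proof -
 have "AE z in hyp. z \<notin> Fbd" using AE_not_in[OF Fbd_null] .
 hence "AE z in hyp. mact A z \<notin> Fbd" if "A \<in> SL2Z" for A
  using AE_hyp_mact[of A "\<lambda>z. z \<notin> Fbd"] that by (auto simp: SL2Z_def)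
 hence "AE z in hyp. \<forall>A\<in>SL2Z. mact A z \<notin> Fbd"
  by (intro AE_ball_countable[THEN iffD2] countable_int_mat) auto
 thus ?thesis using AE_hyp_upper
 proof eventually_elim
  case (elim z)
  obtain B where B: "B \<in> SL2Z" "mact B z \<in> Fdom" using Fdom_reach elim by blast
  define w where "w = mact B z"
  have w: "0 < Im w" "\<bar>Re w\<bar> < 1/2" "1 < cmod w"
  proof -
   have "w \<notin> Fbd" using elim B by (auto simp: w_def)
   thus "0 < Im w" "\<bar>Re w\<bar> < 1/2" "1 < cmod w" using B(2)
    by (auto simp: Fbd_def std_fundamental_domain_def w_def[symmetric] abs_le_iff abs_less_iff order_less_le)
  qed
  have detB: "det B = 1" using B by (simp add: SL2Z_def)
  have iff: "mact A z \<in> Fdom \<longleftrightarrow> A = B \<or> A = mat (-1) ** B" if A: "A \<in> SL2Z" for A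
  proof -
   have Aw: "mact A z = mact (A ** adj2 B) w"
   proof -
    have "mact (A ** adj2 B) w = mact A (mact (adj2 B) w)" by (rule mact_mult) (use w detB in auto)
    also have "mact (adj2 B) w = z" unfolding w_def by (rule mact_adj2) (use elim detB in auto)
    finally show ?thesis by simp
   qed
   have AB: "A ** adj2 B \<in> SL2Z" by (intro SL2Z_mult A SL2Z_adj2 B)
   have "mact A z \<in> Fdom \<longleftrightarrow> A ** adj2 B = mat 1 \<or> A ** adj2 B = mat (-1)"
   proof
    assume "mact A z \<in> Fdom"
    thus "A ** adj2 B = mat 1 \<or> A ** adj2 B = mat (-1)"
     unfolding Aw by (rule Fdom_interior_unique[OF w AB])
   next
    assume "A ** adj2 B = mat 1 \<or> A ** adj2 B = mat (-1)"
    hence "mact (A ** adj2 B) w = w" using mact_mat by auto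
    thus "mact A z \<in> Fdom" unfolding Aw using B(2) by (simp add: w_def)
   qed
   also have "... \<longleftrightarrow> A = B \<or> A = mat (-1) ** B" using adj2_cancel(3,4)[OF B(1)] by (metis matrix_mul_lid)
   finally show ?thesis .
  qed
  have mB: "mat (-1) ** B \<in> SL2Z" using B by (simp add: SL2Z_def det_2)
  have "B $ 1 $ 1 \<noteq> 0 \<or> B $ 1 $ 2 \<noteq> 0" using detB by (auto simp: det_2)
  hence "(mat (-1) ** B) $ 1 $ 1 \<noteq> B $ 1 $ 1 \<or> (mat (-1) ** B) $ 1 $ 2 \<noteq> B $ 1 $ 2" by auto
  hence ne: "mat (-1) ** B \<noteq> B" by metis
  have "(\<integral>\<^sup>+A. indicator Fdom (mact A z) \<partial>count_space SL2Z) = (\<integral>\<^sup>+A. indicator {B, mat (-1) ** B} A \<partial>count_space SL2Z)"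
   by (rule nn_integral_cong) (auto simp: iff indicator_def)
  also have "... = emeasure (count_space SL2Z) {B, mat (-1) ** B}"
   by (rule nn_integral_indicator) (use B mB in auto)
  also have "... = 2" using B mB ne by (subst emeasure_count_space) auto
  finally show ?case .
 qed
qed

text \<open>\<open>Fdom\<close> lies above height 1/2 and is covered by the dyadic strips 2^j/2 <=
  Im z <= 2^j, where 1 / Im^2 is at most 4 / 4^j and the area is 2^j/2; the measures form a
  geometric series.\<close>

lemma hyp_Fdom_finite: "emeasure hyp Fdom < \<infinity>"
proof -
 define C where "C j = {z. \<bar>Re z\<bar> \<le> 1/2 \<and> 2^j / 2 \<le> Im z \<and> Im z \<le> 2^j}" for j :: nat
 have Ccbox: "C j = cbox (Complex (-1/2) (2^j/2)) (Complex (1/2) (2^j))" for j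
  by (auto simp: C_def in_cbox_complex_iff)
 have Cb: "C j \<in> sets borel" for j unfolding Ccbox by simp
 have cover: "Fdom \<subseteq> (\<Union>j. C j)"
 proof
  fix z assume "z \<in> Fdom"
  hence z: "0 < Im z" "\<bar>Re z\<bar> \<le> 1/2" "1 \<le> cmod z" by (auto simp: std_fundamental_domain_def)
  have "\<bar>Re z\<bar>\<^sup>2 \<le> (1/2)\<^sup>2" using z by (intro power_mono) auto
  hence r: "(Re z)\<^sup>2 \<le> 1/4" by (simp add: power_divide)
  have "1 \<le> (cmod z)\<^sup>2" using z by (simp add: one_le_power)
  hence "1 \<le> (Re z)\<^sup>2 + (Im z)\<^sup>2" by (simp only: cmod_power2)
  hence "1/4 \<le> (Im z)\<^sup>2" using r by linarith
  moreover have "(1/2 :: real)\<^sup>2 = 1/4" by (simp add: power2_eq_square)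
  ultimately have "(1/2)\<^sup>2 \<le> (Im z)\<^sup>2" by (simp only:)
  hence y: "1/2 \<le> Im z" by (rule power2_le_imp_le) (use z in simp)
  obtain n where n: "Im z < 2 ^ n" using real_arch_pow[of 2 "Im z"] by auto
  define j where "j = (LEAST n. Im z \<le> 2 ^ n)"
  have j: "Im z \<le> 2 ^ j" unfolding j_def by (rule LeastI[of _ n]) (use n in simp)
  have "2^j / 2 \<le> Im z"
  proof (cases j)
   case 0 thus ?thesis using y by simp
  next
   case (Suc i)
   hence "\<not> Im z \<le> 2 ^ i" using not_less_Least[of i "\<lambda>n. Im z \<le> 2 ^ n"] by (simp add: j_def)
   thus ?thesis using Suc by simp
  qed
  thus "z \<in> (\<Union>j. C j)" using j z by (auto simp: C_def)
 qed
 have Cm: "emeasure hyp (C j) \<le> ennreal (2 * (1/2)^j)" for j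
 proof -
  have "emeasure hyp (C j) = (\<integral>\<^sup>+z. hden z * indicator (C j) z \<partial>lborel)"
   unfolding hyp_def using Cb by (intro emeasure_density) auto
  also have "... \<le> (\<integral>\<^sup>+z. ennreal (4 * (1/4)^j) * indicator (C j) z \<partial>lborel)"
  proof (intro nn_integral_mono)
   fix z
   show "hden z * indicator (C j) z \<le> ennreal (4 * (1/4)^j) * indicator (C j) z"
   proof (cases "z \<in> C j")
    case True
    hence i: "2^j / 2 \<le> Im z" by (simp add: C_def)
    have p: "(0::real) < 2^j / 2" by simp
    have "(2^j / 2)\<^sup>2 \<le> (Im z)\<^sup>2" using i p by (intro power_mono) auto
    hence "1 / (Im z)\<^sup>2 \<le> 1 / (2^j / 2)\<^sup>2"
     using p i by (intro divide_left_mono mult_pos_pos zero_less_power) linarith+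
    also have "1 / (2^j / 2 :: real)\<^sup>2 = 4 * (1/4)^j"
     by (simp add: power_divide power2_eq_square field_simps power_mult_distrib[symmetric])
    finally have le: "1 / (Im z)\<^sup>2 \<le> 4 * (1/4)^j" .
    have "indicator upper_half_plane z / (Im z)\<^sup>2 \<le> 1 / (Im z)\<^sup>2" by (simp add: indicator_def)
    with le have "indicator upper_half_plane z / (Im z)\<^sup>2 \<le> 4 * (1/4)^j" by linarith
    thus ?thesis using True by (simp add: ennreal_leI)
   qed simp
  qed
  also have "... = ennreal (4 * (1/4)^j) * emeasure lborel (C j)"
   using Cb by (intro nn_integral_cmult_indicator) auto
  also have "emeasure lborel (C j) = ennreal (2^j / 2)"
   unfolding Ccbox by (subst emeasure_lborel_cbox) (auto simp: Basis_complex_def)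
  also have "ennreal (4 * (1/4)^j) * ennreal (2^j / 2) = ennreal (2 * (1/2)^j)"
  proof -
   have "(4 * (1/4)^j) * (2^j / 2) = 2 * (((1/4) * 2)^j :: real)" by (simp only: power_mult_distrib)
   thus ?thesis by (subst ennreal_mult[symmetric]) auto
  qed
  finally show ?thesis .
 qed
 have "emeasure hyp Fdom \<le> emeasure hyp (\<Union>j. C j)" using Cb cover by (intro emeasure_mono) auto
 also have "... \<le> (\<Sum>j. emeasure hyp (C j))" using Cb by (intro emeasure_subadditive_countably) auto
 also have "... \<le> (\<Sum>j. ennreal (2 * (1/2)^j))" by (intro suminf_le Cm) auto
 also have "... = ennreal (\<Sum>j. 2 * (1/2)^j)"
  by (rule suminf_ennreal_eq[OF _ summable_sums]) (auto intro: summable_mult summable_geometric)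
 also have "... < \<infinity>" by simp
 finally show ?thesis .
qed

text \<open>Otherwise all translates of \<open>Fdom\<close> would be null, and by the tessellation
  so would the half plane.\<close>

lemma hyp_Fdom_pos: "emeasure hyp Fdom > 0"
proof (rule ccontr)
 assume "\<not> emeasure hyp Fdom > 0"
 hence 0: "emeasure hyp Fdom = 0" by simp
 have "(\<integral>\<^sup>+z. (\<integral>\<^sup>+A. indicator Fdom (mact A z) \<partial>count_space SL2Z) \<partial>hyp) =
   (\<integral>\<^sup>+A. (\<integral>\<^sup>+z. indicator Fdom (mact A z) \<partial>hyp) \<partial>count_space SL2Z)"
  by (intro nn_integral_count_space_nn_integral countable_int_mat) measurable
 also have "... = (\<integral>\<^sup>+A. 0 \<partial>count_space SL2Z)"
 proof (rule nn_integral_cong)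
  fix A assume "A \<in> space (count_space SL2Z)"
  hence "0 < det A" by (simp add: SL2Z_def)
  hence "(\<integral>\<^sup>+z. indicator Fdom (mact A z) \<partial>hyp) = (\<integral>\<^sup>+z. indicator Fdom z \<partial>hyp)"
   by (intro nn_integral_hyp_mact) measurable
  thus "(\<integral>\<^sup>+z. indicator Fdom (mact A z) \<partial>hyp) = 0" using 0 by simp
 qed
 finally have "(\<integral>\<^sup>+z. (\<integral>\<^sup>+A. indicator Fdom (mact A z) \<partial>count_space SL2Z) \<partial>hyp) = 0" by simp
 moreover have "(\<integral>\<^sup>+z. (\<integral>\<^sup>+A. indicator Fdom (mact A z) \<partial>count_space SL2Z) \<partial>hyp) = (\<integral>\<^sup>+z. 2 \<partial>hyp)"
  by (rule nn_integral_cong_AE[OF hyp_tessellation])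
 ultimately have "emeasure hyp UNIV = 0" by simp
 moreover have "emeasure hyp (cbox (Complex 0 1) (Complex 1 2)) \<le> emeasure hyp UNIV" by (intro emeasure_mono) auto
 moreover have "emeasure hyp (cbox (Complex 0 1) (Complex 1 2)) \<noteq> 0"
 proof
  assume "emeasure hyp (cbox (Complex 0 1) (Complex 1 2)) = 0"
  hence "cbox (Complex 0 1) (Complex 1 2) \<in> null_sets hyp" by (intro null_setsI) auto
  hence "AE z in hyp. z \<notin> cbox (Complex 0 1) (Complex 1 2)" by (rule AE_not_in)
  hence "AE z in lborel. 0 < hden z \<longrightarrow> z \<notin> cbox (Complex 0 1) (Complex 1 2)"
   unfolding hyp_def by (subst (asm) AE_density) auto
  hence "AE z in lborel. z \<notin> cbox (Complex 0 1) (Complex 1 2)"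
   by eventually_elim (auto simp: in_cbox_complex_iff indicator_def)
  hence "cbox (Complex 0 1) (Complex 1 2) \<in> null_sets lborel" by (subst (asm) AE_iff_null_sets[symmetric]) auto
  hence "emeasure lborel (cbox (Complex 0 1) (Complex 1 2)) = 0" by (simp add: null_sets_def)
  thus False by (subst (asm) emeasure_lborel_cbox) (auto simp: Basis_complex_def)
 qed
 ultimately show False by simp
qed

section \<open>Invariant integration\<close>

definition sl2_subgroup :: "(int ^ 2 ^ 2) set \<Rightarrow> bool" where
 "sl2_subgroup G \<longleftrightarrow> G \<subseteq> SL2Z \<and> mat 1 \<in> G \<and> (\<forall>A\<in>G. \<forall>B\<in>G. A ** B \<in> G) \<and> (\<forall>A\<in>G. adj2 A \<in> G)"

definition coset_rel :: "(int ^ 2 ^ 2) set \<Rightarrow> (int ^ 2 ^ 2) set \<Rightarrow> ((int ^ 2 ^ 2) \<times> (int ^ 2 ^ 2)) set" where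
 "coset_rel G L = {(A, B). A \<in> G \<and> (\<exists>g\<in>L. B = g ** A)}"

text \<open>The same choice as in \<open>petersson\<close>, so that the two sums can be compared
  term by term.\<close>

definition rep :: "(int ^ 2 ^ 2) set \<Rightarrow> int ^ 2 ^ 2" where
 "rep C = (SOME A. A \<in> C)"

text \<open>The principal congruence subgroup: normal in \<open>SL2Z\<close> and of finite index,
  hence a common ground for forms of different levels and characters.\<close>

definition GammaN :: "nat \<Rightarrow> (int ^ 2 ^ 2) set" where
 "GammaN N = {A \<in> SL2Z. int N dvd A $ 1 $ 1 - 1 \<and> int N dvd A $ 1 $ 2 \<and> int N dvd A $ 2 $ 1 \<and> int N dvd A $ 2 $ 2 - 1}"

lemma sl2_subgroupD:
 assumes "sl2_subgroup G"
 shows "A \<in> G \<Longrightarrow> A \<in> SL2Z" "mat 1 \<in> G" "A \<in> G \<Longrightarrow> B \<in> G \<Longrightarrow> A ** B \<in> G" "A \<in> G \<Longrightarrow> adj2 A \<in> G"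
 using assms by (auto simp: sl2_subgroup_def)

lemma sl2_subgroup_SL2Z: "sl2_subgroup SL2Z" by (auto simp: sl2_subgroup_def SL2Z_1 SL2Z_mult SL2Z_adj2)

lemma sl2_subgroup_Gamma0: "sl2_subgroup (Gamma0 N)"
 by (auto simp: sl2_subgroup_def Gamma0_1 Gamma0_mult Gamma0_adj2 Gamma0_SL2Z)

lemma GammaN_mult: "A \<in> GammaN N \<Longrightarrow> B \<in> GammaN N \<Longrightarrow> A ** B \<in> GammaN N"
proof -
 assume A: "A \<in> GammaN N" and B: "B \<in> GammaN N"
 obtain a b c d where a: "A $ 1 $ 1 = 1 + int N * a" "A $ 1 $ 2 = int N * b" "A $ 2 $ 1 = int N * c" "A $ 2 $ 2 = 1 + int N * d"
  using A by (auto simp: GammaN_def dvd_def algebra_simps)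
 obtain a' b' c' d' where b: "B $ 1 $ 1 = 1 + int N * a'" "B $ 1 $ 2 = int N * b'" "B $ 2 $ 1 = int N * c'" "B $ 2 $ 2 = 1 + int N * d'"
  using B by (auto simp: GammaN_def dvd_def algebra_simps)
 have "A ** B \<in> SL2Z" using A B by (auto simp: GammaN_def SL2Z_mult)
 moreover have "(A ** B) $ 1 $ 1 - 1 = int N * (a' + a + int N * a * a' + int N * b * c')" using a b by (simp add: algebra_simps)
 moreover have "(A ** B) $ 1 $ 2 = int N * (b' + int N * a * b' + b + int N * b * d')" using a b by (simp add: algebra_simps)
 moreover have "(A ** B) $ 2 $ 1 = int N * (c + int N * c * a' + c' + int N * d * c')" using a b by (simp add: algebra_simps)
 moreover have "(A ** B) $ 2 $ 2 - 1 = int N * (int N * c * b' + d' + d + int N * d * d')" using a b by (simp add: algebra_simps)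
 ultimately show ?thesis unfolding GammaN_def mem_Collect_eq by (metis dvd_triv_left)
qed

lemma sl2_subgroup_GammaN: "sl2_subgroup (GammaN N)"
 unfolding sl2_subgroup_def using GammaN_mult by (auto simp: GammaN_def SL2Z_1 SL2Z_adj2)

lemma coset_facts:
 assumes G: "sl2_subgroup G" and L: "sl2_subgroup L" "L \<subseteq> G" and C: "C \<in> G // coset_rel G L"
 shows "rep C \<in> C" "rep C \<in> G" "C = (\<lambda>g. g ** rep C) ` L"
proof -
 obtain A where A: "A \<in> G" "C = coset_rel G L `` {A}" using C by (auto simp: quotient_def)
 hence CA: "C = (\<lambda>g. g ** A) ` L" by (auto simp: coset_rel_def)
 have "A \<in> C" unfolding CA using sl2_subgroupD(2)[OF L(1)] by (metis image_eqI matrix_mul_lid)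
 thus r: "rep C \<in> C" unfolding rep_def by (rule someI)
 then obtain h where h: "h \<in> L" "rep C = h ** A" unfolding CA by blast
 thus "rep C \<in> G" using A L G by (auto simp: sl2_subgroup_def)
 have hS: "h \<in> SL2Z" using h L(1) sl2_subgroupD(1) by blast
 show "C = (\<lambda>g. g ** rep C) ` L"
 proof (intro equalityI subsetI)
  fix B assume "B \<in> C"
  then obtain g where g: "g \<in> L" "B = g ** A" unfolding CA by blast
  hence "B = (g ** adj2 h) ** rep C" unfolding h(2) by (simp only: matrix_mul_assoc adj2_cancel[OF hS])
  thus "B \<in> (\<lambda>g. g ** rep C) ` L" using g h sl2_subgroupD(3,4)[OF L(1)] by blast
 next
  fix B assume "B \<in> (\<lambda>g. g ** rep C) ` L"
  then obtain g where g: "g \<in> L" "B = g ** rep C" by blast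
  hence "B = (g ** h) ** A" unfolding h(2) by (simp only: matrix_mul_assoc)
  thus "B \<in> C" unfolding CA using g h sl2_subgroupD(3)[OF L(1)] by blast
 qed
qed

lemma coset_subset:
 assumes G: "sl2_subgroup G" and L: "sl2_subgroup L" "L \<subseteq> G"
  and C: "C \<in> G // coset_rel G L" and D: "D \<in> G // coset_rel G L" and "X \<in> C" "X \<in> D" shows "C \<subseteq> D"
proof
 obtain g where g: "g \<in> L" "X = g ** rep C" using coset_facts(3)[OF G L C] assms(6) by blast
 obtain h where h: "h \<in> L" "X = h ** rep D" using coset_facts(3)[OF G L D] assms(7) by blast
 have S: "g \<in> SL2Z" using g sl2_subgroupD(1)[OF L(1)] by auto
 have e: "rep C = (adj2 g ** h) ** rep D"
  unfolding matrix_mul_assoc[symmetric] h(2)[symmetric] g(2) by (simp only: adj2_cancel[OF S])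
 fix B assume "B \<in> C"
 then obtain x where x: "x \<in> L" "B = x ** rep C" using coset_facts(3)[OF G L C] by blast
 have "B = (x ** (adj2 g ** h)) ** rep D" unfolding x(2) e by (simp only: matrix_mul_assoc)
 moreover have "x ** (adj2 g ** h) \<in> L" using sl2_subgroupD(3,4)[OF L(1)] x g h by blast
 ultimately show "B \<in> D" using coset_facts(3)[OF G L D] by blast
qed

lemma coset_eqI:
 assumes "sl2_subgroup G" "sl2_subgroup L" "L \<subseteq> G" "C \<in> G // coset_rel G L" "D \<in> G // coset_rel G L" "X \<in> C" "X \<in> D"
 shows "C = D" using coset_subset[OF assms(1-3)] assms by blast

lemma coset_bij:
 assumes G: "sl2_subgroup G" and L: "sl2_subgroup L" "L \<subseteq> G"
 shows "bij_betw (\<lambda>(C, g). g ** rep C) ((G // coset_rel G L) \<times> L) G" unfolding bij_betw_def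
proof
 show "inj_on (\<lambda>(C, g). g ** rep C) ((G // coset_rel G L) \<times> L)"
 proof (rule inj_onI, clarify)
  fix C g D h assume C: "C \<in> G // coset_rel G L" and D: "D \<in> G // coset_rel G L" and gh: "g \<in> L" "h \<in> L"
   and eq: "g ** rep C = h ** rep D"
  have "g ** rep C \<in> C" "h ** rep D \<in> D" using coset_facts(3)[OF G L C] coset_facts(3)[OF G L D] gh by blast+
  hence CD: "C = D" using coset_eqI[OF G L C D] eq by metis
  have "rep C \<in> SL2Z" using coset_facts(2)[OF G L C] sl2_subgroupD(1)[OF G] by blast
  hence "g = h" using eq unfolding CD[symmetric] by (metis adj2_cancel(3))
  thus "C = D \<and> g = h" using CD by simp
 qed
 show "(\<lambda>(C, g). g ** rep C) ` ((G // coset_rel G L) \<times> L) = G"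
 proof (intro equalityI subsetI)
  fix A assume A: "A \<in> G"
  define C where "C = coset_rel G L `` {A}"
  have C: "C \<in> G // coset_rel G L" unfolding C_def using A by (rule quotientI)
  have "A \<in> C" using A sl2_subgroupD(2)[OF L(1)] by (auto simp: C_def coset_rel_def intro!: bexI[of _ "mat 1"])
  then obtain g where "g \<in> L" "A = g ** rep C" using coset_facts(3)[OF G L C] by blast
  thus "A \<in> (\<lambda>(C, g). g ** rep C) ` ((G // coset_rel G L) \<times> L)" using C by force
 next
  fix A assume "A \<in> (\<lambda>(C, g). g ** rep C) ` ((G // coset_rel G L) \<times> L)"
  then obtain C g where C: "C \<in> G // coset_rel G L" "g \<in> L" "A = g ** rep C" by auto
  thus "A \<in> G" using coset_facts(2)[OF G L C(1)] L(2) sl2_subgroupD(3)[OF G] by blast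
 qed
qed

lemma countable_quotient: "countable (G // coset_rel G L)"
 unfolding quotient_def using countable_int_mat[of G] by auto

lemma nn_integral_coset:
 assumes G: "sl2_subgroup G" and L: "sl2_subgroup L" "L \<subseteq> G" shows "(\<integral>\<^sup>+A. F A \<partial>count_space G) =
  (\<integral>\<^sup>+C. (\<integral>\<^sup>+g. F (g ** rep C) \<partial>count_space L) \<partial>count_space (G // coset_rel G L))"
proof -
 let ?Q = "G // coset_rel G L"
 interpret sigma_finite_measure "count_space L"
  by (rule sigma_finite_measure_count_space_countable[OF countable_int_mat])
 have "(\<integral>\<^sup>+A. F A \<partial>count_space G) = (\<integral>\<^sup>+x. F ((\<lambda>(C, g). g ** rep C) x) \<partial>count_space (?Q \<times> L))"
  by (rule nn_integral_bij_count_space[OF coset_bij[OF G L], symmetric])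
 also have "... = (\<integral>\<^sup>+x. F ((\<lambda>(C, g). g ** rep C) x) \<partial>(count_space ?Q \<Otimes>\<^sub>M count_space L))"
  by (simp only: pair_measure_countable[OF countable_quotient countable_int_mat])
 also have "... = (\<integral>\<^sup>+C. (\<integral>\<^sup>+g. F ((\<lambda>(C, g). g ** rep C) (C, g)) \<partial>count_space L) \<partial>count_space ?Q)"
  by (rule nn_integral_fst[symmetric]) (simp add: pair_measure_countable[OF countable_quotient countable_int_mat])
 finally show ?thesis by simp
qed

lemma nn_integral_adj2:
 assumes "sl2_subgroup G" shows "(\<integral>\<^sup>+A. F (adj2 A) \<partial>count_space G) = (\<integral>\<^sup>+A. F A \<partial>count_space G)"
proof (rule nn_integral_bij_count_space)
 show "bij_betw adj2 G G"
  by (rule bij_betw_byWitness[of _ adj2]) (use sl2_subgroupD(4)[OF assms] in auto)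
qed

section \<open>Unfolding and invariance of integrals over quotients\<close>

definition psum :: "(int ^ 2 ^ 2) set \<Rightarrow> (complex \<Rightarrow> ennreal) \<Rightarrow> complex \<Rightarrow> ennreal" where
 "psum G \<phi> z = (\<integral>\<^sup>+g. \<phi> (mact g z) \<partial>count_space G)"

text \<open>For G-invariant h this is the integral over the quotient of the half plane by G, taken
  twice if -1 is not in G. Values in [0, infinity] allow free interchange of sums and
  integrals.\<close>

definition Jint :: "(int ^ 2 ^ 2) set \<Rightarrow> (complex \<Rightarrow> ennreal) \<Rightarrow> ennreal" where
 "Jint G h = (\<integral>\<^sup>+C. (\<integral>\<^sup>+z. indicator Fdom z * h (mact (rep C) z) \<partial>hyp) \<partial>count_space (SL2Z // coset_rel SL2Z G))"

lemma nn_integral_count_space_borel: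
 assumes "countable I" and f: "\<And>i. i \<in> I \<Longrightarrow> f i \<in> borel_measurable M"
 shows "(\<lambda>z. \<integral>\<^sup>+i. (f i z :: ennreal) \<partial>count_space I) \<in> borel_measurable M"
proof -
 interpret sigma_finite_measure "count_space I"
  by (rule sigma_finite_measure_count_space_countable[OF assms(1)])
 have "(\<lambda>(i, z). f i z) \<in> borel_measurable (count_space I \<Otimes>\<^sub>M M)"
  by (rule measurable_pair_measure_countable1[OF assms(1)]) (use f in simp)
 from measurable_pair_swap[OF this]
 have "(\<lambda>(z, i). f i z) \<in> borel_measurable (M \<Otimes>\<^sub>M count_space I)" by (simp add: split_beta')
 from borel_measurable_nn_integral_fst[OF this] show ?thesis by simp
qed

lemma psum_borel [measurable]:
 assumes [measurable]: "\<phi> \<in> borel_measurable borel" shows "psum G \<phi> \<in> borel_measurable borel"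
 unfolding psum_def by (rule nn_integral_count_space_borel[OF countable_int_mat]) measurable

lemma upper_SL2Z: "A \<in> SL2Z \<Longrightarrow> 0 < det A" by (simp add: SL2Z_def)

text \<open>The tessellation covers the half plane twice, by A and -A, hence the factor 2. Moving A
  from the indicator to the argument is invariance of the measure.\<close>

lemma nn_integral_tessellate:
 assumes [measurable]: "\<psi> \<in> borel_measurable borel"
 shows "2 * (\<integral>\<^sup>+z. \<psi> z \<partial>hyp) = (\<integral>\<^sup>+A. (\<integral>\<^sup>+z. indicator Fdom z * \<psi> (mact A z) \<partial>hyp) \<partial>count_space SL2Z)"
proof -
 have "2 * (\<integral>\<^sup>+z. \<psi> z \<partial>hyp) = (\<integral>\<^sup>+z. 2 * \<psi> z \<partial>hyp)" by (rule nn_integral_cmult[symmetric]) measurable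
 also have "... = (\<integral>\<^sup>+z. (\<integral>\<^sup>+A. indicator Fdom (mact A z) * \<psi> z \<partial>count_space SL2Z) \<partial>hyp)"
 proof (rule nn_integral_cong_AE)
  show "AE z in hyp. 2 * \<psi> z = (\<integral>\<^sup>+A. indicator Fdom (mact A z) * \<psi> z \<partial>count_space SL2Z)"
   using hyp_tessellation by eventually_elim (simp add: nn_integral_multc)
 qed
 also have "... = (\<integral>\<^sup>+A. (\<integral>\<^sup>+z. indicator Fdom (mact A z) * \<psi> z \<partial>hyp) \<partial>count_space SL2Z)"
  by (intro nn_integral_count_space_nn_integral countable_int_mat) measurable
 also have "... = (\<integral>\<^sup>+A. (\<integral>\<^sup>+z. indicator Fdom z * \<psi> (mact (adj2 A) z) \<partial>hyp) \<partial>count_space SL2Z)"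
 proof (rule nn_integral_cong)
  fix A assume "A \<in> space (count_space SL2Z)"
  hence A: "0 < det A" using upper_SL2Z by simp
  have "(\<integral>\<^sup>+z. indicator Fdom (mact A z) * \<psi> z \<partial>hyp) =
   (\<integral>\<^sup>+z. indicator Fdom (mact A (mact (adj2 A) z)) * \<psi> (mact (adj2 A) z) \<partial>hyp)"
   by (rule nn_integral_hyp_mact[symmetric]) (use A in auto)
  also have "... = (\<integral>\<^sup>+z. indicator Fdom z * \<psi> (mact (adj2 A) z) \<partial>hyp)"
   by (rule nn_integral_cong_AE, use AE_hyp_upper in eventually_elim) (simp add: mact_adj2 A)
  finally show "(\<integral>\<^sup>+z. indicator Fdom (mact A z) * \<psi> z \<partial>hyp) = (\<integral>\<^sup>+z. indicator Fdom z * \<psi> (mact (adj2 A) z) \<partial>hyp)" .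
 qed
 also have "... = (\<integral>\<^sup>+A. (\<integral>\<^sup>+z. indicator Fdom z * \<psi> (mact A z) \<partial>hyp) \<partial>count_space SL2Z)"
  by (rule nn_integral_adj2[OF sl2_subgroup_SL2Z])
 finally show ?thesis .
qed

text \<open>After tessellation the sum over \<open>SL2Z\<close> is split into cosets of K.
  Invariance of h takes it out of the inner sum over K, which leaves \<open>psum K \<phi>\<close>,
  almost everywhere c.\<close>

lemma unfolding_const:
 assumes K: "sl2_subgroup K" and [measurable]: "h \<in> borel_measurable borel" "\<phi> \<in> borel_measurable borel"
  and inv: "\<And>g z. g \<in> K \<Longrightarrow> 0 < Im z \<Longrightarrow> h (mact g z) = h z" and c: "AE z in hyp. psum K \<phi> z = c"
 shows "2 * (\<integral>\<^sup>+z. \<phi> z * h z \<partial>hyp) = c * Jint K h"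
proof -
 have KS: "K \<subseteq> SL2Z" using K by (auto simp: sl2_subgroup_def)
 have "2 * (\<integral>\<^sup>+z. \<phi> z * h z \<partial>hyp) =
   (\<integral>\<^sup>+A. (\<integral>\<^sup>+z. indicator Fdom z * (\<phi> (mact A z) * h (mact A z)) \<partial>hyp) \<partial>count_space SL2Z)"
  by (rule nn_integral_tessellate) measurable
 also have "... = (\<integral>\<^sup>+C. (\<integral>\<^sup>+g. (\<integral>\<^sup>+z. indicator Fdom z * (\<phi> (mact (g ** rep C) z) * h (mact (g ** rep C) z)) \<partial>hyp)
    \<partial>count_space K) \<partial>count_space (SL2Z // coset_rel SL2Z K))"
  by (rule nn_integral_coset[OF sl2_subgroup_SL2Z K KS])
 also have "... = (\<integral>\<^sup>+C. c * (\<integral>\<^sup>+z. indicator Fdom z * h (mact (rep C) z) \<partial>hyp) \<partial>count_space (SL2Z // coset_rel SL2Z K))"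
 proof (rule nn_integral_cong)
  fix C assume "C \<in> space (count_space (SL2Z // coset_rel SL2Z K))"
  hence C: "rep C \<in> SL2Z" using coset_facts(2)[OF sl2_subgroup_SL2Z K KS] by simp
  have det: "0 < det (rep C)" using C upper_SL2Z by blast
  have "(\<integral>\<^sup>+g. (\<integral>\<^sup>+z. indicator Fdom z * (\<phi> (mact (g ** rep C) z) * h (mact (g ** rep C) z)) \<partial>hyp) \<partial>count_space K) =
   (\<integral>\<^sup>+z. (\<integral>\<^sup>+g. indicator Fdom z * (\<phi> (mact (g ** rep C) z) * h (mact (g ** rep C) z)) \<partial>count_space K) \<partial>hyp)"
   by (intro nn_integral_count_space_nn_integral[symmetric] countable_int_mat) measurable
  also have "... = (\<integral>\<^sup>+z. c * (indicator Fdom z * h (mact (rep C) z)) \<partial>hyp)"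
  proof (rule nn_integral_cong_AE)
   have "AE z in hyp. psum K \<phi> (mact (rep C) z) = c" by (rule AE_hyp_mact[OF det c])
   thus "AE z in hyp. (\<integral>\<^sup>+g. indicator Fdom z * (\<phi> (mact (g ** rep C) z) * h (mact (g ** rep C) z)) \<partial>count_space K)
     = c * (indicator Fdom z * h (mact (rep C) z))" using AE_hyp_upper
   proof eventually_elim
    case (elim z)
    have "(\<integral>\<^sup>+g. indicator Fdom z * (\<phi> (mact (g ** rep C) z) * h (mact (g ** rep C) z)) \<partial>count_space K) =
     (\<integral>\<^sup>+g. \<phi> (mact g (mact (rep C) z)) * (indicator Fdom z * h (mact (rep C) z)) \<partial>count_space K)"
    proof (rule nn_integral_cong)
     fix g assume "g \<in> space (count_space K)"
     hence g: "g \<in> K" by simp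
     have "mact (g ** rep C) z = mact g (mact (rep C) z)" using elim det by (intro mact_mult) auto
     moreover have "h (mact g (mact (rep C) z)) = h (mact (rep C) z)" using inv[OF g] mact_upper[OF _ det] elim by blast
     ultimately show "indicator Fdom z * (\<phi> (mact (g ** rep C) z) * h (mact (g ** rep C) z)) =
      \<phi> (mact g (mact (rep C) z)) * (indicator Fdom z * h (mact (rep C) z))" by (simp only: mult_ac)
    qed
    also have "... = psum K \<phi> (mact (rep C) z) * (indicator Fdom z * h (mact (rep C) z))"
     unfolding psum_def by (rule nn_integral_multc) simp
    finally show ?case using elim by simp
   qed
  qed
  also have "... = c * (\<integral>\<^sup>+z. indicator Fdom z * h (mact (rep C) z) \<partial>hyp)"
   by (rule nn_integral_cmult) measurable
  finally show "(\<integral>\<^sup>+g. (\<integral>\<^sup>+z. indicator Fdom z * (\<phi> (mact (g ** rep C) z) * h (mact (g ** rep C) z)) \<partial>hyp) \<partial>count_space K) =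
   c * (\<integral>\<^sup>+z. indicator Fdom z * h (mact (rep C) z) \<partial>hyp)" .
 qed
 also have "... = c * Jint K h" unfolding Jint_def by (rule nn_integral_cmult) simp
 finally show ?thesis .
qed

text \<open>The weight adds up half the indicator of \<open>Fdom\<close> over the translates
  belonging to the cosets of K. Summing over K as well completes this to a sum over all of
  \<open>SL2Z\<close>, which the tessellation evaluates: half of 2.\<close>

lemma exists_weight:
 assumes K: "sl2_subgroup K"
 obtains \<phi> :: "complex \<Rightarrow> ennreal" where "\<phi> \<in> borel_measurable borel" "AE z in hyp. psum K \<phi> z = 1"
proof -
 have KS: "K \<subseteq> SL2Z" using K by (auto simp: sl2_subgroup_def)
 let ?Q = "SL2Z // coset_rel SL2Z K"
 define v where "v z = (1/2 :: ennreal) * indicator Fdom z" for z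
 have v [measurable]: "v \<in> borel_measurable borel" unfolding v_def by measurable
 define \<phi> where "\<phi> z = (\<integral>\<^sup>+C. v (mact (adj2 (rep C)) z) \<partial>count_space ?Q)" for z
 have "\<phi> \<in> borel_measurable borel"
  unfolding \<phi>_def by (rule nn_integral_count_space_borel[OF countable_quotient]) measurable
 moreover have "AE z in hyp. psum K \<phi> z = 1" using hyp_tessellation AE_hyp_upper
 proof eventually_elim
  case (elim z)
  have "psum K \<phi> z = (\<integral>\<^sup>+g. (\<integral>\<^sup>+C. v (mact (adj2 (rep C)) (mact g z)) \<partial>count_space ?Q) \<partial>count_space K)"
   by (simp add: psum_def \<phi>_def)
  also have "... = (\<integral>\<^sup>+C. (\<integral>\<^sup>+g. v (mact (adj2 (rep C)) (mact g z)) \<partial>count_space K) \<partial>count_space ?Q)"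
   by (rule nn_integral_count_space_nn_integral[OF countable_quotient]) simp
  also have "... = (\<integral>\<^sup>+C. (\<integral>\<^sup>+g. v (mact (adj2 (rep C)) (mact (adj2 g) z)) \<partial>count_space K) \<partial>count_space ?Q)"
   by (intro nn_integral_cong nn_integral_adj2[OF K, symmetric])
  also have "... = (\<integral>\<^sup>+C. (\<integral>\<^sup>+g. v (mact (adj2 (g ** rep C)) z) \<partial>count_space K) \<partial>count_space ?Q)"
  proof (intro nn_integral_cong)
   fix C g assume "g \<in> space (count_space K)"
   hence "det (adj2 g) \<noteq> 0" using KS by (auto simp: SL2Z_def)
   moreover have "adj2 (g ** rep C) = adj2 (rep C) ** adj2 g" by (simp add: mat2_eq_iff algebra_simps)
   ultimately show "v (mact (adj2 (rep C)) (mact (adj2 g) z)) = v (mact (adj2 (g ** rep C)) z)"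
    using mact_mult[of z "adj2 g" "adj2 (rep C)"] elim by simp
  qed
  also have "... = (\<integral>\<^sup>+A. v (mact (adj2 A) z) \<partial>count_space SL2Z)"
   by (rule nn_integral_coset[OF sl2_subgroup_SL2Z K KS, symmetric])
  also have "... = (\<integral>\<^sup>+A. v (mact A z) \<partial>count_space SL2Z)" by (rule nn_integral_adj2[OF sl2_subgroup_SL2Z])
  also have "... = 1/2 * (\<integral>\<^sup>+A. indicator Fdom (mact A z) \<partial>count_space SL2Z)"
   unfolding v_def by (rule nn_integral_cmult) simp
  also have "... = 1" using elim by (simp add: ennreal_divide_times)
  finally show ?case .
 qed
 ultimately show ?thesis using that by blast
qed

text \<open>The K-sum is the L-sum repeated once for each coset, so the constant is the index of L
  in K, possibly infinite at this stage.\<close>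

lemma psum_supergroup_const:
 assumes K: "sl2_subgroup K" and L: "sl2_subgroup L" "L \<subseteq> K" and one: "AE z in hyp. psum L \<phi> z = 1"
 obtains c where "AE z in hyp. psum K \<phi> z = c"
proof -
 let ?Q = "K // coset_rel K L"
 have "AE z in hyp. psum L \<phi> (mact (rep C) z) = 1" if "C \<in> ?Q" for C
  using AE_hyp_mact[OF _ one, of "rep C"] coset_facts(2)[OF K L that] sl2_subgroupD(1)[OF K] upper_SL2Z by blast
 hence "AE z in hyp. \<forall>C\<in>?Q. psum L \<phi> (mact (rep C) z) = 1"
  by (intro AE_ball_countable[THEN iffD2] countable_quotient) auto
 hence "AE z in hyp. psum K \<phi> z = (\<integral>\<^sup>+C. 1 \<partial>count_space ?Q)" using AE_hyp_upper
 proof eventually_elim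
  case (elim z)
  have "psum K \<phi> z = (\<integral>\<^sup>+C. (\<integral>\<^sup>+g. \<phi> (mact (g ** rep C) z) \<partial>count_space L) \<partial>count_space ?Q)"
   unfolding psum_def by (rule nn_integral_coset[OF K L])
  also have "... = (\<integral>\<^sup>+C. 1 \<partial>count_space ?Q)"
  proof (rule nn_integral_cong)
   fix C assume "C \<in> space (count_space ?Q)"
   hence C: "C \<in> ?Q" by simp
   have "det (rep C) \<noteq> 0" using coset_facts(2)[OF K L C] sl2_subgroupD(1)[OF K] by (auto simp: SL2Z_def)
   hence "(\<integral>\<^sup>+g. \<phi> (mact (g ** rep C) z) \<partial>count_space L) = psum L \<phi> (mact (rep C) z)"
    unfolding psum_def using mact_mult[of z "rep C"] elim by simp
   thus "(\<integral>\<^sup>+g. \<phi> (mact (g ** rep C) z) \<partial>count_space L) = 1" using elim C by simp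
  qed
  finally show ?case .
 qed
 thus ?thesis using that by blast
qed

text \<open>Two matrices of \<open>SL2Z\<close> that agree mod N differ by a left factor in
  \<open>GammaN N\<close>, so the entries mod N of the representative determine the coset.\<close>

lemma finite_GammaN_cosets:
 assumes "N > 0" shows "finite (SL2Z // coset_rel SL2Z (GammaN N))"
proof -
 let ?Q = "SL2Z // coset_rel SL2Z (GammaN N)"
 have GS: "GammaN N \<subseteq> SL2Z" by (auto simp: GammaN_def)
 note facts = coset_facts[OF sl2_subgroup_SL2Z sl2_subgroup_GammaN GS]
 define F where "F C = (rep C $ 1 $ 1 mod int N, rep C $ 1 $ 2 mod int N, rep C $ 2 $ 1 mod int N, rep C $ 2 $ 2 mod int N)" for C
 have "inj_on F ?Q"
 proof (rule inj_onI)
  fix C D assume C: "C \<in> ?Q" and D: "D \<in> ?Q" and eq: "F C = F D"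
  define A B where "A = rep C" "B = rep D"
  have AB: "A \<in> SL2Z" "B \<in> SL2Z" using facts(2) C D by (auto simp: A_B_def)
  have det: "B $ 1 $ 1 * B $ 2 $ 2 - B $ 1 $ 2 * B $ 2 $ 1 = 1" using AB by (simp add: SL2Z_def det_2)
  have "int N dvd A $ 1 $ 1 - B $ 1 $ 1" "int N dvd A $ 1 $ 2 - B $ 1 $ 2" "int N dvd A $ 2 $ 1 - B $ 2 $ 1" "int N dvd A $ 2 $ 2 - B $ 2 $ 2"
   using eq by (auto simp: F_def A_B_def mod_eq_dvd_iff)
  then obtain a b c d where e: "A $ 1 $ 1 = B $ 1 $ 1 + int N * a" "A $ 1 $ 2 = B $ 1 $ 2 + int N * b"
    "A $ 2 $ 1 = B $ 2 $ 1 + int N * c" "A $ 2 $ 2 = B $ 2 $ 2 + int N * d"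
   by (auto simp: dvd_def algebra_simps)
  have "A ** adj2 B \<in> SL2Z" by (intro SL2Z_mult SL2Z_adj2 AB)
  moreover have "(A ** adj2 B) $ 1 $ 1 - 1 = int N * (a * B $ 2 $ 2 - b * B $ 2 $ 1)"
   using det by (simp add: e algebra_simps)
  moreover have "(A ** adj2 B) $ 1 $ 2 = int N * (b * B $ 1 $ 1 - a * B $ 1 $ 2)" by (simp add: e algebra_simps)
  moreover have "(A ** adj2 B) $ 2 $ 1 = int N * (c * B $ 2 $ 2 - d * B $ 2 $ 1)" by (simp add: e algebra_simps)
  moreover have "(A ** adj2 B) $ 2 $ 2 - 1 = int N * (d * B $ 1 $ 1 - c * B $ 1 $ 2)"
   using det by (simp add: e algebra_simps)
  ultimately have g: "A ** adj2 B \<in> GammaN N" unfolding GammaN_def mem_Collect_eq by (metis dvd_triv_left)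
  have "A = (A ** adj2 B) ** B" using adj2_cancel(4)[OF AB(2)] by simp
  hence "A \<in> D" using facts(3)[OF D] g unfolding A_B_def by blast
  moreover have "A \<in> C" using facts(1)[OF C] by (simp add: A_B_def)
  ultimately show "C = D" using coset_eqI[OF sl2_subgroup_SL2Z sl2_subgroup_GammaN GS C D] by blast
 qed
 moreover have "F ` ?Q \<subseteq> {0..<int N} \<times> {0..<int N} \<times> {0..<int N} \<times> {0..<int N}"
  using assms by (auto simp: F_def)
 hence "finite (F ` ?Q)" by (rule finite_subset) simp
 ultimately show ?thesis using finite_imageD by blast
qed

text \<open>The volume of the quotient; being positive and finite, it may be cancelled in
  \<open>Jint_invariant\<close>.\<close>

lemma Jint_one:
 assumes "N > 0" shows "Jint (GammaN N) (\<lambda>_. 1) \<noteq> 0" "Jint (GammaN N) (\<lambda>_. 1) \<noteq> \<infinity>"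
proof -
 let ?Q = "SL2Z // coset_rel SL2Z (GammaN N)"
 have fin: "finite ?Q" using finite_GammaN_cosets[OF assms] .
 have "coset_rel SL2Z (GammaN N) `` {mat 1} \<in> ?Q" by (rule quotientI[OF SL2Z_1])
 hence ne: "card ?Q \<noteq> 0" using fin by auto
 have "Jint (GammaN N) (\<lambda>_. 1) = of_nat (card ?Q) * emeasure hyp Fdom"
  unfolding Jint_def nn_integral_count_space_finite[OF fin] by simp
 thus "Jint (GammaN N) (\<lambda>_. 1) \<noteq> 0" "Jint (GammaN N) (\<lambda>_. 1) \<noteq> \<infinity>"
  using ne hyp_Fdom_finite hyp_Fdom_pos by (auto simp: ennreal_mult_eq_top_iff)
qed

text \<open>For g = 1 + N det(X) g0 the conjugate X g X^(-1) equals 1 + N X g0 adj(X), because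
  adj(X) is det(X) times the inverse. Hence it is integral and congruent to 1 mod N.\<close>

lemma GammaN_conj:
 assumes X: "0 < det X" and g: "g \<in> GammaN N1" and N1: "int N1 = int N * det X"
 obtains P where "P \<in> GammaN N" "P ** X = X ** g"
proof -
 obtain a b c d where e: "g $ 1 $ 1 = 1 + int N * det X * a" "g $ 1 $ 2 = int N * det X * b" "g $ 2 $ 1 = int N * det X * c" "g $ 2 $ 2 = 1 + int N * det X * d"
  using g by (auto simp: GammaN_def dvd_def N1 algebra_simps)
 define P where "P = mat 1 + (\<chi> i j. int N * (X ** mat2 a b c d ** adj2 X) $ i $ j)"
 have PX: "P ** X = X ** g" unfolding P_def by (simp add: mat2_eq_iff e det_2 algebra_simps)
 have "det P * det X = det X * det g" using PX by (metis det_mul)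
 moreover have "det g = 1" using g by (simp add: GammaN_def SL2Z_def)
 ultimately have "P \<in> SL2Z" using X by (simp add: SL2Z_def)
 hence "P \<in> GammaN N" by (simp add: GammaN_def P_def)
 thus thesis using PX by (rule that)
qed

text \<open>K1 = \<open>GammaN (N * det X)\<close> and its conjugate L by X both lie in K. A weight
  for K1, moved by X, is a weight for L, and the two have constant K-sums c1 and c2. Unfolding with
  both weights gives c1 J(h after X) = c2 J(h), and h = 1 shows c1 = c2.\<close>

theorem Jint_invariant:
 assumes N: "N > 0" and X: "0 < det X" and h [measurable]: "h \<in> borel_measurable borel"
  and inv: "\<And>g z. g \<in> GammaN N \<Longrightarrow> 0 < Im z \<Longrightarrow> h (mact g z) = h z"
  and invX: "\<And>g z. g \<in> GammaN N \<Longrightarrow> 0 < Im z \<Longrightarrow> h (mact X (mact g z)) = h (mact X z)"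
 shows "Jint (GammaN N) (\<lambda>z. h (mact X z)) = Jint (GammaN N) h"
proof -
 define D where "D = det X"
 define N1 where "N1 = N * nat D"
 have N1: "N1 > 0" "int N1 = int N * D" using N X by (auto simp: N1_def D_def)
 define K where "K = GammaN N"
 define K1 where "K1 = GammaN N1"
 have K: "sl2_subgroup K" "sl2_subgroup K1" by (simp_all add: K_def K1_def sl2_subgroup_GammaN)
 have K1K: "K1 \<subseteq> K" unfolding K_def K1_def GammaN_def N1(2) by (auto dest: dvd_mult_left)
 \<comment> \<open>This is X K1 X^(-1), written without inverses; \<open>GammaN_conj\<close> puts it
   into K.\<close>
 define L where "L = {g \<in> SL2Z. \<exists>g1\<in>K1. g ** X = X ** g1}"
 have Xc: "A = B" if "A ** X = B ** X" for A B :: "int ^ 2 ^ 2"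
 proof -
  have "A ** X ** adj2 X = B ** X ** adj2 X" using that by simp
  hence "A ** mat D = B ** mat D" by (simp only: matrix_mul_assoc[symmetric] adj2_mult D_def)
  thus ?thesis using X by (simp add: mat2_eq_iff D_def)
 qed
 have Xc': "A = B" if "X ** A = X ** B" for A B :: "int ^ 2 ^ 2"
 proof -
  have "adj2 X ** (X ** A) = adj2 X ** (X ** B)" using that by simp
  hence "mat D ** A = mat D ** B" by (simp only: matrix_mul_assoc adj2_mult D_def)
  thus ?thesis using X by (simp add: mat2_eq_iff D_def)
 qed
 have LK: "L \<subseteq> K"
 proof
  fix g assume "g \<in> L"
  then obtain g1 where g: "g \<in> SL2Z" "g1 \<in> K1" "g ** X = X ** g1" by (auto simp: L_def)
  then obtain P where P: "P \<in> K" "P ** X = X ** g1" using GammaN_conj[OF X, of g1 N1 N] N1(2) by (auto simp: K_def K1_def D_def)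
  hence "g = P" using g(3) Xc by simp
  thus "g \<in> K" using P(1) by simp
 qed
 have Ls: "sl2_subgroup L" unfolding sl2_subgroup_def
 proof (intro conjI ballI)
  show "L \<subseteq> SL2Z" by (auto simp: L_def)
  show "mat 1 \<in> L" using SL2Z_1 sl2_subgroupD(2)[OF K(2)] by (auto simp: L_def intro!: bexI[of _ "mat 1"])
  fix A assume A: "A \<in> L"
  then obtain a where a: "A \<in> SL2Z" "a \<in> K1" "A ** X = X ** a" by (auto simp: L_def)
  have aS: "a \<in> SL2Z" using a K(2) sl2_subgroupD(1) by blast
  have "adj2 A ** X = X ** adj2 a"
  proof -
   have "X ** adj2 a = adj2 A ** (A ** X) ** adj2 a" using adj2_cancel(1)[OF a(1), of X] by simp
   also have "... = adj2 A ** X" unfolding a(3) by (simp only: matrix_mul_assoc adj2_cancel[OF aS])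
   finally show "adj2 A ** X = X ** adj2 a" by simp
  qed
  thus "adj2 A \<in> L" using SL2Z_adj2[OF a(1)] sl2_subgroupD(4)[OF K(2) a(2)] by (auto simp: L_def)
  fix B assume "B \<in> L"
  then obtain b where b: "B \<in> SL2Z" "b \<in> K1" "B ** X = X ** b" by (auto simp: L_def)
  have "A ** B ** X = X ** (a ** b)" using a(3) b(3) by (metis matrix_mul_assoc)
  thus "A ** B \<in> L" using SL2Z_mult[OF a(1) b(1)] sl2_subgroupD(3)[OF K(2) a(2) b(2)] by (auto simp: L_def)
 qed
 obtain \<phi> :: "complex \<Rightarrow> ennreal" where \<phi> [measurable]: "\<phi> \<in> borel_measurable borel" and \<phi>1: "AE z in hyp. psum K1 \<phi> z = 1"
  using exists_weight[OF K(2)] by blast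
 obtain c1 where c1: "AE z in hyp. psum K \<phi> z = c1"
  using psum_supergroup_const[OF K(1,2) K1K \<phi>1] by blast
 define \<phi>' where "\<phi>' z = \<phi> (mact (adj2 X) z)" for z
 have \<phi>' [measurable]: "\<phi>' \<in> borel_measurable borel" unfolding \<phi>'_def by measurable
 have "AE z in hyp. psum L \<phi>' z = 1"
  using AE_hyp_mact[OF _ \<phi>1, of "adj2 X", unfolded det_adj2, OF X] AE_hyp_upper
 proof eventually_elim
  case (elim z)
  define \<theta> where "\<theta> g = (THE g1. g1 \<in> K1 \<and> g ** X = X ** g1)" for g
  have \<theta>: "\<theta> g \<in> K1 \<and> g ** X = X ** \<theta> g" if "g \<in> L" for g
  proof -
   have "\<exists>!g1. g1 \<in> K1 \<and> g ** X = X ** g1" using that Xc' by (auto simp: L_def)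
   thus ?thesis unfolding \<theta>_def by (rule theI')
  qed
  have bij: "bij_betw \<theta> L K1" unfolding bij_betw_def
  proof
   show "inj_on \<theta> L"
   proof (rule inj_onI)
    fix g h assume "g \<in> L" "h \<in> L" "\<theta> g = \<theta> h"
    hence "g ** X = h ** X" using \<theta> by metis
    thus "g = h" by (rule Xc)
   qed
   show "\<theta> ` L = K1"
   proof (intro equalityI subsetI)
    fix g1 assume g1: "g1 \<in> K1"
    obtain P where P: "P \<in> K" "P ** X = X ** g1" using GammaN_conj[OF X, of g1 N1 N] N1(2) g1 by (auto simp: K_def K1_def D_def)
    note PX = P(2)
    have "P \<in> L" using P g1 sl2_subgroupD(1)[OF K(1)] by (auto simp: L_def)
    moreover have "\<theta> P = g1" using \<theta>[OF \<open>P \<in> L\<close>] PX Xc' by metis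
    ultimately show "g1 \<in> \<theta> ` L" by blast
   qed (use \<theta> in auto)
  qed
  have "psum L \<phi>' z = (\<integral>\<^sup>+g. \<phi> (mact (\<theta> g) (mact (adj2 X) z)) \<partial>count_space L)" unfolding psum_def \<phi>'_def
  proof (rule nn_integral_cong)
   fix g assume "g \<in> space (count_space L)"
   hence g: "g \<in> L" by simp
   have "adj2 X ** g = \<theta> g ** adj2 X"
   proof (rule Xc)
    have "adj2 X ** g ** X = mat D ** \<theta> g" using \<theta>[OF g] by (metis D_def adj2_mult(1) matrix_mul_assoc)
    also have "... = \<theta> g ** mat D" by (simp add: mat2_eq_iff algebra_simps)
    also have "... = \<theta> g ** adj2 X ** X" by (simp only: matrix_mul_assoc[symmetric] adj2_mult D_def)
    finally show "adj2 X ** g ** X = \<theta> g ** adj2 X ** X" .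
   qed
   hence "mact (adj2 X) (mact g z) = mact (\<theta> g) (mact (adj2 X) z)"
    using mact_mult[of z g "adj2 X"] mact_mult[of z "adj2 X" "\<theta> g"] elim g X by (auto simp: L_def SL2Z_def)
   thus "\<phi> (mact (adj2 X) (mact g z)) = \<phi> (mact (\<theta> g) (mact (adj2 X) z))" by simp
  qed
  also have "... = psum K1 \<phi> (mact (adj2 X) z)" unfolding psum_def by (rule nn_integral_bij_count_space[OF bij])
  finally show ?case using elim by simp
 qed
 then obtain c2 where c2: "AE z in hyp. psum K \<phi>' z = c2"
  using psum_supergroup_const[OF K(1) Ls LK] by blast
 have main: "c1 * Jint K (\<lambda>z. u (mact X z)) = c2 * Jint K u"
  if u [measurable]: "u \<in> borel_measurable borel" and iu: "\<And>g z. g \<in> K \<Longrightarrow> 0 < Im z \<Longrightarrow> u (mact g z) = u z"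
  and iuX: "\<And>g z. g \<in> K \<Longrightarrow> 0 < Im z \<Longrightarrow> u (mact X (mact g z)) = u (mact X z)" for u
 proof -
  have "c1 * Jint K (\<lambda>z. u (mact X z)) = 2 * (\<integral>\<^sup>+z. \<phi> z * u (mact X z) \<partial>hyp)"
   by (rule unfolding_const[OF K(1) _ _ _ c1, symmetric]) (use iuX in auto)
  also have "(\<integral>\<^sup>+z. \<phi> z * u (mact X z) \<partial>hyp) = (\<integral>\<^sup>+z. \<phi> (mact (adj2 X) z) * u (mact X (mact (adj2 X) z)) \<partial>hyp)"
   by (rule nn_integral_hyp_mact[symmetric]) (use X in auto)
  also have "... = (\<integral>\<^sup>+z. \<phi>' z * u z \<partial>hyp)"
   by (rule nn_integral_cong_AE, use AE_hyp_upper in eventually_elim) (simp add: mact_adj2 X \<phi>'_def)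
  also have "2 * \<dots> = c2 * Jint K u" by (rule unfolding_const[OF K(1) _ _ _ c2]) (use iu in auto)
  finally show ?thesis .
 qed
 have "c1 * Jint K (\<lambda>_. 1) = c2 * Jint K (\<lambda>_. 1)" using main[of "\<lambda>_. 1"] by simp
 hence "Jint K (\<lambda>_. 1) * c1 = Jint K (\<lambda>_. 1) * c2" by (simp only: mult.commute)
 hence c12: "c1 = c2" using Jint_one[OF N] unfolding K_def ennreal_mult_cancel_left by auto
 \<comment> \<open>Comparing the volumes of the quotients by K and K1 shows that c1 is neither 0 nor
   infinite and may be cancelled.\<close>
 have "c1 * Jint K (\<lambda>_. 1) = 2 * (\<integral>\<^sup>+z. \<phi> z * 1 \<partial>hyp)"
  by (rule unfolding_const[OF K(1) _ _ _ c1, symmetric]) auto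
 also have "... = 1 * Jint K1 (\<lambda>_. 1)" by (rule unfolding_const[OF K(2) _ _ _ \<phi>1]) auto
 finally have "c1 * Jint K (\<lambda>_. 1) = Jint K1 (\<lambda>_. 1)" by simp
 hence "c1 \<noteq> 0" "c1 \<noteq> \<infinity>" using Jint_one[OF N] Jint_one[OF N1(1)]
  by (auto simp: K_def K1_def ennreal_mult_eq_top_iff)
 thus ?thesis using main[OF h inv invX] c12 unfolding K_def by (simp add: ennreal_mult_cancel_left)
qed

section \<open>Integrals of complex functions over the quotient by \<open>GammaN N\<close>\<close>

abbreviation GN_cosets :: "nat \<Rightarrow> (int ^ 2 ^ 2) set set" where
 "GN_cosets N \<equiv> SL2Z // coset_rel SL2Z (GammaN N)"

abbreviation FI :: "(int ^ 2 ^ 2) set \<Rightarrow> (complex \<Rightarrow> 'a::{banach, second_countable_topology}) \<Rightarrow> 'a" where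
 "FI C h \<equiv> LINT z|hyp. indicator Fdom z *\<^sub>R h (mact (rep C) z)"

definition Iint :: "nat \<Rightarrow> (complex \<Rightarrow> complex) \<Rightarrow> complex" where
 "Iint N h = (\<Sum>C\<in>GN_cosets N. FI C h)"

text \<open>Boundedness is what cusp forms provide, and it gives integrability because
  \<open>Fdom\<close> has finite measure.\<close>

definition hgood :: "nat \<Rightarrow> (complex \<Rightarrow> 'a::real_normed_vector) \<Rightarrow> bool" where
 "hgood N h \<longleftrightarrow> h \<in> borel_measurable borel \<and> (\<exists>B. \<forall>z. 0 < Im z \<longrightarrow> norm (h z) \<le> B) \<and>
   (\<forall>g\<in>GammaN N. \<forall>z. 0 < Im z \<longrightarrow> h (mact g z) = h z)"

lemma GammaN_sub: "GammaN N \<subseteq> SL2Z" by (auto simp: GammaN_def)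

lemmas GN_coset_facts = coset_facts[OF sl2_subgroup_SL2Z sl2_subgroup_GammaN GammaN_sub]

lemma hyp_integrable_bounded:
 fixes h :: "complex \<Rightarrow> 'a::{banach, second_countable_topology}"
 assumes [measurable]: "h \<in> borel_measurable borel" and B: "\<And>z. 0 < Im z \<Longrightarrow> norm (h z) \<le> B" and A: "0 < det A"
 shows "integrable hyp (\<lambda>z. indicator Fdom z *\<^sub>R h (mact A z))"
proof (rule integrableI_bounded_set[where A = Fdom and B = B])
 show "AE x\<in>Fdom in hyp. norm (indicator Fdom x *\<^sub>R h (mact A x)) \<le> B"
 proof (rule AE_I2, intro impI)
  fix x assume "x \<in> Fdom"
  hence "0 < Im x" by (simp add: std_fundamental_domain_def)
  thus "norm (indicator Fdom x *\<^sub>R h (mact A x)) \<le> B" using B[OF mact_upper[OF _ A]] \<open>x \<in> Fdom\<close> by simp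
 qed
qed (use hyp_Fdom_finite in \<open>auto simp: less_top\<close>)

lemma hgood_integrable:
 fixes h :: "complex \<Rightarrow> 'a::{banach, second_countable_topology}"
 assumes "hgood N h" "A \<in> SL2Z" shows "integrable hyp (\<lambda>z. indicator Fdom z *\<^sub>R h (mact A z))"
proof -
 obtain B where "\<And>z. 0 < Im z \<Longrightarrow> norm (h z) \<le> B" using assms(1) by (auto simp: hgood_def)
 thus ?thesis using assms hyp_integrable_bounded[of h B A] by (auto simp: hgood_def upper_SL2Z)
qed

lemma Jint_eq_integral:
 fixes u :: "complex \<Rightarrow> real"
 assumes "hgood N u" "\<And>z. u z \<ge> 0" "N > 0"
 shows "Jint (GammaN N) (\<lambda>z. ennreal (u z)) = ennreal (\<Sum>C\<in>GN_cosets N. FI C u)"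
proof -
 have fin: "finite (GN_cosets N)" by (rule finite_GammaN_cosets[OF assms(3)])
 have "Jint (GammaN N) (\<lambda>z. ennreal (u z)) = (\<Sum>C\<in>GN_cosets N. \<integral>\<^sup>+z. indicator Fdom z * ennreal (u (mact (rep C) z)) \<partial>hyp)"
  unfolding Jint_def by (rule nn_integral_count_space_finite[OF fin])
 also have "... = (\<Sum>C\<in>GN_cosets N. ennreal (FI C u))"
 proof (rule sum.cong[OF refl])
  fix C assume "C \<in> GN_cosets N"
  hence C: "rep C \<in> SL2Z" by (rule GN_coset_facts)
  have "(\<integral>\<^sup>+z. indicator Fdom z * ennreal (u (mact (rep C) z)) \<partial>hyp) = (\<integral>\<^sup>+z. ennreal (indicator Fdom z *\<^sub>R u (mact (rep C) z)) \<partial>hyp)"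
   by (rule nn_integral_cong) (auto simp: indicator_def)
  also have "... = ennreal (FI C u)"
   by (rule nn_integral_eq_integral[OF hgood_integrable[OF assms(1) C]]) (use assms(2) in auto)
  finally show "(\<integral>\<^sup>+z. indicator Fdom z * ennreal (u (mact (rep C) z)) \<partial>hyp) = ennreal (FI C u)" .
 qed
 also have "... = ennreal (\<Sum>C\<in>GN_cosets N. FI C u)"
  by (rule sum_ennreal) (intro Bochner_Integration.integral_nonneg, use assms(2) in auto)
 finally show ?thesis .
qed

lemma real_integral_invariant:
 fixes u :: "complex \<Rightarrow> real"
 assumes u: "hgood N u" "\<And>z. u z \<ge> 0" and uX: "hgood N (\<lambda>z. u (mact X z))" and "N > 0" and X: "0 < det X"
 shows "(\<Sum>C\<in>GN_cosets N. FI C (\<lambda>z. u (mact X z))) =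
   (\<Sum>C\<in>GN_cosets N. FI C u)"
proof -
 have [measurable]: "u \<in> borel_measurable borel" using u by (simp add: hgood_def)
 have "Jint (GammaN N) (\<lambda>z. ennreal (u (mact X z))) = Jint (GammaN N) (\<lambda>z. ennreal (u z))"
  by (rule Jint_invariant[OF assms(4) X]) (use u uX in \<open>auto simp: hgood_def\<close>)
 hence eq: "ennreal (\<Sum>C\<in>GN_cosets N. FI C (\<lambda>z. u (mact X z))) =
   ennreal (\<Sum>C\<in>GN_cosets N. FI C u)"
  using Jint_eq_integral[OF uX _ assms(4)] Jint_eq_integral[OF u assms(4)] u(2) by simp
 have nn: "0 \<le> (\<Sum>C\<in>GN_cosets N. FI C v)" if "\<And>z. v z \<ge> 0" for v :: "complex \<Rightarrow> real"
  by (intro sum_nonneg Bochner_Integration.integral_nonneg) (use that in auto)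
 from nn[of u] nn[of "\<lambda>z. u (mact X z)"]
 have "0 \<le> (\<Sum>C\<in>GN_cosets N. FI C u)"
  "0 \<le> (\<Sum>C\<in>GN_cosets N. FI C (\<lambda>z. u (mact X z)))" using u(2) by blast+
 thus ?thesis using eq ennreal_inj by blast
qed

lemma hgood_comp:
 assumes "hgood N h" "\<And>x y. norm (F x) \<le> norm x" "F \<in> borel_measurable borel"
 shows "hgood N (\<lambda>z. F (h z))"
proof -
 obtain B where "\<forall>z. 0 < Im z \<longrightarrow> norm (h z) \<le> B" using assms(1) by (auto simp: hgood_def)
 hence "\<forall>z. 0 < Im z \<longrightarrow> norm (F (h z)) \<le> B" using assms(2) order_trans by blast
 moreover have "(\<lambda>z. F (h z)) \<in> borel_measurable borel"
  using assms(1) by (intro measurable_compose[OF _ assms(3)]) (simp add: hgood_def)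
 ultimately show ?thesis using assms(1) unfolding hgood_def by auto
qed

text \<open>Positive and negative parts of real and imaginary part reduce this to the nonnegative
  case; each part is bounded by the norm and inherits the invariance, so it is again
  \<open>hgood\<close>.\<close>

theorem Iint_invariant:
 assumes h: "hgood N h" and hX: "hgood N (\<lambda>z. h (mact X z))" and N: "N > 0" and X: "0 < det X"
 shows "Iint N (\<lambda>z. h (mact X z)) = Iint N h"
proof -
 define u where "u i z = (if i = (0::nat) then max 0 (Re z) else if i = 1 then max 0 (- Re z) else if i = 2 then max 0 (Im z) else max 0 (- Im z))" for i z
 have un: "norm (u i z) \<le> norm z" for i z
  using abs_Re_le_cmod[of z] abs_Im_le_cmod[of z] by (auto simp: u_def max_def)
 have ub: "u i \<in> borel_measurable borel" for i unfolding u_def by (cases "i = 0"; cases "i = 1"; cases "i = 2") simp_all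
 have u0: "u i z \<ge> 0" for i z by (simp add: u_def)
 define S where "S i v = (\<Sum>C\<in>GN_cosets N. FI C (\<lambda>z. u i (v z)))" for i v
 have dec: "Iint N v = of_real (S 0 v) - of_real (S 1 v) + \<i> * (of_real (S 2 v) - of_real (S 3 v))" if v: "hgood N v" for v
 proof -
  have g: "hgood N (\<lambda>z. u i (v z))" for i by (rule hgood_comp[OF v un ub])
  have zdec: "z = of_real (u 0 z) - of_real (u 1 z) + \<i> * (of_real (u 2 z) - of_real (u 3 z))" for z
   by (auto simp: u_def complex_eq_iff max_def)
  have "(FI C v) =
    of_real (FI C (\<lambda>z. u 0 (v z))) - of_real (FI C (\<lambda>z. u 1 (v z)))
    + \<i> * (of_real (FI C (\<lambda>z. u 2 (v z))) - of_real (FI C (\<lambda>z. u 3 (v z))))"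
   if C: "C \<in> GN_cosets N" for C
  proof -
   define w where "w i z = indicator Fdom z *\<^sub>R u i (v (mact (rep C) z))" for i z
   have "integrable hyp (w i)" for i
    unfolding w_def by (rule hgood_integrable[OF g GN_coset_facts(2)[OF C]])
   hence intc: "integrable hyp (\<lambda>z. complex_of_real (w i z))" for i by (rule integrable_of_real)
   have "indicator Fdom z *\<^sub>R v (mact (rep C) z) = of_real (w 0 z) - of_real (w 1 z) + \<i> * (of_real (w 2 z) - of_real (w 3 z))" for z
    unfolding w_def using zdec[of "v (mact (rep C) z)"] by (cases "z \<in> Fdom") simp_all
   hence "(FI C v) =
     (LINT z|hyp. (of_real (w 0 z) - of_real (w 1 z)) + \<i> * (of_real (w 2 z) - of_real (w 3 z)))" by simp
   also have "... = of_real (LINT z|hyp. w 0 z) - of_real (LINT z|hyp. w 1 z)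
     + \<i> * (of_real (LINT z|hyp. w 2 z) - of_real (LINT z|hyp. w 3 z))"
    using intc by (simp add: integral_of_real)
   finally show ?thesis unfolding w_def .
  qed
  hence "Iint N v = (\<Sum>C\<in>GN_cosets N. of_real (FI C (\<lambda>z. u 0 (v z))) - of_real (FI C (\<lambda>z. u 1 (v z)))
    + \<i> * (of_real (FI C (\<lambda>z. u 2 (v z))) - of_real (FI C (\<lambda>z. u 3 (v z)))))"
   unfolding Iint_def by (intro sum.cong) auto
  thus ?thesis unfolding S_def by (simp only: sum.distrib sum_subtractf sum_distrib_left[symmetric] of_real_sum)
 qed
 have "S i (\<lambda>z. h (mact X z)) = S i h" for i unfolding S_def
  by (rule real_integral_invariant[OF hgood_comp[OF h un ub] u0 hgood_comp[OF hX un ub] N X])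
 thus ?thesis using dec[OF h] dec[OF hX] by simp
qed

lemma Iint_add: "hgood N h \<Longrightarrow> hgood N g \<Longrightarrow> Iint N (\<lambda>z. h z + g z) = Iint N h + Iint N g"
 unfolding Iint_def sum.distrib[symmetric] scaleR_add_right
 by (intro sum.cong refl Bochner_Integration.integral_add hgood_integrable GN_coset_facts(2))

lemma Iint_cmult: "Iint N (\<lambda>z. c * h z) = c * Iint N h"
 unfolding Iint_def sum_distrib_left by (intro sum.cong refl) (simp flip: integral_mult_right_zero)

lemma Iint_cnj: "Iint N (\<lambda>z. cnj (h z)) = cnj (Iint N h)"
proof -
 have "indicator Fdom z *\<^sub>R cnj (h (mact (rep C) z)) = cnj (indicator Fdom z *\<^sub>R h (mact (rep C) z))" for C z
  by simp
 thus ?thesis unfolding Iint_def cnj_sum by (simp only: Bochner_Integration.integral_cnj)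
qed

lemma Iint_cong:
 assumes "\<And>z. 0 < Im z \<Longrightarrow> h z = g z" shows "Iint N h = Iint N g" unfolding Iint_def
proof (intro sum.cong refl Bochner_Integration.integral_cong)
 fix C z assume "C \<in> GN_cosets N"
 hence "rep C \<in> SL2Z" by (rule GN_coset_facts)
 thus "indicat_real Fdom z *\<^sub>R h (mact (rep C) z) = indicat_real Fdom z *\<^sub>R g (mact (rep C) z)"
  using assms mact_upper_SL2Z[of z "rep C"] by (auto simp: indicator_def std_fundamental_domain_def)
qed


section \<open>The Petersson product\<close>

definition Phi :: "nat \<Rightarrow> (complex \<Rightarrow> complex) \<Rightarrow> (complex \<Rightarrow> complex) \<Rightarrow> complex \<Rightarrow> complex" where
 "Phi k f g z = f z * cnj (g z) * of_real (Im z powr (real k + 1/2))"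

definition ip :: "nat \<Rightarrow> nat \<Rightarrow> (complex \<Rightarrow> complex) \<Rightarrow> (complex \<Rightarrow> complex) \<Rightarrow> complex" where
 "ip k N f g = Iint N (Phi k f g)"

text \<open>A common home for everything the operators produce: rescaled and translated forms lose
  their level, but they stay fixed by \<open>GammaN N\<close> for suitable N, and normality makes
  the space stable under \<open>js\<close> (\<open>Vsp_js\<close>).\<close>

definition Vsp :: "nat \<Rightarrow> nat \<Rightarrow> (complex \<Rightarrow> complex) set" where
 "Vsp k N = {f \<in> cusp_space k. \<forall>A\<in>GammaN N. js k A f = f}"

lemma GammaN_Gamma0: "4 dvd N \<Longrightarrow> A \<in> GammaN N \<Longrightarrow> A \<in> Gamma0 4"
proof -
 assume "4 dvd N" and A: "A \<in> GammaN N"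
 hence "int 4 dvd int N" by (simp only: int_dvd_int_iff)
 thus "A \<in> Gamma0 4" using A dvd_trans[of "int 4" "int N"] by (auto simp: GammaN_def Gamma0_def)
qed

lemma powr_half_odd: "x > 0 \<Longrightarrow> x powr (real k + 1/2) = sqrt x ^ (2 * k + 1)"
proof -
 assume x: "x > 0"
 have "x powr (real k + 1/2) = (x powr (1/2)) powr (real (2 * k + 1))" using x by (simp add: powr_powr field_simps)
 also have "x powr (1/2) = sqrt x" using x by (simp add: powr_half_sqrt)
 also have "sqrt x powr (real (2 * k + 1)) = sqrt x ^ (2 * k + 1)" using x by (intro powr_realpow) auto
 finally show ?thesis .
qed

lemma Im_mact_powr:
 assumes "0 < det X" "0 < Im z" shows "Im (mact X z) powr (real k + 1/2) =
  sqrt (of_int (det X)) ^ (2 * k + 1) * Im z powr (real k + 1/2) / (cmod (den X z)) ^ (2 * k + 1)"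
proof -
 have "Im (mact X z) powr (real k + 1/2) = sqrt (Im (mact X z)) ^ (2 * k + 1)"
  by (rule powr_half_odd) (use mact_upper assms in auto)
 also have "sqrt (Im (mact X z)) = sqrt (of_int (det X)) * sqrt (Im z) / cmod (den X z)"
  by (simp add: Im_mact real_sqrt_divide real_sqrt_mult)
 finally show ?thesis using powr_half_odd[OF assms(2)] by (simp add: power_mult_distrib power_divide)
qed

text \<open>The root of the denominator occurs together with its conjugate, so only |den| enters and
  the sign ambiguity of \<open>sl\<close> is invisible to the product.\<close>

lemma Phi_sl:
 assumes "0 < det X" "0 < Im z"
 shows "Phi k (sl k X f) (sl k X g) z = Phi k f g (mact X z) / of_real (sqrt (of_int (det X)) ^ (2 * k + 1))"
proof -
 define s where "s = csqrt (den X z)"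
 have ss: "s * cnj s = of_real (cmod (den X z))"
  unfolding s_def complex_norm_square[symmetric] by (metis norm_power power2_csqrt)
 have D: "sqrt (of_int (det X)) > 0" using assms by simp
 have "Phi k (sl k X f) (sl k X g) z = f (mact X z) * cnj (g (mact X z)) / (s * cnj s) ^ (2 * k + 1) * of_real (Im z powr (real k + 1/2))"
  by (simp add: Phi_def sl_def s_def power_mult_distrib)
 also have "... = f (mact X z) * cnj (g (mact X z)) * of_real (Im z powr (real k + 1/2) / cmod (den X z) ^ (2 * k + 1))"
  unfolding ss by simp
 also have "Im z powr (real k + 1/2) / cmod (den X z) ^ (2 * k + 1) = Im (mact X z) powr (real k + 1/2) / sqrt (of_int (det X)) ^ (2 * k + 1)"
  unfolding Im_mact_powr[OF assms] using D by simp
 finally show ?thesis by (simp add: Phi_def)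
qed

lemma Phi_cmult: "Phi k (\<lambda>z. c * f z) (\<lambda>z. d * g z) z = c * cnj d * Phi k f g z" by (simp add: Phi_def)

lemma Phi_js:
 assumes "A \<in> Gamma0 4" "0 < Im z" shows "Phi k (js k A f) (js k A g) z = Phi k f g (mact A z)"
proof -
 have det: "det A = 1" using assms by (simp add: Gamma0_def SL2Z_def)
 define e where "e = inverse ((inverse (theta_eps (A $ 2 $ 2)) * of_int (quad_symbol (A $ 2 $ 1) (A $ 2 $ 2))) ^ (2 * k + 1))"
 have "cmod e = 1" using quad_symbol_cases[of "A $ 2 $ 2" "A $ 2 $ 1"] Gamma0_4_odd[OF assms(1)]
  by (auto simp: e_def norm_inverse norm_power norm_mult theta_eps_def)
 hence "e * cnj e = 1" by (simp add: complex_norm_square[symmetric])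
 thus ?thesis
  unfolding js_eq_sl[OF assms(1)] e_def[symmetric] Phi_cmult using Phi_sl[of A z k f g] det assms by simp
qed

text \<open>The function is largest at y = a/c; the inequality ln x <= x - 1 at x = y / (a/c)
  expresses this without derivatives.\<close>

lemma powr_exp_bounded:
 assumes "a > 0" "c > (0::real)"
 obtains K where "\<And>y. y > 0 \<Longrightarrow> y powr a * exp (- c * y) \<le> K"
proof
 fix y :: real assume y: "y > 0"
 define s where "s = a / c"
 have s: "s > 0" using assms by (simp add: s_def)
 have "ln (y / s) \<le> y / s - 1" by (rule ln_le_minus_one) (use y s in simp)
 hence "ln y \<le> y / s - 1 + ln s" using y s by (simp add: ln_div)
 hence "a * ln y \<le> a * (y / s - 1 + ln s)" using assms by simp
 also have "a * (y / s - 1 + ln s) = c * y + a * (ln s - 1)" using assms by (simp add: s_def field_simps)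
 finally have "a * ln y - c * y \<le> a * (ln s - 1)" by simp
 hence "exp (a * ln y - c * y) \<le> exp (a * (ln s - 1))" by simp
 thus "y powr a * exp (- c * y) \<le> exp (a * (ln (a / c) - 1))"
  using y by (simp add: powr_def exp_diff exp_minus field_simps s_def)
qed

lemma Phi_q_cuspidal_bounded:
 assumes "q_cuspidal f"
 obtains B where "\<And>z. 1/2 \<le> Im z \<Longrightarrow> cmod (Phi k f f z) \<le> B"
proof -
 obtain B c where B: "B \<ge> 0" "c > 0" "\<And>z. 1/2 \<le> Im z \<Longrightarrow> norm (f z) \<le> B * exp (- c * Im z)"
  using q_cuspidal_decay[OF assms] by metis
 obtain K where K: "\<And>y. y > 0 \<Longrightarrow> y powr (real k + 1/2) * exp (- (2 * c) * y) \<le> K"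
  using powr_exp_bounded[of "real k + 1/2" "2 * c"] B by auto
 have "cmod (Phi k f f z) \<le> B\<^sup>2 * K" if z: "1/2 \<le> Im z" for z
 proof -
  have "cmod (Phi k f f z) = (cmod (f z))\<^sup>2 * (Im z powr (real k + 1/2))"
   by (simp add: Phi_def norm_mult power2_eq_square)
  also have "... \<le> (B * exp (- c * Im z))\<^sup>2 * (Im z powr (real k + 1/2))"
   using B(3)[OF z] by (intro mult_right_mono power_mono) auto
  also have "... = B\<^sup>2 * (Im z powr (real k + 1/2) * exp (- (2 * c) * Im z))"
   by (simp add: power_mult_distrib power2_eq_square mult_exp_exp)
  also have "... \<le> B\<^sup>2 * K" using K[of "Im z"] z by (intro mult_left_mono) auto
  finally show ?thesis .
 qed
 thus ?thesis using that by blast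
qed

lemma Fdom_Im_ge: "z \<in> Fdom \<Longrightarrow> 1/2 \<le> Im z"
proof -
 assume "z \<in> Fdom"
 hence z: "0 < Im z" "\<bar>Re z\<bar> \<le> 1/2" "1 \<le> cmod z" by (auto simp: std_fundamental_domain_def)
 have "cmod z \<le> \<bar>Re z\<bar> + \<bar>Im z\<bar>" by (rule cmod_le)
 thus ?thesis using z by linarith
qed

text \<open>Every z is equivalent under \<open>SL2Z\<close> to a point of \<open>Fdom\<close>, and f
  has only finitely many translates modulo \<open>GammaN N\<close>, each bounded at height at least
  1/2 by cuspidality.\<close>

lemma Vsp_bounded:
 assumes f: "f \<in> Vsp k N" and N: "N > 0" "4 dvd N"
 obtains B where "\<And>z. 0 < Im z \<Longrightarrow> cmod (Phi k f f z) \<le> B"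
proof -
 have fc: "f \<in> cusp_space k" using f by (simp add: Vsp_def)
 have "\<exists>B. \<forall>z. 1/2 \<le> Im z \<longrightarrow> cmod (Phi k (sl k (rep C) f) (sl k (rep C) f) z) \<le> B" if "C \<in> GN_cosets N" for C
 proof -
  have "rep C \<in> SL2Z" using GN_coset_facts(2)[OF that] .
  hence "q_cuspidal (sl k (rep C) f)" using cusp_space_q_cuspidal[OF fc] upper_SL2Z by blast
  thus ?thesis using Phi_q_cuspidal_bounded by metis
 qed
 then obtain B where B: "\<And>C z. C \<in> GN_cosets N \<Longrightarrow> 1/2 \<le> Im z \<Longrightarrow> cmod (Phi k (sl k (rep C) f) (sl k (rep C) f) z) \<le> B C"
  by metis
 have fin: "finite (GN_cosets N)" by (rule finite_GammaN_cosets[OF N(1)])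
 have "cmod (Phi k f f z) \<le> (\<Sum>C\<in>GN_cosets N. \<bar>B C\<bar>)" if z: "0 < Im z" for z
 proof -
  obtain A where A: "A \<in> SL2Z" "mact A z \<in> Fdom" using Fdom_reach[OF z] by blast
  define w where "w = mact A z"
  have w: "1/2 \<le> Im w" "0 < Im w" using Fdom_Im_ge[OF A(2)] by (auto simp: w_def)
  have zw: "z = mact (adj2 A) w" unfolding w_def using mact_adj2(1)[OF z] A by (simp add: SL2Z_def)
  obtain C g where C: "C \<in> GN_cosets N" "g \<in> GammaN N" "adj2 A = g ** rep C"
   using coset_bij[OF sl2_subgroup_SL2Z sl2_subgroup_GammaN GammaN_sub, of N] SL2Z_adj2[OF A(1)]
   unfolding bij_betw_def by (auto simp: image_iff set_eq_iff) metis
  have rC: "rep C \<in> SL2Z" "det (rep C) = 1" using GN_coset_facts(2)[OF C(1)] by (auto simp: SL2Z_def)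
  have v: "0 < Im (mact (rep C) w)" using mact_upper_SL2Z w rC by blast
  have "z = mact g (mact (rep C) w)" unfolding zw C(3) using mact_mult[of w "rep C" g] w rC by simp
  hence "Phi k f f z = Phi k (js k g f) (js k g f) (mact (rep C) w)"
   using Phi_js[OF GammaN_Gamma0[OF N(2) C(2)] v] by simp
  also have "js k g f = f" using f C(2) by (simp add: Vsp_def)
  also have "Phi k f f (mact (rep C) w) = Phi k (sl k (rep C) f) (sl k (rep C) f) w"
   using Phi_sl[of "rep C" w k f f] rC w by simp
  finally have "cmod (Phi k f f z) \<le> B C" using B[OF C(1) w(1)] by simp
  also have "B C \<le> \<bar>B C\<bar>" by simp
  also have "... \<le> (\<Sum>C\<in>GN_cosets N. \<bar>B C\<bar>)" using fin C(1) by (intro member_le_sum) auto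
  finally show ?thesis .
 qed
 thus ?thesis using that by blast
qed

lemma cusp_space_borel: "f \<in> cusp_space k \<Longrightarrow> f \<in> borel_measurable borel"
proof -
 assume f: "f \<in> cusp_space k"
 have "f \<in> borel_measurable (restrict_space borel upper_half_plane)"
  by (intro borel_measurable_continuous_on_restrict holomorphic_on_imp_continuous_on cusp_space_holomorphic[OF f])
 hence "(\<lambda>z. if z \<in> upper_half_plane then f z else 0) \<in> borel_measurable borel"
  by (subst (asm) measurable_restrict_space_iff) auto
 moreover have "(\<lambda>z. if z \<in> upper_half_plane then f z else 0) = f"
  using cusp_space_upper[OF f] by (auto simp: fun_eq_iff)
 ultimately show ?thesis by simp
qed

lemma Im_cnj_borel [measurable]: "Im \<in> borel_measurable borel" "cnj \<in> borel_measurable borel"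
 by (intro borel_measurable_continuous_onI continuous_intros)+

lemma hgood_Phi:
 assumes f: "f \<in> Vsp k N" and g: "g \<in> Vsp k N" and N: "N > 0" "4 dvd N" shows "hgood N (Phi k f g)"
 unfolding hgood_def
proof (intro conjI ballI allI impI)
 have [measurable]: "f \<in> borel_measurable borel" "g \<in> borel_measurable borel"
  using f g by (auto simp: Vsp_def intro: cusp_space_borel)
 show "Phi k f g \<in> borel_measurable borel" unfolding Phi_def by measurable
 obtain B where B: "\<And>z. 0 < Im z \<Longrightarrow> cmod (Phi k f f z) \<le> B" using Vsp_bounded[OF f N] by blast
 obtain B' where B': "\<And>z. 0 < Im z \<Longrightarrow> cmod (Phi k g g z) \<le> B'" using Vsp_bounded[OF g N] by blast
 \<comment> \<open>The arithmetic mean dominates |f| |g|, so the bounds for (f, f) and (g, g)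
   suffice.\<close>
 have "norm (Phi k f g z) \<le> B + B'" if z: "0 < Im z" for z
 proof -
  define y where "y = Im z powr (real k + 1/2)"
  have y: "y \<ge> 0" by (simp add: y_def)
  have "(cmod (f z))\<^sup>2 * y \<le> B" "(cmod (g z))\<^sup>2 * y \<le> B'"
   using B[OF z] B'[OF z] y by (auto simp: Phi_def norm_mult power2_eq_square y_def)
  moreover have "2 * (cmod (f z) * cmod (g z)) \<le> (cmod (f z))\<^sup>2 + (cmod (g z))\<^sup>2"
   using sum_squares_bound[of "cmod (f z)" "cmod (g z)"] by (simp add: mult.assoc)
  hence "2 * (cmod (f z) * cmod (g z)) * y \<le> ((cmod (f z))\<^sup>2 + (cmod (g z))\<^sup>2) * y"
   using y by (rule mult_right_mono)
  moreover have "norm (Phi k f g z) = cmod (f z) * cmod (g z) * y" using y by (simp add: Phi_def norm_mult y_def)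
  moreover have "0 \<le> cmod (f z) * cmod (g z) * y" using y by simp
  ultimately show ?thesis by (simp add: algebra_simps)
 qed
 thus "\<exists>B. \<forall>z. 0 < Im z \<longrightarrow> norm (Phi k f g z) \<le> B" by blast
 fix A z assume "A \<in> GammaN N" "0 < Im z"
 thus "Phi k f g (mact A z) = Phi k f g z"
  using Phi_js[OF GammaN_Gamma0[OF N(2)], of A z k f g] f g by (simp add: Vsp_def)
qed

text \<open>The operators involve matrices, multipliers and scalings of different kinds; all that
  matters for the product is a pointwise relation between the integrands. That Phi k f g after X is
  again invariant under \<open>GammaN N\<close> is read off from f' and g'.\<close>

lemma ip_transform:
 assumes N: "N > 0" "4 dvd N" and X: "0 < det X" and V: "f \<in> Vsp k N" "g \<in> Vsp k N" "f' \<in> Vsp k N" "g' \<in> Vsp k N"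
  and c: "c \<noteq> 0" "\<And>z. 0 < Im z \<Longrightarrow> Phi k f' g' z = c * Phi k f g (mact X z)"
 shows "ip k N f' g' = c * ip k N f g"
proof -
 note h = hgood_Phi[OF V(1,2) N] and h' = hgood_Phi[OF V(3,4) N]
 have e: "Phi k f g (mact X z) = Phi k f' g' z / c" if "0 < Im z" for z using c that by simp
 have "hgood N (\<lambda>z. Phi k f g (mact X z))" unfolding hgood_def
 proof (intro conjI ballI allI impI)
  have [measurable]: "Phi k f g \<in> borel_measurable borel" using h by (simp add: hgood_def)
  show "(\<lambda>z. Phi k f g (mact X z)) \<in> borel_measurable borel" by measurable
  show "\<exists>B. \<forall>z. 0 < Im z \<longrightarrow> norm (Phi k f g (mact X z)) \<le> B"
  proof -
   obtain B where "\<forall>z. 0 < Im z \<longrightarrow> norm (Phi k f g z) \<le> B" using h by (auto simp: hgood_def)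
   thus ?thesis using mact_upper[OF _ X] by blast
  qed
  fix A z assume A: "A \<in> GammaN N" and z: "0 < Im z"
  have "0 < Im (mact A z)" using mact_upper_SL2Z[OF z] A GammaN_sub by blast
  thus "Phi k f g (mact X (mact A z)) = Phi k f g (mact X z)" using h' A z by (simp add: e hgood_def)
 qed
 hence "Iint N (\<lambda>z. Phi k f g (mact X z)) = Iint N (Phi k f g)" by (rule Iint_invariant[OF h _ N(1) X])
 moreover have "Iint N (Phi k f' g') = Iint N (\<lambda>z. c * Phi k f g (mact X z))" by (rule Iint_cong[OF c(2)])
 ultimately show ?thesis by (simp add: ip_def Iint_cmult)
qed

lemma GammaN_normal:
 assumes "A \<in> GammaN N" "B \<in> SL2Z" shows "B ** A ** adj2 B \<in> GammaN N"
proof -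
 have "det B = 1" using assms(2) by (simp add: SL2Z_def)
 then obtain P where P: "P \<in> GammaN N" "P ** B = B ** A" using GammaN_conj[of B A N N] assms(1) by auto
 have "B ** A ** adj2 B = P" unfolding P(2)[symmetric] by (rule adj2_cancel(3)[OF assms(2)])
 thus ?thesis using P(1) by simp
qed

lemma Vsp_js:
 assumes "f \<in> Vsp k N" "B \<in> Gamma0 4" "4 dvd N" shows "js k B f \<in> Vsp k N"
proof -
 have f: "f \<in> cusp_space k" using assms by (simp add: Vsp_def)
 note up = cusp_space_upper[OF f]
 have "js k A (js k B f) = js k B f" if A: "A \<in> GammaN N" for A
 proof -
  have B: "B \<in> SL2Z" using assms(2) by (rule Gamma0_SL2Z)
  define A' where "A' = B ** A ** adj2 B"
  have A': "A' \<in> GammaN N" unfolding A'_def by (rule GammaN_normal[OF A B])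
  have "js k A (js k B f) = js k (B ** A) f" by (rule js_mult[OF assms(2) GammaN_Gamma0[OF assms(3) A] up])
  also have "B ** A = A' ** B" unfolding A'_def by (simp only: adj2_cancel[OF B])
  also have "js k (A' ** B) f = js k B (js k A' f)" by (rule js_mult[OF GammaN_Gamma0[OF assms(3) A'] assms(2) up, symmetric])
  also have "js k A' f = f" using assms(1) A' by (simp add: Vsp_def)
  finally show ?thesis .
 qed
 thus ?thesis using js_in_cusp_space[OF f assms(2)] by (simp add: Vsp_def)
qed

lemma ip_js:
 assumes "N > 0" "4 dvd N" "f \<in> Vsp k N" "g \<in> Vsp k N" "B \<in> Gamma0 4"
 shows "ip k N (js k B f) (js k B g) = ip k N f g"
proof -
 have "0 < det B" using assms(5) by (simp add: Gamma0_def SL2Z_def)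
 thus ?thesis
  using ip_transform[OF assms(1,2) _ assms(3,4) Vsp_js[OF assms(3,5,2)] Vsp_js[OF assms(4,5,2)], of B 1] Phi_js[OF assms(5)] by simp
qed

lemma js_lin:
 "js k A (\<lambda>z. f z + g z) = (\<lambda>z. js k A f z + js k A g z)" "js k A (\<lambda>z. c * f z) = (\<lambda>z. c * js k A f z)"
 "js k A (\<lambda>z. \<Sum>i\<in>I. F i z) = (\<lambda>z. \<Sum>i\<in>I. js k A (F i) z)" "js k A (\<lambda>z. 0) = (\<lambda>z. 0)"
 by (simp_all add: js_def add_divide_distrib sum_divide_distrib)

lemma Vsp_add: "f \<in> Vsp k N \<Longrightarrow> g \<in> Vsp k N \<Longrightarrow> (\<lambda>z. f z + g z) \<in> Vsp k N"
 and Vsp_cmult: "f \<in> Vsp k N \<Longrightarrow> (\<lambda>z. c * f z) \<in> Vsp k N" and Vsp_zero: "(\<lambda>z. 0) \<in> Vsp k N"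
 by (auto simp: Vsp_def js_lin cusp_space_add cusp_space_cmult cusp_space_zero)

lemma Vsp_sum: "(\<And>i. i \<in> I \<Longrightarrow> F i \<in> Vsp k N) \<Longrightarrow> (\<lambda>z. \<Sum>i\<in>I. F i z) \<in> Vsp k N"
 by (induction I rule: infinite_finite_induct) (auto intro: Vsp_zero Vsp_add)

lemma ip_cmult_left: "ip k N (\<lambda>z. c * f z) g = c * ip k N f g"
 unfolding ip_def Iint_cmult[symmetric] by (rule Iint_cong) (simp add: Phi_def)

lemma ip_cnj: "ip k N g f = cnj (ip k N f g)"
 unfolding ip_def Iint_cnj[symmetric] by (rule Iint_cong) (simp add: Phi_def)

lemma ip_cmult_right: "ip k N f (\<lambda>z. c * g z) = cnj c * ip k N f g"
 using ip_cmult_left[of k N c g f] ip_cnj[of k N f] by (metis complex_cnj_mult)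

lemma ip_add_left:
 assumes "N > 0" "4 dvd N" "f \<in> Vsp k N" "f' \<in> Vsp k N" "g \<in> Vsp k N"
 shows "ip k N (\<lambda>z. f z + f' z) g = ip k N f g + ip k N f' g"
proof -
 have "ip k N (\<lambda>z. f z + f' z) g = Iint N (\<lambda>z. Phi k f g z + Phi k f' g z)"
  unfolding ip_def by (rule Iint_cong) (simp add: Phi_def algebra_simps)
 also have "... = ip k N f g + ip k N f' g" unfolding ip_def by (intro Iint_add hgood_Phi assms)
 finally show ?thesis .
qed

lemma ip_add_right:
 assumes "N > 0" "4 dvd N" "f \<in> Vsp k N" "f' \<in> Vsp k N" "g \<in> Vsp k N"
 shows "ip k N g (\<lambda>z. f z + f' z) = ip k N g f + ip k N g f'"
 by (simp only: ip_cnj[of k N g "\<lambda>z. f z + f' z"] ip_cnj[of k N g f] ip_cnj[of k N g f']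
   ip_add_left[OF assms] complex_cnj_add)

lemma ip_zero_left: "ip k N (\<lambda>z. 0) g = 0" using ip_cmult_left[of k N 0 "\<lambda>z. 0" g] by simp

lemma ip_sum_left:
 assumes "N > 0" "4 dvd N" "g \<in> Vsp k N" "\<And>i. i \<in> I \<Longrightarrow> F i \<in> Vsp k N"
 shows "ip k N (\<lambda>z. \<Sum>i\<in>I. F i z) g = (\<Sum>i\<in>I. ip k N (F i) g)" using assms(4)
proof (induction I rule: infinite_finite_induct)
 case (insert i I)
 thus ?case using ip_add_left[OF assms(1,2), of "F i" k "\<lambda>z. \<Sum>i\<in>I. F i z" g] assms(3) Vsp_sum[of I F k N] by simp
qed (simp_all add: ip_zero_left)

lemma ip_sum_right:
 assumes "N > 0" "4 dvd N" "g \<in> Vsp k N" "\<And>i. i \<in> I \<Longrightarrow> F i \<in> Vsp k N"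
 shows "ip k N g (\<lambda>z. \<Sum>i\<in>I. F i z) = (\<Sum>i\<in>I. ip k N g (F i))"
proof -
 have "ip k N g (\<lambda>z. \<Sum>i\<in>I. F i z) = cnj (\<Sum>i\<in>I. ip k N (F i) g)"
  by (simp only: ip_cnj[of k N g "\<lambda>z. \<Sum>i\<in>I. F i z"] ip_sum_left[OF assms])
 also have "... = (\<Sum>i\<in>I. ip k N g (F i))" unfolding cnj_sum by (intro sum.cong refl ip_cnj[symmetric])
 finally show ?thesis .
qed

text \<open>The integrand is nonnegative, so it vanishes almost everywhere on a translate of
  \<open>Fdom\<close>. By continuity f vanishes on the image of a ball, and analytic continuation
  does the rest.\<close>

lemma ip_definite:
 assumes f: "f \<in> Vsp k N" and N: "N > 0" "4 dvd N" and zero: "ip k N f f = 0" shows "f = (\<lambda>z. 0)"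
proof -
 have fc: "f \<in> cusp_space k" using f by (simp add: Vsp_def)
 define u where "u z = (cmod (f z))\<^sup>2 * Im z powr (real k + 1/2)" for z
 have u0: "u z \<ge> 0" for z by (simp add: u_def)
 have Pu: "Phi k f f z = of_real (u z)" for z unfolding Phi_def u_def of_real_mult complex_norm_square ..
 define w where "w C z = indicator Fdom z *\<^sub>R u (mact (rep C) z)" for C z
 have fin: "finite (GN_cosets N)" by (rule finite_GammaN_cosets[OF N(1)])
 have "hgood N (\<lambda>z. Re (Phi k f f z))"
  by (rule hgood_comp[OF hgood_Phi[OF f f N]]) (auto simp: abs_Re_le_cmod intro!: borel_measurable_continuous_onI continuous_intros)
 hence gu: "hgood N u" by (simp add: Pu)
 have int: "integrable hyp (w C)" if "C \<in> GN_cosets N" for C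
  unfolding w_def by (rule hgood_integrable[OF gu GN_coset_facts(2)[OF that]])
 have "ip k N f f = of_real (\<Sum>C\<in>GN_cosets N. LINT z|hyp. w C z)"
 proof -
  have "indicator Fdom z *\<^sub>R Phi k f f (mact (rep C) z) = of_real (w C z)" for C z
   by (simp add: w_def Pu scaleR_conv_of_real)
  thus ?thesis unfolding ip_def Iint_def by (simp only: integral_complex_of_real of_real_sum)
 qed
 with zero have s0: "(\<Sum>C\<in>GN_cosets N. LINT z|hyp. w C z) = 0" by (simp only: of_real_eq_0_iff)
 have w0: "w C z \<ge> 0" for C z using u0 by (simp add: w_def)
 define C where "C = coset_rel SL2Z (GammaN N) `` {mat 1}"
 have C: "C \<in> GN_cosets N" unfolding C_def by (rule quotientI[OF SL2Z_1])
 hence "(LINT z|hyp. w C z) = 0"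
  using s0 fin w0 by (subst (asm) sum_nonneg_eq_0_iff) (auto intro: Bochner_Integration.integral_nonneg)
 hence "AE z in hyp. w C z = 0" using integral_nonneg_eq_0_iff_AE[OF int[OF C]] w0 by simp
 hence ae: "AE z in lborel. 0 < ennreal (indicator upper_half_plane z / (Im z)\<^sup>2) \<longrightarrow> w C z = 0"
  unfolding hyp_def by (subst (asm) AE_density) auto
 have rC: "rep C \<in> SL2Z" "0 < det (rep C)" using GN_coset_facts(2)[OF C] upper_SL2Z by auto
 define g where "g = f \<circ> mact (rep C)"
 have g: "g holomorphic_on upper_half_plane" unfolding g_def using mact_upper rC
  by (intro holomorphic_on_compose_gen[OF mact_holomorphic cusp_space_holomorphic[OF fc]]) auto
 \<comment> \<open>Any ball inside \<open>Fdom\<close> would do.\<close>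
 define B where "B = ball (2 * \<i>) (1/4)"
 have B: "z \<in> Fdom" if "z \<in> B" for z
 proof -
  have d: "cmod (z - 2 * \<i>) < 1/4" using that by (simp add: B_def dist_norm norm_minus_commute)
  have r: "\<bar>Re z\<bar> < 1/4" "\<bar>Im z - 2\<bar> < 1/4"
   using d abs_Re_le_cmod[of "z - 2 * \<i>"] abs_Im_le_cmod[of "z - 2 * \<i>"] by auto
  hence "1 \<le> Im z" by linarith
  hence "1 \<le> cmod z" using abs_Im_le_cmod[of z] by linarith
  thus ?thesis using r \<open>1 \<le> Im z\<close> by (simp add: std_fundamental_domain_def)
 qed
 have BH: "B \<subseteq> upper_half_plane" using B by (auto simp: std_fundamental_domain_def)
 define Z where "Z = {z \<in> B. g z \<noteq> 0}"
 have "open Z"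
 proof -
  have "continuous_on B g" by (rule continuous_on_subset[OF holomorphic_on_imp_continuous_on[OF g] BH])
  hence "openin (top_of_set B) (B \<inter> g -` (- {0}))" by (intro continuous_openin_preimage_gen) auto
  moreover have "B \<inter> g -` (- {0}) = Z" by (auto simp: Z_def)
  ultimately show ?thesis using openin_open_trans[of B Z] by (simp add: B_def)
 qed
 have "AE z in lborel. z \<notin> Z" using ae
 proof eventually_elim
  case (elim z)
  show ?case
  proof
   assume "z \<in> Z"
   hence z: "z \<in> B" "g z \<noteq> 0" by (auto simp: Z_def)
   have Im: "0 < Im z" using BH z by auto
   hence "w C z = 0" using elim by (simp add: indicator_def)
   hence "u (mact (rep C) z) = 0" using B[OF z(1)] by (simp add: w_def)
   hence "g z = 0" using mact_upper[OF Im rC(2)] by (simp add: u_def g_def)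
   thus False using z by simp
  qed
 qed
 hence "Z \<in> null_sets lborel" using \<open>open Z\<close> by (subst AE_iff_null_sets) auto
 hence "negligible Z" by (simp add: negligible_iff_null_sets null_sets_completionI)
 hence "Z = {}" using open_not_negligible[OF \<open>open Z\<close>] by blast
 hence gB: "g z = 0" if "z \<in> B" for z using that by (auto simp: Z_def)
 have gz: "g z = 0" if "0 < Im z" for z
 proof (rule analytic_continuation_open[of B upper_half_plane g "\<lambda>_. 0"])
  show "B \<noteq> {}" by (simp add: B_def)
 qed (use g gB BH that open_uhp connected_uhp in \<open>auto simp: B_def\<close>)
 have "f z = 0" for z
 proof (cases "0 < Im z")
  case True
  have "g (mact (adj2 (rep C)) z) = 0" by (rule gz) (use mact_upper[OF True, of "adj2 (rep C)"] rC in auto)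
  thus ?thesis using mact_adj2(2)[OF True rC(2)] by (simp add: g_def)
 next
  case False thus ?thesis using cusp_space_upper[OF fc] by blast
 qed
 thus ?thesis by blast
qed

section \<open>Comparison with the Petersson product of level L\<close>

lemma GammaN_Gamma0': "L dvd N \<Longrightarrow> GammaN N \<subseteq> Gamma0 L"
proof
 fix A assume "L dvd N" and A: "A \<in> GammaN N"
 hence "int L dvd int N" by (simp only: int_dvd_int_iff)
 thus "A \<in> Gamma0 L" using A dvd_trans[of "int L" "int N"] by (auto simp: GammaN_def Gamma0_def)
qed

lemma cusp_forms_Vsp: "f \<in> cusp_forms k L \<Longrightarrow> 4 dvd L \<Longrightarrow> L dvd N \<Longrightarrow> f \<in> Vsp k N"
 using cusp_forms_eq[of L k] GammaN_Gamma0' unfolding Vsp_def by blast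

lemma coset_rel_Image: "A \<in> G \<Longrightarrow> coset_rel G L `` {A} = (\<lambda>g. g ** A) ` L" by (auto simp: coset_rel_def)

text \<open>The G-coset C' is a right translate of G by its representative, hence splits into as
  many K-cosets as G itself; \<open>rep C \<in> C'\<close> says that C lies in C'.\<close>

lemma fiber_card:
 assumes G: "sl2_subgroup G" and K: "sl2_subgroup K" "K \<subseteq> G" and C': "C' \<in> SL2Z // coset_rel SL2Z G"
 shows "bij_betw (\<lambda>D. (\<lambda>d. d ** rep C') ` D) (G // coset_rel G K) {C \<in> SL2Z // coset_rel SL2Z K. rep C \<in> C'}"
proof -
 have GS: "G \<subseteq> SL2Z" and KS: "K \<subseteq> SL2Z" using G K by (auto simp: sl2_subgroup_def)
 define r where "r = rep C'"
 have r: "r \<in> SL2Z" "C' = (\<lambda>g. g ** r) ` G"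
  using coset_facts[OF sl2_subgroup_SL2Z G GS C'] by (auto simp: r_def)
 define F where "F D = (\<lambda>d. d ** r) ` D" for D :: "(int ^ 2 ^ 2) set"
 have F: "F (coset_rel G K `` {A}) = coset_rel SL2Z K `` {A ** r}" if "A \<in> G" for A
 proof -
  have "A ** r \<in> SL2Z" using that GS r SL2Z_mult by blast
  thus ?thesis using that by (auto simp: F_def coset_rel_Image matrix_mul_assoc[symmetric] image_iff)
 qed
 have "inj_on F (G // coset_rel G K)"
 proof (rule inj_onI)
  fix D E assume "F D = F E"
  hence "(\<lambda>d. d ** adj2 r) ` F D = (\<lambda>d. d ** adj2 r) ` F E" by simp
  thus "D = E" unfolding F_def image_image by (simp add: adj2_cancel[OF r(1)])
 qed
 moreover have "F ` (G // coset_rel G K) = {C \<in> SL2Z // coset_rel SL2Z K. rep C \<in> C'}"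
 proof (intro equalityI subsetI)
  fix C assume "C \<in> F ` (G // coset_rel G K)"
  then obtain A where A: "A \<in> G" "C = coset_rel SL2Z K `` {A ** r}" using F by (auto simp: quotient_def)
  have Ar: "A ** r \<in> SL2Z" using A GS r SL2Z_mult by blast
  have C: "C \<in> SL2Z // coset_rel SL2Z K" unfolding A(2) using Ar by (rule quotientI)
  have "rep C \<in> C" using coset_facts(1)[OF sl2_subgroup_SL2Z K(1) KS C] .
  then obtain g where "g \<in> K" "rep C = g ** (A ** r)" unfolding A(2) coset_rel_Image[OF Ar] by blast
  hence "rep C = (g ** A) ** r" "g ** A \<in> G" using K A sl2_subgroupD(3)[OF G] by (auto simp: matrix_mul_assoc)
  thus "C \<in> {C \<in> SL2Z // coset_rel SL2Z K. rep C \<in> C'}" using C r(2) by blast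
 next
  fix C assume "C \<in> {C \<in> SL2Z // coset_rel SL2Z K. rep C \<in> C'}"
  hence C: "C \<in> SL2Z // coset_rel SL2Z K" "rep C \<in> C'" by auto
  obtain A where A: "A \<in> G" "rep C = A ** r" using C r by blast
  have Ar: "A ** r \<in> SL2Z" using A GS r SL2Z_mult by blast
  have "C = (\<lambda>g. g ** rep C) ` K" using coset_facts(3)[OF sl2_subgroup_SL2Z K(1) KS C(1)] .
  also have "... = coset_rel SL2Z K `` {A ** r}" unfolding A(2) coset_rel_Image[OF Ar] ..
  also have "... = F (coset_rel G K `` {A})" using F[OF A(1)] by simp
  finally show "C \<in> F ` (G // coset_rel G K)" using quotientI[OF A(1)] by blast
 qed
 ultimately show ?thesis unfolding bij_betw_def F_def r_def by blast
qed

text \<open>n is the index of \<open>GammaN N\<close> in \<open>Gamma0 L\<close>. For forms of level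
  L the integrand depends only on the coset of \<open>Gamma0 L\<close>, and by
  \<open>fiber_card\<close> each of these contributes n equal terms. Vanishing and adjointness thus
  pass between the two products.\<close>

lemma ip_petersson:
 assumes L: "4 dvd L" "L dvd N" and N: "N > 0"
 obtains n :: nat where "n > 0" "\<And>f g. f \<in> cusp_forms k L \<Longrightarrow> g \<in> cusp_forms k L \<Longrightarrow> ip k N f g = of_nat n * petersson k L f g"
proof -
 have N4: "4 dvd N" using L by (rule dvd_trans)
 define G where "G = Gamma0 L"
 have G: "sl2_subgroup G" "G \<subseteq> SL2Z" by (auto simp: G_def sl2_subgroup_Gamma0 Gamma0_SL2Z)
 have KG: "GammaN N \<subseteq> G" unfolding G_def by (rule GammaN_Gamma0'[OF L(2)])
 define Q where "Q = SL2Z // coset_rel SL2Z G"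
 define n where "n = card (G // coset_rel G (GammaN N))"
 have fin: "finite (GN_cosets N)" by (rule finite_GammaN_cosets[OF N])
 note facts = coset_facts[OF sl2_subgroup_SL2Z G]
 have card: "card {C \<in> GN_cosets N. rep C \<in> C'} = n" if "C' \<in> Q" for C'
  unfolding n_def using bij_betw_same_card[OF fiber_card[OF G(1) sl2_subgroup_GammaN KG]] that by (simp add: Q_def)
 have "n > 0"
 proof -
  define C' where "C' = coset_rel SL2Z G `` {mat 1}"
  have C': "C' \<in> Q" unfolding Q_def C'_def by (rule quotientI[OF SL2Z_1])
  hence rC: "rep C' \<in> SL2Z" using facts(2) by (simp add: Q_def)
  have ne: "{C \<in> GN_cosets N. rep C \<in> C'} \<noteq> {}"
  proof -
   define C where "C = coset_rel SL2Z (GammaN N) `` {mat 1}"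
   have C: "C \<in> GN_cosets N" unfolding C_def by (rule quotientI[OF SL2Z_1])
   have "rep C \<in> C" using GN_coset_facts(1)[OF C] .
   also have "C \<subseteq> C'" unfolding C_def C'_def coset_rel_Image[OF SL2Z_1] using KG by blast
   finally show ?thesis using C by blast
  qed
  have "finite {C \<in> GN_cosets N. rep C \<in> C'}" using fin by simp
  hence "card {C \<in> GN_cosets N. rep C \<in> C'} > 0" using ne by (simp add: card_gt_0_iff)
  thus ?thesis using card[OF C'] by simp
 qed
 moreover have "ip k N f g = of_nat n * petersson k L f g" if fg: "f \<in> cusp_forms k L" "g \<in> cusp_forms k L" for f g
 proof -
  have V: "f \<in> Vsp k N" "g \<in> Vsp k N" using fg L cusp_forms_Vsp by auto
  note good = hgood_Phi[OF V N N4]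
  define a where "a C = (LINT z|hyp. indicator Fdom z *\<^sub>R Phi k f g (mact (rep C) z))" for C
  define \<pi> where "\<pi> C = coset_rel SL2Z G `` {rep C}" for C
  have \<pi>: "\<pi> C \<in> Q" "rep C \<in> \<pi> C" if "C \<in> GN_cosets N" for C
   using GN_coset_facts(2)[OF that] sl2_subgroupD(2)[OF G(1)] quotientI[of "rep C" SL2Z "coset_rel SL2Z G"]
   by (auto simp: Q_def \<pi>_def coset_rel_Image image_iff intro!: bexI[of _ "mat 1"])
  have eq\<pi>: "\<pi> C = C' \<longleftrightarrow> rep C \<in> C'" if "C \<in> GN_cosets N" "C' \<in> Q" for C C'
   using \<pi>[OF that(1)] that(2) coset_eqI[OF sl2_subgroup_SL2Z G] unfolding Q_def by blast
  have api: "a C = a (\<pi> C)" if C: "C \<in> GN_cosets N" for C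
  proof -
   obtain h where h: "h \<in> G" "rep C = h ** rep (\<pi> C)"
    using facts(3)[of "\<pi> C"] \<pi>[OF C] unfolding Q_def by blast
   have r: "rep (\<pi> C) \<in> SL2Z" using facts(2) \<pi>[OF C] by (simp add: Q_def)
   have h4: "h \<in> Gamma0 4" using h(1) Gamma0_mono[OF L(1)] by (simp add: G_def)
   have "Phi k f g (mact (rep C) z) = Phi k f g (mact (rep (\<pi> C)) z)" if z: "0 < Im z" for z
   proof -
    have v: "0 < Im (mact (rep (\<pi> C)) z)" using mact_upper_SL2Z[OF z r] .
    have "mact (rep C) z = mact h (mact (rep (\<pi> C)) z)" unfolding h(2) using z r by (intro mact_mult) (auto simp: SL2Z_def)
    hence "Phi k f g (mact (rep C) z) = Phi k (js k h f) (js k h g) (mact (rep (\<pi> C)) z)"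
     using Phi_js[OF h4 v] by simp
    thus ?thesis using fg h(1) cusp_forms_eq[OF L(1)] by (simp add: G_def)
   qed
   thus ?thesis unfolding a_def
    by (intro Bochner_Integration.integral_cong refl) (auto simp: indicator_def std_fundamental_domain_def)
  qed
  have finQ: "finite Q"
  proof -
   have "Q \<subseteq> \<pi> ` GN_cosets N"
   proof
    fix C' assume C': "C' \<in> Q"
    hence "card {C \<in> GN_cosets N. rep C \<in> C'} > 0" using card \<open>n > 0\<close> by simp
    then obtain C where "C \<in> GN_cosets N" "rep C \<in> C'" by (metis (mono_tags, lifting) card_gt_0_iff ex_in_conv mem_Collect_eq)
    thus "C' \<in> \<pi> ` GN_cosets N" using eq\<pi>[OF _ C'] by blast
   qed
   thus ?thesis using fin finite_subset by blast
  qed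
  have "ip k N f g = (\<Sum>C\<in>GN_cosets N. a C)" unfolding ip_def Iint_def a_def ..
  also have "... = (\<Sum>C'\<in>Q. \<Sum>C\<in>{C \<in> GN_cosets N. \<pi> C = C'}. a C)"
   by (rule sum.group[OF fin finQ, symmetric]) (use \<pi> in auto)
  also have "... = (\<Sum>C'\<in>Q. of_nat n * a C')"
  proof (rule sum.cong[OF refl])
   fix C' assume C': "C' \<in> Q"
   have "{C \<in> GN_cosets N. \<pi> C = C'} = {C \<in> GN_cosets N. rep C \<in> C'}" using eq\<pi>[OF _ C'] by blast
   hence "card {C \<in> GN_cosets N. \<pi> C = C'} = n" using card[OF C'] by simp
   moreover have "(\<Sum>C\<in>{C \<in> GN_cosets N. \<pi> C = C'}. a C) = (\<Sum>C\<in>{C \<in> GN_cosets N. \<pi> C = C'}. a C')"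
    by (rule sum.cong) (use api in auto)
   ultimately show "(\<Sum>C\<in>{C \<in> GN_cosets N. \<pi> C = C'}. a C) = of_nat n * a C'" by simp
  qed
  also have "... = of_nat n * (\<Sum>C'\<in>Q. a C')" by (simp only: sum_distrib_left)
  also have "(\<Sum>C'\<in>Q. a C') = petersson k L f g"
  proof -
   have rel: "Gamma0_coset_rel L = coset_rel SL2Z G" by (simp add: Gamma0_coset_rel_def coset_rel_def G_def)
   have [measurable]: "Phi k f g \<in> borel_measurable borel" using good by (simp add: hgood_def)
   have "a C = (LINT z:std_fundamental_domain|lborel. (let w = mact (SOME \<gamma>. \<gamma> \<in> C) z
      in f w * cnj (g w) * of_real (Im w powr (real k + 1/2)) / of_real ((Im z)\<^sup>2)))" for C
   proof -
    have "a C = (LINT z|lborel. (indicator upper_half_plane z / (Im z)\<^sup>2) *\<^sub>R (indicator Fdom z *\<^sub>R Phi k f g (mact (rep C) z)))"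
     unfolding a_def hyp_def by (rule integral_density) (auto, measurable)
    also have "... = (LINT z|lborel. indicator Fdom z *\<^sub>R (Phi k f g (mact (rep C) z) / of_real ((Im z)\<^sup>2)))"
     by (rule Bochner_Integration.integral_cong)
      (auto simp: indicator_def std_fundamental_domain_def scaleR_conv_of_real)
    finally show ?thesis unfolding set_lebesgue_integral_def Phi_def Let_def rep_def .
   qed
   thus ?thesis unfolding petersson_def rel Q_def by simp
  qed
  finally show ?thesis .
 qed
 ultimately show ?thesis using that by blast
qed

section \<open>Hecke operators\<close>

text \<open>For a, d > 0 this is a nonzero multiple of the slash by an upper triangular matrix;
  without square roots it composes with no sign.\<close>

definition aff :: "int \<Rightarrow> int \<Rightarrow> int \<Rightarrow> (complex \<Rightarrow> complex) \<Rightarrow> complex \<Rightarrow> complex" where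
 "aff a b d f = (\<lambda>z. f ((of_int a * z + of_int b) / of_int d))"

lemma aff_mact: "d \<noteq> 0 \<Longrightarrow> aff a b d f z = f (mact (mat2 a b 0 d) z)"
 by (simp add: aff_def mact_eq den_def)

lemma aff_in_cusp_space:
 assumes "f \<in> cusp_space k" "a > 0" "d > 0" shows "aff a b d f \<in> cusp_space k"
proof -
 have "csqrt (of_int d) \<noteq> 0" using assms by simp
 hence "aff a b d f = (\<lambda>z. csqrt (of_int d) ^ (2 * k + 1) * sl k (mat2 a b 0 d) f z)"
  using assms by (simp add: fun_eq_iff sl_def aff_mact) (simp add: den_def)
 thus ?thesis using assms by (simp only:) (intro cusp_space_cmult sl_in_cusp_space, auto)
qed

lemma aff_lin:
 "aff a b d (\<lambda>z. f z + g z) = (\<lambda>z. aff a b d f z + aff a b d g z)"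
 "aff a b d (\<lambda>z. c * f z) = (\<lambda>z. c * aff a b d f z)"
 "aff a b d (\<lambda>z. \<Sum>i\<in>I. F i z) = (\<lambda>z. \<Sum>i\<in>I. aff a b d (F i) z)" by (simp_all add: aff_def)

lemma Im_aff: "a > 0 \<Longrightarrow> d > 0 \<Longrightarrow> 0 < Im z \<Longrightarrow> 0 < Im ((of_int a * z + of_int b) / of_int d)"
 by (simp add: Im_divide_of_real[of _ "of_int d", simplified])

lemma sign_odd_power: "(x :: int) = 1 \<or> x = -1 \<Longrightarrow> (of_int x :: complex) ^ (2 * k + 1) = of_int x" by auto

text \<open>diag(1, r) A = B diag(1, r) for B = (a, b/r; r c, d), which is integral when r divides
  b. The denominators agree, so the theta factors differ just by the symbol (r/d).\<close>

lemma js_aff_diag: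
 assumes A: "A \<in> Gamma0 4" and r: "r > 0" "r dvd A $ 1 $ 2"
 shows "js k A (aff 1 0 r f) = (\<lambda>z. of_int (jacobi r (nat \<bar>A $ 2 $ 2\<bar>)) *
   aff 1 0 r (js k (mat2 (A $ 1 $ 1) (A $ 1 $ 2 div r) (r * A $ 2 $ 1) (A $ 2 $ 2)) f) z)"
  and "mat2 (A $ 1 $ 1) (A $ 1 $ 2 div r) (r * A $ 2 $ 1) (A $ 2 $ 2) \<in> Gamma0 4"
  and "jacobi r (nat \<bar>A $ 2 $ 2\<bar>) = 1 \<or> jacobi r (nat \<bar>A $ 2 $ 2\<bar>) = -1"
proof -
 define a b c d where "a = A $ 1 $ 1" "b = A $ 1 $ 2" "c = A $ 2 $ 1" "d = A $ 2 $ 2"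
 note abcd = this
 obtain b' where b': "b = r * b'" using r by (auto simp: abcd dvd_def)
 have o: "4 dvd c" "odd d" "coprime c d" using Gamma0_4_odd[OF A] by (auto simp: abcd)
 have det: "a * d - b * c = 1" using Gamma0_props(1)[OF A] by (simp add: abcd)
 let ?B = "mat2 a b' (r * c) d"
 have Be: "?B = mat2 (A $ 1 $ 1) (A $ 1 $ 2 div r) (r * A $ 2 $ 1) (A $ 2 $ 2)"
  using b' r by (simp add: abcd)
 have "?B \<in> Gamma0 4" using det o b' by (simp add: Gamma0_mat2 algebra_simps)
 thus BG: "mat2 (A $ 1 $ 1) (A $ 1 $ 2 div r) (r * A $ 2 $ 1) (A $ 2 $ 2) \<in> Gamma0 4" unfolding Be .
 have "coprime (r * c) d" using Gamma0_4_odd(4)[OF \<open>?B \<in> Gamma0 4\<close>] by simp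
 hence rd: "coprime r d" by simp
 have on: "odd (nat \<bar>d\<bar>)" using o by (simp add: even_nat_iff)
 have J: "jacobi r (nat \<bar>d\<bar>) = 1 \<or> jacobi r (nat \<bar>d\<bar>) = -1" using jacobi_coprime[OF on, of r] rd by simp
 thus "jacobi r (nat \<bar>A $ 2 $ 2\<bar>) = 1 \<or> jacobi r (nat \<bar>A $ 2 $ 2\<bar>) = -1" by (simp add: abcd)
 have th: "theta_factor ?B (z / of_int r) = of_int (jacobi r (nat \<bar>d\<bar>)) * theta_factor A z" for z
 proof -
  have "den ?B (z / of_int r) = den A z" using r by (simp add: den_def abcd)
  thus ?thesis using quad_symbol_mult_left[OF r(1) o(2), of c] by (simp add: theta_factor_den abcd)
 qed
 have ac: "mact ?B (z / of_int r) = mact A z / of_int r" for z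
  using r by (simp add: mact_eq den_def abcd[symmetric] b' field_simps)
 show "js k A (aff 1 0 r f) = (\<lambda>z. of_int (jacobi r (nat \<bar>A $ 2 $ 2\<bar>)) *
   aff 1 0 r (js k (mat2 (A $ 1 $ 1) (A $ 1 $ 2 div r) (r * A $ 2 $ 1) (A $ 2 $ 2)) f) z)"
 proof
  fix z
  have "aff 1 0 r (js k ?B f) z = f (mact A z / of_int r) / (of_int (jacobi r (nat \<bar>d\<bar>)) * theta_factor A z) ^ (2 * k + 1)"
   by (simp only: aff_def js_def of_int_1 mult_1_left of_int_0 add_0_right th ac)
  also have "... = f (mact A z / of_int r) / theta_factor A z ^ (2 * k + 1) / of_int (jacobi r (nat \<bar>d\<bar>))"
   unfolding power_mult_distrib sign_odd_power[OF J] by (simp add: field_simps)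
  finally show "js k A (aff 1 0 r f) z = of_int (jacobi r (nat \<bar>A $ 2 $ 2\<bar>)) *
   aff 1 0 r (js k (mat2 (A $ 1 $ 1) (A $ 1 $ 2 div r) (r * A $ 2 $ 1) (A $ 2 $ 2)) f) z"
   unfolding Be[symmetric] using J by (auto simp: js_def aff_def abcd)
 qed
qed

text \<open>Right multiplication by g sends the coset H R_i to some H R_j. The hypothesis that
  distinct indices give distinct cosets makes this map injective, hence a permutation of the finite
  set I.\<close>

lemma trace_invariant:
 assumes fin: "finite I" and R: "\<And>i. i \<in> I \<Longrightarrow> R i \<in> Gamma0 4" and g: "g \<in> Gamma0 4" and H: "sl2_subgroup H" "H \<subseteq> Gamma0 4"
  and up: "\<And>z. \<not> 0 < Im z \<Longrightarrow> f z = 0" and inv: "\<And>h. h \<in> H \<Longrightarrow> js k h f = f"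
  and reach: "\<And>i. i \<in> I \<Longrightarrow> \<exists>j\<in>I. R i ** g ** adj2 (R j) \<in> H"
  and inj: "\<And>i j. i \<in> I \<Longrightarrow> j \<in> I \<Longrightarrow> R i ** adj2 (R j) \<in> H \<Longrightarrow> i = j"
 shows "js k g (\<lambda>z. \<Sum>i\<in>I. js k (R i) f z) = (\<lambda>z. \<Sum>i\<in>I. js k (R i) f z)"
proof -
 obtain \<sigma> where \<sigma>: "\<And>i. i \<in> I \<Longrightarrow> \<sigma> i \<in> I \<and> R i ** g ** adj2 (R (\<sigma> i)) \<in> H" using reach by metis
 have RS: "R i \<in> SL2Z" if "i \<in> I" for i using R[OF that] by (rule Gamma0_SL2Z)
 have gS: "g \<in> SL2Z" using g by (rule Gamma0_SL2Z)
 have "inj_on \<sigma> I"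
 proof (rule inj_onI)
  fix i j assume ij: "i \<in> I" "j \<in> I" "\<sigma> i = \<sigma> j"
  define S where "S = R (\<sigma> i)"
  have S: "S \<in> SL2Z" using \<sigma>[OF ij(1)] RS by (simp add: S_def)
  have m: "R i ** g ** adj2 S \<in> H" "R j ** g ** adj2 S \<in> H" using \<sigma>[OF ij(1)] \<sigma>[OF ij(2)] ij(3) by (simp_all add: S_def)
  have "adj2 (R j ** g ** adj2 S) = S ** adj2 g ** adj2 (R j)" by (simp add: mat2_eq_iff algebra_simps)
  hence "(R i ** g ** adj2 S) ** (S ** adj2 g ** adj2 (R j)) \<in> H"
   using sl2_subgroupD(3,4)[OF H(1)] m by metis
  moreover have "(R i ** g ** adj2 S) ** (S ** adj2 g ** adj2 (R j)) = R i ** adj2 (R j)"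
   by (simp only: matrix_mul_assoc adj2_cancel[OF S] adj2_cancel[OF gS])
  ultimately show "i = j" using inj[OF ij(1,2)] by simp
 qed
 moreover have "\<sigma> ` I \<subseteq> I" using \<sigma> by blast
 ultimately have bij: "bij_betw \<sigma> I I" unfolding bij_betw_def using endo_inj_surj[OF fin] by blast
 have "js k g (js k (R i) f) = js k (R (\<sigma> i)) f" if "i \<in> I" for i
 proof -
  define h where "h = R i ** g ** adj2 (R (\<sigma> i))"
  have h: "h \<in> H" using \<sigma>[OF that] by (simp add: h_def)
  have "R i ** g = h ** R (\<sigma> i)" unfolding h_def using adj2_cancel(4)[OF RS, of "\<sigma> i"] \<sigma>[OF that] by simp
  hence "js k g (js k (R i) f) = js k (h ** R (\<sigma> i)) f" using js_mult[OF R[OF that] g up] by simp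
  also have "... = js k (R (\<sigma> i)) (js k h f)" by (rule js_mult[symmetric]) (use \<sigma>[OF that] R up h H in auto)
  finally show ?thesis using inv[OF h] by simp
 qed
 hence "js k g (\<lambda>z. \<Sum>i\<in>I. js k (R i) f z) = (\<lambda>z. \<Sum>i\<in>I. js k (R (\<sigma> i)) f z)" by (simp add: js_lin)
 also have "... = (\<lambda>z. \<Sum>i\<in>I. js k (R i) f z)" by (rule ext) (rule sum.reindex_bij_betw[OF bij])
 finally show ?thesis .
qed

lemma sum_residues:
 fixes t :: "int \<Rightarrow> 'a::comm_monoid_add" and \<sigma> :: "int \<Rightarrow> int" and q :: int
 assumes per: "\<And>u v. [u = v] (mod q) \<Longrightarrow> t u = t v" and q: "q > 0"
  and inj: "\<And>u v. [\<sigma> u = \<sigma> v] (mod q) \<Longrightarrow> [u = v] (mod q)"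
 shows "(\<Sum>u\<in>{0..<q}. t (\<sigma> u)) = (\<Sum>u\<in>{0..<q}. t u)"
proof -
 have "inj_on (\<lambda>u. \<sigma> u mod q) {0..<q}"
 proof (rule inj_onI)
  fix u v assume uv: "u \<in> {0..<q}" "v \<in> {0..<q}" "\<sigma> u mod q = \<sigma> v mod q"
  have "[\<sigma> u = \<sigma> v] (mod q)" unfolding cong_def by (rule uv(3))
  hence "[u = v] (mod q)" by (rule inj)
  thus "u = v" using uv(1,2) by (simp add: cong_def)
 qed
 moreover have "(\<lambda>u. \<sigma> u mod q) ` {0..<q} \<subseteq> {0..<q}" using q by auto
 ultimately have bij: "bij_betw (\<lambda>u. \<sigma> u mod q) {0..<q} {0..<q}"
  unfolding bij_betw_def using endo_inj_surj[of "{0..<q}" "\<lambda>u. \<sigma> u mod q"] by simp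
 have "(\<Sum>u\<in>{0..<q}. t (\<sigma> u)) = (\<Sum>u\<in>{0..<q}. t (\<sigma> u mod q))"
  by (intro sum.cong refl per) (simp add: cong_def)
 also have "... = (\<Sum>u\<in>{0..<q}. t u)" by (rule sum.reindex_bij_betw[OF bij])
 finally show ?thesis .
qed

lemma aff_periodic:
 assumes "\<And>z. f (z + 1) = f z" "d > 0" "[b = b'] (mod d)" shows "aff a b d f = aff a b' d f"
proof -
 have N: "f (z + of_nat n) = f z" for z n
 proof (induction n)
  case (Suc n) thus ?case using assms(1)[of "z + of_nat n"] by (simp add: add_ac)
 qed simp
 have Z: "f (z + of_int n) = f z" for z n
 proof (cases "n \<ge> 0")
  case True thus ?thesis using N[of z "nat n"] by simp
 next
  case False thus ?thesis using N[of "z + of_int n" "nat (- n)"] by simp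
 qed
 obtain q where q: "b = b' + d * q" using assms(3) by (metis cong_iff_lin cong_sym)
 have "(of_int a * z + of_int b) / of_int d = (of_int a * z + of_int b') / of_int d + of_int q" for z :: complex
  using assms(2) by (simp add: q field_simps)
 thus ?thesis by (simp add: aff_def fun_eq_iff Z)
qed

lemma cusp_forms_periodic: "f \<in> cusp_forms k N \<Longrightarrow> 4 dvd N \<Longrightarrow> f (z + 1) = f z"
proof -
 assume "f \<in> cusp_forms k N" "4 dvd N"
 hence "js k (Tmat 1) f = f" using cusp_forms_eq by (auto simp: Gamma0_mat2)
 thus ?thesis by (simp add: js_Tmat fun_eq_iff)
qed

lemma U_op_aff:
 assumes f: "f \<in> cusp_forms k N" "4 dvd N" and m: "m > 0"
 shows "U_op m f = (\<lambda>z. inverse (of_nat m) * (\<Sum>v\<in>{0..<int m}. aff 1 v (int m) f z))"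
proof
 fix z
 obtain a where a: "has_q_expansion 1 a f" using cusp_forms_expansion[OF f] by blast
 have fc: "f \<in> cusp_space k" using f cusp_forms_eq by blast
 have re: "(\<Sum>v\<in>{0..<int m}. aff 1 v (int m) f z) = (\<Sum>v<m. aff 1 (int v) (int m) f z)"
 proof -
  have "bij_betw int {..<m} {0..<int m}" by (rule bij_betw_byWitness[of _ nat]) auto
  thus ?thesis by (rule sum.reindex_bij_betw[symmetric])
 qed
 show "U_op m f z = inverse (of_nat m) * (\<Sum>v\<in>{0..<int m}. aff 1 v (int m) f z)"
 proof (cases "0 < Im z")
  case True
  show ?thesis unfolding re U_op_eq_average[OF a m True] by (simp add: aff_def field_simps)
 next
  case False
  have "aff 1 v (int m) f z = 0" for v
   unfolding aff_def by (rule cusp_space_upper[OF fc]) (use False m in \<open>simp add: Im_divide_of_nat zero_less_divide_iff\<close>)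
  thus ?thesis using False by (simp add: U_op_def)
 qed
qed

lemma cusp_forms_add: "4 dvd N \<Longrightarrow> f \<in> cusp_forms k N \<Longrightarrow> g \<in> cusp_forms k N \<Longrightarrow> (\<lambda>z. f z + g z) \<in> cusp_forms k N"
 and cusp_forms_cmult: "4 dvd N \<Longrightarrow> f \<in> cusp_forms k N \<Longrightarrow> (\<lambda>z. c * f z) \<in> cusp_forms k N"
 and cusp_forms_zero: "4 dvd N \<Longrightarrow> (\<lambda>z. 0) \<in> cusp_forms k N"
 by (auto simp: cusp_forms_eq js_lin cusp_space_add cusp_space_cmult cusp_space_zero)

lemma cusp_forms_mono: "4 dvd N \<Longrightarrow> N dvd N' \<Longrightarrow> cusp_forms k N \<subseteq> cusp_forms k N'"
 using Gamma0_mono[of N N'] dvd_trans[of 4 N N'] by (auto simp: cusp_forms_eq)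

lemma jacobi_square_coprime: "odd d \<Longrightarrow> coprime r d \<Longrightarrow> jacobi (r * r) (nat \<bar>d\<bar>) = 1"
 by (rule jacobi_square_left) (auto simp: even_nat_iff)

text \<open>U averages the translates by v mod r^2 of F(z) = f(z / r^2). F is fixed by matrices of
  level 4 L whose upper right entry is divisible by r^2, since (r^2/d) = 1. For g of level 4 L the
  matrix T^v g T^(-w) is of this kind for some w, because r divides c and so a + v c is a unit mod
  r^2; thus g permutes the translates.\<close>

lemma U_square_cusp_forms:
 assumes f: "f \<in> cusp_forms k (4 * L)" and L: "L > 0" and r: "r > 0" "r dvd 4 * L"
 shows "U_op (r\<^sup>2) f \<in> cusp_forms k (4 * L)"
proof -
 have N4: "4 dvd 4 * L" by simp
 have fc: "f \<in> cusp_space k" and inv: "\<And>A. A \<in> Gamma0 (4 * L) \<Longrightarrow> js k A f = f" using f cusp_forms_eq[OF N4] by auto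
 define q where "q = int r * int r"
 have q: "q > 0" "int (r\<^sup>2) = q" using r by (simp_all add: q_def power2_eq_square)
 define F where "F = aff 1 0 q f"
 have Fc: "F \<in> cusp_space k" unfolding F_def by (rule aff_in_cusp_space[OF fc]) (use q in auto)
 have Fup: "F z = 0" if "\<not> 0 < Im z" for z using cusp_space_upper[OF Fc that] .
 have aT: "aff 1 v q f = js k (Tmat v) F" for v by (simp add: js_Tmat F_def aff_def)
 have Finv: "js k A F = F" if A: "A \<in> Gamma0 (4 * L)" and b: "q dvd A $ 1 $ 2" for A
 proof -
  have A4: "A \<in> Gamma0 4" by (rule Gamma0_mono[OF _ A]) simp
  let ?B = "mat2 (A $ 1 $ 1) (A $ 1 $ 2 div q) (q * A $ 2 $ 1) (A $ 2 $ 2)"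
  have "int (4 * L) dvd q * A $ 2 $ 1" using Gamma0_props(2)[OF A] by simp
  hence "?B \<in> Gamma0 (4 * L)" using js_aff_diag(2)[OF A4 q(1) b] by (simp add: Gamma0_def)
  hence "js k ?B f = f" by (rule inv)
  moreover have "jacobi q (nat \<bar>A $ 2 $ 2\<bar>) = 1"
  proof -
   have "coprime q (A $ 2 $ 2)"
   proof (rule coprimeI)
    fix x assume "x dvd q" "x dvd A $ 2 $ 2"
    hence "x dvd A $ 1 $ 1 * A $ 2 $ 2 - A $ 1 $ 2 * A $ 2 $ 1" using b by (meson dvd_diff dvd_mult dvd_mult2 dvd_trans)
    thus "is_unit x" using Gamma0_props(1)[OF A4] by simp
   qed
   hence "coprime (int r) (A $ 2 $ 2)" by (simp add: q_def)
   thus ?thesis unfolding q_def using Gamma0_4_odd(2)[OF A4] by (intro jacobi_square_coprime)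
  qed
  ultimately show ?thesis unfolding F_def js_aff_diag(1)[OF A4 q(1) b] by simp
 qed
 have per: "js k (Tmat u) F = js k (Tmat v) F" if "[u = v] (mod q)" for u v
  using aff_periodic[of f q u v 1] cusp_forms_periodic[OF f N4] q that by (simp add: aT)
 define S where "S = (\<lambda>z. \<Sum>v\<in>{0..<q}. js k (Tmat v) F z)"
 have U: "U_op (r\<^sup>2) f = (\<lambda>z. inverse (of_nat (r\<^sup>2)) * S z)"
  using U_op_aff[OF f N4, of "r\<^sup>2"] r unfolding S_def q(2) aT by simp
 have "js k g S = S" if g: "g \<in> Gamma0 (4 * L)" for g
 proof -
  have g4: "g \<in> Gamma0 4" by (rule Gamma0_mono[OF _ g]) simp
  define a b c d where "a = g $ 1 $ 1" "b = g $ 1 $ 2" "c = g $ 2 $ 1" "d = g $ 2 $ 2"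
  note abcd = this
  have det: "a * d - b * c = 1" using Gamma0_props(1)[OF g] by (simp add: abcd)
  have cL: "int (4 * L) dvd c" using Gamma0_props(2)[OF g] by (simp add: abcd)
  have rc: "int r dvd c" using r(2) cL by (meson dvd_trans int_dvd_int_iff)
  have unit: "coprime (a + v * c) q" for v
  proof -
   have "coprime (a + v * c) (int r)"
   proof (rule coprimeI)
    fix x assume x: "x dvd a + v * c" "x dvd int r"
    hence "x dvd c" using rc dvd_trans by blast
    hence "x dvd a" using x(1) by (simp add: dvd_add_left_iff)
    hence "x dvd a * d - b * c" using \<open>x dvd c\<close> by simp
    thus "is_unit x" using det by simp
   qed
   thus ?thesis by (simp add: q_def)
  qed
  have step: "\<exists>w. q dvd (b + v * d) - w * (a + v * c)" for v
  proof -
   obtain y where y: "[(a + v * c) * y = 1] (mod q)" using cong_solve_coprime_int[OF unit] by blast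
   have "[(b + v * d) - ((b + v * d) * y) * (a + v * c) = (b + v * d) - (b + v * d) * 1] (mod q)"
    using cong_scalar_left[OF y, of "b + v * d"] by (intro cong_diff cong_refl) (simp add: mult_ac)
   thus ?thesis by (intro exI[of _ "(b + v * d) * y"]) (simp add: cong_0_iff)
  qed
  define \<sigma> where "\<sigma> v = (SOME w. q dvd (b + v * d) - w * (a + v * c))" for v
  have \<sigma>: "q dvd (b + v * d) - \<sigma> v * (a + v * c)" for v unfolding \<sigma>_def using step by (rule someI_ex)
  have move: "js k g (js k (Tmat v) F) = js k (Tmat (\<sigma> v)) F" for v
  proof -
   define h where "h = Tmat v ** g ** Tmat (- \<sigma> v)"
   have T: "Tmat n \<in> Gamma0 (4 * L)" for n by (simp add: Gamma0_mat2)
   have h: "h \<in> Gamma0 (4 * L)" unfolding h_def by (intro Gamma0_mult T g)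
   have "h $ 1 $ 2 = (b + v * d) - \<sigma> v * (a + v * c)" by (simp add: h_def abcd algebra_simps)
   hence "js k h F = F" using Finv[OF h] \<sigma> by simp
   moreover have "Tmat v ** g = h ** Tmat (\<sigma> v)" by (simp add: h_def mat2_eq_iff algebra_simps)
   moreover have "h \<in> Gamma0 4" by (rule Gamma0_mono[OF _ h]) simp
   moreover have "js k g (js k (Tmat v) F) = js k (Tmat v ** g) F"
    by (rule js_mult[OF Gamma0_4_gens(1) g4 Fup])
   moreover have "js k (Tmat (\<sigma> v)) (js k h F) = js k (h ** Tmat (\<sigma> v)) F"
    by (rule js_mult[OF Gamma0_mono[OF _ h] Gamma0_4_gens(1) Fup]) simp
   ultimately show ?thesis by simp
  qed
  have inj: "[u = v] (mod q)" if "[\<sigma> u = \<sigma> v] (mod q)" for u v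
  proof -
   have "q dvd (\<sigma> u - \<sigma> v)" using that by (simp add: cong_iff_dvd_diff)
   \<comment> \<open>Eliminating between the two congruences leaves (u - v) (a d - b c), and the
     determinant is 1.\<close>
   moreover have "(u - v) = ((b + u * d) - \<sigma> u * (a + u * c)) * (a + v * c) - ((b + v * d) - \<sigma> v * (a + v * c)) * (a + u * c)
     + (\<sigma> u - \<sigma> v) * ((a + u * c) * (a + v * c))"
   proof -
    have "((b + u * d) - \<sigma> u * (a + u * c)) * (a + v * c) - ((b + v * d) - \<sigma> v * (a + v * c)) * (a + u * c)
     + (\<sigma> u - \<sigma> v) * ((a + u * c) * (a + v * c)) = (u - v) * (a * d - b * c)" by (simp add: algebra_simps)
    thus ?thesis using det by simp
   qed
   ultimately have "q dvd u - v" using \<sigma>[of u] \<sigma>[of v] by (metis dvd_add dvd_diff dvd_mult2)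
   thus ?thesis by (simp add: cong_iff_dvd_diff)
  qed
  have "js k g S = (\<lambda>z. \<Sum>v\<in>{0..<q}. js k (Tmat (\<sigma> v)) F z)" unfolding S_def js_lin move ..
  also have "... = S" unfolding S_def
   by (rule ext, rule sum_residues[of q "\<lambda>v. js k (Tmat v) F z" for z]) (use per q inj in auto)
  finally show ?thesis .
 qed
 moreover have "S \<in> cusp_space k" unfolding S_def
  by (intro cusp_space_sum js_in_cusp_space[OF Fc] Gamma0_4_gens)
 ultimately show ?thesis unfolding U by (intro cusp_forms_cmult N4) (simp add: cusp_forms_eq)
qed

subsection \<open>The operators at odd primes\<close>

lemma js_1: "js k (mat 1) f = f"
 using js_Tmat[of k 0 f] by (simp add: js_def mact_mat theta_factor_den den_def theta_eps_def)

text \<open>Squaring identifies 1 and p - 1, so it is not injective on the nonzero residues and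
  therefore not onto.\<close>

lemma exists_nonresidue:
 assumes "prime p" "p > (2::nat)" obtains r where "Legendre r (int p) = -1"
proof -
 define A where "A = {1..<int p}"
 define s where "s x = x * x mod int p" for x
 have fin: "finite A" by (simp add: A_def)
 have sA: "s ` A \<subseteq> A"
 proof
  fix y assume "y \<in> s ` A"
  then obtain x where x: "x \<in> A" "y = s x" by blast
  hence "\<not> int p dvd x" by (auto simp: A_def zdvd_not_zless)
  hence "\<not> int p dvd x * x" using assms(1) by (simp add: prime_dvd_mult_iff)
  hence "y \<noteq> 0" unfolding x s_def by (simp add: dvd_eq_mod_eq_0)
  moreover have "0 \<le> y" "y < int p" unfolding x s_def using assms by auto
  ultimately show "y \<in> A" by (simp add: A_def)
 qed
 have "\<not> inj_on s A"
 proof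
  assume inj: "inj_on s A"
  have "(int p - 1) * (int p - 1) = 1 + int p * (int p - 2)" by (simp add: algebra_simps)
  hence "s (int p - 1) = s 1" by (simp add: s_def)
  moreover have "int p - 1 \<in> A" "1 \<in> A" using assms by (auto simp: A_def)
  ultimately have "int p - 1 = 1" using inj by (meson inj_onD)
  thus False using assms by simp
 qed
 hence "s ` A \<noteq> A" using fin eq_card_imp_inj_on[of A s] by auto
 then obtain r where r: "r \<in> A" "r \<notin> s ` A" using sA by blast
 have "\<not> QuadRes (int p) r"
 proof
  assume "QuadRes (int p) r"
  then obtain y where y: "[y\<^sup>2 = r] (mod int p)" by (auto simp: QuadRes_def)
  define x where "x = y mod int p"
  have "x * x mod int p = y\<^sup>2 mod int p" by (simp add: x_def mod_mult_eq power2_eq_square)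
  also have "... = r" using y r by (simp add: cong_def A_def)
  finally have sx: "s x = r" by (simp add: s_def)
  have "x \<noteq> 0" using sx r by (auto simp: s_def A_def)
  moreover have "0 \<le> x" "x < int p" using assms by (auto simp: x_def)
  ultimately have "x \<in> A" by (simp add: A_def)
  thus False using sx r by blast
 qed
 moreover have "\<not> [r = 0] (mod int p)" using r by (auto simp: cong_def A_def)
 ultimately show ?thesis using that[of r] by (simp add: Legendre_def)
qed

locale odd_prime_level =
 fixes k M p :: nat and m n :: int
 assumes odd_M: "odd M" and prime_p: "prime p" and p_dvd_M: "p dvd M"
  and bezout: "int p * n - 4 * int (M div p) * m = 1"
begin

abbreviation "q \<equiv> int p"
abbreviation "L \<equiv> int (M div p)"

lemma M_eq: "int M = q * L" using p_dvd_M by (simp flip: of_nat_mult)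

lemma L_pos: "L > 0" and M_pos: "M > 0"
proof -
 show "M > 0" using odd_M by (intro Nat.gr0I) auto
 hence "0 < q * L" using M_eq by simp
 thus "L > 0" by (simp add: zero_less_mult_iff)
qed

lemma p_odd: "odd p" "p > 2" "odd q"
proof -
 show "odd p" using odd_M p_dvd_M dvd_trans by blast
 thus "odd q" by simp
 show "p > 2" using \<open>odd p\<close> prime_ge_2_nat[OF prime_p] by (cases "p = 2") auto
qed

lemma q_pos: "q > 0" using p_odd by simp

lemma four_Lm: "4 * L * m = q * n - 1" using bezout by simp

text \<open>By \<open>bezout\<close>, -m is an inverse of 4 L mod p.\<close>

lemma not_dvd_L: "\<not> q dvd 4 * L * x" if "\<not> q dvd x"
proof
 assume "q dvd 4 * L * x"
 hence "q dvd 4 * L * m * x" by (metis dvd_mult2 mult.assoc mult.commute)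
 hence "q dvd q * (n * x) - 4 * L * m * x" by simp
 also have "q * (n * x) - 4 * L * m * x = x" unfolding four_Lm by (simp add: algebra_simps)
 finally show False using that by simp
qed

abbreviation "Sk \<equiv> cusp_forms k (4 * M)"
abbreviation "N0 \<equiv> 16 * M"
abbreviation "GL \<equiv> Gamma0 (4 * (M div p))"

lemma N0: "N0 > 0" "4 dvd N0" "4 * M dvd N0" using M_pos by auto

lemma Sk: "f \<in> Sk \<Longrightarrow> f \<in> cusp_space k" "f \<in> Sk \<Longrightarrow> A \<in> Gamma0 (4 * M) \<Longrightarrow> js k A f = f"
 by (auto simp: cusp_forms_eq)

lemma SkI: "f \<in> cusp_space k \<Longrightarrow> (\<And>A. A \<in> Gamma0 (4 * M) \<Longrightarrow> js k A f = f) \<Longrightarrow> f \<in> Sk"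
 by (auto simp: cusp_forms_eq)

lemma Sk_Vsp: "f \<in> Sk \<Longrightarrow> f \<in> Vsp k N0" by (rule cusp_forms_Vsp) (use N0 in auto)

text \<open>Rescaling by \<open>p\<close> moves the translation by \<open>m/p\<close> into \<open>\<Gamma>\<^sub>0(4)\<close>.\<close>

abbreviation "D \<equiv> aff 1 0 q"

lemma D_cusp: "f \<in> cusp_space k \<Longrightarrow> D f \<in> cusp_space k" by (rule aff_in_cusp_space) (use q_pos in auto)

lemma D_inj: "D f = D g \<Longrightarrow> f = g"
proof
 fix z assume "D f = D g"
 hence "D f (of_int q * z) = D g (of_int q * z)" by simp
 thus "f z = g z" using q_pos by (simp add: aff_def)
qed

abbreviation "J d \<equiv> jacobi q (nat \<bar>d\<bar>)"

text \<open>By reciprocity \<open>J d\<close> is a function of d mod 4 and d mod p.\<close>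

lemma J_cong:
 assumes "odd d" "odd d'" "[d = d'] (mod 4)" "coprime q d" "[d = d'] (mod q)" shows "J d = J d'"
proof -
 have "coprime q d'" using assms(4,5) by (metis cong_imp_coprime coprime_commute)
 thus ?thesis
  using jacobi_reciprocity_int[OF p_odd(1) assms(1)] jacobi_reciprocity_int[OF p_odd(1) assms(2)] assms
   recip_sign_cong[OF assms(3)] jacobi_cong[OF p_odd(1) assms(5)] by simp
qed

lemma J_legendre:
 assumes "[d = 1] (mod 4)" "coprime q d" shows "J d = Legendre d q"
proof -
 have d4: "d mod 4 = 1" using assms(1) by (simp add: cong_def)
 hence "odd d" by presburger
 moreover have "recip_sign q d = 1" using d4 by (simp add: recip_sign_def chi4_def)
 ultimately show ?thesis using jacobi_reciprocity_int[OF p_odd(1), of d] assms jacobi_prime[OF prime_p] by simp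
qed

text \<open>Conjugation by diag(1, p) carries the matrices of \<open>Gamma0 (4 L)\<close> with p
  dividing b into \<open>Gamma0 (4 M)\<close>, where f is fixed; the price is the character
  (p/d).\<close>

lemma D_transform:
 assumes f: "f \<in> Sk" and A: "A \<in> GL" and b: "q dvd A $ 1 $ 2"
 shows "js k A (D f) = (\<lambda>z. of_int (J (A $ 2 $ 2)) * D f z)"
proof -
 have A4: "A \<in> Gamma0 4" by (rule Gamma0_mono[OF _ A]) simp
 have "int (4 * M) dvd q * A $ 2 $ 1" using Gamma0_props(2)[OF A] M_eq by (simp add: mult.assoc mult.left_commute[of 4])
 hence "mat2 (A $ 1 $ 1) (A $ 1 $ 2 div q) (q * A $ 2 $ 1) (A $ 2 $ 2) \<in> Gamma0 (4 * M)"
  using js_aff_diag(2)[OF A4 q_pos b] by (simp add: Gamma0_def)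
 thus ?thesis using js_aff_diag(1)[OF A4 q_pos b, of k f] Sk(2)[OF f] by simp
qed

lemma D_transform_1:
 assumes "f \<in> Sk" "A \<in> GL" "q dvd A $ 1 $ 2" "[A $ 2 $ 2 = 1] (mod 4)" "[A $ 2 $ 2 = 1] (mod q)"
 shows "js k A (D f) = D f"
proof -
 have "odd (A $ 2 $ 2)" using assms(4) unfolding cong_def by presburger
 moreover have "coprime q (A $ 2 $ 2)" using assms(5) by (metis cong_imp_coprime cong_sym coprime_1_right coprime_commute)
 ultimately have "J (A $ 2 $ 2) = J 1" by (intro J_cong) (use assms in auto)
 thus ?thesis using D_transform[OF assms(1-3)] by simp
qed

lemma D_Vsp: assumes "f \<in> Sk" shows "D f \<in> Vsp k N0"
proof -
 have "js k A (D f) = D f" if A: "A \<in> GammaN N0" for A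
 proof (rule D_transform_1[OF assms])
  have d: "int N0 dvd A $ 1 $ 2" "int N0 dvd A $ 2 $ 1" "int N0 dvd A $ 2 $ 2 - 1" using A by (auto simp: GammaN_def)
  have e: "int N0 = q * (16 * L)" "int N0 = 4 * L * (4 * q)" "int N0 = 4 * (4 * int M)" using M_eq by auto
  show "q dvd A $ 1 $ 2" "[A $ 2 $ 2 = 1] (mod q)" using d e(1) unfolding cong_iff_dvd_diff by (metis dvd_mult_left)+
  show "[A $ 2 $ 2 = 1] (mod 4)" using d e(3) unfolding cong_iff_dvd_diff by (metis dvd_mult_left)
  have "4 * L dvd A $ 2 $ 1" using d e(2) by (metis dvd_mult_left)
  thus "A \<in> GL" using A by (simp add: GammaN_def Gamma0_def)
 qed
 thus ?thesis using D_cusp[OF Sk(1)[OF assms]] by (simp add: Vsp_def)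
qed

text \<open>The constant p^(k + 1/2) comes from the power of Im z. Self-adjointness and unitarity of
  W may therefore be tested after rescaling.\<close>

lemma ip_D:
 obtains c :: complex where "c \<noteq> 0" "\<And>f g. f \<in> Sk \<Longrightarrow> g \<in> Sk \<Longrightarrow> ip k N0 (D f) (D g) = c * ip k N0 f g"
proof -
 define c where "c = complex_of_real (of_int q powr (real k + 1/2))"
 have c0: "c \<noteq> 0" using q_pos by (simp add: c_def)
 have "Phi k (D f) (D g) z = c * Phi k f g (mact (mat2 1 0 0 q) z)" if "0 < Im z" for f g z
 proof -
  have w: "mact (mat2 1 0 0 q) z = z / of_int q" by (simp add: mact_eq den_def)
  have "Im z powr (real k + 1/2) = of_int q powr (real k + 1/2) * (Im z / of_int q) powr (real k + 1/2)"
   using q_pos that by (subst powr_mult[symmetric]) auto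
  thus ?thesis unfolding w by (simp add: Phi_def aff_def c_def Im_divide_of_nat)
 qed
 thus ?thesis using that[of c] c0 ip_transform[OF N0(1,2), of "mat2 1 0 0 q"] q_pos Sk_Vsp D_Vsp by simp
qed

abbreviation "Lm u \<equiv> Lmat (4 * L * u)"

lemma Lm_Gamma0: "Lm u \<in> GL" "Lm u \<in> Gamma0 4" by (simp_all add: Gamma0_mat2)

lemma Tm_Gamma0: "Tmat u \<in> GL" by (simp add: Gamma0_mat2)

lemma Gamma0_L4: "A \<in> GL \<Longrightarrow> A \<in> Gamma0 4" by (rule Gamma0_mono[of 4 "4 * (M div p)"]) simp

text \<open>The summands of \<open>W_p2\<close> after rescaling by p (\<open>D_W\<close>).\<close>

definition E :: "(complex \<Rightarrow> complex) \<Rightarrow> int \<Rightarrow> complex \<Rightarrow> complex" where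
 "E f u = js k (Tmat m ** Lm u) (D f)"

lemma D_up: "f \<in> Sk \<Longrightarrow> \<not> 0 < Im z \<Longrightarrow> D f z = 0" using cusp_space_upper[OF D_cusp[OF Sk(1)]] .

lemma js_D_mult:
 "f \<in> Sk \<Longrightarrow> A \<in> GL \<Longrightarrow> B \<in> GL \<Longrightarrow> js k B (js k A (D f)) = js k (A ** B) (D f)"
 by (rule js_mult) (auto intro: Gamma0_L4 D_up)

lemma E_Vsp: "f \<in> Sk \<Longrightarrow> E f u \<in> Vsp k N0"
 unfolding E_def by (intro Vsp_js D_Vsp Gamma0_mult Gamma0_4_gens Lm_Gamma0 N0)

lemma J_cong_inverse:
 assumes "odd d" "odd d'" "[d = d'] (mod 4)" "[d * d' = 1] (mod q)" shows "J d = J d'"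
proof -
 have "coprime q (d * d')" using assms(4) by (metis cong_imp_coprime cong_sym coprime_1_right coprime_commute)
 hence c: "coprime q d" "coprime q d'" by auto
 have "jacobi d p * jacobi d' p = 1"
  using jacobi_mult_left[OF p_odd(1), of d d'] jacobi_cong[OF p_odd(1) assms(4)] p_odd by simp
 hence "jacobi d p = jacobi d' p" using jacobi_cases[OF p_odd(1), of d] jacobi_cases[OF p_odd(1), of d'] by auto
 thus ?thesis
  using jacobi_reciprocity_int[OF p_odd(1) assms(1)] jacobi_reciprocity_int[OF p_odd(1) assms(2)] c
   recip_sign_cong[OF assms(3)] by simp
qed

text \<open>Move A through T^m L_u: the remaining matrix g = T^m L_u A L_(-v) T^(-m) has upper right
  entry divisible by p precisely because of the congruence for v, so \<open>D_transform\<close>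
  applies. Its lower right entry is a mod p, inverse to d, and d mod 4, so it has the same symbol as
  d.\<close>

lemma E_transform:
 assumes f: "f \<in> Sk" and A: "A \<in> GL" and b: "q dvd A $ 1 $ 2"
  and v: "[v * A $ 2 $ 2 = A $ 2 $ 2 - A $ 1 $ 1 + u * A $ 1 $ 1 - m * A $ 2 $ 1] (mod q)"
 shows "js k A (E f u) = (\<lambda>z. of_int (J (A $ 2 $ 2)) * E f v z)"
proof -
 define a b c d where abcd: "a = A $ 1 $ 1" "b = A $ 1 $ 2" "c = A $ 2 $ 1" "d = A $ 2 $ 2"
 have A_eq: "A = mat2 a b c d" by (simp add: abcd mat2_eq_iff)
 have det: "a * d - b * c = 1" using Gamma0_props(1)[OF A] by (simp add: abcd)
 have c4: "4 dvd c" "odd d" using Gamma0_4_odd[OF Gamma0_L4[OF A]] by (auto simp: abcd)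
 obtain b' where b': "b = q * b'" using b by (auto simp: abcd)
 obtain c' where c': "c = 4 * c'" using c4 by blast
 have "q dvd v * d - (d - a + u * a - m * c)" using v by (simp add: abcd cong_iff_dvd_diff)
 then obtain t where "v * d - (d - a + u * a - m * c) = q * t" by blast
 hence t: "v * d = d - a + u * a - m * c + q * t" by simp
 define g where "g = Tmat m ** Lm u ** A ** Lm (- v) ** Tmat (- m)"
 have g: "g \<in> GL" unfolding g_def by (intro Gamma0_mult Tm_Gamma0 Lm_Gamma0 A)
 have eq: "Tmat m ** Lm u ** A = g ** (Tmat m ** Lm v)"
  by (simp add: g_def A_eq mat2_eq_iff mat2_mult algebra_simps)
 have "g $ 1 $ 2 = b * (1 + m * (4 * L * v) + m * (4 * L * u) + m * (4 * L * u) * (m * (4 * L * v))) + m * (d - a) - m * m * c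
   - m * (4 * L * m) * (u * a) + m * (4 * L * m) * (v * d)"
  by (simp add: g_def A_eq mat2_mult algebra_simps)
 also have "... = q * (b' * (1 + m * (4 * L * v) + m * (4 * L * u) + m * (4 * L * u) * (m * (4 * L * v))) - m * t + m * n * (v * d - u * a))"
  unfolding four_Lm b' t by (simp add: algebra_simps)
 finally have g12: "q dvd g $ 1 $ 2" by simp
 have g22': "g $ 2 $ 2 = d + b * (4 * L * u) * (1 + m * (4 * L * v)) - 4 * L * m * (u * a) - m * c + 4 * L * m * (v * d)"
  by (simp add: g_def A_eq mat2_mult algebra_simps)
 also have "... = a + q * (b' * (4 * L * u) * (1 + m * (4 * L * v)) - t + n * (v * d - u * a))"
  unfolding four_Lm b' t by (simp add: algebra_simps)
 finally have g22: "[g $ 2 $ 2 = a] (mod q)" by (simp add: cong_iff_dvd_diff)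
 have "g $ 2 $ 2 - d = 4 * (b * (L * u) * (1 + m * (4 * L * v)) - L * m * (u * a) - m * c' + L * m * (v * d))"
  unfolding g22' c' by (simp add: algebra_simps)
 hence g4: "[g $ 2 $ 2 = d] (mod 4)" by (simp add: cong_iff_dvd_diff)
 have "[g $ 2 $ 2 * d = a * d] (mod q)" using g22 by (intro cong_mult) auto
 moreover have "a * d - 1 = q * (b' * c)" using det b' by (simp add: algebra_simps)
 hence "[a * d = 1] (mod q)" unfolding cong_iff_dvd_diff by simp
 ultimately have "[g $ 2 $ 2 * d = 1] (mod q)" by (rule cong_trans)
 hence "J (g $ 2 $ 2) = J d"
  using Gamma0_4_odd(2)[OF Gamma0_L4[OF g]] c4(2) g4 by (intro J_cong_inverse)
 hence Dg: "js k g (D f) = (\<lambda>z. of_int (J d) * D f z)" using D_transform[OF f g g12] by simp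
 have "js k A (E f u) = js k (g ** (Tmat m ** Lm v)) (D f)" unfolding E_def
  using js_D_mult[OF f _ A, of "Tmat m ** Lm u"] by (simp add: eq Gamma0_mult Tm_Gamma0 Lm_Gamma0)
 also have "... = js k (Tmat m ** Lm v) (js k g (D f))"
  by (rule js_D_mult[OF f g, symmetric]) (intro Gamma0_mult Tm_Gamma0 Lm_Gamma0)
 finally show ?thesis unfolding Dg E_def by (simp add: js_lin abcd)
qed

lemma E_cong: assumes "f \<in> Sk" "[u = v] (mod q)" shows "E f u = E f v"
proof -
 have "mat 1 \<in> GL" by (rule Gamma0_1)
 thus ?thesis
  using E_transform[OF assms(1), of "mat 1" v u] assms(2) js_1[of k "E f u"] by (simp add: mat_nth2 cong_sym_eq)
qed
end

section \<open>The operator W at an odd prime: level, self-adjointness, unitarity\<close>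

lemma mat_act_mat2: "mat_act (mat2 a b c d) z = (of_real a * z + of_real b) / (of_real c * z + of_real d)"
 by (simp add: mat_act_def moebius_def)

lemma slash_alt: "0 < Im z \<Longrightarrow> slash k (A, \<phi>) f z = f (mat_act A z) / \<phi> z ^ (2 * k + 1)"
proof -
 have "- 2 * int k - 1 = - int (2 * k + 1)" by simp
 thus "0 < Im z \<Longrightarrow> ?thesis" by (simp only: slash_def power_int_minus power_int_of_nat) (simp add: field_simps)
qed

context odd_prime_level
begin

definition cW :: complex where
 "cW = cnj (theta_eps q) / of_real (sqrt (real p)) * of_int (Legendre (-1) q) * of_int (Legendre L q)"

abbreviation "W \<equiv> W_p2 k M p m n"

lemma Legendre_L: "Legendre L q = 1 \<or> Legendre L q = -1"
proof -
 have "\<not> [L = 0] (mod q)" using not_dvd_L[of 1] p_odd(2) by (auto simp: cong_iff_dvd_diff zdvd_not_zless)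
 thus ?thesis using Legendre_cases[of L q] by (auto simp: Legendre_def)
qed

lemma Legendre_m1: "Legendre (-1) q = (if q mod 4 = 1 then 1 else -1)"
 using Legendre_minus1[OF prime_p p_odd(2)] p_odd(3) by (simp add: chi4_def)

text \<open>The square of \<open>theta_eps p\<close> is (-1/p); this phase of the constant is what
  makes W self-adjoint.\<close>

lemma cnj_cW: "cnj cW * of_int (Legendre (-1) q) = cW" by (simp add: cW_def Legendre_m1 theta_eps_def)

lemma cmod_cW: "cW * cnj cW * of_int q = 1"
proof -
 have p0: "real p > 0" using q_pos by simp
 have "cW * cnj cW = (theta_eps q * cnj (theta_eps q)) * (of_int (Legendre (-1) q))\<^sup>2 * (of_int (Legendre L q))\<^sup>2
   / (of_real (sqrt (real p)))\<^sup>2" by (simp add: cW_def power2_eq_square)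
 also have "theta_eps q * cnj (theta_eps q) = 1" by (simp add: theta_eps_def)
 also have "(of_int (Legendre (-1) q))\<^sup>2 = (1::complex)" by (simp add: Legendre_m1)
 also have "(of_int (Legendre L q))\<^sup>2 = (1::complex)" using Legendre_L by auto
 also have "(of_real (sqrt (real p)))\<^sup>2 = (complex_of_real (real p))"
  using p0 by (simp flip: of_real_power)
 finally show ?thesis using p0 by simp
qed

lemma E_value:
 assumes f: "f \<in> Sk" and z: "0 < Im z"
 shows "E f u z = D f (mact (Lm u) z + of_int m) / csqrt (of_int (4 * L * u) * z + 1) ^ (2 * k + 1)"
proof -
 have "E f u z = js k (Lm u) (js k (Tmat m) (D f)) z" unfolding E_def
  using js_D_mult[OF f Tm_Gamma0 Lm_Gamma0(1)] by simp
 thus ?thesis by (simp only: js_Tmat js_def[of k "Lm u"] theta_factor_Lmat)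
qed

lemma E_up: "f \<in> Sk \<Longrightarrow> \<not> 0 < Im z \<Longrightarrow> E f u z = 0"
 using E_Vsp[of f u] cusp_space_upper by (auto simp: Vsp_def)

text \<open>By \<open>bezout\<close> each matrix in \<open>W_p2\<close> factors as (p, m; 0, p)
  times (1, 0; 4 M (1 - s), 1): a translation by m/p followed by an element of
  \<open>Gamma0 4\<close> with trivial symbol.\<close>

lemma W_js: assumes f: "f \<in> Sk"
 shows "W f = (\<lambda>z. cW * (\<Sum>s\<in>{0..<q}. js k (Lmat (4 * (int M * (1 - s)))) (aff q m q f) z))"
proof
 fix z
 show "W f z = cW * (\<Sum>s\<in>{0..<q}. js k (Lmat (4 * (int M * (1 - s)))) (aff q m q f) z)"
 proof (cases "0 < Im z")
  case False
  have "js k (Lmat (4 * (int M * (1 - s)))) (aff q m q f) z = 0" for s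
   by (rule cusp_space_upper[where k = k, OF _ False]) (intro js_in_cusp_space aff_in_cusp_space Sk f q_pos Gamma0_4_gens)
  thus ?thesis using False by (simp add: W_p2_def slash_def)
 next
  case z: True
  have q0: "complex_of_int q \<noteq> 0" using q_pos by simp
  have "slash k (mat2 (of_int (q\<^sup>2 * n - 4 * int M * m * s)) (of_int m) (of_int (4 * q * int M * (1 - s))) (of_int q),
      \<lambda>z. csqrt (of_int (4 * int M * (1 - s)) * z + 1)) f z = js k (Lmat (4 * (int M * (1 - s)))) (aff q m q f) z" for s
  proof -
   define y where "y = complex_of_int (4 * (int M * (1 - s))) * z + 1"
   have y0: "y \<noteq> 0" using den_nonzero[OF z, of "Lmat (4 * (int M * (1 - s)))"] by (simp add: y_def den_def)
   have e2: "complex_of_int (4 * q * int M * (1 - s)) * z + of_int q = of_int q * y"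
    unfolding y_def by (simp add: algebra_simps)
   have qn: "q * n = 1 + 4 * L * m" using bezout by simp
   have "q\<^sup>2 * n - 4 * int M * m * s = q * (q * n - 4 * L * m * s)"
    unfolding M_eq by (simp add: power2_eq_square algebra_simps)
   hence e3': "q\<^sup>2 * n - 4 * int M * m * s = q + m * (4 * (int M * (1 - s)))"
    unfolding qn M_eq by (simp add: algebra_simps)
   have e3: "complex_of_int (q\<^sup>2 * n - 4 * int M * m * s) * z + of_int m = of_int q * z + of_int m * y"
    unfolding e3' y_def by (simp add: algebra_simps)
   have "mact (Lmat (4 * (int M * (1 - s)))) z = z / y" by (simp add: mact_eq den_def y_def)
   hence e4: "(of_int q * mact (Lmat (4 * (int M * (1 - s)))) z + of_int m) / of_int q = (of_int q * z + of_int m * y) / (of_int q * y)"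
    using q0 y0 by (simp add: field_simps)
   have e1: "of_int (4 * int M * (1 - s)) * z + 1 = y" unfolding y_def by (simp add: mult.assoc)
   show ?thesis
    unfolding slash_alt[OF z] mat_act_mat2 of_real_of_int_eq e1 e2 e3 js_def theta_factor_Lmat y_def[symmetric] aff_def e4 ..
  qed
  moreover have "{0..q - 1} = {0..<q}" by auto
  ultimately show ?thesis by (simp add: W_p2_def cW_def)
 qed
qed

lemma D_W: assumes f: "f \<in> Sk" shows "D (W f) = (\<lambda>z. cW * (\<Sum>u\<in>{0..<q}. E f u z))"
proof
 fix z
 have tm: "js k (Lmat (4 * (int M * u))) (aff q m q f) (z / of_int q) = E f u z" for u
 proof (cases "0 < Im z")
  case False
  hence F: "\<not> 0 < Im (z / of_int q)" using q_pos by (simp add: Im_divide_of_nat zero_less_divide_iff)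
  have "js k (Lmat (4 * (int M * u))) (aff q m q f) (z / of_int q) = 0"
   by (rule cusp_space_upper[where k = k, OF _ F]) (intro js_in_cusp_space aff_in_cusp_space Sk f q_pos Gamma0_4_gens)
  thus ?thesis using E_up[OF f False] by simp
 next
  case z: True
  have q0: "complex_of_int q \<noteq> 0" using q_pos by simp
  define y where "y = complex_of_int (4 * L * u) * z + 1"
  have y: "of_int (4 * (int M * u)) * (z / of_int q) + 1 = y" unfolding M_eq y_def using q0 by simp
  have "mact (Lmat (4 * (int M * u))) (z / of_int q) = z / of_int q / y"
   by (simp only: mact_eq den_def mat2_nth y of_int_1 of_int_0 mult_1 add_0_right)
  moreover have "mact (Lm u) z = z / y" by (simp add: mact_eq den_def y_def)
  ultimately show ?thesis
   unfolding E_value[OF f z] js_def theta_factor_Lmat y y_def[symmetric] aff_def using q0 by simp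
 qed
 have "D (W f) z = cW * (\<Sum>s\<in>{0..<q}. E f (1 - s) z)"
 proof -
  have "D g z = g (z / of_int q)" for g by (simp add: aff_def)
  thus ?thesis unfolding W_js[OF f] by (simp only: tm)
 qed
 also have "(\<Sum>s\<in>{0..<q}. E f (1 - s) z) = (\<Sum>s\<in>{0..<q}. E f s z)"
  by (rule sum_residues[of q "\<lambda>u. E f u z" "\<lambda>s. 1 - s"])
   (use E_cong[OF f] q_pos cong_diff[OF cong_refl[of 1 q]] in \<open>auto dest: cong_diff[OF cong_refl[of 1 q]]\<close>)
 finally show "D (W f) z = cW * (\<Sum>u\<in>{0..<q}. E f u z)" .
qed

lemma D_cuspD: assumes "D h \<in> cusp_space k" shows "h \<in> cusp_space k"
proof -
 have "h = aff q 0 1 (D h)" using q_pos by (simp add: aff_def fun_eq_iff)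
 thus ?thesis using aff_in_cusp_space[OF assms, of q 1 0] q_pos by simp
qed

text \<open>A sends E_u to E at a (d - a + u a - m c), a bijection mod p because a is a unit there,
  and all summands acquire the same factor (p/d).\<close>

lemma sumE_transform:
 assumes f: "f \<in> Sk" and A: "A \<in> GL" and b: "q dvd A $ 1 $ 2"
 shows "js k A (\<lambda>z. \<Sum>u\<in>{0..<q}. E f u z) = (\<lambda>z. of_int (J (A $ 2 $ 2)) * (\<Sum>u\<in>{0..<q}. E f u z))"
proof -
 define a c d where acd: "a = A $ 1 $ 1" "c = A $ 2 $ 1" "d = A $ 2 $ 2"
 obtain b' where b': "A $ 1 $ 2 = q * b'" using b by blast
 have det: "a * d = 1 + q * (b' * c)" using Gamma0_props(1)[OF A] b' by (simp add: acd algebra_simps)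
 define \<sigma> :: "int \<Rightarrow> int" where "\<sigma> u = a * (d - a + u * a - m * c)" for u
 have 1: "js k A (E f u) = (\<lambda>z. of_int (J d) * E f (\<sigma> u) z)" for u unfolding acd(3)
 proof (rule E_transform[OF f A b])
  have "\<sigma> u * d = (d - a + u * a - m * c) * (a * d)" by (simp add: \<sigma>_def)
  also have "... = (d - a + u * a - m * c) + q * (b' * c * (d - a + u * a - m * c))"
   unfolding det by (simp add: algebra_simps)
  finally show "[\<sigma> u * A $ 2 $ 2 = A $ 2 $ 2 - A $ 1 $ 1 + u * A $ 1 $ 1 - m * A $ 2 $ 1] (mod q)"
   by (simp add: acd cong_iff_dvd_diff)
 qed
 have "(\<Sum>u\<in>{0..<q}. E f (\<sigma> u) z) = (\<Sum>u\<in>{0..<q}. E f u z)" for z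
 proof (rule sum_residues[of q "\<lambda>u. E f u z" \<sigma>])
  show "[u = v] (mod q)" if "[\<sigma> u = \<sigma> v] (mod q)" for u v
  proof -
   have "q dvd \<sigma> u - \<sigma> v" using that by (simp only: cong_iff_dvd_diff)
   also have "\<sigma> u - \<sigma> v = a * (a * (u - v))" by (simp add: \<sigma>_def algebra_simps)
   finally have h: "q dvd a * (a * (u - v))" .
   have "coprime q a"
   proof (rule coprimeI)
    fix x assume x: "x dvd q" "x dvd a"
    hence "x dvd a * d - q * (b' * c)" by (intro dvd_diff dvd_mult2)
    thus "is_unit x" unfolding det by simp
   qed
   thus ?thesis using h by (simp add: coprime_dvd_mult_right_iff cong_iff_dvd_diff)
  qed
 qed (use E_cong[OF f] q_pos in auto)
 thus ?thesis unfolding js_lin 1 by (simp add: fun_eq_iff acd sum_distrib_left[symmetric])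
qed

text \<open>A matrix A of level 4 M is conjugate by diag(1, p) to a matrix B of level 4 L with p
  dividing its upper right entry. The character of D (W f) under B is the one that
  \<open>js_aff_diag\<close> produces, so it cancels and D can be undone.\<close>

lemma W_Sk: assumes f: "f \<in> Sk" shows "W f \<in> Sk"
proof (rule SkI)
 have "D (W f) \<in> cusp_space k" unfolding D_W[OF f]
  using E_Vsp[OF f] by (intro cusp_space_cmult cusp_space_sum) (auto simp: Vsp_def)
 thus "W f \<in> cusp_space k" by (rule D_cuspD)
 fix A assume A: "A \<in> Gamma0 (4 * M)"
 define B where "B = mat2 (A $ 1 $ 1) (q * A $ 1 $ 2) (A $ 2 $ 1 div q) (A $ 2 $ 2)"
 have "4 * int M dvd A $ 2 $ 1" using Gamma0_props(2)[OF A] by simp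
 then obtain c where "A $ 2 $ 1 = 4 * int M * c" by blast
 hence c: "A $ 2 $ 1 = q * (4 * L * c)" by (simp add: M_eq)
 have B: "B \<in> GL" using Gamma0_props(1)[OF A] q_pos by (simp add: B_def Gamma0_mat2 c mult_ac)
 have b: "q dvd B $ 1 $ 2" by (simp add: B_def)
 have A_eq: "mat2 (B $ 1 $ 1) (B $ 1 $ 2 div q) (q * B $ 2 $ 1) (B $ 2 $ 2) = A"
  using q_pos by (simp add: B_def mat2_eq_iff c)
 have "js k B (D (W f)) = (\<lambda>z. of_int (J (B $ 2 $ 2)) * D (W f) z)"
  unfolding D_W[OF f] js_lin(2) sumE_transform[OF f B b] by (simp add: fun_eq_iff)
 moreover have "js k B (D (W f)) = (\<lambda>z. of_int (J (B $ 2 $ 2)) * D (js k A (W f)) z)"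
  using js_aff_diag(1)[OF Gamma0_L4[OF B] q_pos b, of k "W f"] unfolding A_eq .
 moreover have "J (B $ 2 $ 2) \<noteq> 0" using js_aff_diag(3)[OF Gamma0_L4[OF B] q_pos b] by auto
 ultimately have "D (js k A (W f)) = D (W f)" by (simp add: fun_eq_iff)
 thus "js k A (W f) = W f" by (rule D_inj)
qed

abbreviation "ipN \<equiv> ip k N0"

lemma Vsp_DTm: "f \<in> Sk \<Longrightarrow> js k (Tmat u) (D f) \<in> Vsp k N0" by (intro Vsp_js D_Vsp Gamma0_4_gens N0)

lemma js_Lm_D: "f \<in> Sk \<Longrightarrow> js k (Lm u) (D f) = D f" by (rule D_transform_1) (auto simp: Lm_Gamma0)

lemma ip_Lm: "f \<in> Vsp k N0 \<Longrightarrow> g \<in> Sk \<Longrightarrow> ipN (js k (Lm u) f) (D g) = ipN f (D g)"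
 using ip_js[OF N0(1,2) _ D_Vsp Lm_Gamma0(2), of f g u] js_Lm_D[of g u] by simp

text \<open>L_u fixes D g, so all p summands of W have the same product with D g, and W is reduced
  to a single translation by m.\<close>

lemma ip_E: assumes "f \<in> Sk" "g \<in> Sk" shows "ipN (E f u) (D g) = ipN (js k (Tmat m) (D f)) (D g)"
proof -
 have "E f u = js k (Lm u) (js k (Tmat m) (D f))" unfolding E_def
  using js_D_mult[OF assms(1) Tm_Gamma0 Lm_Gamma0(1)] by simp
 thus ?thesis using ip_Lm[OF Vsp_DTm[OF assms(1)] assms(2)] by simp
qed

lemma ip_DW_left: assumes "f \<in> Sk" "g \<in> Sk"
 shows "ipN (D (W f)) (D g) = cW * of_int q * ipN (js k (Tmat m) (D f)) (D g)"
 unfolding D_W[OF assms(1)] ip_cmult_left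
 using ip_sum_left[OF N0(1,2) D_Vsp[OF assms(2)], of "{0..<q}" "E f"] E_Vsp[OF assms(1)]
 by (simp add: ip_E[OF assms])

text \<open>Both sides reduce by \<open>ip_DW_left\<close> to products with a translate, by m on the
  left and, after moving the translation across, by -m on the right. The two translates of D f
  differ by a matrix h acting through (-1/p) and by L_2, which is harmless; \<open>cnj_cW\<close>
  matches the constants.\<close>

lemma W_selfadjoint: assumes f: "f \<in> Sk" and g: "g \<in> Sk"
 shows "ipN (D (W f)) (D g) = ipN (D f) (D (W g))"
proof -
 \<comment> \<open>Chosen to solve T^(-m) = h T^m L_2. The 2 makes its lower right entry 1 + 2 (4 L
   m), which is -1 mod p.\<close>
 define h where "h = Tmat (- m) ** Lm (- 2) ** Tmat (- m)"
 have h: "h \<in> GL" unfolding h_def by (intro Gamma0_mult Tm_Gamma0 Lm_Gamma0)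
 have "h $ 1 $ 2 = - 2 * m * (1 + 4 * L * m)" and h22': "h $ 2 $ 2 = 1 + 2 * (4 * L * m)"
  by (simp_all add: h_def algebra_simps)
 hence h12: "q dvd h $ 1 $ 2" and h22: "[h $ 2 $ 2 = -1] (mod q)"
  unfolding four_Lm by (simp_all add: cong_iff_dvd_diff)
 have h4: "[h $ 2 $ 2 = 1] (mod 4)" unfolding h22' by (simp add: cong_iff_dvd_diff)
 have "coprime q (h $ 2 $ 2)" using h22 by (metis cong_imp_coprime cong_sym coprime_1_right coprime_commute coprime_minus_right_iff)
 hence "J (h $ 2 $ 2) = Legendre (-1) q" using J_legendre[OF h4] Legendre_cong[OF h22] by simp
 hence jh: "js k h (D f) = (\<lambda>z. of_int (Legendre (-1) q) * D f z)" using D_transform[OF f h h12] by simp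
 have "Tmat (- m) = h ** (Tmat m ** Lm 2)" by (simp add: h_def mat2_mult mat2_eq_iff algebra_simps)
 hence "js k (Tmat (- m)) (D f) = js k (Tmat m ** Lm 2) (js k h (D f))"
  using js_D_mult[OF f h Gamma0_mult[OF Tm_Gamma0 Lm_Gamma0(1)], of m 2] by (simp only:)
 hence Tm: "js k (Tmat (- m)) (D f) = (\<lambda>z. of_int (Legendre (-1) q) * E f 2 z)"
  unfolding jh js_lin E_def .
 have "ipN (D f) (D (W g)) = cnj (ipN (D (W g)) (D f))" by (rule ip_cnj)
 also have "... = cnj cW * of_int q * ipN (D f) (js k (Tmat m) (D g))"
  unfolding ip_DW_left[OF g f] by (simp add: ip_cnj[of k N0 "D f"])
 also have "ipN (D f) (js k (Tmat m) (D g)) = ipN (js k (Tmat m) (js k (Tmat (- m)) (D f))) (js k (Tmat m) (D g))"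
  by (simp add: js_Tmat)
 also have "... = ipN (js k (Tmat (- m)) (D f)) (D g)"
  by (rule ip_js[OF N0(1,2) Vsp_DTm[OF f] D_Vsp[OF g] Gamma0_4_gens(1)])
 also have "... = of_int (Legendre (-1) q) * ipN (js k (Tmat m) (D f)) (D g)"
  unfolding Tm ip_cmult_left ip_E[OF f g] ..
 also have "cnj cW * of_int q * (of_int (Legendre (-1) q) * ipN (js k (Tmat m) (D f)) (D g))
   = (cnj cW * of_int (Legendre (-1) q)) * of_int q * ipN (js k (Tmat m) (D f)) (D g)" by simp
 finally show ?thesis unfolding cnj_cW ip_DW_left[OF f g] ..
qed
end

context odd_prime_level
begin

lemma js_E_Lm:
 assumes "f \<in> Sk" shows "js k (Lm w) (E f u) = E f (u + w)"
proof -
 have "js k (Lm w) (E f u) = js k (Tmat m ** Lm u ** Lm w) (D f)" unfolding E_def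
  by (rule js_D_mult[OF assms Gamma0_mult[OF Tm_Gamma0 Lm_Gamma0(1)] Lm_Gamma0(1)])
 also have "Tmat m ** Lm u ** Lm w = Tmat m ** Lm (u + w)" by (simp add: mat2_eq_iff algebra_simps)
 finally show ?thesis unfolding E_def .
qed

lemma Lm_Tm_js: assumes "f \<in> Sk" shows "js k (Tmat (- m)) (E f 0) = D f"
 using js_E_Lm[OF assms, of 0 0] E_value[OF assms]
proof -
 have "E f 0 = js k (Tmat m) (D f)" by (simp add: E_def mat2_mult)
 thus ?thesis by (simp add: js_Tmat)
qed

text \<open>Slashing both arguments by L_(-v) and then by T^(-m) turns the second one into D g; only
  the difference u - v remains.\<close>

lemma ip_E_E: assumes f: "f \<in> Sk" and g: "g \<in> Sk"
 shows "ipN (E f u) (E g v) = ipN (js k (Tmat (- m)) (E f (u - v))) (D g)"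
proof -
 have "ipN (E f u) (E g v) = ipN (js k (Lm (- v)) (E f u)) (js k (Lm (- v)) (E g v))"
  by (rule ip_js[symmetric]) (intro N0 E_Vsp f g Lm_Gamma0)+
 also have "... = ipN (E f (u - v)) (E g 0)" unfolding js_E_Lm[OF f] js_E_Lm[OF g] by simp
 also have "... = ipN (js k (Tmat (- m)) (E f (u - v))) (js k (Tmat (- m)) (E g 0))"
  by (rule ip_js[symmetric]) (intro N0 E_Vsp f g Gamma0_4_gens)+
 finally show ?thesis unfolding Lm_Tm_js[OF g] .
qed

text \<open>Put Y_w = T^m L_w T^(-m). The matrix h = Y_(r u) L_(-\<kappa>) Y_(-u) has upper right
  entry divisible by p as soon as r u \<kappa> = r - 1 mod p, and then its lower right entry is
  inverse to r mod p. So h acts on D f by (r/p), while L_\<kappa> is invisible against D g.\<close>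

lemma ip_E_multiple:
 assumes f: "f \<in> Sk" and g: "g \<in> Sk" and r: "\<not> q dvd r" and u: "\<not> q dvd u"
 shows "ipN (js k (Tmat (- m)) (E f (r * u))) (D g) = of_int (Legendre r q) * ipN (js k (Tmat (- m)) (E f u)) (D g)"
proof -
 have "\<not> q dvd r * u" using r u prime_p by (simp add: prime_dvd_mult_iff)
 hence "coprime (r * u) q" using prime_p by (metis coprime_commute prime_imp_coprime prime_nat_int_transfer)
 then obtain k1 where "[r * u * k1 = 1] (mod q)" using cong_solve_coprime_int by blast
 hence "q dvd (r * u * k1 - 1) * (r - 1)" by (simp add: cong_iff_dvd_diff)
 then obtain t where t: "(r * u * k1 - 1) * (r - 1) = q * t" by blast
 \<comment> \<open>k1 is the inverse of r u mod p, so this is (r - 1) / (r u).\<close>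
 define \<kappa> where "\<kappa> = k1 * (r - 1)"
 have \<kappa>: "r * u * \<kappa> = r - 1 + q * t" unfolding \<kappa>_def using t by (simp add: algebra_simps)
 define Y where "Y w = Tmat m ** Lm w ** Tmat (- m)" for w
 have Y0: "Y w \<in> GL" for w unfolding Y_def by (intro Gamma0_mult Tm_Gamma0 Lm_Gamma0)
 have jY: "js k (Tmat (- m)) (E f w) = js k (Y w) (D f)" for w
  unfolding E_def Y_def by (rule js_D_mult[OF f Gamma0_mult[OF Tm_Gamma0 Lm_Gamma0(1)] Tm_Gamma0])
 define h where "h = Y (r * u) ** Lm (- \<kappa>) ** Y (- u)"
 have h: "h \<in> GL" unfolding h_def by (intro Gamma0_mult Y0 Lm_Gamma0)
 have eq: "Y (r * u) = h ** (Y u ** Lm \<kappa>)"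
  by (simp add: h_def Y_def mat2_mult mat2_eq_iff algebra_simps)
 define s where "s = 4 * L * m"
 have s: "s = q * n - 1" unfolding s_def by (rule four_Lm)
 have "h $ 1 $ 2 = m * ((1 + s * (r * u) + s * (r * u) * (s * \<kappa>)) * (s * u) - s * (r * u) * (1 + s * u))"
  by (simp add: h_def Y_def s_def mat2_mult algebra_simps)
 also have "... = m * (s * u) * (1 - r + s * s * (r * u * \<kappa>))" by (simp add: algebra_simps)
 also have "... = q * (m * (s * u) * (s * s * t + n * (q * n - 2) * (r - 1)))"
  unfolding \<kappa> s by (simp add: algebra_simps)
 finally have h12: "q dvd h $ 1 $ 2" by simp
 have h22: "h $ 2 $ 2 = s * u * (s * (r * u)) - s * u * (s * \<kappa>) * (1 - s * (r * u)) + (1 - s * (r * u)) * (1 + s * u)"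
  by (simp add: h_def Y_def s_def mat2_mult algebra_simps)
 have "h $ 2 $ 2 - 1 = 4 * (L * m * (u * (s * (r * u)) - u * (s * \<kappa>) * (1 - s * (r * u)) + u - r * u * (1 + s * u)))"
  unfolding h22 by (simp add: s_def algebra_simps)
 hence h4: "[h $ 2 $ 2 = 1] (mod 4)" by (simp add: cong_iff_dvd_diff)
 have "[s = -1] (mod q)" unfolding s by (simp add: cong_iff_dvd_diff)
 hence "[h $ 2 $ 2 = -1 * u * (-1 * (r * u)) - -1 * u * (-1 * \<kappa>) * (1 - -1 * (r * u)) + (1 - -1 * (r * u)) * (1 + -1 * u)] (mod q)"
  unfolding h22 by (intro cong_add cong_diff cong_mult cong_refl)
 hence "[r * h $ 2 $ 2 = r * (-1 * u * (-1 * (r * u)) - -1 * u * (-1 * \<kappa>) * (1 - -1 * (r * u)) + (1 - -1 * (r * u)) * (1 + -1 * u))] (mod q)"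
  by (rule cong_scalar_left)
 also have "r * (-1 * u * (-1 * (r * u)) - -1 * u * (-1 * \<kappa>) * (1 - -1 * (r * u)) + (1 - -1 * (r * u)) * (1 + -1 * u))
   = r - r * u + r * r * u - (r * u * \<kappa>) * (1 + r * u)" by (simp add: algebra_simps)
 also have "... = 1 + q * (- t * (1 + r * u))" unfolding \<kappa> by (simp add: algebra_simps)
 also have "[1 + q * (- t * (1 + r * u)) = 1] (mod q)" unfolding cong_iff_dvd_diff by simp
 finally have rh: "[r * h $ 2 $ 2 = 1] (mod q)" .
 hence "coprime (r * h $ 2 $ 2) q" using cong_imp_coprime[OF cong_sym[OF rh]] by simp
 hence cop: "coprime q (h $ 2 $ 2)" by (simp add: coprime_commute)
 have "QuadRes q 1" unfolding QuadRes_def by (rule exI[of _ 1]) simp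
 hence L1: "Legendre 1 q = 1" using p_odd(2) by (simp add: Legendre_def cong_iff_dvd_diff)
 have "Legendre r q * Legendre (h $ 2 $ 2) q = 1"
  using Legendre_mult[OF prime_p p_odd(2), of r "h $ 2 $ 2"] Legendre_cong[OF rh] by (simp add: L1)
 hence "Legendre (h $ 2 $ 2) q = Legendre r q" using Legendre_cases[of r q] Legendre_cases[of "h $ 2 $ 2" q] by auto
 hence "J (h $ 2 $ 2) = Legendre r q" using J_legendre[OF h4 cop] by simp
 hence jh: "js k h (D f) = (\<lambda>z. of_int (Legendre r q) * D f z)" using D_transform[OF f h h12] by simp
 have "js k (Y (r * u)) (D f) = js k (Y u ** Lm \<kappa>) (js k h (D f))"
  unfolding eq by (rule js_D_mult[OF f h Gamma0_mult[OF Y0 Lm_Gamma0(1)], symmetric])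
 also have "... = (\<lambda>z. of_int (Legendre r q) * js k (Lm \<kappa>) (js k (Y u) (D f)) z)"
  unfolding jh js_lin(2) js_D_mult[OF f Y0 Lm_Gamma0(1)] ..
 finally have "ipN (js k (Y (r * u)) (D f)) (D g) = of_int (Legendre r q) * ipN (js k (Lm \<kappa>) (js k (Y u) (D f))) (D g)"
  by (simp add: ip_cmult_left)
 also have "ipN (js k (Lm \<kappa>) (js k (Y u) (D f))) (D g) = ipN (js k (Y u) (D f)) (D g)"
  by (intro ip_Lm g Vsp_js D_Vsp f Gamma0_L4 Y0 N0)
 finally show ?thesis unfolding jY .
qed

text \<open>The double sum depends only on u - v. Over the nonzero differences it is reversed in
  sign by u -> r u for a nonresidue r, hence 0; the p diagonal terms are balanced by |cW|^2 p =
  1.\<close>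

lemma W_unitary: assumes f: "f \<in> Sk" and g: "g \<in> Sk" shows "ipN (D (W f)) (D (W g)) = ipN (D f) (D g)"
proof -
 define B where "B u = ipN (js k (Tmat (- m)) (E f u)) (D g)" for u
 have Bper: "B u = B v" if "[u = v] (mod q)" for u v using E_cong[OF f that] by (simp add: B_def)
 \<comment> \<open>Cut off at the multiples of p, where the relation under u -> r u need not hold;
   B' satisfies it for all u, and its full sum can be reindexed.\<close>
 define B' where "B' u = (if q dvd u then 0 else B u)" for u
 have B'per: "B' u = B' v" if "[u = v] (mod q)" for u v
  using Bper[OF that] cong_dvd_iff[OF that] by (simp add: B'_def)
 obtain r where r: "Legendre r q = -1" using exists_nonresidue[OF prime_p p_odd(2)] .
 have rq: "\<not> q dvd r" using r by (auto simp: Legendre_def cong_0_iff)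
 have "(\<Sum>u\<in>{0..<q}. B' (r * u)) = (\<Sum>u\<in>{0..<q}. B' u)"
 proof (rule sum_residues[OF B'per q_pos])
  fix u v assume "[r * u = r * v] (mod q)"
  hence "q dvd r * (u - v)" by (simp add: cong_iff_dvd_diff algebra_simps)
  thus "[u = v] (mod q)" using rq prime_p by (simp add: prime_dvd_mult_iff cong_iff_dvd_diff)
 qed
 moreover have "B' (r * u) = - B' u" for u
  using ip_E_multiple[OF f g rq, of u] r rq prime_p by (simp add: B'_def B_def prime_dvd_mult_iff)
 ultimately have "(\<Sum>u\<in>{0..<q}. B' u) = 0" by (simp add: sum_negf eq_neg_iff_add_eq_0)
 moreover have "(\<Sum>u\<in>{0..<q}. B u) = B 0 + (\<Sum>u\<in>{0..<q} - {0}. B u)" using q_pos by (intro sum.remove) auto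
 moreover have "(\<Sum>u\<in>{0..<q}. B' u) = B' 0 + (\<Sum>u\<in>{0..<q} - {0}. B' u)" using q_pos by (intro sum.remove) auto
 moreover have "(\<Sum>u\<in>{0..<q} - {0}. B u) = (\<Sum>u\<in>{0..<q} - {0}. B' u)"
  by (intro sum.cong refl) (auto simp: B'_def zdvd_not_zless)
 ultimately have sumB: "(\<Sum>u\<in>{0..<q}. B u) = B 0" by (simp add: B'_def)
 have Bsh: "(\<Sum>u\<in>{0..<q}. B (u - v)) = B 0" for v
 proof -
  have "(\<Sum>u\<in>{0..<q}. B (u - v)) = (\<Sum>u\<in>{0..<q}. B u)"
   by (rule sum_residues[OF Bper q_pos]) (simp_all only: cong_iff_dvd_diff diff_diff_eq2 diff_add_cancel)
  thus ?thesis unfolding sumB .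
 qed
 have B0: "B 0 = ipN (D f) (D g)" unfolding B_def Lm_Tm_js[OF f] ..
 have V: "(\<lambda>z. \<Sum>u\<in>{0..<q}. E g u z) \<in> Vsp k N0" by (intro Vsp_sum E_Vsp g)
 have "ipN (D (W f)) (D (W g)) = cW * cnj cW * (\<Sum>u\<in>{0..<q}. \<Sum>v\<in>{0..<q}. ipN (E f u) (E g v))"
  unfolding D_W[OF f] D_W[OF g] ip_cmult_left ip_cmult_right
  using ip_sum_left[OF N0(1,2) V, of "{0..<q}" "E f"] ip_sum_right[OF N0(1,2) E_Vsp[OF f], of "{0..<q}" "E g"]
   E_Vsp[OF f] E_Vsp[OF g] by simp
 also have "(\<Sum>u\<in>{0..<q}. \<Sum>v\<in>{0..<q}. ipN (E f u) (E g v)) = (\<Sum>v\<in>{0..<q}. \<Sum>u\<in>{0..<q}. B (u - v))"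
  unfolding ip_E_E[OF f g] B_def by (rule sum.swap)
 also have "... = of_int q * B 0" unfolding Bsh by simp
 finally show ?thesis by (simp only: B0 mult.assoc[symmetric] cmod_cW mult_1)
qed

lemma Sk_lin: "f \<in> Sk \<Longrightarrow> g \<in> Sk \<Longrightarrow> (\<lambda>z. f z + c * g z) \<in> Sk"
 by (intro cusp_forms_add cusp_forms_cmult) auto

lemma Sk_definite: assumes "f \<in> Sk" "ipN f f = 0" shows "f = (\<lambda>z. 0)"
 using ip_definite[OF Sk_Vsp[OF assms(1)] N0(1,2) assms(2)] .

lemma W_involution: assumes f: "f \<in> Sk" shows "W (W f) = f"
proof -
 define h where "h = (\<lambda>z. W (W f) z + (-1) * f z)"
 have WW: "W (W f) \<in> Sk" by (intro W_Sk f)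
 have h: "h \<in> Sk" unfolding h_def by (intro Sk_lin WW f)
 have "ipN (D h) (D h) = ipN (D (W (W f))) (D h) + ipN (\<lambda>z. (-1) * D f z) (D h)"
  unfolding h_def aff_lin(1,2)
  using ip_add_left[OF N0(1,2) D_Vsp[OF WW] Vsp_cmult[OF D_Vsp[OF f], of "-1"] D_Vsp[OF h]]
  unfolding h_def aff_lin(1,2) .
 also have "ipN (D (W (W f))) (D h) = ipN (D (W f)) (D (W h))" by (rule W_selfadjoint[OF W_Sk[OF f] h])
 also have "... = ipN (D f) (D h)" by (rule W_unitary[OF f h])
 finally have "ipN (D h) (D h) = 0" unfolding ip_cmult_left by simp
 moreover obtain c :: complex where "c \<noteq> 0" "\<And>f g. f \<in> Sk \<Longrightarrow> g \<in> Sk \<Longrightarrow> ipN (D f) (D g) = c * ipN f g" by (rule ip_D) blast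
 ultimately have "ipN h h = 0" using h by simp
 hence "h = (\<lambda>z. 0)" by (rule Sk_definite[OF h])
 thus ?thesis by (simp add: h_def fun_eq_iff)
qed

lemma W_selfadjoint': assumes f: "f \<in> Sk" and g: "g \<in> Sk" shows "ipN (W f) g = ipN f (W g)"
proof -
 obtain c :: complex where c: "c \<noteq> 0" "\<And>f g. f \<in> Sk \<Longrightarrow> g \<in> Sk \<Longrightarrow> ipN (D f) (D g) = c * ipN f g" by (rule ip_D) blast
 show ?thesis using W_selfadjoint[OF f g] c W_Sk f g by simp
qed
end

lemma csqrt_scale: assumes "r > 0" shows "csqrt (of_real r * x) = of_real (sqrt r) * csqrt x"
proof (rule csqrt_unique)
 show "(of_real (sqrt r) * csqrt x)\<^sup>2 = of_real r * x"
  using assms by (simp add: power_mult_distrib flip: of_real_power)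
 show "0 < Re (of_real (sqrt r) * csqrt x) \<or> Re (of_real (sqrt r) * csqrt x) = 0 \<and> 0 \<le> Im (of_real (sqrt r) * csqrt x)"
  using csqrt_principal[of x] assms by (auto simp: zero_less_mult_iff)
qed

section \<open>The operator Q at an odd prime as a trace\<close>

context odd_prime_level
begin

abbreviation "Q \<equiv> Q_p k M p m n"
abbreviation "SL \<equiv> cusp_forms k (4 * (M div p))"

lemma SL_Sk: "f \<in> SL \<Longrightarrow> f \<in> Sk"
proof -
 have "4 * (M div p) dvd 4 * M" using dvd_mult_div_cancel[OF p_dvd_M] by (metis dvd_triv_right mult_dvd_mono dvd_refl)
 thus "f \<in> SL \<Longrightarrow> f \<in> Sk" using cusp_forms_mono[of "4 * (M div p)" "4 * M" k] by auto
qed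

text \<open>Together with the identity these represent the p + 1 cosets of
  \<open>Gamma0 (4 M)\<close> in \<open>Gamma0 (4 L)\<close>.\<close>

definition \<gamma> :: "int \<Rightarrow> int ^ 2 ^ 2" where "\<gamma> s = Lm 1 ** Tmat (m - s)"

lemma \<gamma>_Gamma0: "\<gamma> s \<in> GL" "\<gamma> s \<in> Gamma0 4"
 unfolding \<gamma>_def by (intro Gamma0_mult Tm_Gamma0 Lm_Gamma0 Gamma0_4_gens)+

text \<open>The factors in \<open>Q_p\<close> carry no symbol. They are nevertheless the theta
  factors, because the lower right entry is 1 mod 4 L, which makes both the symbol and
  \<open>theta_eps\<close> trivial.\<close>

lemma Q_js: assumes "\<And>z. \<not> 0 < Im z \<Longrightarrow> f z = 0" shows "Q f = (\<lambda>z. \<Sum>s\<in>{0..<q}. js k (\<gamma> s) f z)"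
proof
 fix z
 have *: "slash k (mat2 1 (of_int (m - s)) (of_int (4 * L)) (of_int (n * q - 4 * L * s)),
   \<lambda>z. csqrt (of_int (4 * L) * z + of_int (n * q - 4 * L * s))) f z = js k (\<gamma> s) f z" for s
 proof (cases "0 < Im z")
  case False
  have "det (\<gamma> s) = 1" using \<gamma>_Gamma0(2)[of s] by (simp add: Gamma0_def SL2Z_def)
  thus ?thesis using js_upper_zero[of "\<gamma> s" f z k] assms False by (simp add: slash_def)
 next
  case True
  define d where "d = n * q - 4 * L * s"
  have d: "d = 1 + 4 * L * (m - s)" unfolding d_def using bezout by (simp add: algebra_simps)
  have \<gamma>: "\<gamma> s = mat2 1 (m - s) (4 * L) d" by (simp add: \<gamma>_def mat2_mult d add.commute)
  have "quad_symbol (4 * L) d = quad_symbol (4 * L) 1"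
  proof (rule quad_symbol_periodic)
   show "odd d" unfolding d by simp
   show "coprime (4 * L) d" using Gamma0_4_odd(4)[OF \<gamma>_Gamma0(2)[of s]] by (simp add: \<gamma>)
   show "[d = 1] (mod 4 * L)" unfolding d cong_iff_dvd_diff by simp
  qed auto
  moreover have "theta_eps d = 1" unfolding theta_eps_def d by (simp add: mult.assoc)
  ultimately have "theta_factor (\<gamma> s) z = csqrt (of_int (4 * L) * z + of_int d)"
   by (simp add: theta_factor_def \<gamma>)
  thus ?thesis unfolding slash_alt[OF True] d_def[symmetric] js_def mact_eq den_def mat_act_mat2 by (simp add: \<gamma>)
 qed
 have "{0..q - 1} = {0..<q}" by auto
 thus "Q f z = (\<Sum>s\<in>{0..<q}. js k (\<gamma> s) f z)" unfolding Q_p_def * by simp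
qed

text \<open>A matrix of level 4 L with lower left entry 4 L x has level 4 M if p divides x. For a
  matrix with lower row (4 L x, y), the coset of the identity covers p dvd x, and otherwise that of
  \<gamma>_j with x j = m y mod p.\<close>

lemma Q_trace: assumes f: "f \<in> Sk" shows "(\<lambda>z. f z + Q f z) \<in> SL"
proof -
 have up: "f z = 0" if "\<not> 0 < Im z" for z by (rule cusp_space_upper[OF Sk(1)[OF f] that])
 \<comment> \<open>The index p, outside the residues 0, ..., p - 1, stands for the identity.\<close>
 define R where "R i = (if i = q then mat 1 else \<gamma> i)" for i
 define I where "I = insert q {0..<q}"
 have R: "R i \<in> GL" for i by (simp add: R_def \<gamma>_Gamma0 Gamma0_1)
 have sum: "(\<lambda>z. f z + Q f z) = (\<lambda>z. \<Sum>i\<in>I. js k (R i) f z)"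
 proof
  fix z
  have "(\<Sum>s\<in>{0..<q}. js k (\<gamma> s) f z) = (\<Sum>i\<in>{0..<q}. js k (R i) f z)" by (intro sum.cong) (auto simp: R_def)
  thus "f z + Q f z = (\<Sum>i\<in>I. js k (R i) f z)" by (simp add: I_def Q_js[OF up] R_def js_1)
 qed
 have "(\<lambda>z. \<Sum>i\<in>I. js k (R i) f z) \<in> cusp_space k"
  by (intro cusp_space_sum js_in_cusp_space Sk f Gamma0_L4 R)
 moreover have "js k g (\<lambda>z. \<Sum>i\<in>I. js k (R i) f z) = (\<lambda>z. \<Sum>i\<in>I. js k (R i) f z)" if g: "g \<in> GL" for g
 proof (rule trace_invariant[where H = "Gamma0 (4 * M)"])
  show "finite I" "sl2_subgroup (Gamma0 (4 * M))" by (simp_all add: I_def sl2_subgroup_Gamma0)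
  show "Gamma0 (4 * M) \<subseteq> Gamma0 4" using Gamma0_mono[of 4 "4 * M"] by auto
  show "R i \<in> Gamma0 4" "g \<in> Gamma0 4" for i using Gamma0_L4 R g by auto
  show "js k h f = f" if "h \<in> Gamma0 (4 * M)" for h using Sk(2)[OF f that] .
  have lev: "X \<in> Gamma0 (4 * M)" if h: "X \<in> GL" "X $ 2 $ 1 = 4 * L * x" "q dvd x" for X x
  proof -
   obtain t where "x = q * t" using h(3) by blast
   hence "X $ 2 $ 1 = int (4 * M) * t" using h(2) by (simp add: M_eq)
   thus ?thesis using h(1) by (simp add: Gamma0_def)
  qed
  show "\<exists>j\<in>I. R i ** g ** adj2 (R j) \<in> Gamma0 (4 * M)" for i
  proof -
   define X where "X = R i ** g"
   have X: "X \<in> GL" unfolding X_def by (intro Gamma0_mult R g)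
   obtain x where x: "X $ 2 $ 1 = 4 * L * x" using Gamma0_props(2)[OF X] by auto
   show ?thesis
   proof (cases "q dvd x")
    case True
    hence "X ** adj2 (R q) \<in> Gamma0 (4 * M)"
     by (intro lev[of _ x] Gamma0_mult X Gamma0_adj2 R) (simp_all add: R_def x)
    thus ?thesis unfolding X_def I_def by blast
   next
    case False
    define y where "y = X $ 2 $ 2"
    have "coprime x q" using False prime_p by (metis coprime_commute prime_imp_coprime prime_nat_int_transfer)
    then obtain x' where "[x * x' = 1] (mod q)" using cong_solve_coprime_int by blast
    then obtain t where t: "x * x' = 1 + q * t" unfolding cong_iff_dvd_diff by (metis dvd_def add.commute diff_add_cancel)
    \<comment> \<open>The condition is x (1 + 4 L m) - 4 L x j - y = 0 mod p. Since 4 L m = -1 mod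
      p, the solution is j = m y / x.\<close>
    define j where "j = (m * y * x') mod q"
    obtain t' where t': "j = m * y * x' + q * t'" unfolding j_def
     by (metis add_diff_cancel_left' minus_mult_div_eq_mod mult_minus_right uminus_add_conv_diff diff_conv_add_uminus)
    have j: "j \<in> {0..<q}" using q_pos by (simp add: j_def)
    have "x * j = m * y * (x * x') + q * t' * x" unfolding t' by (simp add: algebra_simps)
    also have "... = m * y + q * (m * y * t + t' * x)" unfolding t by (simp add: algebra_simps)
    finally have xj: "x * j = m * y + q * (m * y * t + t' * x)" .
    have "(X ** adj2 (R j)) $ 2 $ 1 = 4 * L * (x + 4 * L * m * x - 4 * L * (x * j) - y)"
     using j by (simp add: R_def \<gamma>_def x y_def[symmetric] algebra_simps)
    moreover have "x + 4 * L * m * x - 4 * L * (x * j) - y = (1 + 4 * L * m) * (x - y) - q * (4 * L * (m * y * t + t' * x))"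
     unfolding xj by (simp add: algebra_simps)
    hence "q dvd x + 4 * L * m * x - 4 * L * (x * j) - y" by (simp add: four_Lm)
    ultimately have "X ** adj2 (R j) \<in> Gamma0 (4 * M)" by (intro lev Gamma0_mult X Gamma0_adj2 R)
    thus ?thesis using j unfolding X_def I_def by blast
   qed
  qed
  show "i = j" if ij: "i \<in> I" "j \<in> I" "R i ** adj2 (R j) \<in> Gamma0 (4 * M)" for i j
  proof -
   have "int (4 * M) dvd (R i ** adj2 (R j)) $ 2 $ 1" using ij(3) by (rule Gamma0_props(2))
   moreover have "4 * L \<noteq> 0" using L_pos by simp
   moreover have "int (4 * M) = 4 * L * q" by (simp add: M_eq)
   ultimately have d: "(R i ** adj2 (R j)) $ 2 $ 1 = 4 * L * x \<Longrightarrow> q dvd x" for x by simp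
   have n1: "\<not> q dvd 1" "\<not> q dvd -1" using p_odd(2) by (auto simp: zdvd_not_zless)
   show ?thesis
   proof (cases "i = q \<or> j = q")
    case True
    show ?thesis
    proof (rule ccontr)
     assume "i \<noteq> j"
     then consider "i = q" "j \<noteq> q" | "j = q" "i \<noteq> q" using True by blast
     thus False by cases (use d[of 1] d[of "-1"] n1 in \<open>simp_all add: R_def \<gamma>_def\<close>)
    qed
   next
    case False
    have "(R i ** adj2 (R j)) $ 2 $ 1 = 4 * L * (4 * L * (i - j))"
     using False by (simp add: R_def \<gamma>_def algebra_simps)
    hence "q dvd 4 * L * (i - j)" by (rule d)
    hence "q dvd i - j" using not_dvd_L by blast
    moreover have "0 \<le> i" "i < q" "0 \<le> j" "j < q" using ij(1,2) False by (auto simp: I_def)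
    ultimately show ?thesis by (metis cong_iff_dvd_diff cong_less_imp_eq_int)
   qed
  qed
 qed (rule up)
 ultimately show ?thesis unfolding sum by (auto simp: cusp_forms_eq)
qed

lemma Q_Sk: assumes "f \<in> Sk" shows "Q f \<in> Sk"
proof -
 have "(\<lambda>z. (f z + Q f z) + (-1) * f z) \<in> Sk" by (rule Sk_lin[OF SL_Sk[OF Q_trace] assms]) (rule assms)
 thus ?thesis by simp
qed

text \<open>Every \<gamma>_s fixes g, so each of the p + 1 terms of the trace has the same product
  with g.\<close>

lemma ip_Q_trace: assumes f: "f \<in> Sk" and g: "g \<in> SL"
 shows "ipN (\<lambda>z. f z + Q f z) g = (1 + of_int q) * ipN f g"
proof -
 have up: "f z = 0" if "\<not> 0 < Im z" for z by (rule cusp_space_upper[OF Sk(1)[OF f] that])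
 have Qf: "Q f = (\<lambda>z. \<Sum>s\<in>{0..<q}. js k (\<gamma> s) f z)" by (rule Q_js) (rule up)
 note V = Sk_Vsp[OF f] Sk_Vsp[OF SL_Sk[OF g]]
 have s: "ipN (js k (\<gamma> s) f) g = ipN f g" for s
 proof -
  have "js k (\<gamma> s) g = g" using g \<gamma>_Gamma0(1) by (auto simp: cusp_forms_eq)
  thus ?thesis using ip_js[OF N0(1,2) V \<gamma>_Gamma0(2), of s] by simp
 qed
 have "ipN (\<lambda>z. f z + Q f z) g = ipN f g + ipN (Q f) g"
  by (rule ip_add_left[OF N0(1,2) V(1) Sk_Vsp[OF Q_Sk[OF f]] V(2)])
 also have "ipN (Q f) g = (\<Sum>s\<in>{0..<q}. ipN (js k (\<gamma> s) f) g)" unfolding Qf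
  using ip_sum_left[OF N0(1,2) V(2), of "{0..<q}" "\<lambda>s. js k (\<gamma> s) f"] Vsp_js[OF V(1) \<gamma>_Gamma0(2) N0(2)] by simp
 finally show ?thesis unfolding s by (simp add: algebra_simps)
qed

text \<open>For the converse the trace f + Q f, which lies in the space at the lower level, is
  tested against itself.\<close>

lemma Q_eigen_iff: assumes f: "f \<in> Sk" shows "Q f = - f \<longleftrightarrow> (\<forall>g\<in>SL. ipN f g = 0)"
proof
 have nz: "1 + complex_of_int q \<noteq> 0" by (metis add.commute of_nat_Suc of_int_of_nat_eq of_nat_neq_0)
 show "\<forall>g\<in>SL. ipN f g = 0" if "Q f = - f"
 proof
  fix g assume "g \<in> SL"
  hence "(1 + of_int q) * ipN f g = ipN (\<lambda>z. 0) g" using ip_Q_trace[OF f] that by simp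
  thus "ipN f g = 0" using nz by (simp add: ip_zero_left)
 qed
 assume "\<forall>g\<in>SL. ipN f g = 0"
 hence "ipN (\<lambda>z. f z + Q f z) (\<lambda>z. f z + Q f z) = 0"
  using ip_Q_trace[OF f Q_trace[OF f]] Q_trace[OF f] by simp
 hence "(\<lambda>z. f z + Q f z) = (\<lambda>z. 0)" by (rule Sk_definite[OF SL_Sk[OF Q_trace[OF f]]])
 thus "Q f = - f" by (auto simp: fun_eq_iff add_eq_0_iff)
qed
end

section \<open>The composite of Q and W is a multiple of U_{p^2}\<close>

lemma sum_residues_pair:
 fixes t :: "int \<Rightarrow> 'a::comm_monoid_add" and \<sigma> :: "int \<times> int \<Rightarrow> int"
 assumes per: "\<And>u v. [u = v] (mod q * q) \<Longrightarrow> t u = t v" and q: "q > 0"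
  and inj: "\<And>s u s' u'. s \<in> {0..<q} \<Longrightarrow> s' \<in> {0..<q} \<Longrightarrow> [\<sigma> (s, u) = \<sigma> (s', u')] (mod q * q) \<Longrightarrow> [s = s'] (mod q) \<and> [u = u'] (mod q)"
 shows "(\<Sum>s\<in>{0..<q}. \<Sum>u\<in>{0..<q}. t (\<sigma> (s, u))) = (\<Sum>v\<in>{0..<q * q}. t v)"
proof -
 let ?P = "{0..<q} \<times> {0..<q}"
 \<comment> \<open>Congruence mod q becomes equality because both members range over 0, ..., q - 1;
   with q^2 elements on both sides the map is then onto.\<close>
 have inj: "inj_on (\<lambda>x. \<sigma> x mod (q * q)) ?P"
 proof (rule inj_onI, clarify)
  fix s u s' u' assume a: "s \<in> {0..<q}" "u \<in> {0..<q}" "s' \<in> {0..<q}" "u' \<in> {0..<q}"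
   "\<sigma> (s, u) mod (q * q) = \<sigma> (s', u') mod (q * q)"
  hence "[s = s'] (mod q)" "[u = u'] (mod q)" using inj[of s s' u u'] by (auto simp: cong_def)
  thus "s = s' \<and> u = u'" using a(1-4) by (auto simp: cong_def)
 qed
 have "(\<lambda>x. \<sigma> x mod (q * q)) ` ?P \<subseteq> {0..<q * q}" using q by auto
 moreover have "card ((\<lambda>x. \<sigma> x mod (q * q)) ` ?P) = card {0..<q * q}"
  using card_image[OF inj] q by (simp add: card_cartesian_product nat_mult_distrib)
 ultimately have im: "(\<lambda>x. \<sigma> x mod (q * q)) ` ?P = {0..<q * q}" by (intro card_subset_eq) auto
 have "(\<Sum>s\<in>{0..<q}. \<Sum>u\<in>{0..<q}. t (\<sigma> (s, u))) = (\<Sum>x\<in>?P. t (\<sigma> x))" by (simp add: sum.cartesian_product)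
 also have "... = (\<Sum>x\<in>?P. t (\<sigma> x mod (q * q)))" by (intro sum.cong refl per) (simp add: cong_def)
 also have "... = (\<Sum>v\<in>{0..<q * q}. t v)" unfolding im[symmetric] using inj by (simp add: sum.reindex)
 finally show ?thesis .
qed

text \<open>Brings the product of a translation by m/p and a lower row of the composite into the
  form: unimodular matrix times (1, b; 0, q^2), the second factor being a term of U_{p^2}. In use c
  = 4 L (p u + 1), so that q c is divisible by 4 M.\<close>

lemma QW_matrix:
 fixes q e m c :: int assumes "c * m = q * e - 1"
 shows "mat2 q m 0 q ** mat2 1 m c (q * e) = mat2 (q * (1 + e) - 1) (m * (1 + e)\<^sup>2) (q * c) (q * e * (1 + e) - 1) ** mat2 1 (- (q * m * (1 + e))) 0 (q * q)"
  and "det (mat2 (q * (1 + e) - 1) (m * (1 + e)\<^sup>2) (q * c) (q * e * (1 + e) - 1)) = 1"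
proof -
 have e: "m * (1 + e)\<^sup>2 * (q * c) = q * (1 + e)\<^sup>2 * (c * m)" by simp
 show "det (mat2 (q * (1 + e) - 1) (m * (1 + e)\<^sup>2) (q * c) (q * e * (1 + e) - 1)) = 1"
  unfolding det_mat2 e assms by (simp add: power2_eq_square algebra_simps)
 have "q * c * (- (q * m * (1 + e))) = - (q * q * (1 + e) * (c * m))" by simp
 hence "q * (q * e) = q * c * (- (q * m * (1 + e))) + (q * e * (1 + e) - 1) * (q * q)"
  unfolding assms by (simp add: algebra_simps)
 moreover have "q + m * c = q * (1 + e) - 1" using assms by (simp add: algebra_simps)
 moreover have "q * m + m * (q * e) = (q * (1 + e) - 1) * (- (q * m * (1 + e))) + m * (1 + e)\<^sup>2 * (q * q)"
  by (simp add: power2_eq_square algebra_simps)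
 ultimately show "mat2 q m 0 q ** mat2 1 m c (q * e) = mat2 (q * (1 + e) - 1) (m * (1 + e)\<^sup>2) (q * c) (q * e * (1 + e) - 1) ** mat2 1 (- (q * m * (1 + e))) 0 (q * q)"
  unfolding mat2_mult by simp
qed

context odd_prime_level
begin

text \<open>Chosen so that q times it is the lower right entry of
  \<open>Lmat (4 M u) ** \<gamma> 0\<close>, namely 4 L m (q u + 1) + 1.\<close>

definition e1 :: "int \<Rightarrow> int" where "e1 u = n * (q * u + 1) - u"

text \<open>The quotient of theta factors in \<open>QW_factor\<close>. Its independence of u is what
  makes the whole sum a multiple of U_{p^2}.\<close>

definition C1 :: complex where
 "C1 = inverse (theta_eps q) * of_int (J (q * n * (1 + n) - 1)) * of_int (Legendre L q) * of_real (sqrt (1 / real p))"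

definition C2 :: complex where "C2 = C1 ^ (2 * k + 1)"

text \<open>Both symbols are reduced to (4 L w / e). On the left d = e mod 4 L w, and M = p L
  contributes (p/d); on the right the factor p of p e contributes (L/p), since w = 1 mod p. Finally
  (p/d) is constant because d = p mod 4 and d = -1 mod p for every u.\<close>

lemma QW_factor:
 assumes z: "0 < Im z" and u: "w = q * u + 1"
 shows "theta_factor (mat2 (q * (1 + e1 u) - 1) (m * (1 + e1 u)\<^sup>2) (4 * (int M * w)) (q * e1 u * (1 + e1 u) - 1))
    ((z - of_int (q * m * (1 + e1 u))) / of_int (q * q))
  = C1 * theta_factor (mat2 1 m (4 * (L * w)) (q * e1 u)) z"
proof -
 define e where "e = e1 u"
 define d where "d = q * e * (1 + e) - 1"
 have e: "e = n * w - u" by (simp add: e_def e1_def u)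
 have qe: "q * e = 4 * L * m * w + 1"
 proof -
  have "q * e = (q * n) * w - q * u" unfolding e by (simp add: algebra_simps)
  also have "... = (4 * L * m + 1) * w - q * u" using bezout by (simp add: algebra_simps)
  finally show ?thesis by (simp add: u algebra_simps)
 qed
 have qe1: "q * e - 4 * (L * w) * m = 1" unfolding qe by (simp add: algebra_simps)
 have q4: "[q * q = 1] (mod 4)"
 proof -
  have "q mod 4 = 1 \<or> q mod 4 = 3" using p_odd(3) by presburger
  moreover have "(q * q) mod 4 = ((q mod 4) * (q mod 4)) mod 4" by (simp only: mod_mult_eq)
  ultimately show ?thesis by (auto simp: cong_def)
 qed
 have inv4: "[x = q] (mod 4)" if "[q * x = 1] (mod 4)" for x
 proof -
  have "[q * q * x = 1 * x] (mod 4)" by (intro cong_mult q4) simp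
  moreover have "[q * (q * x) = q * 1] (mod 4)" by (intro cong_mult that) simp
  ultimately show ?thesis by (simp add: mult.assoc) (metis cong_sym cong_trans)
 qed
 have qe4: "[q * e = 1] (mod 4)" unfolding qe by (simp add: cong_iff_dvd_diff mult.assoc)
 have e4: "[e = q] (mod 4)" using qe4 by (rule inv4)
 have d4: "[d = q] (mod 4)"
 proof -
  have "[q * e * (1 + e) - 1 = 1 * (1 + q) - 1] (mod 4)" by (intro cong_diff cong_mult cong_add qe4 e4 cong_refl)
  thus ?thesis by (simp add: d_def)
 qed
 have oe: "odd e" "odd d" "odd (q * e)"
 proof -
  have "e mod 4 = q mod 4" "d mod 4 = q mod 4" "q * e mod 4 = 1" using e4 d4 qe4 by (auto simp: cong_def)
  thus "odd e" "odd d" "odd (q * e)" using p_odd(3) by presburger+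
 qed
 have cop: "coprime (4 * (L * w)) e" "coprime (4 * (L * w)) (q * e)"
 proof -
  show "coprime (4 * (L * w)) (q * e)"
  proof (rule coprimeI)
   fix x assume x: "x dvd 4 * (L * w)" "x dvd q * e"
   have "x dvd q * e - 4 * (L * w) * m" by (rule dvd_diff[OF x(2) dvd_mult2[OF x(1)]])
   thus "is_unit x" unfolding qe1 .
  qed
  thus "coprime (4 * (L * w)) e" by simp
 qed
 have dm: "d = e + 4 * (L * w) * (m * (1 + e))"
 proof -
  have "d = (q * e) * (1 + e) - 1" by (simp add: d_def)
  thus ?thesis unfolding qe by (simp add: algebra_simps)
 qed
 have "quad_symbol (4 * (int M * w)) d = quad_symbol (q * (4 * (L * w))) d" unfolding M_eq by (simp add: mult_ac)
 also have "... = J d * quad_symbol (4 * (L * w)) d" by (rule quad_symbol_mult_left[OF q_pos oe(2)])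
 also have "quad_symbol (4 * (L * w)) d = quad_symbol (4 * (L * w)) e"
 proof (rule quad_symbol_periodic[symmetric])
  show "[e = d] (mod 4 * (L * w))" unfolding dm cong_iff_dvd_diff by simp
 qed (use oe cop in auto)
 finally have Q1: "quad_symbol (4 * (int M * w)) d = J d * quad_symbol (4 * (L * w)) e" .
 have jL: "jacobi (4 * (L * w)) p = jacobi L p"
 proof -
  have "[4 * (L * w) = 4 * (L * 1)] (mod int p)" unfolding u by (intro cong_mult cong_refl) (simp add: cong_iff_dvd_diff)
  hence "jacobi (4 * (L * w)) p = jacobi (2 * 2 * L) p" using jacobi_cong[OF p_odd(1)] by simp
  also have "... = jacobi (2 * 2) p * jacobi L p" using p_odd(1) by (rule jacobi_mult_left)
  also have "jacobi (2 * 2) p = 1" using p_odd(1) by (intro jacobi_square_left) auto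
  finally show ?thesis by simp
 qed
 have "nat \<bar>q * e\<bar> = p * nat \<bar>e\<bar>" by (simp add: abs_mult nat_mult_distrib)
 moreover have "nat \<bar>e\<bar> \<noteq> 0" "p \<noteq> 0" using oe(1) q_pos by auto
 ultimately have je: "jacobi (4 * (L * w)) (nat \<bar>q * e\<bar>) = Legendre L q * jacobi (4 * (L * w)) (nat \<bar>e\<bar>)"
  using jL jacobi_mult_right[of p "nat \<bar>e\<bar>"] jacobi_prime[OF prime_p] by simp
 have "q * e < 0 \<longleftrightarrow> e < 0" using q_pos by (simp add: mult_less_0_iff)
 hence Q2: "quad_symbol (4 * (L * w)) (q * e) = Legendre L q * quad_symbol (4 * (L * w)) e"
  unfolding quad_symbol_jacobi je by simp
 have LL: "Legendre L q * Legendre L q = 1" using Legendre_L by auto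
 define d0 where "d0 = q * n * (1 + n) - 1"
 have "q * n = 4 * (L * m) + 1" using bezout by simp
 hence qn4: "[q * n = 1] (mod 4)" by (simp add: cong_iff_dvd_diff)
 have d04: "[d0 = q] (mod 4)"
 proof -
  have "[q * n * (1 + n) - 1 = 1 * (1 + q) - 1] (mod 4)" by (intro cong_diff cong_mult cong_add qn4 inv4 cong_refl)
  thus ?thesis by (simp add: d0_def)
 qed
 have dq: "[d = -1] (mod q)" "[d0 = -1] (mod q)" by (simp_all add: d_def d0_def cong_iff_dvd_diff mult.assoc)
 have Jd: "J d = J d0"
 proof (rule J_cong)
  have "d0 mod 4 = q mod 4" using d04 by (simp add: cong_def)
  thus "odd d0" using p_odd(3) by presburger
  show "coprime q d" using cong_imp_coprime[OF cong_sym[OF dq(1)]] by (simp add: coprime_commute)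
  show "[d = d0] (mod 4)" "[d = d0] (mod q)" using d4 d04 dq by (metis cong_sym cong_trans)+
 qed (rule oe)
 have "theta_eps d = theta_eps q" "theta_eps (q * e) = 1" using d4 qe4 by (simp_all add: theta_eps_def cong_def)
 moreover have "q \<noteq> 0" "real p > 0" using q_pos by auto
 hence "den (mat2 (q * (1 + e) - 1) (m * (1 + e)\<^sup>2) (4 * (int M * w)) d) ((z - of_int (q * m * (1 + e))) / of_int (q * q))
   = of_real (1 / real p) * den (mat2 1 m (4 * (L * w)) (q * e)) z"
  unfolding den_def dm M_eq by (simp add: field_simps)
 hence "csqrt (den (mat2 (q * (1 + e) - 1) (m * (1 + e)\<^sup>2) (4 * (int M * w)) d) ((z - of_int (q * m * (1 + e))) / of_int (q * q)))
   = of_real (sqrt (1 / real p)) * csqrt (den (mat2 1 m (4 * (L * w)) (q * e)) z)"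
  using \<open>real p > 0\<close> by (simp only:) (rule csqrt_scale, simp)
 moreover have "quad_symbol (4 * (int M * w)) d = J d0 * Legendre L q * quad_symbol (4 * (L * w)) (q * e)"
  unfolding Q1 Q2 Jd using LL by (simp add: mult.assoc)
 ultimately show ?thesis
  unfolding theta_factor_den mat2_nth e_def[symmetric] d_def[symmetric] C1_def d0_def[symmetric] by simp
qed

lemma QW_term: assumes f: "f \<in> Sk" and z: "0 < Im z"
 shows "js k (Lmat (4 * (int M * u)) ** \<gamma> 0) (aff q m q f) z = C2 * aff 1 (- (q * m * (1 + e1 u))) (q * q) f z"
proof -
 define w e where "w = q * u + 1" and "e = e1 u"
 define g where "g = mat2 1 m (4 * (L * w)) (q * e)"
 define h where "h = mat2 (q * (1 + e) - 1) (m * (1 + e)\<^sup>2) (4 * (int M * w)) (q * e * (1 + e) - 1)"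
 define x where "x = (z - of_int (q * m * (1 + e))) / of_int (q * q)"
 have qe: "q * e = 4 * L * m * w + 1"
 proof -
  have "q * e = (q * n) * w - q * u" unfolding e_def e1_def w_def by (simp add: algebra_simps)
  also have "... = (4 * L * m + 1) * w - q * u" using bezout by (simp add: algebra_simps)
  finally show ?thesis by (simp add: w_def algebra_simps)
 qed
 have g_eq: "Lmat (4 * (int M * u)) ** \<gamma> 0 = g"
  unfolding g_def qe by (simp add: \<gamma>_def mat2_mult mat2_eq_iff w_def M_eq algebra_simps)
 have det_g: "det g = 1" unfolding g_def det_mat2 qe by (simp add: algebra_simps)
 have cm: "4 * (L * w) * m = q * e - 1" unfolding qe by (simp add: algebra_simps)
 have h_eq: "h = mat2 (q * (1 + e) - 1) (m * (1 + e)\<^sup>2) (q * (4 * (L * w))) (q * e * (1 + e) - 1)"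
  by (simp add: h_def M_eq mult_ac)
 have "det h = 1" unfolding h_eq by (rule QW_matrix[OF cm])
 hence h: "h \<in> Gamma0 (4 * M)" by (simp add: Gamma0_def SL2Z_def h_def mult.assoc)
 have "0 < Im x" using Im_aff[of 1 "q * q" z "- (q * m * (1 + e))"] z q_pos by (simp add: x_def)
 have "(of_int q * mact g z + of_int m) / of_int q = mact (mat2 q m 0 q) (mact g z)" by (simp add: mact_eq den_def)
 also have "... = mact (mat2 q m 0 q ** g) z" by (rule mact_mult[symmetric]) (use z det_g in auto)
 also have "mat2 q m 0 q ** g = h ** mat2 1 (- (q * m * (1 + e))) 0 (q * q)"
  unfolding h_eq g_def by (rule QW_matrix[OF cm])
 also have "mact \<dots> z = mact h (mact (mat2 1 (- (q * m * (1 + e))) 0 (q * q)) z)"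
  by (rule mact_mult) (use z q_pos in auto)
 also have "mact (mat2 1 (- (q * m * (1 + e))) 0 (q * q)) z = x" by (simp add: mact_eq den_def x_def)
 finally have v: "aff q m q f (mact g z) = f (mact h x)" by (simp add: aff_def)
 have "js k h f x = f x" using Sk(2)[OF f h] by simp
 moreover have "theta_factor h x \<noteq> 0" using theta_factor_nonzero[OF Gamma0_mono[OF _ h]] \<open>0 < Im x\<close> by simp
 ultimately have "f (mact h x) = theta_factor h x ^ (2 * k + 1) * f x" by (simp add: js_def field_simps)
 also have "theta_factor h x = C1 * theta_factor g z"
  unfolding h_def g_def x_def e_def by (rule QW_factor[OF z w_def])
 finally have "f (mact h x) = C2 * theta_factor g z ^ (2 * k + 1) * f x" by (simp add: C2_def power_mult_distrib)
 moreover have "g \<in> Gamma0 4" using det_g by (simp add: g_def Gamma0_mat2)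
 hence "theta_factor g z \<noteq> 0" using z by (rule theta_factor_nonzero)
 ultimately have "js k g (aff q m q f) z = C2 * f x" by (simp add: js_def v)
 thus ?thesis unfolding g_eq by (simp add: aff_def x_def e_def)
qed

text \<open>The translations that arise from \<open>QW_term\<close> run over all residues mod p^2: s
  supplies the residue mod p, and u the next digit, because u enters with the coefficient p m (n p -
  1) and both m and n p - 1 are units mod p.\<close>

lemma QW_U: assumes f: "f \<in> Sk" shows "Q (W f) = (\<lambda>z. cW * C2 * of_int (q * q) * U_op (p\<^sup>2) f z)"
proof -
 have up: "W f z = 0" if "\<not> 0 < Im z" for z by (rule cusp_space_upper[OF Sk(1)[OF W_Sk[OF f]] that])
 have per: "aff 1 u (q * q) f = aff 1 v (q * q) f" if "[u = v] (mod q * q)" for u v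
  using that by (intro aff_periodic cusp_forms_periodic[OF f]) (use q_pos in auto)
 have aff_c: "aff q m q f \<in> cusp_space k" by (intro aff_in_cusp_space Sk f q_pos)
 have tm: "js k (\<gamma> s) (js k (Lmat (4 * (int M * u))) (aff q m q f)) z = C2 * aff 1 (- (q * m * (1 + e1 u)) - s) (q * q) f z" for s u z
 proof (cases "0 < Im z")
  case False
  have "js k (\<gamma> s) (js k (Lmat (4 * (int M * u))) (aff q m q f)) z = 0"
   by (rule cusp_space_upper[where k = k, OF _ False]) (intro js_in_cusp_space aff_c Gamma0_4_gens \<gamma>_Gamma0)
  moreover have "aff 1 (- (q * m * (1 + e1 u)) - s) (q * q) f z = 0"
   by (rule cusp_space_upper[where k = k, OF _ False]) (intro aff_in_cusp_space Sk f, use q_pos in auto)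
  ultimately show ?thesis by simp
 next
  case True
  have "js k (\<gamma> s) (js k (Lmat (4 * (int M * u))) (aff q m q f)) = js k (Lmat (4 * (int M * u)) ** \<gamma> s) (aff q m q f)"
   by (rule js_mult) (auto intro: Gamma0_4_gens \<gamma>_Gamma0 cusp_space_upper[OF aff_c])
  also have "Lmat (4 * (int M * u)) ** \<gamma> s = (Lmat (4 * (int M * u)) ** \<gamma> 0) ** Tmat (- s)"
   by (simp add: \<gamma>_def mat2_mult mat2_eq_iff algebra_simps)
  also have "js k \<dots> (aff q m q f) = js k (Tmat (- s)) (js k (Lmat (4 * (int M * u)) ** \<gamma> 0) (aff q m q f))"
   by (rule js_mult[symmetric]) (auto intro: Gamma0_mult Gamma0_4_gens \<gamma>_Gamma0 cusp_space_upper[OF aff_c])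
  finally have "js k (\<gamma> s) (js k (Lmat (4 * (int M * u))) (aff q m q f)) z
   = js k (Lmat (4 * (int M * u)) ** \<gamma> 0) (aff q m q f) (z - of_int s)" by (simp add: js_Tmat)
  also have "... = C2 * aff 1 (- (q * m * (1 + e1 u))) (q * q) f (z - of_int s)"
   by (rule QW_term[OF f]) (use True in simp)
  finally show ?thesis by (simp add: aff_def algebra_simps)
 qed
 define \<sigma> :: "int \<times> int \<Rightarrow> int" where "\<sigma> = (\<lambda>(s, u). - (q * m * (1 + e1 (1 - u))) - s)"
 have inj: "[s = s'] (mod q) \<and> [u = u'] (mod q)"
  if s: "s \<in> {0..<q}" "s' \<in> {0..<q}" and c: "[\<sigma> (s, u) = \<sigma> (s', u')] (mod q * q)" for s u s' u'
 proof -
  have d: "q * q dvd \<sigma> (s, u) - \<sigma> (s', u')" using c by (simp only: cong_iff_dvd_diff)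
  have eq: "\<sigma> (s, u) - \<sigma> (s', u') = q * (m * (n * q - 1) * (u - u')) - (s - s')"
   by (simp add: \<sigma>_def e1_def algebra_simps)
  have "q dvd q * (m * (n * q - 1) * (u - u')) - (s - s')" using d unfolding eq by (rule dvd_mult_left)
  hence "q dvd s - s'" by (metis dvd_diff_right_iff dvd_triv_left)
  hence ss: "s = s'" using s by (metis atLeastLessThan_iff cong_iff_dvd_diff cong_less_imp_eq_int)
  have "q dvd m * (n * q - 1) * (u - u')"
  proof -
   have "q * q dvd q * (m * (n * q - 1) * (u - u'))" using d unfolding eq unfolding ss by simp
   thus ?thesis using q_pos by simp
  qed
  hence "q dvd m \<or> q dvd n * q - 1 \<or> q dvd u - u'" using prime_p by (simp add: prime_dvd_mult_iff)
  moreover have n1: "\<not> q dvd 1" using p_odd(2) by (simp add: zdvd_not_zless)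
  have "\<not> q dvd n * q - 1"
  proof
   assume "q dvd n * q - 1"
   hence "q dvd n * q - (n * q - 1)" by (rule dvd_diff[OF dvd_triv_right])
   thus False using n1 by simp
  qed
  moreover have "\<not> q dvd m"
  proof
   assume "q dvd m"
   hence "q dvd q * n - 4 * L * m" by simp
   thus False using n1 unfolding bezout by simp
  qed
  ultimately show ?thesis using ss by (simp add: cong_iff_dvd_diff)
 qed
 have "Q (W f) = (\<lambda>z. \<Sum>s\<in>{0..<q}. js k (\<gamma> s) (W f) z)" by (rule Q_js) (rule up)
 also have "... = (\<lambda>z. \<Sum>s\<in>{0..<q}. cW * (\<Sum>u\<in>{0..<q}. js k (\<gamma> s) (js k (Lmat (4 * (int M * (1 - u)))) (aff q m q f)) z))"
  by (subst W_js[OF f]) (simp only: js_lin)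
 also have "... = (\<lambda>z. cW * C2 * (\<Sum>s\<in>{0..<q}. \<Sum>u\<in>{0..<q}. aff 1 (\<sigma> (s, u)) (q * q) f z))"
  unfolding tm by (simp add: \<sigma>_def sum_distrib_left mult.assoc)
 also have "... = (\<lambda>z. cW * C2 * (\<Sum>v\<in>{0..<q * q}. aff 1 v (q * q) f z))"
 proof -
  have "(\<Sum>s\<in>{0..<q}. \<Sum>u\<in>{0..<q}. aff 1 (\<sigma> (s, u)) (q * q) f z) = (\<Sum>v\<in>{0..<q * q}. aff 1 v (q * q) f z)" for z
   by (rule sum_residues_pair[where t = "\<lambda>u. aff 1 u (q * q) f z", OF fun_cong[OF per] q_pos inj])
  thus ?thesis by simp
 qed
 finally have QW: "Q (W f) = (\<lambda>z. cW * C2 * (\<Sum>v\<in>{0..<q * q}. aff 1 v (q * q) f z))" .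
 have pp: "int (p\<^sup>2) = q * q" "complex_of_nat (p\<^sup>2) = of_int (q * q)" by (simp_all add: power2_eq_square)
 have p0: "p\<^sup>2 > 0" using q_pos by simp
 have N4: "4 dvd 4 * M" by simp
 have U: "U_op (p\<^sup>2) f = (\<lambda>z. inverse (of_int (q * q)) * (\<Sum>v\<in>{0..<q * q}. aff 1 v (q * q) f z))"
  using U_op_aff[OF f N4 p0] unfolding pp .
 have "complex_of_int (q * q) \<noteq> 0" using q_pos by simp
 hence "cW * C2 * of_int (q * q) * (inverse (of_int (q * q)) * x) = cW * C2 * x" for x
  by (simp add: field_simps)
 note * = this
 show ?thesis unfolding QW U * ..
qed

lemma QW_const: "cW * C2 * of_int (q * q) \<noteq> 0"
proof -
 define d where "d = q * n * (1 + n) - 1"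
 have "even (n * (1 + n))" by simp
 hence "odd d" unfolding d_def by (simp add: mult.assoc)
 moreover have "[d = -1] (mod q)" by (simp add: d_def cong_iff_dvd_diff mult.assoc)
 hence "coprime q d" using cong_imp_coprime[OF cong_sym, of d "-1" q] by (simp add: coprime_commute)
 ultimately have "J d \<noteq> 0" using jacobi_coprime[of "nat \<bar>d\<bar>" q] by (auto simp: even_nat_iff)
 moreover have "Legendre L q \<noteq> 0" "sqrt (1 / real p) \<noteq> 0" using Legendre_L q_pos by auto
 ultimately have "C1 \<noteq> 0" unfolding C1_def d_def[symmetric]
  by (intro no_zero_divisors) (simp_all only: of_int_eq_0_iff of_real_eq_0_iff nonzero_imp_inverse_nonzero theta_eps_nonzero not_False_eq_True)
 moreover have "cW \<noteq> 0" using cmod_cW by auto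
 ultimately show ?thesis using q_pos by (simp add: C2_def)
qed

lemma W_cmult: "W (\<lambda>z. c * f z) = (\<lambda>z. c * W f z)"
proof -
 have "slash k \<xi> (\<lambda>z. c * f z) = (\<lambda>z. c * slash k \<xi> f z)" for \<xi> by (simp add: slash_def fun_eq_iff)
 thus ?thesis unfolding W_p2_def by (simp only: sum_distrib_left[symmetric] mult.left_commute)
qed

text \<open>U_{p^2} f is a multiple of Q (W f), which is the trace W f + Q (W f) minus W f.\<close>

lemma U_square_decomp: assumes f: "f \<in> SL"
 obtains g h where "g \<in> SL" "h \<in> SL" "U_op (p\<^sup>2) f = (\<lambda>z. g z + W h z)"
proof -
 define c where "c = inverse (cW * C2 * of_int (q * q))"
 define g where "g = (\<lambda>z. W f z + Q (W f) z)"
 have fS: "f \<in> Sk" by (rule SL_Sk[OF f])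
 have g: "g \<in> SL" unfolding g_def by (intro Q_trace W_Sk fS)
 have "c * (cW * C2 * of_int (q * q)) = 1" unfolding c_def using QW_const by (rule left_inverse)
 hence *: "c * (cW * C2 * of_int (q * q) * x) = x" for x by (simp only: mult.assoc[symmetric] mult_1)
 have "U_op (p\<^sup>2) f = (\<lambda>z. c * Q (W f) z)" unfolding QW_U[OF fS] * ..
 also have "... = (\<lambda>z. c * g z + W (\<lambda>z. - c * f z) z)" unfolding W_cmult g_def by (simp add: algebra_simps)
 finally have eq: "U_op (p\<^sup>2) f = (\<lambda>z. c * g z + W (\<lambda>z. - c * f z) z)" .
 have N4: "4 dvd 4 * (M div p)" by simp
 show ?thesis by (rule that[OF cusp_forms_cmult[OF N4 g] cusp_forms_cmult[OF N4 f] eq])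
qed

text \<open>Conjugation by the involution W turns the condition on Q' at f into the condition on Q
  at W f; self-adjointness then moves W to the other argument.\<close>

lemma eigen_iff: assumes f: "f \<in> Sk"
 shows "Q f = - f \<and> - f = W (Q (W f)) \<longleftrightarrow> (\<forall>g\<in>SL. ipN f g = 0 \<and> ipN f (W g) = 0)"
proof -
 have neg: "W (- h) = - W h" for h using W_cmult[of "-1" h] by (simp add: fun_Compl_def)
 have "- f = W (Q (W f)) \<longleftrightarrow> Q (W f) = - W f"
 proof
  assume "- f = W (Q (W f))"
  hence "W (- f) = Q (W f)" using W_involution[OF Q_Sk[OF W_Sk[OF f]]] by simp
  thus "Q (W f) = - W f" by (simp add: neg)
 next
  assume "Q (W f) = - W f"
  thus "- f = W (Q (W f))" using W_involution[OF f] by (simp add: neg)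
 qed
 also have "... \<longleftrightarrow> (\<forall>g\<in>SL. ipN (W f) g = 0)" by (rule Q_eigen_iff[OF W_Sk[OF f]])
 also have "... \<longleftrightarrow> (\<forall>g\<in>SL. ipN f (W g) = 0)" using W_selfadjoint'[OF f] SL_Sk by simp
 finally show ?thesis using Q_eigen_iff[OF f] by blast
qed
end

subsection \<open>The operators at 2\<close>

text \<open>Principal roots of numbers in the right half plane have argument below pi/4 in absolute
  value, so their quotient stays in the right half plane.\<close>

lemma csqrt_divide_right_half:
 assumes "0 < Re a" "0 < Re b" shows "csqrt (a / b) = csqrt a / csqrt b"
proof (rule csqrt_unique)
 show "(csqrt a / csqrt b)\<^sup>2 = a / b" by (simp add: power_divide)
 have *: "\<bar>Im (csqrt x)\<bar> < Re (csqrt x)" if "0 < Re x" for x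
 proof -
  have "Re x = Re ((csqrt x)\<^sup>2)" by simp
  also have "... = (Re (csqrt x))\<^sup>2 - (Im (csqrt x))\<^sup>2" by (simp only: Re_power2)
  finally have "\<bar>Im (csqrt x)\<bar>\<^sup>2 < (Re (csqrt x))\<^sup>2" using that by (simp only: power2_abs)
  moreover have "0 \<le> Re (csqrt x)" using csqrt_principal[of x] by auto
  ultimately show ?thesis by (rule power2_less_imp_less)
 qed
 have "0 < Re (csqrt a) * Re (csqrt b) + Im (csqrt a) * Im (csqrt b)"
 proof -
  have "\<bar>Im (csqrt a) * Im (csqrt b)\<bar> < Re (csqrt a) * Re (csqrt b)"
   unfolding abs_mult using *[OF assms(1)] *[OF assms(2)] by (intro mult_strict_mono') auto
  thus ?thesis by linarith
 qed
 moreover have "0 < (cmod (csqrt b))\<^sup>2" using assms(2) by auto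
 ultimately have "0 < Re (csqrt a / csqrt b)" unfolding Re_divide cmod_power2 by (rule divide_pos_pos)
 thus "0 < Re (csqrt a / csqrt b) \<or> Re (csqrt a / csqrt b) = 0 \<and> 0 \<le> Im (csqrt a / csqrt b)" by simp
qed

section \<open>The map z -> -1/(4 z) and the theta multiplier\<close>

abbreviation Wm :: "int ^ 2 ^ 2" where "Wm \<equiv> mat2 0 (-1) 4 0"

text \<open>Automorphy factor for z -> -1/(4 z). For z in the half plane -2 i z has positive real
  part, so no branch is crossed.\<close>

definition Wfac :: "complex \<Rightarrow> complex" where "Wfac z = csqrt (- 2 * \<i> * z)"

definition Wop :: "nat \<Rightarrow> (complex \<Rightarrow> complex) \<Rightarrow> complex \<Rightarrow> complex" where
 "Wop k f = (\<lambda>z. f (mact Wm z) / Wfac z ^ (2 * k + 1))"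

text \<open>Conjugation of \<open>Gamma0 4\<close> by \<open>Wm\<close>
  (\<open>Wm_conj\<close>).\<close>

definition Wconj :: "int ^ 2 ^ 2 \<Rightarrow> int ^ 2 ^ 2" where
 "Wconj A = mat2 (A $ 2 $ 2) (- (A $ 2 $ 1 div 4)) (- 4 * A $ 1 $ 2) (A $ 1 $ 1)"

lemma Wconj_Gamma0: "A \<in> Gamma0 4 \<Longrightarrow> Wconj A \<in> Gamma0 4"
proof -
 assume A: "A \<in> Gamma0 4"
 obtain c where c: "A $ 2 $ 1 = 4 * c" using Gamma0_4_odd(1)[OF A] by blast
 show "Wconj A \<in> Gamma0 4" using Gamma0_props(1)[OF A] by (simp add: Wconj_def Gamma0_mat2 c algebra_simps)
qed

lemma Wm_conj: "A \<in> Gamma0 4 \<Longrightarrow> Wm ** A = Wconj A ** Wm"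
proof -
 assume A: "A \<in> Gamma0 4"
 obtain c where c: "A $ 2 $ 1 = 4 * c" using Gamma0_4_odd(1)[OF A] by blast
 show "Wm ** A = Wconj A ** Wm" by (simp add: Wconj_def mat2_eq_iff c)
qed

lemma Wconj_mult: "A \<in> Gamma0 4 \<Longrightarrow> B \<in> Gamma0 4 \<Longrightarrow> Wconj (A ** B) = Wconj A ** Wconj B"
proof -
 assume AB: "A \<in> Gamma0 4" "B \<in> Gamma0 4"
 obtain c d where c: "A $ 2 $ 1 = 4 * c" "B $ 2 $ 1 = 4 * d" using AB Gamma0_4_odd(1) by (meson dvd_def)
 have "(A ** B) $ 2 $ 1 = 4 * (c * B $ 1 $ 1 + A $ 2 $ 2 * d)" by (simp add: c algebra_simps)
 hence "(A ** B) $ 2 $ 1 div 4 = c * B $ 1 $ 1 + A $ 2 $ 2 * d" by simp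
 thus ?thesis unfolding Wconj_def mat2_eq_iff mult2_nth mat2_nth by (simp add: c algebra_simps)
qed

lemma Wconj_adj2: "A \<in> Gamma0 4 \<Longrightarrow> Wconj (adj2 A) = adj2 (Wconj A)"
proof -
 assume A: "A \<in> Gamma0 4"
 obtain c where c: "A $ 2 $ 1 = 4 * c" using Gamma0_4_odd(1)[OF A] by blast
 have "- (4 * c) div 4 = - c" by simp
 thus ?thesis by (simp add: Wconj_def mat2_eq_iff c)
qed

lemma Re_Wfac_arg: "0 < Im z \<Longrightarrow> 0 < Re (- 2 * \<i> * z)" by simp

lemma Wfac_nonzero: "0 < Im z \<Longrightarrow> Wfac z \<noteq> 0" by (auto simp: Wfac_def)

lemma mact_Wm_upper: "0 < Im z \<Longrightarrow> 0 < Im (mact Wm z)" by (rule mact_upper) auto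

lemma mact_Wm_Gamma0: "A \<in> Gamma0 4 \<Longrightarrow> 0 < Im z \<Longrightarrow> mact Wm (mact A z) = mact (Wconj A) (mact Wm z)"
proof -
 assume A: "A \<in> Gamma0 4" and z: "0 < Im z"
 have "det A = 1" using A by (simp add: Gamma0_def SL2Z_def)
 hence "mact Wm (mact A z) = mact (Wm ** A) z" using z by (subst mact_mult) auto
 also have "... = mact (Wconj A) (mact Wm z)" unfolding Wm_conj[OF A] using z by (subst mact_mult) auto
 finally show ?thesis .
qed

text \<open>Checked on the generators, where the roots involved are quotients of roots from the
  right half plane; products and inverses follow from the cocycle relation. In this way the symbols
  of A and of its conjugate are compared without evaluating either.\<close>

lemma Wfac_commute:
 assumes "A \<in> Gamma0 4" "0 < Im z"
 shows "theta_factor (Wconj A) (mact Wm z) * Wfac z = Wfac (mact A z) * theta_factor A z" using assms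
proof (induction A arbitrary: z rule: Gamma0_4_induct)
 case (T z)
 hence z0: "z \<noteq> 0" by auto
 have "Wconj (Tmat 1) = Lmat (- 4)" by (simp add: Wconj_def)
 moreover have "of_int (- 4) * mact Wm z + 1 = (- 2 * \<i> * (z + 1)) / (- 2 * \<i> * z)"
  using z0 by (simp add: mact_eq den_def field_simps)
 moreover have "csqrt ((- 2 * \<i> * (z + 1)) / (- 2 * \<i> * z)) = Wfac (z + 1) / Wfac z"
  unfolding Wfac_def by (rule csqrt_divide_right_half) (use T in auto)
 moreover have "mact (Tmat 1) z = z + 1" by (simp add: mact_eq den_def)
 ultimately show ?case using Wfac_nonzero[OF T] by (simp add: theta_factor_Lmat)
next
 case (L z)
 have d0: "den (Lmat 4) z \<noteq> 0" using L by (intro den_nonzero) auto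
 have "Wconj (Lmat 4) = Tmat (- 1)" by (simp add: Wconj_def)
 moreover have z': "0 < Im (mact (Lmat 4) z)" using L by (intro mact_upper) auto
 moreover have "4 * z + 1 = (- 2 * \<i> * z) / (- 2 * \<i> * mact (Lmat 4) z)"
 proof -
  have "z \<noteq> 0" using L by auto
  moreover have "mact (Lmat 4) z = z / (4 * z + 1)" by (simp add: mact_eq den_def)
  moreover have "4 * z + 1 \<noteq> 0" using d0 by (simp add: den_def)
  ultimately show ?thesis by simp
 qed
 hence "csqrt (4 * z + 1) = Wfac z / Wfac (mact (Lmat 4) z)"
  unfolding Wfac_def using csqrt_divide_right_half[OF Re_Wfac_arg[OF L] Re_Wfac_arg[OF z']] by simp
 ultimately show ?case using Wfac_nonzero[OF z'] by (simp add: theta_factor_Lmat)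
next
 case (neg z)
 have "Wconj (mat2 (-1) 0 0 (-1)) = mat2 (-1) 0 0 (-1)" by (simp add: Wconj_def)
 moreover have "mact (mat2 (-1) 0 0 (-1)) z = z" by (simp add: mact_eq den_def)
 ultimately show ?case by (simp add: theta_factor_neg1)
next
 case (mult A B z)
 have Bz: "0 < Im (mact B z)" using mult by (intro mact_upper_SL2Z Gamma0_SL2Z)
 have "det B = 1" using mult by (simp add: Gamma0_def SL2Z_def)
 hence AB: "mact (A ** B) z = mact A (mact B z)" using mult by (intro mact_mult) auto
 have "theta_factor (Wconj (A ** B)) (mact Wm z) * Wfac z
   = theta_factor (Wconj A) (mact (Wconj B) (mact Wm z)) * (theta_factor (Wconj B) (mact Wm z) * Wfac z)"
  using mult.hyps mult.prems by (simp add: Wconj_mult theta_factor_mult Wconj_Gamma0 mact_Wm_upper)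
 also have "... = theta_factor (Wconj A) (mact Wm (mact B z)) * Wfac (mact B z) * theta_factor B z"
  using mult.IH(2)[OF mult.prems] mact_Wm_Gamma0[OF mult.hyps(2) mult.prems] by simp
 also have "... = Wfac (mact A (mact B z)) * theta_factor A (mact B z) * theta_factor B z"
  using mult.IH(1)[OF Bz] by simp
 finally show ?case using mult.hyps mult.prems by (simp add: AB theta_factor_mult)
next
 case (inverse A z)
 define y where "y = mact (adj2 A) z"
 have A: "A \<in> Gamma0 4" "adj2 A \<in> Gamma0 4" using inverse by (auto intro: Gamma0_adj2)
 have det: "0 < det A" "A \<in> SL2Z" using A by (auto simp: Gamma0_def SL2Z_def)
 have y: "0 < Im y" unfolding y_def using inverse A by (intro mact_upper_SL2Z Gamma0_SL2Z)
 have Ay: "mact A y = z" unfolding y_def by (rule mact_adj2(2)[OF inverse.prems det(1)])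
 have t1: "theta_factor A y * theta_factor (adj2 A) z = 1"
  using theta_factor_mult[OF A(1) A(2) inverse.prems] adj2_SL2Z(2)[OF det(2)]
  by (simp add: y_def theta_factor_den den_def theta_eps_def)
 have "theta_factor (Wconj A) (mact (adj2 (Wconj A)) (mact Wm z)) * theta_factor (adj2 (Wconj A)) (mact Wm z) = 1"
  using theta_factor_mult[OF Wconj_Gamma0[OF A(1)] Gamma0_adj2[OF Wconj_Gamma0[OF A(1)]] mact_Wm_upper[OF inverse.prems]]
   adj2_SL2Z(2)[OF Gamma0_SL2Z[OF Wconj_Gamma0[OF A(1)]]]
  by (simp add: theta_factor_den den_def theta_eps_def)
 hence t2: "theta_factor (Wconj A) (mact Wm y) * theta_factor (Wconj (adj2 A)) (mact Wm z) = 1"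
  using mact_Wm_Gamma0[OF A(2) inverse.prems] Wconj_adj2[OF A(1)] by (simp add: y_def)
 have "theta_factor (Wconj (adj2 A)) (mact Wm z) * Wfac z
  = theta_factor (Wconj (adj2 A)) (mact Wm z) * (Wfac z * theta_factor A y) * theta_factor (adj2 A) z"
  using t1 by simp
 also have "Wfac z * theta_factor A y = theta_factor (Wconj A) (mact Wm y) * Wfac y"
  using inverse.IH[OF y] Ay by simp
 finally show ?case using t2 by (simp add: y_def[symmetric] mult_ac)
qed

lemma js_Wop:
 assumes "A \<in> Gamma0 4" "\<And>z. \<not> 0 < Im z \<Longrightarrow> f z = 0" shows "js k A (Wop k f) = Wop k (js k (Wconj A) f)"
proof
 fix z
 have det: "det A = 1" "det (Wconj A) = 1" using assms(1) Wconj_Gamma0[OF assms(1)] by (auto simp: Gamma0_def SL2Z_def)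
 show "js k A (Wop k f) z = Wop k (js k (Wconj A) f) z"
 proof (cases "0 < Im z")
  case False
  hence "\<not> 0 < Im (mact Wm (mact A z))" "\<not> 0 < Im (mact (Wconj A) (mact Wm z))"
   using det by (simp_all add: mact_not_upper)
  thus ?thesis using assms(2) by (simp add: js_def Wop_def)
 next
  case True
  have "Wfac (mact A z) ^ (2 * k + 1) * theta_factor A z ^ (2 * k + 1)
    = theta_factor (Wconj A) (mact Wm z) ^ (2 * k + 1) * Wfac z ^ (2 * k + 1)"
   unfolding power_mult_distrib[symmetric] Wfac_commute[OF assms(1) True] ..
  thus ?thesis unfolding js_def Wop_def mact_Wm_Gamma0[OF assms(1) True] divide_divide_eq_left by simp
 qed
qed

lemma Wop_Wop: assumes "\<And>z. \<not> 0 < Im z \<Longrightarrow> f z = 0" shows "Wop k (Wop k f) = f"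
proof
 fix z
 show "Wop k (Wop k f) z = f z"
 proof (cases "0 < Im z")
  case False
  hence "\<not> 0 < Im (mact Wm (mact Wm z))" by (simp add: mact_not_upper)
  thus ?thesis using assms False by (simp add: Wop_def)
 next
  case True
  hence z0: "z \<noteq> 0" by auto
  have WW: "mact Wm (mact Wm z) = z" using z0 by (simp add: mact_eq den_def)
  have "- 2 * \<i> * mact Wm z = 1 / (- 2 * \<i> * z)" using z0 by (simp add: mact_eq den_def field_simps)
  hence "Wfac (mact Wm z) = 1 / Wfac z"
   unfolding Wfac_def using csqrt_divide_right_half[of 1 "- 2 * \<i> * z"] True by simp
  thus ?thesis using Wfac_nonzero[OF True] by (simp add: Wop_def WW power_divide)
 qed
qed

text \<open>Multiplication by -i turns the upper half plane into the right half plane; the root,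
  with argument in (0, pi/2), is turned by -pi/4 and remains principal.\<close>

lemma csqrt_rotate: assumes "0 < Im x" shows "csqrt (- \<i> * x) = csqrt x / csqrt \<i>"
proof (rule csqrt_unique)
 show "(csqrt x / csqrt \<i>)\<^sup>2 = - \<i> * x"
 proof -
  have "(csqrt x / csqrt \<i>)\<^sup>2 = x / \<i>" by (simp only: power_divide power2_csqrt)
  also have "... = - \<i> * x" by (rule complex_eqI) simp_all
  finally show ?thesis .
 qed
 have "Im x = 2 * Re (csqrt x) * Im (csqrt x)"
  using arg_cong[OF power2_csqrt[of x], of Im] by (simp only: Im_power2)
 moreover have "0 \<le> Re (csqrt x)" using csqrt_principal[of x] by auto
 moreover have "Re (csqrt x) \<noteq> 0"
 proof
  assume "Re (csqrt x) = 0"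
  with \<open>Im x = 2 * Re (csqrt x) * Im (csqrt x)\<close> show False using assms by (simp del: csqrt.simps)
 qed
 ultimately have "0 < Re (csqrt x)" "0 < 2 * Re (csqrt x) * Im (csqrt x)" using assms by linarith+
 hence c: "0 < Re (csqrt x)" "0 < Im (csqrt x)" by (simp_all add: zero_less_mult_iff del: csqrt.simps)
 have "csqrt x / csqrt \<i> = csqrt x * (1 - \<i>) / of_real (sqrt 2)"
 proof -
  have i1: "\<i> + 1 \<noteq> 0" by (simp add: complex_eq_iff)
  show ?thesis unfolding csqrt_ii
   by (simp add: divide_simps i1 del: csqrt.simps) (simp add: algebra_simps i1 flip: of_real_mult del: csqrt.simps)
 qed
 hence "Re (csqrt x / csqrt \<i>) = (Re (csqrt x) + Im (csqrt x)) / sqrt 2"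
  by (simp only: Re_divide_of_real) (simp only: times_complex.simps minus_complex.simps one_complex.simps imaginary_unit.simps diff_0 diff_zero mult_1_right mult_minus_right diff_minus_eq_add)
 also have "... > 0" using c by (intro divide_pos_pos add_pos_pos) auto
 finally show "0 < Re (csqrt x / csqrt \<i>) \<or> Re (csqrt x / csqrt \<i>) = 0 \<and> 0 \<le> Im (csqrt x / csqrt \<i>)" by blast
qed

section \<open>The operator W_4: level, involution, adjoint\<close>

locale even_prime_level =
 fixes k M :: nat and m n :: int
 assumes odd_M: "odd M" and bezout: "4 * n - m * int M = 1"
begin

abbreviation "W4 \<equiv> W_4 k M m n"
abbreviation "s2 \<equiv> quad_symbol 2 (2 * int k + 1)"

text \<open>The factor in \<open>Gamma0 4\<close> that remains when \<open>Wm\<close> is split off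
  from the matrix \<omega> of \<open>W_4\<close> (\<open>\<delta>_Wm\<close>).\<close>

definition \<delta> :: "int ^ 2 ^ 2" where "\<delta> = mat2 (- m) n (- 4) (int M)"
definition \<omega> :: "int ^ 2 ^ 2" where "\<omega> = mat2 (4 * n) m (4 * int M) 4"

lemma M_pos: "M > 0" using odd_M by (intro Nat.gr0I) auto

lemma \<delta>_Gamma0: "\<delta> \<in> Gamma0 4" using bezout by (simp add: \<delta>_def Gamma0_mat2)

lemma \<delta>_Wm: "\<delta> ** Wm = \<omega>" by (simp add: \<delta>_def \<omega>_def mat2_mult mult.commute)

lemma det_\<omega>: "det \<omega> = 4" using bezout by (simp add: \<omega>_def algebra_simps)

lemma s2_cases: "s2 = 1 \<or> s2 = -1" by (rule quad_symbol_cases) auto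

text \<open>The constant \<open>omega\<close> in \<open>W_4\<close> is the inverse of the constant
  part of the multiplier of \<delta>, raised to the weight.\<close>

lemma omega_cancel: "omega k M * (inverse (theta_eps (int M)) * of_int (chi4 (int M))) ^ (2 * k + 1) = 1"
proof -
 have "int M mod 4 = 1 \<or> int M mod 4 = 3" using odd_M by presburger
 moreover have "int M mod 4 = 1 \<longleftrightarrow> M mod 4 = 1" by presburger
 moreover have "- (\<i> * x * (\<i> * x)) = 1" if "x * x = 1" for x :: complex
 proof -
  have "\<i> * x * (\<i> * x) = (\<i> * \<i>) * (x * x)" by (simp only: mult_ac)
  thus ?thesis using that by simp
 qed
 moreover have "(-1::complex) ^ k * (-1) ^ k = 1" by (simp flip: power_mult_distrib)
 ultimately show ?thesis by (auto simp: omega_def theta_eps_def chi4_def power_mult)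
qed

lemma theta_factor_\<delta>:
 assumes z: "0 < Im z" shows "theta_factor \<delta> (mact Wm z) * Wfac z
  = inverse (theta_eps (int M)) * of_int (chi4 (int M)) * (csqrt (2 * of_nat M * z + 2) / csqrt \<i>)"
proof -
 define x where "x = 2 * of_nat M * z + 2"
 have x: "0 < Im x" using z M_pos by (simp add: x_def)
 have z0: "z \<noteq> 0" using z by auto
 have "quad_symbol (- 4) (int M) = chi4 (int M) * jacobi 4 M"
  using quad_symbol_neg[of "-4" "int M"] odd_M by simp
 also have "jacobi (2 * 2) M = 1" using odd_M by (intro jacobi_square_left) auto
 hence "jacobi 4 M = 1" by simp
 finally have 1: "quad_symbol (- 4) (int M) = chi4 (int M)" by simp
 have "den \<delta> (mact Wm z) = (- \<i> * x) / (- 2 * \<i> * z)"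
  using z0 by (simp add: den_def \<delta>_def mact_eq x_def field_simps)
 moreover have "csqrt ((- \<i> * x) / (- 2 * \<i> * z)) = csqrt (- \<i> * x) / Wfac z"
  unfolding Wfac_def by (rule csqrt_divide_right_half) (use x z in auto)
 ultimately have "csqrt (den \<delta> (mact Wm z)) * Wfac z = csqrt x / csqrt \<i>"
  using Wfac_nonzero[OF z] csqrt_rotate[OF x] by simp
 thus ?thesis unfolding theta_factor_den x_def[symmetric] by (simp add: \<delta>_def 1 mult.assoc)
qed

lemma W4_value:
 assumes "0 < Im z"
 shows "W4 f z = of_int s2 * csqrt \<i> ^ (2 * k + 1) * omega k M * (f (mact \<omega> z) / csqrt (2 * of_nat M * z + 2) ^ (2 * k + 1))"
proof -
 have "exp ((2 * of_nat k + 1) * pi * \<i> / 4) = exp (of_nat (2 * k + 1) * (of_real pi * \<i> / 4))"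
  by (simp add: algebra_simps)
 also have "... = exp (of_real pi * \<i> / 4) ^ (2 * k + 1)" by (rule exp_of_nat_mult)
 also have "exp (of_real pi * \<i> / 4) = cis (pi / 4)" by (simp add: cis_conv_exp mult.commute)
 also have "... = csqrt \<i>" by (simp add: complex_eq_iff cos_45 sin_45 real_div_sqrt Re_divide_of_real Im_divide_of_real field_simps)
 finally have e: "exp ((2 * of_nat k + 1) * pi * \<i> / 4) = csqrt \<i> ^ (2 * k + 1)" .
 have "mat_act (mat2 (of_int (4 * n)) (of_int m) (of_nat (4 * M)) 4) z = mact \<omega> z"
  by (simp add: mact_eq den_def \<omega>_def mat_act_def moebius_def)
 thus ?thesis unfolding W_4_def e by (simp only: slash_alt[OF assms])
qed

lemma W4_upper: "\<not> 0 < Im z \<Longrightarrow> W4 f z = 0" by (simp add: W_4_def slash_def)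

text \<open>All constants of \<open>W_4\<close> except the sign (2/(2k+1)) are absorbed by the
  multiplier of \<delta>, so that \<open>js_Wop\<close> and \<open>Wop_Wop\<close> govern
  \<open>W_4\<close>.\<close>

lemma W4_Wop:
 assumes "\<And>z. \<not> 0 < Im z \<Longrightarrow> f z = 0" shows "W4 f = (\<lambda>z. of_int s2 * Wop k (js k \<delta> f) z)"
proof
 fix z
 have det: "det \<delta> = 1" using \<delta>_Gamma0 by (simp add: Gamma0_def SL2Z_def)
 show "W4 f z = of_int s2 * Wop k (js k \<delta> f) z"
 proof (cases "0 < Im z")
  case False
  hence "\<not> 0 < Im (mact \<delta> (mact Wm z))" using det by (simp add: mact_not_upper)
  thus ?thesis using assms False by (simp add: W4_upper Wop_def js_def)
 next
  case True
  define \<kappa> where "\<kappa> = inverse (theta_eps (int M)) * of_int (chi4 (int M))"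
  have \<kappa>: "omega k M * \<kappa> ^ (2 * k + 1) = 1" unfolding \<kappa>_def by (rule omega_cancel)
  hence "\<kappa> ^ (2 * k + 1) \<noteq> 0" by auto
  hence om: "omega k M = 1 / \<kappa> ^ (2 * k + 1)" using \<kappa> by (simp add: eq_divide_eq)
  have "mact \<delta> (mact Wm z) = mact \<omega> z" using True by (simp add: mact_mult flip: \<delta>_Wm)
  hence "Wop k (js k \<delta> f) z = f (mact \<omega> z) / (theta_factor \<delta> (mact Wm z) * Wfac z) ^ (2 * k + 1)"
   unfolding Wop_def js_def by (simp only: divide_divide_eq_left power_mult_distrib)
  also have "... = f (mact \<omega> z) / (\<kappa> * (csqrt (2 * of_nat M * z + 2) / csqrt \<i>)) ^ (2 * k + 1)"
   unfolding theta_factor_\<delta>[OF True] \<kappa>_def ..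
  also have "... = csqrt \<i> ^ (2 * k + 1) * omega k M * (f (mact \<omega> z) / csqrt (2 * of_nat M * z + 2) ^ (2 * k + 1))"
   unfolding om power_mult_distrib power_divide by (simp only: divide_divide_eq_right divide_divide_eq_left times_divide_times_eq mult_1 mult_ac times_divide_eq_left times_divide_eq_right)
  finally show ?thesis unfolding W4_value[OF True] by (simp only: mult.assoc)
 qed
qed

lemma W4_sl:
 obtains c :: complex where "c \<noteq> 0" "\<And>f. f \<in> cusp_space k \<Longrightarrow> W4 f = (\<lambda>z. c * sl k \<omega> f z)"
proof -
 define c where "c = of_int s2 * csqrt \<i> ^ (2 * k + 1) * omega k M / of_real (sqrt (1 / 2)) ^ (2 * k + 1)"
 have "omega k M \<noteq> 0" using omega_cancel by auto
 hence "c \<noteq> 0" using s2_cases unfolding c_def by (auto simp del: csqrt_ii)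
 moreover have "W4 f = (\<lambda>z. c * sl k \<omega> f z)" if f: "f \<in> cusp_space k" for f
 proof
  fix z
  show "W4 f z = c * sl k \<omega> f z"
  proof (cases "0 < Im z")
   case False
   thus ?thesis using W4_upper sl_upper_zero[of \<omega> f z k] cusp_space_upper[OF f] det_\<omega> by simp
  next
   case True
   have "csqrt (of_real (1 / 2) * den \<omega> z) = of_real (sqrt (1 / 2)) * csqrt (den \<omega> z)" by (rule csqrt_scale) simp
   moreover have "of_real (1 / 2) * den \<omega> z = 2 * of_nat M * z + 2" by (simp add: den_def \<omega>_def field_simps)
   ultimately have "csqrt (2 * of_nat M * z + 2) = of_real (sqrt (1 / 2)) * csqrt (den \<omega> z)" by (simp only:)
   thus ?thesis unfolding W4_value[OF True] sl_def c_def by (simp only: power_mult_distrib times_divide_times_eq mult.assoc times_divide_eq_left times_divide_eq_right divide_divide_eq_left)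
  qed
 qed
 ultimately show ?thesis by (rule that)
qed

lemma W4_cusp_space: assumes "f \<in> cusp_space k" shows "W4 f \<in> cusp_space k"
proof -
 obtain c :: complex where "W4 f = (\<lambda>z. c * sl k \<omega> f z)" using W4_sl assms by metis
 thus ?thesis using cusp_space_cmult[OF sl_in_cusp_space[OF assms]] det_\<omega> by simp
qed

lemma W4_cmult: "W4 (\<lambda>z. c * f z) = (\<lambda>z. c * W4 f z)" by (simp add: W_4_def slash_def fun_eq_iff)

text \<open>Conjugating A by \<open>Wm\<close> and then by \<delta> leads back into
  \<open>Gamma0 (4 N)\<close>. Stated for every divisor N of M because both level 4 M and level 4
  M/p occur.\<close>

lemma W4_level:
 assumes f: "f \<in> cusp_forms k (4 * N)" and N: "N dvd M" shows "W4 f \<in> cusp_forms k (4 * N)"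
proof -
 have N4: "4 dvd 4 * N" by simp
 have fc: "f \<in> cusp_space k" and inv: "A \<in> Gamma0 (4 * N) \<Longrightarrow> js k A f = f" for A
  using f cusp_forms_eq[OF N4] by auto
 note up = cusp_space_upper[OF fc]
 have "js k A (W4 f) = W4 f" if A: "A \<in> Gamma0 (4 * N)" for A
 proof -
  have A4: "A \<in> Gamma0 4" by (rule Gamma0_mono[OF N4 A])
  have C4: "Wconj A \<in> Gamma0 4" by (rule Wconj_Gamma0[OF A4])
  obtain c where c: "A $ 2 $ 1 = 4 * (int N * c)" using Gamma0_props(2)[OF A] by (auto simp: dvd_def mult.assoc)
  have "int N dvd int M" using N by simp
  then obtain M' where M': "int M = int N * M'" by blast
  define B where "B = \<delta> ** Wconj A ** adj2 \<delta>"
  have B4: "B \<in> Gamma0 4" unfolding B_def by (intro Gamma0_mult Gamma0_adj2 \<delta>_Gamma0 C4)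
  have "B $ 2 $ 1 = int (4 * N) * (A $ 1 $ 1 * M' - A $ 2 $ 2 * M' - A $ 1 $ 2 * M' * int M + 4 * c)"
   by (simp add: B_def \<delta>_def Wconj_def c M' algebra_simps)
  hence B: "B \<in> Gamma0 (4 * N)" using B4 by (simp add: Gamma0_def)
  have "\<delta> ** Wconj A = B ** \<delta>" unfolding B_def using adj2_cancel(4)[OF Gamma0_SL2Z[OF \<delta>_Gamma0]] by simp
  moreover have up\<delta>: "js k \<delta> f z = 0" if "\<not> 0 < Im z" for z
   using js_in_cusp_space[OF fc \<delta>_Gamma0] that cusp_space_upper by blast
  moreover have "js k (Wconj A) (js k \<delta> f) = js k (\<delta> ** Wconj A) f" by (rule js_mult[OF \<delta>_Gamma0 C4 up])
  moreover have "js k (B ** \<delta>) f = js k \<delta> (js k B f)" by (rule js_mult[OF B4 \<delta>_Gamma0 up, symmetric])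
  ultimately have "js k (Wconj A) (js k \<delta> f) = js k \<delta> f" using inv[OF B] by simp
  hence "js k A (Wop k (js k \<delta> f)) = Wop k (js k \<delta> f)" using js_Wop[OF A4, of "js k \<delta> f" k] up\<delta> by simp
  moreover have "W4 f = (\<lambda>z. of_int s2 * Wop k (js k \<delta> f) z)" by (rule W4_Wop) (rule up)
  ultimately show ?thesis by (simp add: js_lin(2))
 qed
 thus ?thesis using W4_cusp_space[OF fc] by (simp add: cusp_forms_eq)
qed

text \<open>Moving \<delta> across \<open>Wop\<close> leaves the slash by \<delta> times its
  conjugate, a matrix of \<open>Gamma0 (4 M)\<close>; the two maps z -> -1/(4 z) and the two signs
  cancel.\<close>

lemma W4_involution:
 assumes f: "f \<in> cusp_forms k (4 * M)" shows "W4 (W4 f) = f"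
proof -
 have N4: "4 dvd 4 * M" by simp
 have fc: "f \<in> cusp_space k" and inv: "A \<in> Gamma0 (4 * M) \<Longrightarrow> js k A f = f" for A
  using f cusp_forms_eq[OF N4] by auto
 note up = cusp_space_upper[OF fc]
 have up\<delta>: "js k \<delta> f z = 0" if "\<not> 0 < Im z" for z
  using js_in_cusp_space[OF fc \<delta>_Gamma0] that cusp_space_upper by blast
 have C4: "Wconj \<delta> \<in> Gamma0 4" by (rule Wconj_Gamma0[OF \<delta>_Gamma0])
 have W: "W4 f = (\<lambda>z. of_int s2 * Wop k (js k \<delta> f) z)" by (rule W4_Wop) (rule up)
 have WW: "W4 (W4 f) = (\<lambda>z. of_int s2 * Wop k (js k \<delta> (W4 f)) z)" by (rule W4_Wop) (rule W4_upper)
 have "js k \<delta> (Wop k (js k \<delta> f)) = Wop k (js k (Wconj \<delta>) (js k \<delta> f))" by (rule js_Wop[OF \<delta>_Gamma0 up\<delta>])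
 also have "js k (Wconj \<delta>) (js k \<delta> f) = js k (\<delta> ** Wconj \<delta>) f" by (rule js_mult[OF \<delta>_Gamma0 C4 up])
 also have "... = f"
 proof (rule inv)
  have "\<delta> ** Wconj \<delta> \<in> Gamma0 4" by (intro Gamma0_mult \<delta>_Gamma0 C4)
  moreover have "(\<delta> ** Wconj \<delta>) $ 2 $ 1 = int (4 * M) * (- 1 - n)" by (simp add: \<delta>_def Wconj_def algebra_simps)
  ultimately show "\<delta> ** Wconj \<delta> \<in> Gamma0 (4 * M)" by (simp add: Gamma0_def)
 qed
 finally have 1: "js k \<delta> (Wop k (js k \<delta> f)) = Wop k f" .
 have lin: "Wop k (\<lambda>z. c * g z) = (\<lambda>z. c * Wop k g z)" for c g by (simp add: Wop_def)
 have "Wop k (Wop k f) = f" by (rule Wop_Wop) (rule up)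
 moreover have "complex_of_int s2 * (of_int s2 * x) = x" for x using s2_cases by auto
 ultimately show ?thesis unfolding WW by (subst W) (simp only: js_lin(2) 1 lin)
qed

text \<open>Writing g as W_4 (W_4 g) makes both arguments slashes by the same matrix \<omega>, up to
  constants.\<close>

lemma W4_ip:
 assumes N: "N > 0" "4 * M dvd N"
 obtains c :: complex where "c \<noteq> 0"
  "\<And>f g. f \<in> cusp_forms k (4 * M) \<Longrightarrow> g \<in> cusp_forms k (4 * M) \<Longrightarrow> ip k N (W4 f) g = c * ip k N f (W4 g)"
proof -
 have N4: "4 dvd N" using N(2) by (metis dvd_mult_left)
 obtain c :: complex where c: "c \<noteq> 0" "\<And>f. f \<in> cusp_space k \<Longrightarrow> W4 f = (\<lambda>z. c * sl k \<omega> f z)" using W4_sl by blast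
 have V: "f \<in> Vsp k N" if "f \<in> cusp_forms k (4 * M)" for f using that N by (intro cusp_forms_Vsp[of f k "4 * M"]) auto
 have C: "f \<in> cusp_space k" if "f \<in> cusp_forms k (4 * M)" for f using that cusp_forms_eq[of "4 * M"] by auto
 define c' where "c' = c * cnj c / of_real (sqrt (of_int (det \<omega>)) ^ (2 * k + 1))"
 have c': "c' \<noteq> 0" using c(1) by (simp add: c'_def det_\<omega>)
 have "ip k N (W4 f) g = c' * ip k N f (W4 g)" if f: "f \<in> cusp_forms k (4 * M)" and g: "g \<in> cusp_forms k (4 * M)" for f g
 proof -
  have W: "W4 f \<in> cusp_forms k (4 * M)" "W4 g \<in> cusp_forms k (4 * M)" using W4_level f g by auto
  have "Phi k (W4 f) g z = c' * Phi k f (W4 g) (mact \<omega> z)" if z: "0 < Im z" for z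
  proof -
   have "Phi k (W4 f) g z = Phi k (\<lambda>z. c * sl k \<omega> f z) (\<lambda>z. c * sl k \<omega> (W4 g) z) z"
    using c(2)[OF C[OF f]] c(2)[OF C[OF W(2)]] W4_involution[OF g] by simp
   also have "... = c * cnj c * Phi k (sl k \<omega> f) (sl k \<omega> (W4 g)) z" by (simp add: Phi_def)
   also have "... = c' * Phi k f (W4 g) (mact \<omega> z)"
    using Phi_sl[of \<omega> z k f "W4 g"] z det_\<omega> by (simp add: c'_def)
   finally show ?thesis .
  qed
  thus ?thesis using det_\<omega> by (intro ip_transform[OF N(1) N4 _ V[OF f] V[OF W(2)] V[OF W(1)] V[OF g] c', of \<omega>]) auto
 qed
 thus ?thesis using that[of c'] c' by blast
qed
end

section \<open>W_4 and U_{p^2}, up to nonzero constants\<close>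

definition prop_to :: "(complex \<Rightarrow> complex) \<Rightarrow> (complex \<Rightarrow> complex) \<Rightarrow> bool" where
 "prop_to f g \<longleftrightarrow> (\<exists>c. c \<noteq> 0 \<and> f = (\<lambda>z. c * g z))"

lemma prop_to_sym: "prop_to f g \<Longrightarrow> prop_to g f"
 unfolding prop_to_def by (elim exE conjE, rule_tac x = "inverse c" in exI) auto

lemma prop_to_trans [trans]: assumes "prop_to f g" "prop_to g h" shows "prop_to f h"
proof -
 obtain c d where "c \<noteq> 0" "f = (\<lambda>z. c * g z)" "d \<noteq> 0" "g = (\<lambda>z. d * h z)" using assms by (auto simp: prop_to_def)
 thus ?thesis unfolding prop_to_def by (intro exI[of _ "c * d"]) auto
qed

lemma prop_to_sl: assumes "prop_to f g" shows "prop_to (sl k A f) (sl k A g)"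
proof -
 obtain c where "c \<noteq> 0" "f = (\<lambda>z. c * g z)" using assms by (auto simp: prop_to_def)
 thus ?thesis unfolding prop_to_def by (intro exI[of _ c]) (simp add: sl_lin)
qed

text \<open>The sign of \<open>sl_mult\<close> disappears in the constant. Where only the vanishing
  of products is at stake this replaces the tracking of square roots.\<close>

lemma prop_to_sl_mult:
 assumes f: "f \<in> cusp_space k" and det: "0 < det A" "0 < det B"
 shows "prop_to (sl k B (sl k A f)) (sl k (A ** B) f)"
proof -
 obtain e :: complex where e: "e = 1 \<or> e = -1" "\<And>f z. 0 < Im z \<Longrightarrow> sl k B (sl k A f) z = e * sl k (A ** B) f z"
  using sl_mult[OF det] by blast
 have AB: "0 < det (A ** B)" using det by (simp add: det_mul)
 have "sl k B (sl k A f) z = e * sl k (A ** B) f z" for z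
 proof (cases "0 < Im z")
  case False
  hence "sl k B (sl k A f) z = 0" "sl k (A ** B) f z = 0"
   by (rule cusp_space_upper[OF sl_in_cusp_space[OF sl_in_cusp_space[OF f det(1)] det(2)]],
     rule cusp_space_upper[OF sl_in_cusp_space[OF f AB]])
  thus ?thesis by simp
 qed (rule e)
 thus ?thesis unfolding prop_to_def using e(1) by (intro exI[of _ e]) auto
qed

lemma prop_to_aff: assumes "d > 0" shows "prop_to (aff a b d f) (sl k (mat2 a b 0 d) f)"
proof -
 have "csqrt (of_int d) \<noteq> 0" using assms by simp
 hence "aff a b d f = (\<lambda>z. csqrt (of_int d) ^ (2 * k + 1) * sl k (mat2 a b 0 d) f z)"
  using assms by (simp add: fun_eq_iff sl_def aff_mact) (simp add: den_def)
 thus ?thesis unfolding prop_to_def using \<open>csqrt (of_int d) \<noteq> 0\<close> by (intro exI[of _ "csqrt (of_int d) ^ (2 * k + 1)"]) simp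
qed

lemma prop_to_js: assumes "A \<in> Gamma0 4" shows "prop_to (js k A f) (sl k A f)"
proof -
 have "quad_symbol (A $ 2 $ 1) (A $ 2 $ 2) \<noteq> 0"
  using quad_symbol_cases[of "A $ 2 $ 2" "A $ 2 $ 1"] Gamma0_4_odd[OF assms] by auto
 thus ?thesis unfolding prop_to_def js_eq_sl[OF assms]
  by (intro exI[of _ "inverse ((inverse (theta_eps (A $ 2 $ 2)) * of_int (quad_symbol (A $ 2 $ 1) (A $ 2 $ 2))) ^ (2 * k + 1))"]) simp
qed

lemma prop_to_scalar: assumes "s > 0" shows "prop_to (sl k (mat s ** A) f) (sl k A f)"
proof -
 define c where "c = inverse (complex_of_real (sqrt (real_of_int s)) ^ (2 * k + 1))"
 have den: "den (mat s ** A) z = of_real (real_of_int s) * den A z" for z by (simp add: den_def algebra_simps)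
 have "sl k (mat s ** A) f z = c * sl k A f z" for z
 proof -
  have "mact (mat s ** A) z = (of_int s * (of_int (A $ 1 $ 1) * z + of_int (A $ 1 $ 2))) / (of_int s * den A z)"
   unfolding mact_eq den by (simp add: algebra_simps)
  hence "mact (mat s ** A) z = mact A z" using assms by (simp add: mact_eq)
  moreover have "csqrt (den (mat s ** A) z) = of_real (sqrt (real_of_int s)) * csqrt (den A z)"
   unfolding den by (rule csqrt_scale) (use assms in simp)
  ultimately show ?thesis unfolding sl_def c_def by (simp only: power_mult_distrib) (simp add: field_simps)
 qed
 thus ?thesis unfolding prop_to_def using assms by (intro exI[of _ c]) (auto simp: c_def)
qed

context even_prime_level
begin

abbreviation "S4 N \<equiv> cusp_forms k (4 * N)"

lemma S4_cusp: "f \<in> S4 N \<Longrightarrow> f \<in> cusp_space k" "f \<in> S4 N \<Longrightarrow> A \<in> Gamma0 (4 * N) \<Longrightarrow> js k A f = f"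
 by (auto simp: cusp_forms_eq)

text \<open>The left side is 4 times an integral matrix of determinant p^2, whose upper left entry a
  is prime to p because p divides M. Subtracting v = b/a mod p^2 times the first column from the
  second makes the latter divisible by p^2, which is the factor (1, v; 0, p^2).\<close>

lemma W4_U_matrix:
 fixes p :: nat defines "r \<equiv> int p * int p"
 assumes p: "prime p" "p dvd M"
 obtains \<gamma> v where "\<gamma> \<in> Gamma0 (4 * M)"
  "\<omega> ** mat2 1 0 0 r ** adj2 \<omega> = mat 4 ** (\<gamma> ** (mat2 1 0 0 r ** Tmat v))"
proof -
 define a b c d where "a = r - 4 * n * (r - 1)" and "b = n * m * (r - 1)" and "c = - 4 * int M * (r - 1)" and "d = 1 + 4 * n * (r - 1)"
 note abcd = this
 have mM: "m * int M = 4 * n - 1" using bezout by simp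
 have det: "a * d - b * c = r"
 proof -
  have "a * d - b * c = a * d + 4 * n * (r - 1) * (r - 1) * (m * int M)" by (simp add: b_def c_def algebra_simps)
  thus ?thesis unfolding mM a_def d_def by (simp add: algebra_simps)
 qed
 have "coprime a (int p)"
 proof (rule coprimeI)
  fix x assume x: "x dvd a" "x dvd int p"
  have "x dvd int M" using x(2) p(2) by (meson dvd_trans of_nat_dvd_iff)
  hence "x dvd a - r + 4 * n * r - m * int M" using x(1) x(2) unfolding r_def
   by (intro dvd_diff dvd_add dvd_mult) auto
  also have "a - r + 4 * n * r - m * int M = 1" unfolding mM a_def by (simp add: algebra_simps)
  finally show "is_unit x" .
 qed
 hence cop: "coprime a r" unfolding r_def by simp
 then obtain a' where "[a * a' = 1] (mod r)" using cong_solve_coprime_int by blast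
 hence "r dvd (a * a' - 1) * b" by (simp add: cong_iff_dvd_diff)
 moreover have "(a * a' - 1) * b = - (b - a * (a' * b))" by (simp add: algebra_simps)
 ultimately have "r dvd b - a * (a' * b)" by (metis dvd_minus_iff)
 then obtain w where w: "b - a * (a' * b) = r * w" by blast
 define v where "v = a' * b"
 have "a * (d - c * v) = r + c * (b - a * v)" using det by (simp add: algebra_simps)
 also have "b - a * v = r * w" using w by (simp add: v_def)
 also have "r + c * (r * w) = r * (1 + c * w)" by (simp add: algebra_simps)
 finally have "r dvd a * (d - c * v)" by simp
 hence "r dvd d - c * v" using cop by (simp add: coprime_commute coprime_dvd_mult_right_iff)
 then obtain u where u: "d - c * v = r * u" by blast
 have r0: "r > 0" using p(1) by (simp add: r_def prime_gt_0_nat)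
 have "r * (a * u - w * c) = a * (r * u) - (r * w) * c" by (simp add: algebra_simps)
 also have "... = a * (d - c * v) - (b - a * v) * c" using u w by (simp add: v_def)
 also have "... = r * 1" using det by (simp add: algebra_simps)
 finally have "a * u - w * c = 1" using r0 by (metis mult_left_cancel less_irrefl)
 hence "mat2 a w c u \<in> Gamma0 (4 * M)" by (simp add: Gamma0_mat2 c_def)
 moreover have "\<omega> ** mat2 1 0 0 r ** adj2 \<omega> = mat 4 ** mat2 a b c d"
 proof -
  have "16 * n - 4 * (r * (m * int M)) = 4 * a" "- 4 * (m * int M) + 16 * n * r = 4 * d"
   unfolding mM a_def d_def by (simp_all add: algebra_simps)
  moreover have "\<omega> ** mat2 1 0 0 r ** adj2 \<omega> = mat2 (16 * n - 4 * (r * (m * int M))) (4 * b) (4 * c) (- 4 * (m * int M) + 16 * n * r)"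
   by (simp add: \<omega>_def mat2_eq_iff b_def c_def algebra_simps)
  ultimately show ?thesis by (simp add: mat2_eq_iff)
 qed
 moreover have "mat2 a b c d = mat2 a w c u ** (mat2 1 0 0 r ** Tmat v)"
 proof -
  have "b = a * v + w * r" "d = c * v + u * r" using w u by (simp_all add: v_def mult.commute)
  thus ?thesis by (simp add: mat2_mult)
 qed
 ultimately show ?thesis using that[of "mat2 a w c u" v] by simp
qed

text \<open>Translations by integers fix f and W_4 f, so in the products U_{p^2} h may be replaced
  by h(z / p^2). By \<open>W4_U_matrix\<close>, undoing W_4 turns this into a translate of h'(z /
  p^2) with h' = W_4 h, which is again of level 4 M/p, and the assumption on f applies to
  h'.\<close>

lemma ip_W4_U:
 assumes p: "prime p" "p dvd M" and f: "f \<in> S4 M" and orth: "\<And>h. h \<in> S4 (M div p) \<Longrightarrow> petersson k (4 * M) f (U_op (p\<^sup>2) h) = 0"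
  and h: "h \<in> S4 (M div p)" shows "petersson k (4 * M) (W4 f) (U_op (p\<^sup>2) h) = 0"
proof -
 define r N where "r = int p * int p" and "N = 4 * M * (p * p)"
 have p0: "p > 0" using p by (simp add: prime_gt_0_nat)
 have r0: "r > 0" using p0 by (simp add: r_def)
 have N: "N > 0" "4 dvd N" "4 * M dvd N" using M_pos p0 by (auto simp: N_def)
 obtain \<nu> :: nat where \<nu>: "\<nu> > 0" "\<And>f g. f \<in> S4 M \<Longrightarrow> g \<in> S4 M \<Longrightarrow> ip k N f g = of_nat \<nu> * petersson k (4 * M) f g"
  using ip_petersson[OF _ N(3) N(1), of k] by auto
 have sub: "S4 (M div p) \<subseteq> S4 M"
 proof -
  have "4 * (M div p) dvd 4 * M" using dvd_mult_div_cancel[OF p(2)] by (metis dvd_triv_right mult_dvd_mono dvd_refl)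
  thus ?thesis by (intro cusp_forms_mono) auto
 qed
 have V: "f \<in> Vsp k N" if "f \<in> S4 M" for f using that N by (intro cusp_forms_Vsp[of f k "4 * M"]) auto
 define D where "D = (aff 1 0 r :: (complex \<Rightarrow> complex) \<Rightarrow> complex \<Rightarrow> complex)"
 have Dc: "D h \<in> cusp_space k" if "h \<in> S4 M" for h unfolding D_def using S4_cusp(1)[OF that] r0 by (intro aff_in_cusp_space) auto
 have DV: "D h \<in> Vsp k N" if h: "h \<in> S4 M" for h
 proof -
  have "js k A (D h) = D h" if A: "A \<in> GammaN N" for A
  proof -
   have A4: "A \<in> Gamma0 4" using GammaN_Gamma0[OF N(2) A] .
   have d: "int N dvd A $ 1 $ 2" "int N dvd A $ 2 $ 1" using A by (auto simp: GammaN_def)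
   have "int N = r * (4 * int M)" "int N = int (4 * M) * r" by (simp_all add: N_def r_def)
   hence b: "r dvd A $ 1 $ 2" and c: "int (4 * M) dvd A $ 2 $ 1" using d by (metis dvd_mult_left)+
   have "jacobi r (nat \<bar>A $ 2 $ 2\<bar>) = 1"
   proof -
    have "coprime (int p) (A $ 2 $ 2)"
    proof (rule coprimeI)
     fix x assume x: "x dvd int p" "x dvd A $ 2 $ 2"
     have "x dvd A $ 1 $ 2" using x(1) b unfolding r_def by (meson dvd_mult_left dvd_trans)
     hence "x dvd A $ 1 $ 1 * A $ 2 $ 2 - A $ 1 $ 2 * A $ 2 $ 1" using x(2) by (intro dvd_diff) auto
     thus "is_unit x" using Gamma0_props(1)[OF A4] by simp
    qed
    thus ?thesis unfolding r_def using Gamma0_4_odd(2)[OF A4] by (intro jacobi_square_coprime)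
   qed
   moreover have "mat2 (A $ 1 $ 1) (A $ 1 $ 2 div r) (r * A $ 2 $ 1) (A $ 2 $ 2) \<in> Gamma0 (4 * M)"
    using js_aff_diag(2)[OF A4 r0 b] c by (simp add: Gamma0_def)
   ultimately show ?thesis unfolding D_def using js_aff_diag(1)[OF A4 r0 b, of k h] S4_cusp(2)[OF h] by simp
  qed
  thus ?thesis using Dc[OF h] by (simp add: Vsp_def)
 qed
 have U: "U_op (p\<^sup>2) h = (\<lambda>z. inverse (of_int r) * (\<Sum>v\<in>{0..<r}. js k (Tmat v) (D h) z))" if h: "h \<in> S4 M" for h
 proof -
  have pp: "int (p\<^sup>2) = r" "complex_of_nat (p\<^sup>2) = of_int r" by (simp_all add: power2_eq_square r_def)
  have "p\<^sup>2 > 0" "4 dvd 4 * M" using p0 by simp_all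
  moreover have "aff 1 v r h = js k (Tmat v) (D h)" for v by (simp add: js_Tmat D_def aff_def)
  ultimately show ?thesis using U_op_aff[OF h, of "p\<^sup>2"] unfolding pp by simp
 qed
 have ipU: "ip k N g (U_op (p\<^sup>2) h) = ip k N g (D h)" if g: "g \<in> S4 M" and h: "h \<in> S4 M" for g h
 proof -
  have 1: "js k (Tmat v) (D h) \<in> Vsp k N" for v by (intro Vsp_js DV h Gamma0_4_gens N)
  have "ip k N g (js k (Tmat v) (D h)) = ip k N g (D h)" for v
   using ip_js[OF N(1,2) V[OF g] DV[OF h] Gamma0_4_gens(1), of v] S4_cusp(2)[OF g, of "Tmat v"] by (simp add: Gamma0_mat2)
  moreover have "ip k N g (\<lambda>z. \<Sum>v\<in>{0..<r}. js k (Tmat v) (D h) z) = (\<Sum>v\<in>{0..<r}. ip k N g (js k (Tmat v) (D h)))"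
   by (rule ip_sum_right[OF N(1,2) V[OF g] 1])
  ultimately show ?thesis unfolding U[OF h] ip_cmult_right using r0 by simp
 qed
 have Um: "U_op (p\<^sup>2) h \<in> S4 M" if h: "h \<in> S4 (M div p)" for h
  using U_square_cusp_forms[of h k M p] h sub M_pos p0 p(2) by auto
 define h' where "h' = W4 h"
 have M': "M div p dvd M" using p(2) by (metis dvd_mult_div_cancel dvd_triv_right)
 have h': "h' \<in> S4 (M div p)" unfolding h'_def by (rule W4_level[OF h M'])
 have hM: "h \<in> S4 M" "h' \<in> S4 M" using h h' sub by auto
 have "ip k N f (D h') = 0" using ipU[OF f hM(2)] \<nu>(2)[OF f Um[OF h']] orth[OF h'] by simp
 obtain \<gamma> v where \<gamma>: "\<gamma> \<in> Gamma0 (4 * M)" "\<omega> ** mat2 1 0 0 r ** adj2 \<omega> = mat 4 ** (\<gamma> ** (mat2 1 0 0 r ** Tmat v))"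
  using W4_U_matrix[OF p] unfolding r_def .
 have \<gamma>4: "\<gamma> \<in> Gamma0 4" by (rule Gamma0_mono[OF _ \<gamma>(1)]) simp
 have dets: "0 < det \<omega>" "0 < det (adj2 \<omega>)" "0 < det (mat2 1 0 0 r)" "0 < det \<gamma>" "0 < det (Tmat v)"
  "0 < det (mat2 1 0 0 r ** Tmat v)" using det_\<omega> r0 \<gamma>4 by (auto simp: Gamma0_def SL2Z_def det_mul)
 have W4pt: "prop_to (W4 g) (sl k \<omega> g)" if "g \<in> cusp_space k" for g
  using W4_sl that unfolding prop_to_def by metis
 define G where "G = sl k (adj2 \<omega>) (D h)"
 have hc: "h \<in> cusp_space k" "h' \<in> cusp_space k" "f \<in> cusp_space k" using S4_cusp(1) h h' f by auto
 have "prop_to G (js k (Tmat v) (D h'))"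
 proof -
  have "h = W4 h'" unfolding h'_def using W4_involution[OF hM(1)] by simp
  hence "prop_to h (sl k \<omega> h')" using W4pt[OF hc(2)] by simp
  hence "prop_to (sl k (mat2 1 0 0 r) h) (sl k (mat2 1 0 0 r) (sl k \<omega> h'))" by (rule prop_to_sl)
  also have "prop_to \<dots> (sl k (\<omega> ** mat2 1 0 0 r) h')" by (rule prop_to_sl_mult[OF hc(2) dets(1,3)])
  finally have "prop_to (D h) (sl k (\<omega> ** mat2 1 0 0 r) h')"
   unfolding D_def by (rule prop_to_trans[OF prop_to_aff[OF r0]])
  hence "prop_to G (sl k (adj2 \<omega>) (sl k (\<omega> ** mat2 1 0 0 r) h'))" unfolding G_def by (rule prop_to_sl)
  also have "prop_to \<dots> (sl k (\<omega> ** mat2 1 0 0 r ** adj2 \<omega>) h')"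
   by (rule prop_to_sl_mult[OF hc(2)]) (use dets in \<open>simp_all add: det_mul\<close>)
  also have "prop_to \<dots> (sl k (\<gamma> ** (mat2 1 0 0 r ** Tmat v)) h')" unfolding \<gamma>(2) by (rule prop_to_scalar) simp
  also have "prop_to \<dots> (sl k (mat2 1 0 0 r ** Tmat v) (sl k \<gamma> h'))" by (rule prop_to_sym[OF prop_to_sl_mult[OF hc(2) dets(4,6)]])
  also have "prop_to \<dots> (sl k (mat2 1 0 0 r ** Tmat v) h')"
   using prop_to_sl[where k = k and A = "mat2 1 0 0 r ** Tmat v", OF prop_to_sym[OF prop_to_js[where k = k and f = h', OF \<gamma>4]]] S4_cusp(2)[OF hM(2) \<gamma>(1)] by simp
  also have "prop_to \<dots> (sl k (Tmat v) (sl k (mat2 1 0 0 r) h'))" by (rule prop_to_sym[OF prop_to_sl_mult[OF hc(2) dets(3,5)]])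
  also have "prop_to \<dots> (sl k (Tmat v) (D h'))" unfolding D_def by (rule prop_to_sl[OF prop_to_sym[OF prop_to_aff[OF r0]]])
  also have "prop_to \<dots> (js k (Tmat v) (D h'))" by (rule prop_to_sym[OF prop_to_js[OF Gamma0_4_gens(1)]])
  finally show ?thesis .
 qed
 then obtain c1 where c1: "c1 \<noteq> 0" "G = (\<lambda>z. c1 * js k (Tmat v) (D h') z)" by (auto simp: prop_to_def)
 have "prop_to f (sl k (adj2 \<omega>) (W4 f))"
 proof (rule prop_to_sym)
  have "prop_to (sl k (adj2 \<omega>) (W4 f)) (sl k (adj2 \<omega>) (sl k \<omega> f))" by (rule prop_to_sl[OF W4pt[OF hc(3)]])
  also have "prop_to \<dots> (sl k (\<omega> ** adj2 \<omega>) f)" by (rule prop_to_sl_mult[OF hc(3) dets(1,2)])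
  also have "\<omega> ** adj2 \<omega> = mat 4 ** Tmat 0" by (simp add: adj2_mult det_\<omega> mat2_eq_iff)
  also have "prop_to (sl k (mat 4 ** Tmat 0) f) (sl k (Tmat 0) f)" by (rule prop_to_scalar) simp
  also have "sl k (Tmat 0) f = f" by (simp add: sl_def mact_eq den_def)
  finally show "prop_to (sl k (adj2 \<omega>) (W4 f)) f" .
 qed
 then obtain c2 where c2: "c2 \<noteq> 0" "f = (\<lambda>z. c2 * sl k (adj2 \<omega>) (W4 f) z)" by (auto simp: prop_to_def)
 have GV: "G \<in> Vsp k N" unfolding c1(2) by (intro Vsp_cmult Vsp_js DV hM Gamma0_4_gens N)
 have Wf: "W4 f \<in> S4 M" by (rule W4_level[OF f dvd_refl])
 define c3 where "c3 = c2 / of_real (sqrt (of_int (det (adj2 \<omega>))) ^ (2 * k + 1))"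
 have c3: "c3 \<noteq> 0" using c2(1) dets(2) by (simp add: c3_def)
 have "Phi k f G z = c3 * Phi k (W4 f) (D h) (mact (adj2 \<omega>) z)" if z: "0 < Im z" for z
 proof -
  have "Phi k f G z = Phi k (\<lambda>z. c2 * sl k (adj2 \<omega>) (W4 f) z) (sl k (adj2 \<omega>) (D h)) z" using c2(2) unfolding G_def by simp
  also have "... = c2 * Phi k (sl k (adj2 \<omega>) (W4 f)) (sl k (adj2 \<omega>) (D h)) z" by (simp add: Phi_def)
  finally show ?thesis unfolding Phi_sl[OF dets(2) z] by (simp add: c3_def)
 qed
 hence "ip k N f G = c3 * ip k N (W4 f) (D h)"
  by (rule ip_transform[OF N(1,2) dets(2) V[OF Wf] DV[OF hM(1)] V[OF f] GV c3])
 moreover have "ip k N f G = cnj c1 * ip k N f (js k (Tmat v) (D h'))" unfolding c1(2) ip_cmult_right ..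
 moreover have "ip k N f (js k (Tmat v) (D h')) = ip k N f (D h')"
  using ip_js[OF N(1,2) V[OF f] DV[OF hM(2)] Gamma0_4_gens(1), of v] S4_cusp(2)[OF f, of "Tmat v"] by (simp add: Gamma0_mat2)
 ultimately have "ip k N (W4 f) (D h) = 0" using c3 \<open>ip k N f (D h') = 0\<close> by simp
 thus ?thesis using ipU[OF Wf hM(1)] \<nu>(1) \<nu>(2)[OF Wf Um[OF h]] by simp
qed
end

section \<open>Explicit form of Q'_2 and the involution R\<close>

lemma csqrt_mult_upper_pos:
 assumes "0 < Im b \<or> b = 1" "0 < Im (a * b)" shows "csqrt a * csqrt b = csqrt (a * b)"
proof (cases "b = 1")
 case False
 hence "0 < Im b" using assms(1) by simp
 thus ?thesis using csqrt_mult_upper[of b a] assms(2) by simp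
qed simp

text \<open>4 a = 16 mod 4 - a, and 16 is a square prime to this odd modulus.\<close>

lemma quad_symbol_4_minus:
 assumes "odd a" shows "quad_symbol (4 * a) (4 - a) = 1"
proof -
 have o: "odd (nat \<bar>4 - a\<bar>)" using assms by (auto simp: even_nat_iff)
 have "quad_symbol (4 * a) (4 - a) = jacobi (4 * a) (nat \<bar>4 - a\<bar>)" by (simp add: quad_symbol_jacobi)
 also have "... = jacobi (4 * 4) (nat \<bar>4 - a\<bar>)"
 proof (rule jacobi_cong[OF o])
  have "4 * a - 4 * 4 = (4 - a) * (- 4)" by simp
  hence "(4 - a) dvd 4 * a - 4 * 4" by (metis dvd_triv_left)
  thus "[4 * a = 4 * 4] (mod int (nat \<bar>4 - a\<bar>))" by (simp add: cong_iff_dvd_diff)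
 qed
 also have "... = 1"
 proof (rule jacobi_square_left[OF o])
  have "coprime (2 * 2) (4 - a)" using assms by (subst coprime_mult_left_iff) auto
  thus "coprime 4 (int (nat \<bar>4 - a\<bar>))" by simp
 qed
 finally show ?thesis .
qed

text \<open>Depends on k mod 4 only, as (2/(2k+1)) is 1 for k = 0, 3 and -1 for k = 1, 2 mod 4. It
  evaluates the constants of \<open>W_4\<close> that remain in Q'_2.\<close>

lemma rho_value: "of_int (quad_symbol 2 (2 * int k + 1)) * \<i> ^ k * (1 + \<i>) * (- \<i> * (-1) ^ k) = 1 - (-1) ^ k * \<i>"
proof -
 define j t where "j = k div 4" and "t = k mod 4"
 have k: "k = 4 * j + t" by (simp add: j_def t_def)
 have "nat \<bar>2 * int k + 1\<bar> = 2 * k + 1" by simp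
 hence "quad_symbol 2 (2 * int k + 1) = jacobi 2 (2 * k + 1)" by (simp only: quad_symbol_jacobi) simp
 also have "... = chi8 (int (2 * k + 1))" by (rule jacobi_2) simp
 also have "... = (if t = 0 \<or> t = 3 then 1 else - 1)"
 proof -
  have "int (2 * k + 1) mod 8 = int ((2 * k + 1) mod 8)" by (simp only: zmod_int of_nat_numeral)
  also have "(2 * k + 1) mod 8 = 2 * t + 1" unfolding t_def by presburger
  finally have "int (2 * k + 1) mod 8 = int (2 * t + 1)" .
  moreover have "t < 4" by (simp add: t_def)
  ultimately show ?thesis unfolding chi8_def by auto
 qed
 finally have s: "quad_symbol 2 (2 * int k + 1) = (if t = 0 \<or> t = 3 then 1 else - 1)" .
 have i: "\<i> ^ k = \<i> ^ t" "(-1 :: complex) ^ k = (-1) ^ t" by (simp_all add: k power_add power_mult)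
 have "t < 4" by (simp add: t_def)
 hence "t = 0 \<or> t = 1 \<or> t = 2 \<or> t = 3" by linarith
 thus ?thesis unfolding s i by (auto simp: algebra_simps power2_eq_square power3_eq_cube)
qed

context even_prime_level
begin

abbreviation "Am u \<equiv> Lmat (4 * (int M * u))"
abbreviation "shift s \<equiv> aff 4 s 4"

text \<open>The weight of the translation by 1/4 in R; \<open>R_coeff\<close> shows that with its
  conjugate it produces the signs of the plus space condition.\<close>

definition \<rho> :: complex where "\<rho> = (1 - (-1) ^ k * \<i>) / 2"

lemma level_factor:
 assumes f: "f \<in> S4 M" and \<gamma>: "\<gamma> \<in> Gamma0 (4 * M)" and Y: "0 < det Y" and X: "X = \<gamma> ** Y" and z: "0 < Im z"
 shows "f (mact X z) = theta_factor \<gamma> (mact Y z) ^ (2 * k + 1) * f (mact Y z)"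
  and "den X z = den \<gamma> (mact Y z) * den Y z"
proof -
 have \<gamma>4: "\<gamma> \<in> Gamma0 4" by (rule Gamma0_mono[OF _ \<gamma>]) simp
 have y: "0 < Im (mact Y z)" by (rule mact_upper[OF z Y])
 have "js k \<gamma> f (mact Y z) = f (mact Y z)" using S4_cusp(2)[OF f \<gamma>] by simp
 hence "f (mact \<gamma> (mact Y z)) = theta_factor \<gamma> (mact Y z) ^ (2 * k + 1) * f (mact Y z)"
  using theta_factor_nonzero[OF \<gamma>4 y] by (simp add: js_def field_simps)
 moreover have "mact X z = mact \<gamma> (mact Y z)" unfolding X using z Y by (intro mact_mult) auto
 ultimately show "f (mact X z) = theta_factor \<gamma> (mact Y z) ^ (2 * k + 1) * f (mact Y z)" by simp
 show "den X z = den \<gamma> (mact Y z) * den Y z" unfolding X using z Y by (intro den_mult) auto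
qed

lemma shift_Am:
 assumes "0 < Im z"
 shows "js k (Am u) (shift s f) z = f (mact (mat2 4 s 0 4 ** Am u) z) / csqrt (4 * of_int (int M * u) * z + 1) ^ (2 * k + 1)"
proof -
 have "mact (mat2 4 s 0 4 ** Am u) z = mact (mat2 4 s 0 4) (mact (Am u) z)" using assms by (intro mact_mult) auto
 thus ?thesis unfolding js_def theta_factor_Lmat by (simp add: aff_mact)
qed

definition C4 :: complex where
 "C4 = of_int s2 * csqrt \<i> ^ (2 * k + 1) * omega k M * inverse (theta_eps (- int M)) ^ (2 * k + 1) * of_real (sqrt 2) ^ (2 * k + 1)"

text \<open>The matrices (1, v; 0, 4) \<omega> and (4, 1; 0, 4) \<open>Am u\<close>, both of
  determinant 16, differ by a left factor \<gamma> in \<open>Gamma0 (4 M)\<close> when v is written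
  as M (m - n - u). The symbol of \<gamma> is 1 by \<open>quad_symbol_4_minus\<close> and its
  \<open>theta_eps\<close> depends on M only, so the constant is the same for all u.\<close>

lemma W4_aff:
 assumes f: "f \<in> S4 M" and z: "0 < Im z" and u: "u \<ge> 0"
 shows "W4 (aff 1 (int M * (m - n - u)) 4 f) z = C4 * js k (Am u) (shift 1 f) z"
proof -
 define v t where "v = int M * (m - n - u)" and "t = 1 - 4 * u"
 define X where "X = mat2 1 v 0 4 ** \<omega>"
 define Y where "Y = mat2 4 1 0 4 ** Am u"
 have mM: "m * int M = 4 * n - 1" using bezout by simp
 obtain j where j: "int M * int M = 1 + 4 * j"
 proof -
  have "int M mod 4 = 1 \<or> int M mod 4 = 3" using odd_M by presburger
  moreover have "(int M * int M) mod 4 = ((int M mod 4) * (int M mod 4)) mod 4" by (simp only: mod_mult_eq)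
  ultimately have "(int M * int M) mod 4 = 1" by auto
  moreover have "4 dvd x - 1" if "x mod 4 = 1" for x :: int using that by presburger
  ultimately have "4 dvd int M * int M - 1" by blast
  thus thesis using that by (auto simp: dvd_def algebra_simps)
 qed
 \<comment> \<open>The upper right entry of \<gamma>. That four times it has the required value, and
   hence that \<gamma> is integral, comes from M^2 = 1 + 4 j and m M = 4 n - 1.\<close>
 define w where "w = - j * (m - n - u) + v + n * u + v * int M * u"
 have Mv: "int M * v = (1 + 4 * j) * (m - n - u)" unfolding v_def j[symmetric] by simp
 have w: "4 * w = - (n + int M * v) + (m + 4 * v) * (1 + int M * u)"
 proof -
  have "(m + 4 * v) * (1 + int M * u) = m + 4 * v + (m * int M) * u + 4 * (v * int M * u)" by (simp add: algebra_simps)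
  thus ?thesis unfolding Mv mM w_def by (simp add: algebra_simps)
 qed
 define a where "a = n + int M * v - int M * u * (m + 4 * v)"
 define \<gamma> where "\<gamma> = mat2 a w (4 * int M * t) (4 - int M * t)"
 have XY: "X = \<gamma> ** Y"
 proof -
  have w4: "w * (16 * (int M * u)) = 4 * w * (4 * (int M * u))" "w * 4 = 4 * w" by simp_all
  have "X = mat2 (4 * (n + int M * v)) (m + 4 * v) (16 * int M) 16"
   by (simp add: X_def \<omega>_def mat2_mult mat2_eq_iff algebra_simps)
  moreover have "Y = mat2 (4 + 4 * (int M * u)) 1 (16 * (int M * u)) 4" by (simp add: Y_def mat2_mult)
  moreover have "4 * (n + int M * v) = a * (4 + 4 * (int M * u)) + w * (16 * (int M * u))"
   unfolding w4 w a_def by (simp add: algebra_simps)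
  moreover have "m + 4 * v = a * 1 + w * 4" unfolding w4 w a_def by (simp add: algebra_simps)
  moreover have "16 * int M = 4 * int M * t * (4 + 4 * (int M * u)) + (4 - int M * t) * (16 * (int M * u))"
   unfolding t_def by (simp add: algebra_simps)
  moreover have "16 = 4 * int M * t * 1 + (4 - int M * t) * 4" by (simp add: algebra_simps)
  ultimately show ?thesis unfolding \<gamma>_def by (simp only: mat2_mult)
 qed
 have detY: "det Y = 16" by (simp add: Y_def det_mul)
 have "det X = 16" using det_\<omega> by (simp add: X_def det_mul)
 hence det\<gamma>: "det \<gamma> = 1" unfolding XY using detY by (simp add: det_mul)
 have \<gamma>: "\<gamma> \<in> Gamma0 (4 * M)" using det\<gamma> by (simp add: Gamma0_def SL2Z_def \<gamma>_def mult.assoc)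
 have dY: "0 < det Y" unfolding detY by simp
 note lf = level_factor[OF f \<gamma> dY XY z]
 define y where "y = mact Y z"
 define b where "b = 4 * complex_of_int (int M * u) * z + 1"
 have b0: "b \<noteq> 0" using den_nonzero[OF z, of "Am u"] by (simp add: b_def den_def)
 have denX: "den X z = 16 * (of_nat M * z + 1)" by (simp add: X_def \<omega>_def den_def algebra_simps)
 have denY: "den Y z = 4 * b" by (simp add: Y_def den_def b_def algebra_simps)
 have dg: "den \<gamma> y * b = 4 * (of_nat M * z + 1)"
 proof -
  have "4 * (den \<gamma> y * b) = 4 * (4 * (of_nat M * z + 1))"
   using lf(2) unfolding denX denY y_def[symmetric] by (simp only: mult.left_commute[of "den \<gamma> y" 4] mult.assoc[symmetric]) simp
  thus ?thesis by (simp only: mult_cancel_left) simp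
 qed
 \<comment> \<open>For u = 0 the factor b is 1 and not in the upper half plane; this is the second
   alternative in \<open>csqrt_mult_upper_pos\<close>.\<close>
 have "0 < Im b \<or> b = 1" using u z M_pos by (cases "u = 0") (auto simp: b_def)
 moreover have "0 < Im (den \<gamma> y * b)" unfolding dg using z M_pos by simp
 ultimately have "csqrt (den \<gamma> y) * csqrt b = csqrt (den \<gamma> y * b)" by (rule csqrt_mult_upper_pos)
 also have "den \<gamma> y * b = of_real 2 * (2 * of_nat M * z + 2)" unfolding dg by simp
 also have "csqrt \<dots> = of_real (sqrt 2) * csqrt (2 * of_nat M * z + 2)" by (rule csqrt_scale) simp
 finally have sq: "csqrt (den \<gamma> y) * csqrt b = of_real (sqrt 2) * csqrt (2 * of_nat M * z + 2)" .
 define c where "c = csqrt (2 * of_nat M * z + 2)"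
 have "0 < Im (2 * of_nat M * z + 2)" using z M_pos by simp
 hence c0: "c \<noteq> 0" unfolding c_def by (metis csqrt_eq_0 less_irrefl zero_complex.sel(2))
 have cb0: "csqrt b \<noteq> 0" using b0 by simp
 have ot: "odd (int M * t)" using odd_M by (simp add: t_def)
 have "quad_symbol (4 * int M * t) (4 - int M * t) = 1" using quad_symbol_4_minus[OF ot] by (simp add: mult.assoc)
 moreover have "theta_eps (4 - int M * t) = theta_eps (- int M)"
 proof -
  have "4 - int M * t = - int M + 4 * (1 + int M * u)" by (simp add: t_def algebra_simps)
  hence "(4 - int M * t) mod 4 = (- int M) mod 4" by (simp only: mod_mult_self2)
  thus ?thesis by (simp only: theta_eps_def)
 qed
 ultimately have th: "theta_factor \<gamma> y = inverse (theta_eps (- int M)) * csqrt (den \<gamma> y)"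
  by (simp add: theta_factor_den \<gamma>_def)
 have "csqrt (den \<gamma> y) = of_real (sqrt 2) * c / csqrt b" using sq cb0 unfolding c_def by (simp add: field_simps)
 hence th': "theta_factor \<gamma> y / c = inverse (theta_eps (- int M)) * of_real (sqrt 2) / csqrt b" using c0 unfolding th by simp
 have "W4 (aff 1 v 4 f) z = of_int s2 * csqrt \<i> ^ (2 * k + 1) * omega k M * (aff 1 v 4 f (mact \<omega> z) / c ^ (2 * k + 1))"
  unfolding c_def by (rule W4_value[OF z])
 also have "aff 1 v 4 f (mact \<omega> z) = f (mact X z)"
  unfolding X_def using z det_\<omega> by (simp add: aff_mact mact_mult)
 also have "f (mact X z) / c ^ (2 * k + 1) = (theta_factor \<gamma> y / c) ^ (2 * k + 1) * f y"
  unfolding lf(1) y_def by (simp only: power_divide times_divide_eq_left)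
 also have "... = inverse (theta_eps (- int M)) ^ (2 * k + 1) * of_real (sqrt 2) ^ (2 * k + 1) * (f y / csqrt b ^ (2 * k + 1))"
  unfolding th' by (simp only: power_divide power_mult_distrib times_divide_eq_left times_divide_eq_right mult.assoc)
 also have "f y / csqrt b ^ (2 * k + 1) = js k (Am u) (shift 1 f) z"
  unfolding shift_Am[OF z] y_def Y_def b_def ..
 finally show ?thesis unfolding v_def C4_def by (simp only: mult.assoc)
qed

lemma C4_value: "2 powi (1 - int k) * (inverse 4 * C4) = \<rho>"
proof -
 have "omega k M * inverse (theta_eps (- int M)) ^ (2 * k + 1) = - \<i> * (-1) ^ k"
 proof -
  have "int M mod 4 = 1 \<or> int M mod 4 = 3" using odd_M by presburger
  moreover have "int M mod 4 = 1 \<longleftrightarrow> M mod 4 = 1" by presburger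
  moreover have "(- x) mod 4 = 1 \<longleftrightarrow> x mod 4 = 3" for x :: int by presburger
  moreover have "inverse \<i> ^ (2 * k + 1) = - \<i> * (-1) ^ k" by (simp add: power_mult)
  moreover have "(1::int) \<noteq> 3" by simp
  ultimately show ?thesis by (elim disjE) (simp_all add: omega_def theta_eps_def)
 qed
 moreover have "csqrt \<i> ^ (2 * k + 1) * of_real (sqrt 2) ^ (2 * k + 1) = \<i> ^ k * (1 + \<i>) * 2 ^ k"
 proof -
  have "csqrt \<i> * of_real (sqrt 2) = 1 + \<i>" by (simp add: csqrt_ii)
  moreover have "csqrt \<i> ^ 2 = \<i>" "complex_of_real (sqrt 2) ^ 2 = 2" by (rule power2_csqrt, simp flip: of_real_power)
  ultimately show ?thesis by (simp add: power_mult power_add del: csqrt_ii)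
 qed
 moreover have "C4 = of_int s2 * (csqrt \<i> ^ (2 * k + 1) * of_real (sqrt 2) ^ (2 * k + 1)) * (omega k M * inverse (theta_eps (- int M)) ^ (2 * k + 1))"
  unfolding C4_def by (simp only: mult_ac)
 ultimately have C: "C4 = of_int s2 * (\<i> ^ k * (1 + \<i>) * 2 ^ k) * (- \<i> * (-1) ^ k)" by simp
 also have "... = (of_int s2 * \<i> ^ k * (1 + \<i>) * (- \<i> * (-1) ^ k)) * 2 ^ k" by (simp only: mult_ac)
 also have "... = (1 - (-1) ^ k * \<i>) * 2 ^ k" unfolding rho_value ..
 finally have C: "C4 = (1 - (-1) ^ k * \<i>) * 2 ^ k" .
 have "(2::complex) powi (1 - int k) = 2 / 2 ^ k" by (simp add: power_int_diff)
 thus ?thesis unfolding C \<rho>_def by simp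
qed

lemma W4_sum: "W4 (\<lambda>z. \<Sum>i\<in>I. F i z) = (\<lambda>z. \<Sum>i\<in>I. W4 (F i) z)"
 by (simp add: W_4_def slash_def fun_eq_iff sum_distrib_left sum_distrib_right)

text \<open>As \<open>W_4\<close> is an involution, Q'_2 is 2^(1-k) W_4 U_4. M being odd, the
  residues v mod 4 in U_4 are parametrised by u as in \<open>W4_aff\<close>.\<close>

lemma Q_2'_formula:
 assumes f: "f \<in> S4 M" shows "Q_2' k M m n f = (\<lambda>z. \<rho> * (\<Sum>u\<in>{0..<4}. js k (Am u) (shift 1 f) z))"
proof
 fix z
 have N4: "4 dvd 4 * M" by simp
 have fc: "f \<in> cusp_space k" by (rule S4_cusp(1)[OF f])
 have U: "U_op 4 f = (\<lambda>z. inverse 4 * (\<Sum>v\<in>{0..<4}. aff 1 v 4 f z))"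
  using U_op_aff[OF f N4, of 4] by simp
 have Q: "Q_2' k M m n f = (\<lambda>z. 2 powi (1 - int k) * W4 (U_op 4 f) z)"
  unfolding Q_2'_def Q_2_def comp_def W4_involution[OF f] W4_cmult ..
 show "Q_2' k M m n f z = \<rho> * (\<Sum>u\<in>{0..<4}. js k (Am u) (shift 1 f) z)"
 proof (cases "0 < Im z")
  case False
  have "js k (Am u) (shift 1 f) z = 0" for u
   by (rule cusp_space_upper[where k = k, OF _ False]) (intro js_in_cusp_space aff_in_cusp_space fc Gamma0_4_gens, auto)
  thus ?thesis using False by (simp add: Q W4_upper)
 next
  case True
  have per: "W4 (aff 1 u 4 f) z = W4 (aff 1 v 4 f) z" if "[u = v] (mod 4)" for u v
  proof -
   have "aff 1 u 4 f = aff 1 v 4 f" using that by (intro aff_periodic cusp_forms_periodic[OF f]) auto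
   thus ?thesis by simp
  qed
  have inj: "[u = v] (mod 4)" if "[int M * (m - n - u) = int M * (m - n - v)] (mod 4)" for u v
  proof -
   have "4 dvd int M * (m - n - u) - int M * (m - n - v)" using that by (simp only: cong_iff_dvd_diff)
   also have "int M * (m - n - u) - int M * (m - n - v) = int M * (v - u)" by (simp add: algebra_simps)
   finally have "4 dvd int M * (v - u)" .
   moreover have "coprime (2 * 2) (int M)" using odd_M by (subst coprime_mult_left_iff) auto
   ultimately have "4 dvd v - u" by (simp add: coprime_dvd_mult_right_iff)
   thus ?thesis by (simp add: cong_iff_dvd_diff dvd_diff_commute)
  qed
  have "W4 (U_op 4 f) z = inverse 4 * (\<Sum>v\<in>{0..<4}. W4 (aff 1 v 4 f) z)" unfolding U W4_cmult W4_sum ..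
  also have "(\<Sum>v\<in>{0..<4}. W4 (aff 1 v 4 f) z) = (\<Sum>u\<in>{0..<4}. W4 (aff 1 (int M * (m - n - u)) 4 f) z)"
   by (rule sum_residues[where t = "\<lambda>v. W4 (aff 1 v 4 f) z", symmetric]) (use per inj in auto)
  also have "... = (\<Sum>u\<in>{0..<4}. C4 * js k (Am u) (shift 1 f) z)"
   by (intro sum.cong refl W4_aff[OF f True]) simp
  finally have "Q_2' k M m n f z = (2 powi (1 - int k) * (inverse 4 * C4)) * (\<Sum>u\<in>{0..<4}. js k (Am u) (shift 1 f) z)"
   unfolding Q by (simp only: sum_distrib_left[symmetric] mult.assoc)
  thus ?thesis unfolding C4_value .
 qed
qed
end

context even_prime_level
begin

lemma shift_cusp: "f \<in> cusp_space k \<Longrightarrow> shift s f \<in> cusp_space k" by (rule aff_in_cusp_space) auto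

lemma shift_value: "shift s f z = f (z + of_int s / 4)" by (simp add: aff_def add_divide_distrib)

lemma Lm4_power: "(\<i> * (-1) ^ k) = \<i> ^ (2 * k + 1)" by (simp add: power_mult)

text \<open>(4, 1; 0, 4) \<open>Am 2\<close> is a matrix of \<open>Gamma0 (4 M)\<close> times (4,
  -1; 0, 4). The lower right entry 1 + 2 M is 3 mod 4 and the symbol is (8 M / (1 + 2 M)) = (-4 / (1
  + 2 M)) = -1, so the multiplier contributes a factor i.\<close>

lemma shift_Am_2:
 assumes f: "f \<in> S4 M" shows "js k (Am 2) (shift 1 f) = (\<lambda>z. \<i> * (-1) ^ k * shift (-1) f z)"
proof
 fix z
 have fc: "f \<in> cusp_space k" by (rule S4_cusp(1)[OF f])
 show "js k (Am 2) (shift 1 f) z = \<i> * (-1) ^ k * shift (-1) f z"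
 proof (cases "0 < Im z")
  case False
  have "js k (Am 2) (shift 1 f) z = 0" "shift (-1) f z = 0"
   by (rule cusp_space_upper[where k = k, OF _ False], intro js_in_cusp_space shift_cusp fc Gamma0_4_gens)+
  thus ?thesis by simp
 next
  case True
  define X where "X = mat2 4 1 0 4 ** Am 2"
  define Y where "Y = mat2 4 (-1) 0 (4 :: int)"
  obtain e where e: "int M = 2 * e + 1" using odd_M by (metis even_of_nat oddE)
  define \<gamma> where "\<gamma> = mat2 (1 + 2 * int M) (e + 1) (8 * int M) (1 + 2 * int M)"
  have XY: "X = \<gamma> ** Y" by (simp add: X_def Y_def \<gamma>_def mat2_mult mat2_eq_iff e algebra_simps)
  have "(1 + 2 * int M) * (1 + 2 * int M) - (e + 1) * (8 * int M) = 1" unfolding e by (simp add: algebra_simps)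
  hence \<gamma>: "\<gamma> \<in> Gamma0 (4 * M)" by (simp add: \<gamma>_def Gamma0_mat2)
  have dY: "0 < det Y" by (simp add: Y_def)
  note lf = level_factor[OF f \<gamma> dY XY True]
  define y where "y = mact Y z"
  have y: "y = z + of_int (-1) / 4" by (simp add: y_def Y_def mact_eq den_def diff_divide_distrib)
  have denXY: "den X z = (4 * of_int (int M * 2) * z + 1) * 4" "den Y z = 4"
   by (simp_all add: X_def Y_def den_def algebra_simps)
  have dg: "den \<gamma> y = 4 * of_int (int M * 2) * z + 1"
  proof -
   have "den \<gamma> y * 4 = (4 * of_int (int M * 2) * z + 1) * 4" using lf(2) unfolding denXY y_def by (rule sym)
   thus ?thesis by (simp only: mult_cancel_right) simp
  qed
  have o: "odd (nat \<bar>1 + 2 * int M\<bar>)" by (auto simp: even_nat_iff)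
  have "quad_symbol (8 * int M) (1 + 2 * int M) = jacobi (8 * int M) (nat \<bar>1 + 2 * int M\<bar>)" by (simp add: quad_symbol_pos)
  also have "... = jacobi (- 1 * (2 * 2)) (nat \<bar>1 + 2 * int M\<bar>)"
  proof (rule jacobi_cong[OF o])
   have "8 * int M - (- 1 * (2 * 2)) = 4 * (1 + 2 * int M)" by simp
   hence "(1 + 2 * int M) dvd 8 * int M - (- 1 * (2 * 2))" by (metis dvd_triv_right)
   thus "[8 * int M = - 1 * (2 * 2)] (mod int (nat \<bar>1 + 2 * int M\<bar>))" by (simp add: cong_iff_dvd_diff)
  qed
  also have "... = jacobi (- 1) (nat \<bar>1 + 2 * int M\<bar>) * jacobi (2 * 2) (nat \<bar>1 + 2 * int M\<bar>)" by (rule jacobi_mult_left[OF o])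
  also have "jacobi (2 * 2) (nat \<bar>1 + 2 * int M\<bar>) = 1" by (rule jacobi_square_left[OF o]) simp
  also have "jacobi (- 1) (nat \<bar>1 + 2 * int M\<bar>) = chi4 (1 + 2 * int M)" using jacobi_minus1[OF o] by simp
  finally have qs: "quad_symbol (8 * int M) (1 + 2 * int M) = chi4 (1 + 2 * int M)" by simp
  have m4: "(1 + 2 * int M) mod 4 = 3" unfolding e by presburger
  have "theta_factor \<gamma> y = \<i> * csqrt (4 * of_int (int M * 2) * z + 1)"
   unfolding theta_factor_den dg unfolding \<gamma>_def mat2_nth qs by (simp add: theta_eps_def chi4_def m4)
  hence "f (mact X z) = (\<i> * csqrt (4 * of_int (int M * 2) * z + 1)) ^ (2 * k + 1) * f y" using lf(1) by (simp add: y_def)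
  moreover have "csqrt (4 * of_int (int M * 2) * z + 1) \<noteq> 0"
   using den_nonzero[OF True, of "Am 2"] by (simp add: den_def)
  ultimately show ?thesis unfolding shift_Am[OF True] X_def[symmetric] Lm4_power shift_value y
   by (simp only: power_mult_distrib) (simp add: field_simps)
 qed
qed

text \<open>With x = 1 + M v, which is even, the translation by 1/4 is absorbed by a matrix of
  \<open>Gamma0 (4 M)\<close> with lower right entry d = 1 - x + x^2. Its upper left entry is
  negative of a square modulo d, so the symbol is (-1/d), and d is 1 or 3 mod 4 according to whether
  4 divides x.\<close>

lemma shift_Am_odd:
 assumes f: "f \<in> S4 M" and v: "v > 0" "odd v" and z: "0 < Im z"
 shows "js k (Am v) (shift 1 f) (z + 1 / 4)
  = (if 4 dvd 1 + int M * v then 1 else \<i> * (-1) ^ k) * js k (Am v) (shift 1 f) z"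
proof -
 define x where "x = 1 + int M * v"
 have ox: "even x" using v odd_M by (simp add: x_def)
 then obtain j where j: "x = 2 * j" by blast
 define X where "X = mat2 4 1 0 4 ** Am v ** mat2 4 1 0 4"
 define Y where "Y = mat2 4 1 0 4 ** Am v"
 define \<gamma> where "\<gamma> = mat2 (1 + x - x * x) (j * j) (4 * (int M * (v * (1 - x)))) (1 - x + x * x)"
 define X' where "X' = mat2 (4 * x) (x + 1) (16 * (int M * v)) (4 * x)"
 have Mv: "int M * v = x - 1" by (simp add: x_def)
 have X'Y: "X' = \<gamma> ** Y"
 proof -
  have Y: "Y = mat2 (4 * x) 1 (16 * (x - 1)) 4" unfolding Y_def Mv by (simp add: mat2_mult algebra_simps)
  have c: "4 * (int M * (v * (1 - x))) = 4 * ((x - 1) * (1 - x))" unfolding mult.assoc[symmetric] Mv by simp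
  have jj: "j * j * (16 * (x - 1)) = x * x * 4 * (x - 1)" "j * j * 4 = x * x" by (simp_all add: j)
  have "(1 + x - x * x) * (4 * x) + j * j * (16 * (x - 1)) = 4 * x" unfolding jj by (simp add: algebra_simps)
  moreover have "(1 + x - x * x) * 1 + j * j * 4 = x + 1" unfolding jj by (simp add: algebra_simps)
  moreover have "4 * ((x - 1) * (1 - x)) * (4 * x) + (1 - x + x * x) * (16 * (x - 1)) = 16 * (x - 1)"
   by (simp add: algebra_simps)
  moreover have "4 * ((x - 1) * (1 - x)) * 1 + (1 - x + x * x) * 4 = 4 * x" by (simp add: algebra_simps)
  ultimately show ?thesis unfolding X'_def \<gamma>_def Mv c Y by (simp only: mat2_mult)
 qed
 have XX: "X = mat 4 ** X'" by (simp add: X_def X'_def mat2_mult mat2_eq_iff x_def)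
 have dets: "det Y = 16" "det (mat2 4 1 0 (4::int)) = 16" by (simp_all add: Y_def det_mul)
 have "det X' = 4 * x * (4 * x) - (x + 1) * (16 * (x - 1))" by (simp add: X'_def Mv)
 hence dX': "det X' = 16" by (simp add: algebra_simps)
 hence "det \<gamma> = 1" unfolding X'Y using dets by (simp add: det_mul)
 hence \<gamma>: "\<gamma> \<in> Gamma0 (4 * M)" by (simp add: Gamma0_def SL2Z_def \<gamma>_def)
 have dY: "0 < det Y" using dets by simp
 note lf = level_factor[OF f \<gamma> dY X'Y z]
 define y where "y = mact Y z"
 define b where "b = 4 * complex_of_int (int M * v) * z + 1"
 define a where "a = 4 * complex_of_int (int M * v) * (z + 1 / 4) + 1"
 have a: "a = 4 * complex_of_int (int M * v) * z + of_int x" by (simp add: a_def x_def algebra_simps)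
 have "den X' z = 4 * a" "den Y z = 4 * b" by (simp_all add: X'_def Y_def den_def a b_def algebra_simps)
 hence dg: "den \<gamma> y * b = a" using lf(2) by (simp add: y_def)
 have Mv0: "0 < int M * v" using v M_pos by simp
 have Ib: "0 < Im b" "0 < Im a" unfolding a b_def using z Mv0 by (simp_all del: of_int_mult)
 hence sq: "csqrt (den \<gamma> y) * csqrt b = csqrt a" using csqrt_mult_upper_pos[of b "den \<gamma> y"] dg by simp
 have ab0: "csqrt a \<noteq> 0" "csqrt b \<noteq> 0" using Ib by (metis csqrt_eq_0 less_irrefl zero_complex.sel(2))+
 define d where "d = 1 - x + x * x"
 have od: "odd d" using ox by (simp add: d_def)
 have o: "odd (nat \<bar>d\<bar>)" using od by (auto simp: even_nat_iff)
 have d0: "d > 0"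
 proof -
  have "0 \<le> (2 * x - 1)\<^sup>2" by simp
  hence "4 * d \<ge> 3" by (simp add: d_def power2_eq_square algebra_simps)
  thus ?thesis by simp
 qed
 have cc: "4 * (int M * (v * (1 - x))) = - 1 * ((2 * (x - 1)) * (2 * (x - 1)))"
  unfolding mult.assoc[symmetric, of "int M"] Mv by (simp add: algebra_simps)
 have "\<not> d < 0" using d0 by simp
 hence "quad_symbol (4 * (int M * (v * (1 - x)))) d = jacobi (- 1 * ((2 * (x - 1)) * (2 * (x - 1)))) (nat \<bar>d\<bar>)"
  by (simp only: quad_symbol_jacobi cc simp_thms if_False mult_1)
 also have "... = jacobi (- 1) (nat \<bar>d\<bar>) * jacobi ((2 * (x - 1)) * (2 * (x - 1))) (nat \<bar>d\<bar>)"
  by (rule jacobi_mult_left[OF o])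
 also have "jacobi ((2 * (x - 1)) * (2 * (x - 1))) (nat \<bar>d\<bar>) = 1"
 proof (rule jacobi_square_left[OF o])
  have "coprime (x - 1) d"
  proof (rule coprimeI)
   fix t assume t: "t dvd x - 1" "t dvd d"
   have "t dvd d - x * (x - 1)" by (rule dvd_diff[OF t(2) dvd_mult[OF t(1)]])
   also have "d - x * (x - 1) = 1" by (simp add: d_def algebra_simps)
   finally show "is_unit t" .
  qed
  moreover have "int (nat \<bar>d\<bar>) = d" using d0 by simp
  ultimately show "coprime (2 * (x - 1)) (int (nat \<bar>d\<bar>))" using od by (simp only: coprime_mult_left_iff coprime_left_2_iff_odd simp_thms)
 qed
 also have "jacobi (- 1) (nat \<bar>d\<bar>) = chi4 d" using jacobi_minus1[OF o] d0 by simp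
 finally have qs: "quad_symbol (4 * (int M * (v * (1 - x)))) d = chi4 d" by simp
 define \<epsilon> :: complex where "\<epsilon> = (if 4 dvd x then 1 else \<i>)"
 have d4: "d mod 4 = (if 4 dvd x then 1 else 3)"
 proof (cases "4 dvd x")
  case True
  then obtain y where "x = 4 * y" by blast
  hence "d = 1 + 4 * (- y + 4 * y * y)" by (simp add: d_def)
  thus ?thesis using True by (simp only: mod_mult_self2) simp
 next
  case False
  hence "odd j" using j by auto
  then obtain y where "j = 2 * y + 1" by (elim oddE)
  hence "d = 3 + 4 * (3 * y + 4 * y * y)" by (simp add: d_def j algebra_simps)
  thus ?thesis using False by (simp only: mod_mult_self2) simp
 qed
 have th: "theta_factor \<gamma> y = \<epsilon> * csqrt (den \<gamma> y)"
  unfolding theta_factor_den unfolding \<gamma>_def mat2_nth d_def[symmetric] qs by (auto simp: theta_eps_def chi4_def d4 \<epsilon>_def)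
 have \<epsilon>: "\<epsilon> ^ (2 * k + 1) = (if 4 dvd x then 1 else \<i> * (-1) ^ k)" unfolding \<epsilon>_def Lm4_power by (simp only: if_distrib[of "\<lambda>t. t ^ (2 * k + 1)"] power_one)
 have z1: "0 < Im (z + 1 / 4)" using z by simp
 have "mact (mat2 4 1 0 4 ** Am v) (z + 1 / 4) = mact Y (mact (mat2 4 1 0 4) z)" by (simp add: Y_def mact_eq[of "mat2 4 1 0 4"] den_def add_divide_distrib)
 also have "... = mact X z" unfolding X_def Y_def using z dets by (intro mact_mult[symmetric]) auto
 also have "... = mact X' z"
 proof -
  have "mact X z = mact (mat 4) (mact X' z)" unfolding XX using z dX' by (intro mact_mult) auto
  thus ?thesis by (simp add: mact_mat)
 qed
 finally have "js k (Am v) (shift 1 f) (z + 1 / 4) = f (mact X' z) / csqrt a ^ (2 * k + 1)"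
  unfolding shift_Am[OF z1] a_def by simp
 also have "... = (\<epsilon> * csqrt (den \<gamma> y) / csqrt a) ^ (2 * k + 1) * f y"
  unfolding lf(1) y_def[symmetric] th by (simp only: power_divide times_divide_eq_left)
 also have "\<epsilon> * csqrt (den \<gamma> y) / csqrt a = \<epsilon> / csqrt b" using ab0 unfolding sq[symmetric] by simp
 also have "(\<epsilon> / csqrt b) ^ (2 * k + 1) * f y = \<epsilon> ^ (2 * k + 1) * js k (Am v) (shift 1 f) z"
  unfolding shift_Am[OF z] y_def Y_def b_def by (simp only: power_divide times_divide_eq_left times_divide_eq_right)
 finally show ?thesis unfolding \<epsilon> x_def .
qed

text \<open>The sign change of coefficients, written with translates so that it also applies to
  functions that are not of level 4 M.\<close>

definition R :: "(complex \<Rightarrow> complex) \<Rightarrow> complex \<Rightarrow> complex" where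
 "R f = (\<lambda>z. \<rho> * shift 1 f z + cnj \<rho> * shift (-1) f z)"

lemma R_cusp: "f \<in> cusp_space k \<Longrightarrow> R f \<in> cusp_space k"
 unfolding R_def by (intro cusp_space_add cusp_space_cmult shift_cusp)

lemma \<rho>_cnj: "\<rho> * (\<i> * (-1) ^ k) = cnj \<rho>" "cnj \<rho> * (\<i> * (-1) ^ k) = - \<rho>"
 "\<rho> * \<rho> + cnj \<rho> * cnj \<rho> = 0" "\<rho> * cnj \<rho> + cnj \<rho> * \<rho> = 1" "\<rho> + cnj \<rho> = 1"
 by (cases "even k"; simp add: \<rho>_def complex_eq_iff)+

text \<open>Of the four terms in \<open>Q_2'_formula\<close>, u = 0 and u = 2 combine to R f; u = 1
  and u = 3 are the same two terms slashed by \<open>Am 1\<close>.\<close>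

lemma Q_2'_R:
 assumes f: "f \<in> S4 M" shows "Q_2' k M m n f = (\<lambda>z. R f z + js k (Am 1) (R f) z)"
proof -
 have fc: "f \<in> cusp_space k" by (rule S4_cusp(1)[OF f])
 note up = cusp_space_upper[OF shift_cusp[OF fc]]
 have s: "{0..<4::int} = {0, 1, 2, 3}" by auto
 have "js k (Am 3) (shift 1 f) = js k (Am 2 ** Am 1) (shift 1 f)" by (simp add: mat2_mult)
 also have "... = js k (Am 1) (js k (Am 2) (shift 1 f))" by (rule js_mult[OF Gamma0_4_gens(2) Gamma0_4_gens(2) up, symmetric])
 finally have 3: "js k (Am 3) (shift 1 f) = (\<lambda>z. \<i> * (-1) ^ k * js k (Am 1) (shift (-1) f) z)"
  unfolding shift_Am_2[OF f] js_lin(2) .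
 have 0: "js k (Am 0) (shift 1 f) = shift 1 f" using js_Tmat[of k 0 "shift 1 f"] by simp
 have "\<rho> * (\<Sum>u\<in>{0..<4}. js k (Am u) (shift 1 f) z) = \<rho> * shift 1 f z + \<rho> * js k (Am 1) (shift 1 f) z
   + (\<rho> * (\<i> * (-1) ^ k)) * shift (-1) f z + (\<rho> * (\<i> * (-1) ^ k)) * js k (Am 1) (shift (-1) f) z" for z
  unfolding s using 0 shift_Am_2[OF f] 3 by (simp add: algebra_simps)
 thus ?thesis unfolding Q_2'_formula[OF f] \<rho>_cnj(1) R_def js_lin by (simp add: algebra_simps)
qed

lemma Q_2'_S4: assumes f: "f \<in> S4 M" shows "Q_2' k M m n f \<in> S4 M"
proof -
 have "U_op (2\<^sup>2) f \<in> S4 M" using f M_pos by (intro U_square_cusp_forms) auto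
 hence "(\<lambda>z. 2 powi (1 - int k) * W4 (U_op 4 f) z) \<in> S4 M"
  using W4_level[of _ M] by (intro cusp_forms_cmult) auto
 moreover have "Q_2' k M m n f = (\<lambda>z. 2 powi (1 - int k) * W4 (U_op 4 f) z)"
  unfolding Q_2'_def Q_2_def comp_def W4_involution[OF f] W4_cmult ..
 ultimately show ?thesis by simp
qed

lemma R_R: assumes f: "f \<in> S4 M" shows "R (R f) = f"
proof
 fix z
 have "f (z - 1/2 + 1) = f (z - 1/2)" by (rule cusp_forms_periodic[OF f]) simp
 moreover have "z - 1/2 + 1 = z + 1/2" by simp
 ultimately have p: "f (z + 1/2) = f (z - 1/2)" by (simp only:)
 have "R (R f) z = (\<rho> * \<rho> + cnj \<rho> * cnj \<rho>) * f (z + 1/2) + (\<rho> * cnj \<rho> + cnj \<rho> * \<rho>) * f z"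
  using p by (simp add: R_def shift_value algebra_simps)
 thus "R (R f) z = f z" unfolding \<rho>_cnj by simp
qed

text \<open>By \<open>shift_Am_odd\<close> translation by 1/4 is multiplication by \<epsilon>, equal
  to 1 or i (-1)^k, and in both cases \<rho> \<epsilon> plus its conjugate is 1.\<close>

lemma R_eigen:
 assumes f: "f \<in> S4 M" and v: "v > 0" "odd v"
 shows "R (js k (Am v) (shift 1 f)) = js k (Am v) (shift 1 f)"
proof
 fix z
 define g where "g = js k (Am v) (shift 1 f)"
 define \<epsilon> :: complex where "\<epsilon> = (if 4 dvd 1 + int M * v then 1 else \<i> * (-1) ^ k)"
 have gc: "g \<in> cusp_space k" unfolding g_def by (intro js_in_cusp_space shift_cusp S4_cusp(1)[OF f] Gamma0_4_gens)
 show "R g z = g z"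
 proof (cases "0 < Im z")
  case False
  thus ?thesis using cusp_space_upper[OF gc False] cusp_space_upper[OF R_cusp[OF gc] False] by simp
 next
  case True
  have z1: "0 < Im (z - 1 / 4)" using True by simp
  have 1: "g (z + 1/4) = \<epsilon> * g z" using shift_Am_odd[OF f v True] by (simp add: g_def \<epsilon>_def)
  have 2: "g z = \<epsilon> * g (z - 1/4)" using shift_Am_odd[OF f v z1] by (simp add: g_def \<epsilon>_def)
  have "\<epsilon> * cnj \<epsilon> = 1" by (cases "even k") (simp_all add: \<epsilon>_def)
  hence 3: "g (z - 1/4) = cnj \<epsilon> * g z" unfolding 2 by (simp add: mult.assoc[symmetric] mult.commute[of "cnj \<epsilon>"])
  have "\<rho> * \<epsilon> + cnj \<rho> * cnj \<epsilon> = 1" by (cases "even k") (simp_all add: \<epsilon>_def \<rho>_def complex_eq_iff)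
  moreover have "R g z = (\<rho> * \<epsilon> + cnj \<rho> * cnj \<epsilon>) * g z"
   using 1 3 by (simp add: R_def shift_value algebra_simps)
  ultimately show ?thesis by simp
 qed
qed
end

context even_prime_level
begin

text \<open>Conjugation by the translation s/4 gives the entries a + s c/4, b + s e, c, d - s c/4
  with e = (d - a - s c/4)/4; the factor 16 in the modulus makes e integral. Dropping the square 4
  from c does not change the symbol, which is then periodic mod c/4.\<close>

lemma shift_Vsp: assumes f: "f \<in> S4 M" and N: "16 * M dvd N" shows "shift s f \<in> Vsp k N"
proof -
 have fc: "f \<in> cusp_space k" by (rule S4_cusp(1)[OF f])
 have "js k A (shift s f) = shift s f" if A: "A \<in> GammaN N" for A
 proof
  fix z
  have "4 * (4 * M) dvd N" using N by simp
  hence N4: "4 dvd N" by (rule dvd_mult_left)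
  have A4: "A \<in> Gamma0 4" by (rule GammaN_Gamma0[OF N4 A])
  show "js k A (shift s f) z = shift s f z"
  proof (cases "0 < Im z")
   case False
   have "js k A (shift s f) z = 0" "shift s f z = 0"
    by (rule cusp_space_upper[where k = k, OF _ False], intro js_in_cusp_space shift_cusp fc A4)+
   thus ?thesis by simp
  next
   case True
   define a b c d where "a = A $ 1 $ 1" and "b = A $ 1 $ 2" and "c = A $ 2 $ 1" and "d = A $ 2 $ 2"
   note abcd = this
   have A_eq: "A = mat2 a b c d" by (simp add: abcd mat2_eq_iff)
   have det: "a * d - b * c = 1" using Gamma0_props(1)[OF A4] by (simp add: abcd)
   have N16: "16 * int M dvd int N" using N by (metis of_nat_dvd_iff of_nat_mult of_nat_numeral)
   have dN: "int N dvd a - 1" "int N dvd c" "int N dvd d - 1" using A by (auto simp: GammaN_def abcd)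
   have "16 * int M dvd c" using N16 dN(2) by (rule dvd_trans)
   then obtain c' where c': "c = 16 * int M * c'" by blast
   define c1 where "c1 = 4 * (int M * c')"
   have c1: "c = 4 * c1" by (simp add: c' c1_def)
   have four: "4 dvd int N" using N4 by (metis of_nat_dvd_iff of_nat_numeral)
   have "4 dvd (d - 1) - (a - 1) - s * c1" using dvd_trans[OF four dN(1)] dvd_trans[OF four dN(3)]
    by (intro dvd_diff[OF dvd_diff]) (auto simp: c1_def)
   then obtain e where e: "d - a - s * c1 = 4 * e" by (auto simp: dvd_def)
   define d' where "d' = d - s * c1"
   define \<gamma> where "\<gamma> = mat2 (a + s * c1) (b + s * e) c d'"
   define X where "X = mat2 4 s 0 4 ** A"
   define Y where "Y = mat2 4 s 0 (4 :: int)"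
   have XY: "X = \<gamma> ** Y"
   proof -
    have se: "(b + s * e) * 4 = 4 * b + s * (d - a - s * c1)" unfolding e by (simp add: algebra_simps)
    show ?thesis unfolding X_def Y_def A_eq \<gamma>_def d'_def c1 mat2_mult se by (simp add: algebra_simps)
   qed
   have dets: "det Y = 16" "det A = 1" using A4 by (simp_all add: Y_def Gamma0_def SL2Z_def)
   have "det \<gamma> * 16 = 16" using arg_cong[OF XY, of det] dets by (simp add: X_def det_mul)
   hence \<gamma>: "\<gamma> \<in> Gamma0 (4 * M)" by (simp add: Gamma0_def SL2Z_def \<gamma>_def c')
   have dY: "0 < det Y" using dets by simp
   note lf = level_factor[OF f \<gamma> dY XY True]
   have y: "mact Y z = z + of_int s / 4" by (simp add: Y_def mact_eq den_def add_divide_distrib)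
   have denXY: "den X z = den A z * 4" "den Y z = 4" by (simp_all add: X_def Y_def den_def algebra_simps)
   have dg: "den \<gamma> (mact Y z) = den A z" using lf(2) unfolding denXY by simp
   have od: "odd d" "odd d'" using Gamma0_4_odd(2)[OF A4] by (simp_all add: abcd d'_def c1_def)
   have cop: "coprime c1 d" using Gamma0_4_odd(4)[OF A4] by (simp add: abcd[symmetric] c1)
   have q: "quad_symbol c x = quad_symbol c1 x" if "odd x" for x
   proof -
    have "jacobi (2 * 2) (nat \<bar>x\<bar>) = 1" using that by (intro jacobi_square_left) (auto simp: even_nat_iff)
    thus ?thesis using quad_symbol_mult_left[of 4 x c1] that by (simp add: c1)
   qed
   have "quad_symbol c1 d' = quad_symbol c1 d"
    by (rule quad_symbol_periodic[symmetric]) (use od cop in \<open>auto simp: c1_def d'_def cong_iff_dvd_diff\<close>)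
   moreover have "d' mod 4 = d mod 4" by (simp add: d'_def c1_def mod_eq_dvd_iff)
   ultimately have th: "theta_factor \<gamma> (mact Y z) = theta_factor A z"
    unfolding theta_factor_den dg using od by (simp add: \<gamma>_def abcd[symmetric] q theta_eps_def)
   have "shift s f (mact A z) = f (mact X z)" unfolding X_def using True dets by (simp add: aff_mact mact_mult)
   thus ?thesis using lf(1) theta_factor_nonzero[OF A4 True] unfolding th unfolding y by (simp add: js_def shift_value)
  qed
 qed
 thus ?thesis using shift_cusp[OF fc] by (simp add: Vsp_def)
qed

text \<open>The adjoint of the translation by s/4 is the one by -s/4, and conjugation exchanges the
  two weights, so R is self-adjoint. \<open>Am 1\<close> fixes forms of level 4 M, so the second
  half of Q'_2 contributes the same product as R.\<close>

lemma Q_2'_selfadjoint: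
 assumes f: "f \<in> S4 M" and g: "g \<in> S4 M"
 shows "petersson k (4 * M) (Q_2' k M m n f) g = petersson k (4 * M) f (Q_2' k M m n g)"
proof -
 define N where "N = 16 * M"
 have N: "N > 0" "4 dvd N" "4 * M dvd N" "16 * M dvd N" using M_pos by (auto simp: N_def)
 obtain \<nu> :: nat where \<nu>: "\<nu> > 0" "\<And>f g. f \<in> S4 M \<Longrightarrow> g \<in> S4 M \<Longrightarrow> ip k N f g = of_nat \<nu> * petersson k (4 * M) f g"
  using ip_petersson[OF _ N(3) N(1), of k] by auto
 have V: "f \<in> Vsp k N" if "f \<in> S4 M" for f using that N by (intro cusp_forms_Vsp[of f k "4 * M"]) auto
 have sh: "ip k N (shift s f) g = ip k N f (shift (- s) g)" if "f \<in> S4 M" "g \<in> S4 M" for s f g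
 proof -
  have dX: "0 < det (mat2 4 s 0 (4::int))" by simp
  have "Phi k (shift s f) g z = 1 * Phi k f (shift (- s) g) (mact (mat2 4 s 0 4) z)" if "0 < Im z" for z
  proof -
   have "mact (mat2 4 s 0 4) z = z + of_int s / 4" by (simp add: mact_eq den_def add_divide_distrib)
   thus ?thesis by (simp add: Phi_def shift_value)
  qed
  from ip_transform[OF N(1,2) dX V[OF that(1)] shift_Vsp[OF that(2) N(4)] shift_Vsp[OF that(1) N(4)] V[OF that(2)] _ this]
  show ?thesis by simp
 qed
 have RV: "R f \<in> Vsp k N" if "f \<in> S4 M" for f
  unfolding R_def by (intro Vsp_add Vsp_cmult shift_Vsp that N)
 have R1: "ip k N (R f) g = \<rho> * ip k N (shift 1 f) g + cnj \<rho> * ip k N (shift (-1) f) g" if "f \<in> S4 M" "g \<in> S4 M" for f g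
  using ip_add_left[OF N(1,2) Vsp_cmult[OF shift_Vsp[OF that(1) N(4)]] Vsp_cmult[OF shift_Vsp[OF that(1) N(4)]] V[OF that(2)], of \<rho> 1 "cnj \<rho>" "-1"]
  unfolding R_def ip_cmult_left .
 have RR: "ip k N (R f) g = cnj (ip k N (R g) f)" if "f \<in> S4 M" "g \<in> S4 M" for f g
  unfolding R1[OF that] R1[OF that(2,1)] sh[OF that] by (simp add: ip_cnj[of k N f])
 have js: "ip k N (Q_2' k M m n f) g = 2 * ip k N (R f) g" if "f \<in> S4 M" "g \<in> S4 M" for f g
 proof -
  have "js k (Am 1) g = g" by (rule S4_cusp(2)[OF that(2)]) (simp add: Gamma0_mat2)
  hence "ip k N (js k (Am 1) (R f)) g = ip k N (R f) g"
   using ip_js[OF N(1,2) RV[OF that(1)] V[OF that(2)] Gamma0_4_gens(2), of "int M * 1"] by simp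
  thus ?thesis unfolding Q_2'_R[OF that(1)]
   using ip_add_left[OF N(1,2) RV[OF that(1)] Vsp_js[OF RV[OF that(1)] Gamma0_4_gens(2) N(2)] V[OF that(2)]] by simp
 qed
 have "ip k N (Q_2' k M m n f) g = cnj (ip k N (Q_2' k M m n g) f)"
  unfolding js[OF f g] js[OF g f] RR[OF f g] by simp
 also have "... = ip k N f (Q_2' k M m n g)" by (rule ip_cnj[symmetric])
 finally show ?thesis using \<nu> f g Q_2'_S4 by simp
qed

lemma R_coeff: "\<rho> * \<i> ^ j + cnj \<rho> * (- \<i>) ^ j = (if ((-1) ^ k * int j) mod 4 \<in> {0, 1} then 1 else -1)"
proof -
 define i t where "i = j div 4" and "t = j mod 4"
 have j: "j = 4 * i + t" by (simp add: i_def t_def)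
 have pw: "\<i> ^ j = \<i> ^ t" "(- \<i>) ^ j = (- \<i>) ^ t" by (simp_all add: j power_add power_mult)
 have "((-1) ^ k * int j) mod 4 = ((-1) ^ k * int t) mod 4"
 proof -
  have "(-1) ^ k * int j = (-1) ^ k * int t + 4 * ((-1) ^ k * int i)" by (simp add: j algebra_simps)
  thus ?thesis by (simp only: mod_mult_self2)
 qed
 moreover have "t < 4" by (simp add: t_def)
 hence "t = 0 \<or> t = 1 \<or> t = 2 \<or> t = 3" by linarith
 ultimately show ?thesis unfolding pw
  by (cases "even k") (auto simp: \<rho>_def complex_eq_iff power2_eq_square power3_eq_cube)
qed

lemma R_fixed_iff: assumes f: "f \<in> S4 M" shows "R f = f \<longleftrightarrow> f \<in> plus_space k (4 * M)"
proof -
 have N4: "4 dvd 4 * M" by simp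
 have fc: "f \<in> cusp_space k" by (rule S4_cusp(1)[OF f])
 obtain a where a: "a 0 = 0" "has_q_expansion 1 a f" using cusp_forms_expansion[OF f N4] .
 have e: "exp (2 * pi * \<i> * of_nat j * (of_int s / 4) / of_nat 1) = exp (of_int s * (of_real (pi / 2) * \<i>)) ^ j" for j s
  by (subst exp_of_nat_mult[symmetric]) (simp add: algebra_simps)
 have e1: "exp (of_real (pi / 2) * \<i>) = \<i>" using cis_pi_half by (simp add: cis_conv_exp mult.commute)
 have s1: "has_q_expansion 1 (\<lambda>j. a j * \<i> ^ j) (shift 1 f)"
  using has_q_expansion_shift[OF a(2), of "of_int 1 / 4"] e1 unfolding e shift_value[abs_def] by simp
 have s2: "has_q_expansion 1 (\<lambda>j. a j * (- \<i>) ^ j) (shift (-1) f)"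
  using has_q_expansion_shift[OF a(2), of "of_int (-1) / 4"] e1 unfolding e shift_value[abs_def] by (simp add: exp_minus)
 have R: "has_q_expansion 1 (\<lambda>j. \<rho> * (a j * \<i> ^ j) + cnj \<rho> * (a j * (- \<i>) ^ j)) (R f)"
  unfolding R_def by (intro has_q_expansion_add has_q_expansion_cmult s1 s2)
 have co: "\<rho> * (a j * \<i> ^ j) + cnj \<rho> * (a j * (- \<i>) ^ j) = a j * (if ((-1) ^ k * int j) mod 4 \<in> {0, 1} then 1 else -1)" for j
  unfolding R_coeff[symmetric] by (simp add: algebra_simps)
 define b where "b = (\<lambda>j. a j * (if ((-1) ^ k * int j) mod 4 \<in> {0, 1} then 1 else -1))"
 have R: "has_q_expansion 1 b (R f)" using R unfolding co b_def .
 have "R f = f \<longleftrightarrow> b = a"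
 proof
  assume "R f = f"
  thus "b = a" using has_q_expansion_unique[of 1 b f a] R a(2) by simp
 next
  assume "b = a"
  show "R f = f"
  proof
   fix z
   show "R f z = f z"
   proof (cases "0 < Im z")
    case True
    thus ?thesis using R a(2) \<open>b = a\<close> sums_unique2 unfolding has_q_expansion_def by blast
   next
    case False
    thus ?thesis using cusp_space_upper[OF fc False] cusp_space_upper[OF R_cusp[OF fc] False] by simp
   qed
  qed
 qed
 also have "... \<longleftrightarrow> (\<forall>j. ((-1) ^ k * int j) mod 4 \<notin> {0, 1} \<longrightarrow> a j = 0)"
  by (auto simp: b_def fun_eq_iff split: if_splits)
 also have "... \<longleftrightarrow> f \<in> plus_space k (4 * M)" using f fourier_coeff_eq[OF a(2)] by (simp add: plus_space_def)
 finally show ?thesis .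
qed

lemma Q_2'_plus: assumes "f \<in> plus_space k (4 * M)" shows "Q_2' k M m n f = (\<lambda>z. 2 * f z)"
proof -
 have f: "f \<in> S4 M" using assms by (simp add: plus_space_def)
 have "R f = f" using R_fixed_iff[OF f] assms by simp
 moreover have "js k (Am 1) f = f" by (rule S4_cusp(2)[OF f]) (simp add: Gamma0_mat2)
 ultimately show ?thesis unfolding Q_2'_R[OF f] by simp
qed

text \<open>The function is (R f + f) + \<rho> (g1 + g3). R fixes the first bracket because it is an
  involution, and g1, g3 by \<open>R_eigen\<close>, as 1 and 3 are odd.\<close>

lemma Q_2'_add_plus: assumes f: "f \<in> S4 M" shows "(\<lambda>z. Q_2' k M m n f z + f z) \<in> plus_space k (4 * M)"
proof -
 have fc: "f \<in> cusp_space k" by (rule S4_cusp(1)[OF f])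
 note up = cusp_space_upper[OF shift_cusp[OF fc]]
 define g1 g3 where "g1 = js k (Am 1) (shift 1 f)" and "g3 = js k (Am 3) (shift 1 f)"
 have "js k (Am 3) (shift 1 f) = js k (Am 2 ** Am 1) (shift 1 f)" by (simp add: mat2_mult)
 also have "... = js k (Am 1) (js k (Am 2) (shift 1 f))" by (rule js_mult[OF Gamma0_4_gens(2) Gamma0_4_gens(2) up, symmetric])
 finally have 3: "g3 = (\<lambda>z. \<i> * (-1) ^ k * js k (Am 1) (shift (-1) f) z)"
  unfolding shift_Am_2[OF f] js_lin(2) g3_def .
 have "js k (Am 1) (R f) = (\<lambda>z. \<rho> * g1 z + cnj \<rho> * js k (Am 1) (shift (-1) f) z)" unfolding R_def js_lin g1_def ..
 also have "... = (\<lambda>z. \<rho> * g1 z + \<rho> * g3 z)" unfolding 3 \<rho>_cnj(1)[symmetric] by (simp add: mult.assoc)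
 finally have Q: "(\<lambda>z. Q_2' k M m n f z + f z) = (\<lambda>z. R f z + (\<rho> * g1 z + \<rho> * g3 z) + f z)"
  unfolding Q_2'_R[OF f] by simp
 have g: "R g1 = g1" "R g3 = g3" unfolding g1_def g3_def by (rule R_eigen[OF f]; simp)+
 have Radd: "R (\<lambda>z. F z + G z) = (\<lambda>z. R F z + R G z)" for F G by (simp add: R_def aff_lin algebra_simps)
 have Rc: "R (\<lambda>z. c * F z) = (\<lambda>z. c * R F z)" for c F by (simp add: R_def aff_lin algebra_simps)
 have "(\<lambda>z. Q_2' k M m n f z + f z) \<in> S4 M" by (intro cusp_forms_add Q_2'_S4 f) simp
 moreover have "R (\<lambda>z. Q_2' k M m n f z + f z) = (\<lambda>z. Q_2' k M m n f z + f z)"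
  unfolding Q Radd Rc R_R[OF f] g by (simp add: add_ac)
 ultimately show ?thesis using R_fixed_iff by simp
qed
end

subsection \<open>The minus space\<close>

context even_prime_level
begin

abbreviation "pet \<equiv> petersson k (4 * M)"

lemma pet_ip:
 obtains \<nu> :: nat where "\<nu> > 0" "\<And>f g. f \<in> S4 M \<Longrightarrow> g \<in> S4 M \<Longrightarrow> ip k (16 * M) f g = of_nat \<nu> * pet f g"
proof -
 have "4 dvd 4 * M" "4 * M dvd 16 * M" "0 < 16 * M" using M_pos by simp_all
 thus thesis by (rule ip_petersson) (rule that)
qed

lemma S4_Vsp: "f \<in> S4 M \<Longrightarrow> f \<in> Vsp k (16 * M)" by (rule cusp_forms_Vsp) auto

lemma pet_ip_0: "f \<in> S4 M \<Longrightarrow> g \<in> S4 M \<Longrightarrow> ip k (16 * M) f g = 0 \<longleftrightarrow> pet f g = 0" by (rule pet_ip) simp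

lemma N16: "16 * M > 0" "4 dvd 16 * M" using M_pos by auto

lemma pet_add_right:
 assumes "f \<in> S4 M" "g \<in> S4 M" "h \<in> S4 M" shows "pet f (\<lambda>z. g z + h z) = pet f g + pet f h"
proof -
 obtain \<nu> :: nat where \<nu>: "\<nu> > 0" "\<And>f g. f \<in> S4 M \<Longrightarrow> g \<in> S4 M \<Longrightarrow> ip k (16 * M) f g = of_nat \<nu> * pet f g" by (rule pet_ip) blast
 have "(\<lambda>z. g z + h z) \<in> S4 M" using assms by (intro cusp_forms_add) auto
 hence "of_nat \<nu> * pet f (\<lambda>z. g z + h z) = of_nat \<nu> * (pet f g + pet f h)"
  using \<nu>(2)[symmetric] ip_add_right[OF N16 S4_Vsp[OF assms(2)] S4_Vsp[OF assms(3)] S4_Vsp[OF assms(1)]] assms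
  by (simp add: distrib_left)
 thus ?thesis using \<nu>(1) by simp
qed

lemma pet_cmult: "pet f (\<lambda>z. c * g z) = cnj c * pet f g" "pet (\<lambda>z. c * f z) g = c * pet f g"
 unfolding petersson_def set_lebesgue_integral_def Let_def sum_distrib_left
 by (intro sum.cong refl, subst integral_mult_right_zero[symmetric], rule Bochner_Integration.integral_cong; simp)+

lemma pet_sym: "pet g f = cnj (pet f g)" if "f \<in> S4 M" "g \<in> S4 M"
proof -
 obtain \<nu> :: nat where \<nu>: "\<nu> > 0" "\<And>f g. f \<in> S4 M \<Longrightarrow> g \<in> S4 M \<Longrightarrow> ip k (16 * M) f g = of_nat \<nu> * pet f g" by (rule pet_ip) blast
 have "of_nat \<nu> * pet g f = cnj (of_nat \<nu> * pet f g)"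
  unfolding \<nu>(2)[OF that, symmetric] \<nu>(2)[OF that(2,1), symmetric] by (rule ip_cnj)
 thus ?thesis using \<nu>(1) by simp
qed

lemma pet_add_left:
 assumes "f \<in> S4 M" "g \<in> S4 M" "h \<in> S4 M" shows "pet (\<lambda>z. g z + h z) f = pet g f + pet h f"
proof -
 have "(\<lambda>z. g z + h z) \<in> S4 M" using assms by (intro cusp_forms_add) auto
 thus ?thesis using pet_add_right[OF assms] pet_sym[OF assms(1)] assms by simp
qed

lemma pet_definite: "f \<in> S4 M \<Longrightarrow> pet f f = 0 \<Longrightarrow> f = (\<lambda>z. 0)"
 using ip_definite[OF S4_Vsp N16] pet_ip_0 by blast

definition orth :: "(complex \<Rightarrow> complex) \<Rightarrow> (complex \<Rightarrow> complex) set \<Rightarrow> bool" where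
 "orth f X \<longleftrightarrow> (\<forall>g\<in>X. pet f g = 0)"

text \<open>Each summand is contained in the sum because 0 lies in the other. The two closure
  statements allow the lemma to be iterated.\<close>

lemma orth_plus:
 assumes "f \<in> S4 M" "X \<subseteq> S4 M" "Y \<subseteq> S4 M" "0 \<in> X" "0 \<in> Y"
 shows "orth f (X + Y) \<longleftrightarrow> orth f X \<and> orth f Y" "X + Y \<subseteq> S4 M" "0 \<in> X + Y"
proof -
 have p: "g + h = (\<lambda>z. g z + h z)" for g h :: "complex \<Rightarrow> complex" by (simp add: fun_eq_iff)
 have "X \<subseteq> X + Y" "Y \<subseteq> X + Y" using set_zero_plus2[OF assms(5), of X] set_zero_plus2[OF assms(4), of Y] by (simp_all add: add.commute)
 moreover have "pet f g = 0" if "orth f X" "orth f Y" "g \<in> X + Y" for g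
 proof -
  obtain x y where "g = x + y" "x \<in> X" "y \<in> Y" using \<open>g \<in> X + Y\<close> by (rule set_plus_elim)
  thus ?thesis using that pet_add_right[OF assms(1), of x y] assms(2,3) by (auto simp: orth_def p)
 qed
 ultimately show "orth f (X + Y) \<longleftrightarrow> orth f X \<and> orth f Y" unfolding orth_def by blast
 show "X + Y \<subseteq> S4 M"
 proof
  fix g assume "g \<in> X + Y"
  then obtain x y where "g = x + y" "x \<in> X" "y \<in> Y" by (rule set_plus_elim)
  thus "g \<in> S4 M" using assms(2,3) cusp_forms_add[of "4 * M" x k y] by (auto simp: p)
 qed
 show "0 \<in> X + Y" using \<open>X \<subseteq> X + Y\<close> assms(4) by blast
qed

lemma orth_sum:
 assumes f: "f \<in> S4 M" and "finite I" and "\<And>i. i \<in> I \<Longrightarrow> X i \<subseteq> S4 M \<and> 0 \<in> X i"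
 shows "(orth f (\<Sum>i\<in>I. X i) \<longleftrightarrow> (\<forall>i\<in>I. orth f (X i))) \<and> (\<Sum>i\<in>I. X i) \<subseteq> S4 M \<and> 0 \<in> (\<Sum>i\<in>I. X i)"
 using assms(2,3)
proof (induction I rule: finite_induct)
 case empty
 have "pet f (\<lambda>z. 0) = 0" using pet_cmult(1)[of f 0 f] by simp
 moreover have "(\<lambda>z. 0) \<in> S4 M" by (rule cusp_forms_zero) simp
 ultimately show ?case by (simp add: orth_def set_zero zero_fun_def)
next
 case (insert i I)
 have Xi: "X i \<subseteq> S4 M" "0 \<in> X i" using insert.prems[of i] by (blast intro: insertI1)+
 have IH: "(orth f (\<Sum>i\<in>I. X i) \<longleftrightarrow> (\<forall>i\<in>I. orth f (X i))) \<and> (\<Sum>i\<in>I. X i) \<subseteq> S4 M \<and> 0 \<in> (\<Sum>i\<in>I. X i)"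
  by (rule insert.IH) (rule insert.prems, rule insertI2)
 have "sum X (insert i I) = X i + sum X I" using insert.hyps by (rule sum.insert)
 thus ?case using orth_plus[OF f Xi(1) conjunct1[OF conjunct2[OF IH]] Xi(2) conjunct2[OF conjunct2[OF IH]]] IH
  by (simp only: ball_simps simp_thms)
qed

lemma zero_S4: "0 \<in> S4 N" unfolding zero_fun_def by (rule cusp_forms_zero) simp

lemma zero_plus: "0 \<in> plus_space k (4 * N)"
proof -
 have "has_q_expansion 1 (\<lambda>n. 0) (0 :: complex \<Rightarrow> complex)" by (simp add: has_q_expansion_def)
 thus ?thesis using zero_S4 fourier_coeff_eq by (simp add: plus_space_def)
qed

lemma plus_mono: assumes "d dvd N" shows "plus_space k (4 * d) \<subseteq> plus_space k (4 * N)"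
 using cusp_forms_mono[of "4 * d" "4 * N" k] assms by (auto simp: plus_space_def)

lemma S4_mono: assumes "d dvd N" shows "S4 d \<subseteq> S4 N"
 using cusp_forms_mono[of "4 * d" "4 * N" k] assms by auto

lemma fourier_coeff_U: assumes "f \<in> S4 N" "r > 0" shows "fourier_coeff (U_op r f) j = fourier_coeff f (r * j)"
proof -
 obtain a where a: "a 0 = 0" "has_q_expansion 1 a f" using cusp_forms_expansion[OF assms(1)] by auto
 have "has_q_expansion 1 (\<lambda>n. a (r * n)) (U_op r f)" by (rule U_op_q_expansion[OF a(2) assms(2)])
 thus ?thesis using fourier_coeff_eq a(2) by metis
qed

lemma U_op_U_op: assumes "f \<in> S4 N" "r > 0" shows "U_op s (U_op r f) = U_op (s * r) f"
 unfolding U_op_def[of s] fourier_coeff_U[OF assms] unfolding U_op_def[of "s * r"] mult.left_commute[of r s] mult.assoc[of s r] ..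

text \<open>M/d is odd, so its square is 1 mod 4 and the residue class of (-1)^k n is kept.\<close>

lemma U_plus:
 assumes f: "f \<in> plus_space k (4 * d)" and d: "d dvd M" shows "U_op ((M div d)\<^sup>2) f \<in> plus_space k (4 * M)"
proof -
 define e where "e = M div d"
 have e: "M = e * d" using d by (simp add: e_def)
 hence e0: "e > 0" "odd e" "e dvd 4 * M" using M_pos odd_M by auto
 have fM: "f \<in> S4 M" using f plus_mono[OF d] by (auto simp: plus_space_def)
 have "fourier_coeff (U_op (e\<^sup>2) f) n = 0" if n: "((-1) ^ k * int n) mod 4 \<notin> {0, 1}" for n
 proof -
  obtain i where i: "e = 2 * i + 1" using e0(2) by (elim oddE)
  have "(-1) ^ k * int (e\<^sup>2 * n) = (-1) ^ k * int n + 4 * ((-1) ^ k * int ((i * i + i) * n))"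
   by (simp add: i power2_eq_square algebra_simps)
  hence "((-1) ^ k * int (e\<^sup>2 * n)) mod 4 = ((-1) ^ k * int n) mod 4" by (simp only: mod_mult_self2)
  hence "fourier_coeff f (e\<^sup>2 * n) = 0" using f n by (simp add: plus_space_def)
  thus ?thesis using fourier_coeff_U[OF fM, of "e\<^sup>2"] e0 by simp
 qed
 moreover have "U_op (e\<^sup>2) f \<in> S4 M" by (rule U_square_cusp_forms[OF fM M_pos e0(1,3)])
 ultimately show ?thesis by (simp add: plus_space_def e_def)
qed

definition plus_old :: "(complex \<Rightarrow> complex) set" where
 "plus_old = (\<Sum>d\<in>{d. d dvd M \<and> d < M}. plus_space k (4 * d) + U_op ((M div d)\<^sup>2) ` plus_space k (4 * d))"

lemma U_zero: "U_op r 0 = 0"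
proof -
 have "has_q_expansion 1 (\<lambda>n. 0) (0 :: complex \<Rightarrow> complex)" by (simp add: has_q_expansion_def)
 thus ?thesis using fourier_coeff_eq by (simp add: U_op_def fun_eq_iff)
qed

lemma orth_plus_old:
 assumes f: "f \<in> S4 M"
 shows "orth f plus_old \<longleftrightarrow> (\<forall>d. d dvd M \<and> d < M \<longrightarrow> orth f (plus_space k (4 * d)) \<and> orth f (U_op ((M div d)\<^sup>2) ` plus_space k (4 * d)))"
proof -
 have X: "plus_space k (4 * d) \<subseteq> S4 M" "U_op ((M div d)\<^sup>2) ` plus_space k (4 * d) \<subseteq> S4 M" "0 \<in> plus_space k (4 * d)" "0 \<in> U_op ((M div d)\<^sup>2) ` plus_space k (4 * d)"
  if "d dvd M" for d
 proof -
  have P: "plus_space k (4 * M) \<subseteq> S4 M" by (auto simp: plus_space_def)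
  show "plus_space k (4 * d) \<subseteq> S4 M" using plus_mono[OF that] P by (rule subset_trans)
  show "U_op ((M div d)\<^sup>2) ` plus_space k (4 * d) \<subseteq> S4 M" using U_plus[OF _ that] P by blast
  show "0 \<in> plus_space k (4 * d)" by (rule zero_plus)
  show "0 \<in> U_op ((M div d)\<^sup>2) ` plus_space k (4 * d)"
   by (rule image_eqI[where x = 0]) (rule U_zero[symmetric], rule zero_plus)
 qed
 have fin: "finite {d. d dvd M \<and> d < M}" by simp
 have "orth f plus_old \<longleftrightarrow> (\<forall>d\<in>{d. d dvd M \<and> d < M}. orth f (plus_space k (4 * d) + U_op ((M div d)\<^sup>2) ` plus_space k (4 * d)))"
  unfolding plus_old_def
 proof (rule conjunct1[OF orth_sum[OF f fin]])
  fix d assume "d \<in> {d. d dvd M \<and> d < M}"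
  hence "d dvd M" by simp
  from orth_plus(2,3)[OF f X[OF this]]
  show "plus_space k (4 * d) + U_op ((M div d)\<^sup>2) ` plus_space k (4 * d) \<subseteq> S4 M \<and>
   0 \<in> plus_space k (4 * d) + U_op ((M div d)\<^sup>2) ` plus_space k (4 * d)" by (rule conjI)
 qed
 also have "... \<longleftrightarrow> (\<forall>d. d dvd M \<and> d < M \<longrightarrow> orth f (plus_space k (4 * d)) \<and> orth f (U_op ((M div d)\<^sup>2) ` plus_space k (4 * d)))"
  using orth_plus(1)[OF f X] by blast
 finally show ?thesis .
qed

lemma plus_new_iff: "f \<in> plus_new_space k M \<longleftrightarrow> f \<in> plus_space k (4 * M) \<and> orth f plus_old"
 by (simp add: plus_new_space_def orth_compl_def orth_def plus_old_def)

lemma pet_pr: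
 assumes f: "f \<in> S4 M" and g: "g \<in> plus_space k (4 * M)"
 shows "pet (\<lambda>z. Q_2' k M m n f z + f z) g = 3 * pet f g"
proof -
 have gS: "g \<in> S4 M" using g by (simp add: plus_space_def)
 have "pet (\<lambda>z. Q_2' k M m n f z + f z) g = pet f (\<lambda>z. 2 * g z) + pet f g"
  unfolding pet_add_left[OF gS Q_2'_S4[OF f] f] Q_2'_selfadjoint[OF f gS] Q_2'_plus[OF g] ..
 thus ?thesis unfolding pet_cmult by simp
qed

text \<open>g = Q'_2 f + f lies in the plus space, and <g, h> = 3 <f, h> for h there, so g inherits
  orthogonality to the old forms from f and is new. Then <f, g> = 0, and <g, g> = 3 <f, g> shows
  that g vanishes.\<close>

lemma Q_2'_eigen:
 assumes f: "f \<in> S4 M"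
  and old: "\<And>p h. prime p \<Longrightarrow> p dvd M \<Longrightarrow> h \<in> S4 (M div p) \<Longrightarrow> pet f h = 0 \<and> pet f (U_op (p\<^sup>2) h) = 0"
  and new: "orth f (plus_new_space k M)" shows "Q_2' k M m n f = - f"
proof -
 define g where "g = (\<lambda>z. Q_2' k M m n f z + f z)"
 have g: "g \<in> plus_space k (4 * M)" unfolding g_def by (rule Q_2'_add_plus[OF f])
 hence gS: "g \<in> S4 M" by (simp add: plus_space_def)
 have "orth g plus_old" unfolding orth_plus_old[OF gS]
 proof (intro allI impI)
  fix d assume d: "d dvd M \<and> d < M"
  define e where "e = M div d"
  have e: "M = e * d" using d by (simp add: e_def)
  hence "e \<noteq> 1" using d by auto
  \<comment> \<open>With M/d = p r, level 4 d divides 4 M/p, and U at (M/d)^2 is U_{p^2} after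
    U_{r^2}, where U_{r^2} keeps level 4 M/p because r divides M/p.\<close>
  then obtain p where p: "prime p" "p dvd e" using prime_factor_nat by blast
  obtain r where r: "e = p * r" using p(2) by blast
  have p0: "p > 0" using p(1) prime_gt_0_nat by blast
  have r0: "r > 0" using e r M_pos by (intro Nat.gr0I) auto
  have Mp: "M div p = r * d" using p0 by (simp add: e r)
  have pM: "p dvd M" using e r by simp
  have sub: "plus_space k (4 * d) \<subseteq> S4 (M div p)" using S4_mono[of d "M div p"] by (auto simp: plus_space_def Mp)
  have "pet g h = 0" if h: "h \<in> plus_space k (4 * d)" for h
  proof -
   have "h \<in> plus_space k (4 * M)" "h \<in> S4 (M div p)" using h sub plus_mono[of d M] d by blast+
   thus ?thesis using pet_pr[OF f] old[OF p(1) pM] by (simp add: g_def)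
  qed
  moreover have "pet g (U_op (e\<^sup>2) h) = 0" if h: "h \<in> plus_space k (4 * d)" for h
  proof -
   have hp: "h \<in> S4 (M div p)" using h sub by blast
   have "0 < M div p" using Mp r0 e M_pos by simp
   hence "U_op (r\<^sup>2) h \<in> S4 (M div p)" using Mp by (intro U_square_cusp_forms[OF hp _ r0]) auto
   moreover have "U_op (p\<^sup>2) (U_op (r\<^sup>2) h) = U_op (e\<^sup>2) h"
    using U_op_U_op[OF hp, of "r\<^sup>2" "p\<^sup>2"] r0 by (simp add: r power_mult_distrib)
   ultimately have "pet f (U_op (e\<^sup>2) h) = 0" using old[OF p(1) pM] by metis
   moreover have "U_op (e\<^sup>2) h \<in> plus_space k (4 * M)" unfolding e_def using U_plus[OF h] d by simp
   ultimately show ?thesis using pet_pr[OF f] by (simp add: g_def)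
  qed
  ultimately show "orth g (plus_space k (4 * d)) \<and> orth g (U_op ((M div d)\<^sup>2) ` plus_space k (4 * d))"
   by (auto simp: orth_def e_def)
 qed
 hence "pet f g = 0" using new g plus_new_iff by (simp add: orth_def)
 hence "pet g g = 0" using pet_pr[OF f g] by (simp add: g_def)
 hence "g = (\<lambda>z. 0)" by (rule pet_definite[OF gS])
 thus ?thesis by (auto simp: g_def fun_eq_iff add_eq_0_iff)
qed
end

section \<open>The minus space as a list of orthogonality conditions, and the equivalence\<close>

lemma minus_space_iff:
 assumes E2: "even_prime_level M m\<^sub>2 n\<^sub>2" and Op: "\<And>p. p \<in> prime_factors M \<Longrightarrow> odd_prime_level M p (m p) (n p)"
  and f: "f \<in> cusp_forms k (4 * M)" shows "f \<in> minus_space k M m n m\<^sub>2 n\<^sub>2 \<longleftrightarrow>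
  (\<forall>p\<in>prime_factors M. \<forall>g\<in>cusp_forms k (4 * (M div p)).
    petersson k (4 * M) f g = 0 \<and> petersson k (4 * M) f (W_p2 k M p (m p) (n p) g) = 0) \<and>
  (\<forall>g\<in>plus_new_space k M. petersson k (4 * M) f g = 0 \<and> petersson k (4 * M) f (W_4 k M m\<^sub>2 n\<^sub>2 g) = 0)"
proof -
 interpret E2: even_prime_level k M m\<^sub>2 n\<^sub>2 by (rule E2)
 have W0: "W_p2 k M p (m p) (n p) 0 = 0" "W_4 k M m\<^sub>2 n\<^sub>2 0 = 0" for p
 proof -
  have "slash k \<xi> 0 = (\<lambda>z. 0)" for \<xi> by (simp add: slash_def fun_eq_iff)
  thus "W_p2 k M p (m p) (n p) 0 = 0" "W_4 k M m\<^sub>2 n\<^sub>2 0 = 0" by (simp_all add: W_p2_def W_4_def fun_eq_iff)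
 qed
 have B: "cusp_forms k (4 * (M div p)) \<subseteq> cusp_forms k (4 * M)"
  "W_p2 k M p (m p) (n p) ` cusp_forms k (4 * (M div p)) \<subseteq> cusp_forms k (4 * M)"
  "0 \<in> cusp_forms k (4 * (M div p))" "0 \<in> W_p2 k M p (m p) (n p) ` cusp_forms k (4 * (M div p))"
  if "p \<in> prime_factors M" for p
 proof -
  interpret odd_prime_level k M p "m p" "n p" by (rule Op[OF that])
  show "cusp_forms k (4 * (M div p)) \<subseteq> cusp_forms k (4 * M)" using SL_Sk by blast
  show "W ` cusp_forms k (4 * (M div p)) \<subseteq> cusp_forms k (4 * M)" using SL_Sk W_Sk by blast
  show "0 \<in> cusp_forms k (4 * (M div p))" by (rule E2.zero_S4)
  hence "W 0 \<in> W ` cusp_forms k (4 * (M div p))" by (rule imageI)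
  thus "0 \<in> W ` cusp_forms k (4 * (M div p))" unfolding W0 .
 qed
 have P: "plus_new_space k M \<subseteq> cusp_forms k (4 * M)" "W_4 k M m\<^sub>2 n\<^sub>2 ` plus_new_space k M \<subseteq> cusp_forms k (4 * M)"
  "0 \<in> plus_new_space k M" "0 \<in> W_4 k M m\<^sub>2 n\<^sub>2 ` plus_new_space k M"
 proof -
  show P: "plus_new_space k M \<subseteq> cusp_forms k (4 * M)" by (auto simp: plus_new_space_def orth_compl_def plus_space_def)
  show "W_4 k M m\<^sub>2 n\<^sub>2 ` plus_new_space k M \<subseteq> cusp_forms k (4 * M)" using P E2.W4_level[of _ M] by auto
  have "petersson k (4 * M) (\<lambda>z. 0) g = 0" for g using E2.pet_cmult(2)[of 0 "\<lambda>z. 0" g] by simp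
  hence "E2.orth 0 E2.plus_old" by (simp add: E2.orth_def zero_fun_def)
  thus "0 \<in> plus_new_space k M" using E2.zero_plus by (simp add: E2.plus_new_iff)
  hence "W_4 k M m\<^sub>2 n\<^sub>2 0 \<in> W_4 k M m\<^sub>2 n\<^sub>2 ` plus_new_space k M" by (rule imageI)
  thus "0 \<in> W_4 k M m\<^sub>2 n\<^sub>2 ` plus_new_space k M" unfolding W0 .
 qed
 define BB where "BB = (\<Sum>p\<in>prime_factors M. B_space k M m n p)"
 have BBs: "(E2.orth f BB \<longleftrightarrow> (\<forall>p\<in>prime_factors M. E2.orth f (B_space k M m n p))) \<and> BB \<subseteq> cusp_forms k (4 * M) \<and> 0 \<in> BB"
  unfolding BB_def
 proof (rule E2.orth_sum[OF f])
  fix p assume "p \<in> prime_factors M"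
  from E2.orth_plus(2,3)[OF f B[OF this]]
  show "B_space k M m n p \<subseteq> cusp_forms k (4 * M) \<and> 0 \<in> B_space k M m n p" unfolding B_space_def by (rule conjI)
 qed simp
 note BP = E2.orth_plus[OF f conjunct1[OF conjunct2[OF BBs]] P(1) conjunct2[OF conjunct2[OF BBs]] P(3)]
 have "f \<in> minus_space k M m n m\<^sub>2 n\<^sub>2 \<longleftrightarrow> E2.orth f (BB + plus_new_space k M + W_4 k M m\<^sub>2 n\<^sub>2 ` plus_new_space k M)"
  using f by (simp add: minus_space_def E_space_def orth_compl_def E2.orth_def BB_def)
 also have "... \<longleftrightarrow> (\<forall>p\<in>prime_factors M. E2.orth f (B_space k M m n p)) \<and> E2.orth f (plus_new_space k M)
   \<and> E2.orth f (W_4 k M m\<^sub>2 n\<^sub>2 ` plus_new_space k M)"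
  using E2.orth_plus(1)[OF f BP(2) P(2) BP(3) P(4)] BP(1) BBs by blast
 also have "(\<forall>p\<in>prime_factors M. E2.orth f (B_space k M m n p)) \<longleftrightarrow>
   (\<forall>p\<in>prime_factors M. E2.orth f (cusp_forms k (4 * (M div p))) \<and> E2.orth f (W_p2 k M p (m p) (n p) ` cusp_forms k (4 * (M div p))))"
  unfolding B_space_def using E2.orth_plus(1)[OF f B] by (rule ball_cong[OF refl])
 finally show ?thesis unfolding E2.orth_def by blast
qed

theorem theorem9:
  fixes k M :: nat and m n :: "nat \<Rightarrow> int" and m\<^sub>2 n\<^sub>2 :: int and f :: "complex \<Rightarrow> complex"
  assumes "k \<ge> 1"
    and "odd M" and "squarefree M" and "M \<noteq> 1"
    and "\<And>p. prime p \<Longrightarrow> p dvd M \<Longrightarrow> int p * n p - 4 * int (M div p) * m p = 1"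
    and "4 * n\<^sub>2 - m\<^sub>2 * int M = 1"
    and "f \<in> cusp_forms k (4 * M)"
  shows "f \<in> minus_space k M m n m\<^sub>2 n\<^sub>2 \<longleftrightarrow>
    (\<forall>p. prime p \<and> p dvd M \<longrightarrow>
       Q_p k M p (m p) (n p) f = - f \<and> - f = Q_p' k M p (m p) (n p) f) \<and>
    Q_2 k M m\<^sub>2 n\<^sub>2 f = - f \<and> - f = Q_2' k M m\<^sub>2 n\<^sub>2 f"
proof -
 note f = assms(7)
 interpret E2: even_prime_level k M m\<^sub>2 n\<^sub>2 by unfold_locales (rule assms)+
 have M0: "M \<noteq> 0" using assms(2) by (intro notI) simp
 have Op: "odd_prime_level M p (m p) (n p)" if "prime p" "p dvd M" for p
  by unfold_locales (use assms that in auto)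
 have pf: "p \<in> prime_factors M \<longleftrightarrow> prime p \<and> p dvd M" for p using M0 by (auto simp: prime_factors_dvd)
 let ?pet = "petersson k (4 * M)"
 have odd_eq: "(Q_p k M p (m p) (n p) f = - f \<and> - f = Q_p' k M p (m p) (n p) f) \<longleftrightarrow>
   (\<forall>g\<in>cusp_forms k (4 * (M div p)). ?pet f g = 0 \<and> ?pet f (W_p2 k M p (m p) (n p) g) = 0)"
  if p: "prime p" "p dvd M" for p
 proof -
  interpret odd_prime_level k M p "m p" "n p" by (rule Op[OF p])
  show ?thesis using eigen_iff[OF f] E2.pet_ip_0[OF f] SL_Sk W_Sk by (simp add: Q_p'_def comp_def)
 qed
 obtain c where c: "c \<noteq> 0" "\<And>g. g \<in> cusp_forms k (4 * M) \<Longrightarrow> ?pet (E2.W4 f) g = c * ?pet f (E2.W4 g)"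
 proof -
  obtain c where c: "c \<noteq> 0" "\<And>f g. f \<in> cusp_forms k (4 * M) \<Longrightarrow> g \<in> cusp_forms k (4 * M) \<Longrightarrow>
    ip k (16 * M) (E2.W4 f) g = c * ip k (16 * M) f (E2.W4 g)"
   using E2.W4_ip[of "16 * M"] E2.M_pos by auto
  obtain \<nu> :: nat where \<nu>: "\<nu> > 0" "\<And>f g. f \<in> cusp_forms k (4 * M) \<Longrightarrow> g \<in> cusp_forms k (4 * M) \<Longrightarrow> ip k (16 * M) f g = of_nat \<nu> * ?pet f g"
   by (rule E2.pet_ip) blast
  have "?pet (E2.W4 f) g = c * ?pet f (E2.W4 g)" if g: "g \<in> cusp_forms k (4 * M)" for g
   using c(2)[OF f g] \<nu> E2.W4_level[of _ M] f g by simp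
  thus thesis using that c(1) by blast
 qed
 have Wf: "E2.W4 f \<in> cusp_forms k (4 * M)" by (rule E2.W4_level[OF f dvd_refl])
 have Q2: "Q_2' k M m\<^sub>2 n\<^sub>2 (E2.W4 f) = E2.W4 (Q_2 k M m\<^sub>2 n\<^sub>2 f)"
  by (simp add: Q_2'_def E2.W4_involution[OF f])
 have W4_neg: "E2.W4 (- g) = - E2.W4 g" for g using E2.W4_cmult[of "-1" g] by (simp add: fun_Compl_def)
 have Q2_S: "Q_2 k M m\<^sub>2 n\<^sub>2 f \<in> cusp_forms k (4 * M)"
 proof -
  have "U_op (2\<^sup>2) (E2.W4 f) \<in> cusp_forms k (4 * M)" by (rule U_square_cusp_forms[OF Wf E2.M_pos]) auto
  thus ?thesis unfolding Q_2_def by (intro cusp_forms_cmult) auto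
 qed
 \<comment> \<open>W_4 intertwines Q_2 and Q'_2, so the condition on Q_2 is the condition on Q'_2 at
   W_4 f, and both halves at 2 can be treated by the same lemmas.\<close>
 have Q2_iff: "Q_2 k M m\<^sub>2 n\<^sub>2 f = - f \<longleftrightarrow> Q_2' k M m\<^sub>2 n\<^sub>2 (E2.W4 f) = - E2.W4 f"
  unfolding Q2 using E2.W4_involution[OF Q2_S] E2.W4_involution[OF f] W4_neg by metis
 have M_minus: "f \<in> minus_space k M m n m\<^sub>2 n\<^sub>2 \<longleftrightarrow>
  (\<forall>p. prime p \<and> p dvd M \<longrightarrow> Q_p k M p (m p) (n p) f = - f \<and> - f = Q_p' k M p (m p) (n p) f) \<and>
  (\<forall>g\<in>plus_new_space k M. ?pet f g = 0 \<and> ?pet (E2.W4 f) g = 0)"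
 proof -
  have "plus_new_space k M \<subseteq> cusp_forms k (4 * M)" by (auto simp: plus_new_space_def orth_compl_def plus_space_def)
  hence "?pet f (E2.W4 g) = 0 \<longleftrightarrow> ?pet (E2.W4 f) g = 0" if "g \<in> plus_new_space k M" for g
   using c that by auto
  moreover have "odd_prime_level M p (m p) (n p)" if "p \<in> prime_factors M" for p using Op pf that by blast
  ultimately show ?thesis
   using minus_space_iff[OF E2.even_prime_level_axioms _ f, of m n] odd_eq pf by (simp add: Ball_def)
 qed
 \<comment> \<open>By \<open>pet_pr\<close> the product of Q'_2 F + F = 0 with g is 3 times that of
   F.\<close>
 have eig_new: "?pet F g = 0" if F: "F \<in> cusp_forms k (4 * M)" "Q_2' k M m\<^sub>2 n\<^sub>2 F = - F" and g: "g \<in> plus_new_space k M" for F g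
 proof -
  have g': "g \<in> plus_space k (4 * M)" using g by (simp add: E2.plus_new_iff)
  have "3 * ?pet F g = ?pet (\<lambda>z. 0) g" using E2.pet_pr[OF F(1) g'] F(2) by simp
  thus ?thesis using E2.pet_cmult(2)[of 0 F g] by simp
 qed
 show ?thesis unfolding M_minus
 proof (intro iffI conjI)
  assume a: "(\<forall>p. prime p \<and> p dvd M \<longrightarrow> Q_p k M p (m p) (n p) f = - f \<and> - f = Q_p' k M p (m p) (n p) f) \<and>
   Q_2 k M m\<^sub>2 n\<^sub>2 f = - f \<and> - f = Q_2' k M m\<^sub>2 n\<^sub>2 f"
  thus "\<forall>g\<in>plus_new_space k M. ?pet f g = 0 \<and> ?pet (E2.W4 f) g = 0"
   using eig_new[OF f] eig_new[OF Wf] Q2_iff by metis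
 next
  assume a: "(\<forall>p. prime p \<and> p dvd M \<longrightarrow> Q_p k M p (m p) (n p) f = - f \<and> - f = Q_p' k M p (m p) (n p) f) \<and>
   (\<forall>g\<in>plus_new_space k M. ?pet f g = 0 \<and> ?pet (E2.W4 f) g = 0)"
  have orth_p: "?pet f h = 0 \<and> ?pet f (U_op (p\<^sup>2) h) = 0" if p: "prime p" "p dvd M" and h: "h \<in> cusp_forms k (4 * (M div p))" for p h
  proof -
   interpret odd_prime_level k M p "m p" "n p" by (rule Op[OF p])
   have o: "?pet f g = 0 \<and> ?pet f (W g) = 0" if "g \<in> SL" for g using a odd_eq[OF p] p that by blast
   obtain g1 g2 where g: "g1 \<in> SL" "g2 \<in> SL" "U_op (p\<^sup>2) h = (\<lambda>z. g1 z + W g2 z)" by (rule U_square_decomp[OF h])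
   hence "?pet f (U_op (p\<^sup>2) h) = 0"
    using E2.pet_add_right[OF f SL_Sk[OF g(1)] W_Sk[OF SL_Sk[OF g(2)]]] o by simp
   thus ?thesis using o[OF h] by simp
  qed
  \<comment> \<open>The assumptions of \<open>Q_2'_eigen\<close> for W_4 f: W_4 keeps level 4 M/p,
    which settles the first product, and the second is \<open>ip_W4_U\<close>.\<close>
  have orth_W: "?pet (E2.W4 f) h = 0 \<and> ?pet (E2.W4 f) (U_op (p\<^sup>2) h) = 0" if p: "prime p" "p dvd M" and h: "h \<in> cusp_forms k (4 * (M div p))" for p h
  proof -
   interpret odd_prime_level k M p "m p" "n p" by (rule Op[OF p])
   have "M div p dvd M" using p(2) by (metis dvd_mult_div_cancel dvd_triv_right)
   hence "E2.W4 h \<in> SL" by (rule E2.W4_level[OF h])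
   hence "?pet (E2.W4 f) h = 0" using c(2)[OF SL_Sk[OF h]] orth_p[OF p] by simp
   moreover have "?pet (E2.W4 f) (U_op (p\<^sup>2) h) = 0" by (rule E2.ip_W4_U[OF p f _ h]) (use orth_p[OF p] in blast)
   ultimately show ?thesis ..
  qed
  have "Q_2' k M m\<^sub>2 n\<^sub>2 f = - f" by (rule E2.Q_2'_eigen[OF f orth_p]) (use a in \<open>auto simp: E2.orth_def\<close>)
  moreover have "Q_2' k M m\<^sub>2 n\<^sub>2 (E2.W4 f) = - E2.W4 f"
   by (rule E2.Q_2'_eigen[OF Wf orth_W]) (use a in \<open>auto simp: E2.orth_def\<close>)
  ultimately show "Q_2 k M m\<^sub>2 n\<^sub>2 f = - f" "- f = Q_2' k M m\<^sub>2 n\<^sub>2 f" using Q2_iff by auto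
 qed blast+
qed

end
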